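(* Let $D$ be an orientable signed chord diagram, and fix an ordering of its chords. Then the bigraded group $\mathcal C(D)$ with the homomorphism $d:\mathcal C^{i,j}(D)\to \mathcal C^{i+1,j}(D)$ defined by the Khovanov construction is a complex, i.e. $d\circ d=0$. Moreover, if $D$ and $D'$ are orientable signed chord diagrams related by a Reidemeister move of signed chord diagrams which preserves an orientation (i.e. $D$ and $D'$ have orientations of chord diagrams coinciding outside the fragment changed by the move), then the bigraded complexes $\mathcal C(D)$ and $\mathcal C(D')$ (for any fixed orderings of chords) are homotopy equivalent, by homotopy equivalences preserving both gradings.
   Context: A chord diagram is a closed 1-manifold $B$ (the base, a finite disjoint union of circles) with a finite set of chords, each connecting two points of $B$, all the end points of chords being pairwise distinct. A signed chord diagram is a chord diagram with oriented base, each chord of which is equipped with a sign $+$ or $-$. Its writhe $w(D)$ is the sum of the signs of all chords. Orientation of a chord diagram: the end points of chords divide the base into arcs. An orientation of the chord diagram is a choice of orientations of all these arcs (not related to the orientation of the base) such that (1) at each end point of a chord the orientations of the two adjacent arcs do not extend over the point: either both arcs are directed towards the point (the point is attractive) or both are directed away from it (the point is repulsive); (2) for each chord, one of its end points is attractive and the other one is repulsive. A chord diagram is orientable if it admits an orientation; a signed chord diagram is orientable if its chord diagram is. States and smoothings: a state $s$ of $D$ is an assignment of a sign (marker) to each chord; $a(s)$ and $b(s)$ are the numbers of positive and negative markers. The smoothing $D_s$ is the closed 1-manifold obtained from the base by surgery along all chords: for a chord with end points $p,q$, remove small neighborhoods of $p$ and $q$; let $p_-,p_+$ (resp. $q_-,q_+$)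 be the resulting ends just before and just after $p$ (resp. $q$) with respect to the orientation of the base. If the marker coincides with the sign of the chord, connect $p_-$ to $q_+$ and $q_-$ to $p_+$ (surgery preserving orientation); if they are opposite, connect $p_-$ to $q_-$ and $p_+$ to $q_+$. Denote by $|s|$ the number of components of $D_s$. Khovanov construction: let $\mathcal A$ be the graded free abelian group with two generators, $1$ of grading $1$ and $x$ of grading $-1$. Let $m:\mathcal A\otimes \mathcal A\to\mathcal A$ be defined by $1\otimes1\mapsto1$, $1\otimes x\mapsto x$, $x\otimes 1\mapsto x$, $x\otimes x\mapsto 0$, and $\Delta:\mathcal A\to\mathcal A\otimes\mathcal A$ by $1\mapsto 1\otimes x+x\otimes 1$, $x\mapsto x\otimes x$. For a state $s$ let $C(s)$ be the tensor product of copies $\mathcal A_C$ of $\mathcal A$ over all components $C$ of $D_s$, with first grading identically equal to $i(s)=\frac{w(D)-a(s)+b(s)}2$, and second grading $j$ equal to the grading of the tensor product shifted by $\frac{3w(D)-a(s)+b(s)}2$. Put $\mathcal C(D)=\bigoplus_s C(s)$. The homomorphism $d$ is the sum of partial differentials $C(s)\to C(t)$ over all pairs of states $s,t$ such that $t$ differs from $s$ only at one chord, where the marker of $s$ is positive and that of $t$ is negative. Let this chord have number $k$ in the ordering, and let $r$ be the number of negative markers of $s$ at chords with numbers greater than $k$. In an orientable diagram the number of components changes by one from $D_s$ to $D_t$. If two components $C_1,C_2$ of $D_s$ merge into one component $C$ of $D_t$, then $C(s)=\mathcal A_{C_1}\otimes\mathcal A_{C_2}\otimes B$, $C(t)=\mathcal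 A_C\otimes B$ (where $B$ is the tensor product over the other components), and the partial differential is $(-1)^r m\otimes \mathrm{id}_B$. If one component $C$ of $D_s$ splits into two components $C_1,C_2$ of $D_t$, the partial differential is $(-1)^r\Delta\otimes \mathrm{id}_B:\mathcal A_C\otimes B\to\mathcal A_{C_1}\otimes\mathcal A_{C_2}\otimes B$. Reidemeister moves of signed chord diagrams: a virtual link diagram is the image of a generic immersion of an oriented closed 1-manifold in the plane, each double point being either a classical crossing (with over-pass and under-pass shown) or an undecorated virtual crossing. Its Gauss diagram is the source 1-manifold with, for each classical crossing, an arrow from the over-pass to the under-pass equipped with the sign (local writhe) of the crossing; its blunted Gauss diagram is the signed chord diagram obtained by forgetting the directions of arrows. Every signed chord diagram is the blunted Gauss diagram of some virtual link diagram. A Reidemeister move of signed chord diagrams is the transformation of blunted Gauss diagrams induced by a (first, second or third) Reidemeister move, involving only classical crossings, of virtual link diagrams. *)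

theory Defs
  imports Complex_Main "HOL-Algebra.Free_Abelian_Groups"
begin

section \<open>Chord diagrams\<close>

text \<open>
  A chord diagram is encoded by the arcs into which the end points of the chords divide the
  oriented base, the chords (two-element sets of points), and for every end point \<open>p\<close> the arc
  \<open>arc_in p\<close> that ends at \<open>p\<close> and the arc \<open>arc_out p\<close> that starts at \<open>p\<close>, with respect to the
  orientation of the base.  An arc that is neither the incoming nor the outgoing arc of an end
  point is a whole circle of the base without end points.
\<close>

record ('p, 'a) chord_diagram =
  arcs :: "'a set"
  chords :: "'p set set"
  arc_in :: "'p \<Rightarrow> 'a"
  arc_out :: "'p \<Rightarrow> 'a"

definition points :: "('p, 'a, 'z) chord_diagram_scheme \<Rightarrow> 'p set" where
  "points D = \<Union> (chords D)"

text \<open>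
  The conditions on \<open>arc_in\<close> and \<open>arc_out\<close> say that \<open>p \<mapsto> q\<close> with \<open>arc_in q = arc_out p\<close> is a
  permutation of the end points; its cycles are the circles that carry end points.
\<close>

definition is_chord_diagram :: "('p, 'a, 'z) chord_diagram_scheme \<Rightarrow> bool" where
  "is_chord_diagram D \<longleftrightarrow>
     finite (arcs D) \<and> finite (chords D) \<and>
     (\<forall>c\<in>chords D. card c = 2) \<and>
     (\<forall>c\<in>chords D. \<forall>c'\<in>chords D. c \<noteq> c' \<longrightarrow> c \<inter> c' = {}) \<and>
     inj_on (arc_in D) (points D) \<and> inj_on (arc_out D) (points D) \<and>
     arc_in D ` points D = arc_out D ` points D \<and>
     arc_in D ` points D \<subseteq> arcs D"

record ('p, 'a) signed_chord_diagram = "('p, 'a) chord_diagram" +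
  sign :: "'p set \<Rightarrow> int"

definition is_signed_chord_diagram :: "('p, 'a, 'z) signed_chord_diagram_scheme \<Rightarrow> bool" where
  "is_signed_chord_diagram D \<longleftrightarrow> is_chord_diagram D \<and> (\<forall>c\<in>chords D. sign D c \<in> {1, -1})"

definition writhe :: "('p, 'a, 'z) signed_chord_diagram_scheme \<Rightarrow> int" where
  "writhe D = (\<Sum>c\<in>chords D. sign D c)"

section \<open>Orientations of chord diagrams\<close>

text \<open>
  Orientations of the arcs are given by a predicate \<open>ori\<close>: \<open>ori a\<close> holds if \<open>a\<close> is oriented along
  the orientation of the base, and \<open>\<not> ori a\<close> if it is oriented against it.
\<close>

definition attractive ::
    "('p, 'a, 'z) chord_diagram_scheme \<Rightarrow> ('a \<Rightarrow> bool) \<Rightarrow> 'p \<Rightarrow> bool" where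
  "attractive D ori p \<longleftrightarrow> ori (arc_in D p) \<and> \<not> ori (arc_out D p)"

definition repulsive ::
    "('p, 'a, 'z) chord_diagram_scheme \<Rightarrow> ('a \<Rightarrow> bool) \<Rightarrow> 'p \<Rightarrow> bool" where
  "repulsive D ori p \<longleftrightarrow> \<not> ori (arc_in D p) \<and> ori (arc_out D p)"

definition is_orientation ::
    "('p, 'a, 'z) chord_diagram_scheme \<Rightarrow> ('a \<Rightarrow> bool) \<Rightarrow> bool" where
  "is_orientation D ori \<longleftrightarrow>
     (\<forall>p\<in>points D. attractive D ori p \<or> repulsive D ori p) \<and>
     (\<forall>c\<in>chords D. \<exists>p q. c = {p, q} \<and> attractive D ori p \<and> repulsive D ori q)"

definition orientable :: "('p, 'a, 'z) chord_diagram_scheme \<Rightarrow> bool" where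
  "orientable D \<longleftrightarrow> (\<exists>ori. is_orientation D ori)"

section \<open>States and smoothings\<close>

definition equiv_closure :: "('a \<times> 'a) set \<Rightarrow> ('a \<times> 'a) set" where
  "equiv_closure r = (r \<union> converse r)\<^sup>*"

text \<open>A state is encoded by the set \<open>N \<subseteq> chords D\<close> of the chords with negative marker.\<close>

definition states :: "('p, 'a, 'z) chord_diagram_scheme \<Rightarrow> 'p set set set" where
  "states D = Pow (chords D)"

definition marker :: "'p set set \<Rightarrow> 'p set \<Rightarrow> int" where
  "marker N c = (if c \<in> N then -1 else 1)"

definition num_pos :: "('p, 'a, 'z) chord_diagram_scheme \<Rightarrow> 'p set set \<Rightarrow> int" where
  "num_pos D N = int (card {c\<in>chords D. marker N c = 1})"

definition num_neg :: "('p, 'a, 'z) chord_diagram_scheme \<Rightarrow> 'p set set \<Rightarrow> int" where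
  "num_neg D N = int (card {c\<in>chords D. marker N c = -1})"

text \<open>
  The pairs of arcs that are joined by the surgeries.  The end just before \<open>p\<close> belongs to the
  arc \<open>arc_in D p\<close>, the end just after \<open>p\<close> to \<open>arc_out D p\<close>.
\<close>

definition glued ::
    "('p, 'a, 'z) signed_chord_diagram_scheme \<Rightarrow> 'p set set \<Rightarrow> ('a \<times> 'a) set" where
  "glued D N = {(a, b). \<exists>c\<in>chords D. \<exists>p q. c = {p, q} \<and> p \<noteq> q \<and>
     (if marker N c = sign D c
      then a = arc_in D p \<and> b = arc_out D q
      else (a = arc_in D p \<and> b = arc_in D q) \<or> (a = arc_out D p \<and> b = arc_out D q))}"

text \<open>
  The smoothing is a union of arcs joined at their ends, so a component of it is represented by
  the set of arcs contained in it.
\<close>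

definition components ::
    "('p, 'a, 'z) signed_chord_diagram_scheme \<Rightarrow> 'p set set \<Rightarrow> 'a set set" where
  "components D N = arcs D // equiv_closure (glued D N)"

section \<open>Bigraded complexes\<close>

record 'x bigraded =
  grp :: "int \<Rightarrow> int \<Rightarrow> 'x monoid"
  diff :: "int \<Rightarrow> int \<Rightarrow> 'x \<Rightarrow> 'x"

definition is_bigraded_complex :: "'x bigraded \<Rightarrow> bool" where
  "is_bigraded_complex K \<longleftrightarrow>
     (\<forall>i j. comm_group (grp K i j) \<and>
        diff K i j \<in> hom (grp K i j) (grp K (i + 1) j) \<and>
        (\<forall>x\<in>carrier (grp K i j). diff K (i + 1) j (diff K i j x) = \<one>\<^bsub>grp K (i + 1 + 1) j\<^esub>))"

definition chain_map ::
    "'x bigraded \<Rightarrow> 'y bigraded \<Rightarrow> (int \<Rightarrow> int \<Rightarrow> 'x \<Rightarrow> 'y) \<Rightarrow> bool" where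
  "chain_map K L f \<longleftrightarrow>
     (\<forall>i j. f i j \<in> hom (grp K i j) (grp L i j) \<and>
        (\<forall>x\<in>carrier (grp K i j). f (i + 1) j (diff K i j x) = diff L i j (f i j x)))"

definition chain_homotopic ::
    "'x bigraded \<Rightarrow> 'y bigraded \<Rightarrow> (int \<Rightarrow> int \<Rightarrow> 'x \<Rightarrow> 'y) \<Rightarrow> (int \<Rightarrow> int \<Rightarrow> 'x \<Rightarrow> 'y) \<Rightarrow> bool" where
  "chain_homotopic K L f g \<longleftrightarrow>
     (\<exists>h. \<forall>i j. h i j \<in> hom (grp K i j) (grp L (i - 1) j) \<and>
        (\<forall>x\<in>carrier (grp K i j).
           f i j x = g i j x \<otimes>\<^bsub>grp L i j\<^esub>
             (diff L (i - 1) j (h i j x) \<otimes>\<^bsub>grp L i j\<^esub> h (i + 1) j (diff K i j x))))"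

definition homotopy_equivalent_complexes :: "'x bigraded \<Rightarrow> 'y bigraded \<Rightarrow> bool" where
  "homotopy_equivalent_complexes K L \<longleftrightarrow>
     (\<exists>f g. chain_map K L f \<and> chain_map L K g \<and>
        chain_homotopic K K (\<lambda>i j. g i j \<circ> f i j) (\<lambda>i j x. x) \<and>
        chain_homotopic L L (\<lambda>i j. f i j \<circ> g i j) (\<lambda>i j x. x))"

section \<open>The Khovanov complex\<close>

datatype kh_gen = Gen1 | GenX

fun kh_degree :: "kh_gen \<Rightarrow> int" where
  "kh_degree Gen1 = 1"
| "kh_degree GenX = -1"

fun kh_mult :: "kh_gen \<Rightarrow> kh_gen \<Rightarrow> (kh_gen \<Rightarrow>\<^sub>0 int)" where
  "kh_mult Gen1 Gen1 = frag_of Gen1"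
| "kh_mult Gen1 GenX = frag_of GenX"
| "kh_mult GenX Gen1 = frag_of GenX"
| "kh_mult GenX GenX = 0"

fun kh_comult :: "kh_gen \<Rightarrow> (kh_gen \<times> kh_gen \<Rightarrow>\<^sub>0 int)" where
  "kh_comult Gen1 = frag_of (Gen1, GenX) + frag_of (GenX, Gen1)"
| "kh_comult GenX = frag_of (GenX, GenX)"

text \<open>
  \<open>C(s)\<close>, a tensor product of free groups over the components of the smoothing, is the free
  abelian group on the labellings of these components by the two generators; the direct sum over
  all states is the free abelian group on the pairs of a state and such a labelling.
\<close>

type_synonym ('p, 'a) kh_basis = "'p set set \<times> ('a set \<Rightarrow> kh_gen)"

definition kh_generators ::
    "('p, 'a, 'z) signed_chord_diagram_scheme \<Rightarrow> ('p, 'a) kh_basis set" where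
  "kh_generators D = (SIGMA N:states D. components D N \<rightarrow>\<^sub>E UNIV)"

text \<open>The divisions by 2 are exact, because \<open>w(D)\<close>, \<open>3w(D)\<close> and \<open>a(s) + b(s)\<close> have equal parity.\<close>

definition i_grading ::
    "('p, 'a, 'z) signed_chord_diagram_scheme \<Rightarrow> ('p, 'a) kh_basis \<Rightarrow> int" where
  "i_grading D = (\<lambda>(N, l). (writhe D - num_pos D N + num_neg D N) div 2)"

definition j_grading ::
    "('p, 'a, 'z) signed_chord_diagram_scheme \<Rightarrow> ('p, 'a) kh_basis \<Rightarrow> int" where
  "j_grading D = (\<lambda>(N, l).
     (\<Sum>K\<in>components D N. kh_degree (l K)) + (3 * writhe D - num_pos D N + num_neg D N) div 2)"

definition merges ::
    "('p, 'a, 'z) signed_chord_diagram_scheme \<Rightarrow> 'p set set \<Rightarrow> 'p set set \<Rightarrow>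
     'a set \<times> 'a set \<times> 'a set \<Rightarrow> bool" where
  "merges D N M = (\<lambda>(C1, C2, C). C1 \<noteq> C2 \<and>
     components D N - components D M = {C1, C2} \<and> components D M - components D N = {C})"

text \<open>
  The unsigned partial differential from state \<open>N\<close> to state \<open>M\<close> on the generator with labelling
  \<open>l\<close>.  The two components \<open>C1\<close>, \<open>C2\<close> are chosen in an arbitrary order, which is irrelevant as
  \<open>kh_mult\<close> is commutative and \<open>kh_comult\<close> cocommutative.  The value 0 in the remaining case, in
  which the number of components does not change by one, never occurs in orientable diagrams.
\<close>

definition kh_partial ::
    "('p, 'a, 'z) signed_chord_diagram_scheme \<Rightarrow> 'p set set \<Rightarrow> 'p set set \<Rightarrow>
     ('a set \<Rightarrow> kh_gen) \<Rightarrow> (('p, 'a) kh_basis \<Rightarrow>\<^sub>0 int)" where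
  "kh_partial D N M l =
     (if \<exists>T. merges D N M T then
        (case (SOME T. merges D N M T) of (C1, C2, C) \<Rightarrow>
           frag_extend (\<lambda>g. frag_of (M, restrict (l(C := g)) (components D M)))
             (kh_mult (l C1) (l C2)))
      else if \<exists>T. merges D M N T then
        (case (SOME T. merges D M N T) of (C1, C2, C) \<Rightarrow>
           frag_extend
             (\<lambda>(g1, g2). frag_of (M, restrict (l(C1 := g1, C2 := g2)) (components D M)))
             (kh_comult (l C)))
      else 0)"

definition chord_ordering ::
    "('p, 'a, 'z) chord_diagram_scheme \<Rightarrow> ('p set \<Rightarrow> nat) \<Rightarrow> bool" where
  "chord_ordering D num \<longleftrightarrow> bij_betw num (chords D) {1..card (chords D)}"

definition kh_diff ::
    "('p, 'a, 'z) signed_chord_diagram_scheme \<Rightarrow> ('p set \<Rightarrow> nat) \<Rightarrow>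
     (('p, 'a) kh_basis \<Rightarrow>\<^sub>0 int) \<Rightarrow> (('p, 'a) kh_basis \<Rightarrow>\<^sub>0 int)" where
  "kh_diff D num = frag_extend (\<lambda>(N, l).
     \<Sum>c\<in>{c\<in>chords D. marker N c = 1}.
       frag_cmul ((-1) ^ card {c'\<in>chords D. marker N c' = -1 \<and> num c' > num c})
         (kh_partial D N (insert c N) l))"

definition khovanov_complex ::
    "('p, 'a, 'z) signed_chord_diagram_scheme \<Rightarrow> ('p set \<Rightarrow> nat) \<Rightarrow>
     (('p, 'a) kh_basis \<Rightarrow>\<^sub>0 int) bigraded" where
  "khovanov_complex D num =
     \<lparr> grp = (\<lambda>i j. free_Abelian_group {e \<in> kh_generators D. i_grading D e = i \<and> j_grading D e = j}),
       diff = (\<lambda>i j. kh_diff D num) \<rparr>"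

section \<open>Gauss diagrams and Reidemeister moves\<close>

text \<open>
  A virtual link diagram enters only through its Gauss diagram.  The arrows are recorded by the
  set of their tails, the end points on over-passes; the blunted Gauss diagram is obtained by
  \<^const>\<open>signed_chord_diagram.truncate\<close>.  Every Gauss diagram comes from a virtual link diagram in
  which a prescribed local fragment is drawn as in the plane, so a Reidemeister move with
  classical crossings amounts to a replacement of such fragments in Gauss diagrams.
\<close>

record ('p, 'a) gauss_diagram = "('p, 'a) signed_chord_diagram" +
  overs :: "'p set"

definition is_gauss_diagram :: "('p, 'a, 'z) gauss_diagram_scheme \<Rightarrow> bool" where
  "is_gauss_diagram G \<longleftrightarrow> is_signed_chord_diagram G \<and> (\<forall>c\<in>chords G. card (c \<inter> overs G) = 1)"

text \<open>
  \<open>erases G' X f g G\<close>: the Gauss diagram \<open>G\<close> is obtained from \<open>G'\<close> by erasing the chords in \<open>X\<close>.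
  Here \<open>f\<close> sends the end points of \<open>G\<close> to the corresponding end points of \<open>G'\<close>, and \<open>g\<close> sends an
  arc of \<open>G'\<close> to the arc of \<open>G\<close> which contains it: arcs that meet at erased points become one.
\<close>

definition erases ::
    "('q, 'b) gauss_diagram \<Rightarrow> 'q set set \<Rightarrow> ('p \<Rightarrow> 'q) \<Rightarrow> ('b \<Rightarrow> 'a) \<Rightarrow>
     ('p, 'a) gauss_diagram \<Rightarrow> bool" where
  "erases G' X f g G \<longleftrightarrow>
     X \<subseteq> chords G' \<and>
     bij_betw f (points G) (points G' - \<Union> X) \<and>
     (\<lambda>c. f ` c) ` chords G = chords G' - X \<and>
     (\<forall>c\<in>chords G. sign G' (f ` c) = sign G c) \<and>
     (\<forall>p\<in>points G. f p \<in> overs G' \<longleftrightarrow> p \<in> overs G) \<and>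
     g ` arcs G' = arcs G \<and>
     (\<forall>a\<in>arcs G'. \<forall>b\<in>arcs G'.
        g a = g b \<longleftrightarrow> (a, b) \<in> equiv_closure {(arc_in G' p, arc_out G' p) | p. p \<in> \<Union> X}) \<and>
     (\<forall>p\<in>points G. g (arc_in G' (f p)) = arc_in G p \<and> g (arc_out G' (f p)) = arc_out G p)"

text \<open>
  In the relations below, \<open>R\<close> is the correspondence between the arcs of \<open>G\<close> and of \<open>G'\<close> outside the
  fragment changed by the move.

  First move: \<open>G'\<close> has an additional kink.  Its crossing may have either sign, and either end
  point of the arrow may come first.
\<close>

definition first_move ::
    "('p, 'a) gauss_diagram \<Rightarrow> ('q, 'b) gauss_diagram \<Rightarrow> ('a \<times> 'b) set \<Rightarrow> bool" where
  "first_move G G' R \<longleftrightarrow>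
     (\<exists>f g p q. p \<noteq> q \<and> erases G' {{p, q}} f g G \<and>
        arc_out G' p = arc_in G' q \<and>
        R = {(g a, a) | a. a \<in> arcs G' - {arc_out G' p}})"

text \<open>
  Second move: \<open>G'\<close> has two additional crossings of opposite signs, at both of which the strand
  from \<open>p1\<close> to \<open>p2\<close> passes over the strand from \<open>q1\<close> to \<open>q2\<close>.  The strands may have equal or
  opposite directions, and either of the crossings may be the positive one.
\<close>

definition second_move ::
    "('p, 'a) gauss_diagram \<Rightarrow> ('q, 'b) gauss_diagram \<Rightarrow> ('a \<times> 'b) set \<Rightarrow> bool" where
  "second_move G G' R \<longleftrightarrow>
     (\<exists>f g p1 p2 q1 q2 c c'. distinct [p1, p2, q1, q2] \<and>
        (c = {p1, q1} \<and> c' = {p2, q2} \<or> c = {p1, q2} \<and> c' = {p2, q1}) \<and>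
        erases G' {c, c'} f g G \<and>
        p1 \<in> overs G' \<and> p2 \<in> overs G' \<and> q1 \<notin> overs G' \<and> q2 \<notin> overs G' \<and>
        sign G' c = - sign G' c' \<and>
        arc_out G' p1 = arc_in G' p2 \<and> arc_out G' q1 = arc_in G' q2 \<and>
        R = {(g a, a) | a. a \<in> arcs G' - {arc_out G' p1, arc_out G' q1}})"

definition cross :: "complex \<Rightarrow> complex \<Rightarrow> real" where
  "cross u v = Re u * Im v - Im u * Re v"

text \<open>
  The fragment of the third move consists of three strands 0, 1, 2, strand 0 being the top one and
  strand 2 the bottom one.  They are drawn as oriented straight lines \<open>t \<mapsto> P i + t V i\<close> which
  form a triangle; line \<open>i\<close> meets line \<open>j\<close> at time \<open>T i j\<close>, and \<open>x i j\<close> is the corresponding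
  point on strand \<open>i\<close> in the Gauss diagram.  A crossing is positive if and only if
  the directions of the over-pass and of the under-pass form a positive basis of the plane.
\<close>

definition third_move_fragment ::
    "('p, 'a) gauss_diagram \<Rightarrow> (nat \<Rightarrow> nat \<Rightarrow> 'p) \<Rightarrow> (nat \<Rightarrow> nat \<Rightarrow> real) \<Rightarrow> bool" where
  "third_move_fragment G x T \<longleftrightarrow>
     inj_on (\<lambda>(i, j). x i j) {(i, j). i < 3 \<and> j < 3 \<and> i \<noteq> j} \<and>
     (\<exists>(P :: nat \<Rightarrow> complex) (V :: nat \<Rightarrow> complex).
        (\<forall>i<3. \<forall>j<3. i \<noteq> j \<longrightarrow>
           {x i j, x j i} \<in> chords G \<and>
           (x i j \<in> overs G \<longleftrightarrow> i < j) \<and>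
           cross (V i) (V j) \<noteq> 0 \<and>
           P i + of_real (T i j) * V i = P j + of_real (T j i) * V j \<and>
           (i < j \<longrightarrow> real_of_int (sign G {x i j, x j i}) = sgn (cross (V i) (V j))))) \<and>
     (\<forall>i<3. \<forall>j<3. \<forall>k<3. distinct [i, j, k] \<longrightarrow>
        T i j \<noteq> T i k \<and> (T i j < T i k \<longrightarrow> arc_out G (x i j) = arc_in G (x i k)))"

text \<open>
  The move takes a strand across the crossing of the two others.  It keeps the crossings and
  interchanges the two of them that lie on each of the three strands.
\<close>

definition third_move ::
    "('p, 'a) gauss_diagram \<Rightarrow> ('q, 'b) gauss_diagram \<Rightarrow> ('a \<times> 'b) set \<Rightarrow> bool" where
  "third_move G G' R \<longleftrightarrow>
     (\<exists>f g x T. third_move_fragment G x T \<and>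
        bij_betw f (points G) (points G') \<and>
        bij_betw g (arcs G) (arcs G') \<and>
        (\<lambda>c. f ` c) ` chords G = chords G' \<and>
        (\<forall>c\<in>chords G. sign G' (f ` c) = sign G c) \<and>
        (\<forall>p\<in>points G. f p \<in> overs G' \<longleftrightarrow> p \<in> overs G) \<and>
        (\<forall>p\<in>points G - {x i j | i j. i < 3 \<and> j < 3 \<and> i \<noteq> j}.
           arc_in G' (f p) = g (arc_in G p) \<and> arc_out G' (f p) = g (arc_out G p)) \<and>
        (\<forall>i<3. \<forall>j<3. \<forall>k<3. distinct [i, j, k] \<longrightarrow>
           arc_in G' (f (x i j)) = g (arc_in G (x i k)) \<and>
           arc_out G' (f (x i j)) = g (arc_out G (x i k))) \<and>
        R = {(a, g a) | a. a \<in> arcs G -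
               {arc_out G (x i j) | i j k. i < 3 \<and> j < 3 \<and> k < 3 \<and> distinct [i, j, k] \<and>
                  T i j < T i k}})"

definition gauss_move ::
    "('p, 'a) gauss_diagram \<Rightarrow> ('q, 'b) gauss_diagram \<Rightarrow> ('a \<times> 'b) set \<Rightarrow> bool" where
  "gauss_move G G' R \<longleftrightarrow>
     is_gauss_diagram G \<and> is_gauss_diagram G' \<and>
     (first_move G G' R \<or> first_move G' G (converse R) \<or>
      second_move G G' R \<or> second_move G' G (converse R) \<or>
      third_move G G' R \<or> third_move G' G (converse R))"

definition reidemeister_move ::
    "('p, 'a) signed_chord_diagram \<Rightarrow> ('q, 'b) signed_chord_diagram \<Rightarrow> ('a \<times> 'b) set \<Rightarrow> bool" where
  "reidemeister_move D D' R \<longleftrightarrow>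
     (\<exists>G G'. signed_chord_diagram.truncate G = D \<and> signed_chord_diagram.truncate G' = D' \<and>
        gauss_move G G' R)"

definition preserves_orientation ::
    "('p, 'a) signed_chord_diagram \<Rightarrow> ('q, 'b) signed_chord_diagram \<Rightarrow> ('a \<times> 'b) set \<Rightarrow> bool" where
  "preserves_orientation D D' R \<longleftrightarrow>
     (\<exists>ori ori'. is_orientation D ori \<and> is_orientation D' ori' \<and>
        (\<forall>(a, a')\<in>R. ori a \<longleftrightarrow> ori' a'))"

end

theory Submission
  imports "HOL-Combinatorics.Orbits" "HOL-Library.Multiset" "HOL-Library.Function_Algebras" Defs
begin

text \<open>
  The proof replaces tensor products of copies of \<open>\<A>\<close> by cyclic modules.  The group \<open>C(s)\<close> is the
  quotient of the polynomial ring over the integers, with one variable for each arc, by the squares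
  of the variables and by the differences of the variables of arcs on the same circle of the
  smoothing.  In this description multiplication is induced by the identity of the polynomial ring,
  and comultiplication is multiplication by the sum of the variables of the two circles that arise.
  So a partial differential is multiplication by a polynomial, its \<open>saddle\<close>, that depends only on
  the relations at its two ends.  An orientation of the chord diagram makes every smoothing a set of
  cycles of a permutation of the arcs, a surgery composes this permutation with a transposition, and
  hence a surgery merges two circles or splits one (\<open>smoothing_rel_surgered\<close>).  That the partial
  differentials commute around a square (\<open>saddle_exchange\<close>) becomes a statement about fusing classes of
  two equivalence relations; with the signs of the ordering of the chords it gives
  \<open>d \<circ> d = 0\<close>.

  For the invariance, let \<open>Y\<close> be the set of arcs between the end points of the fragment that is
  changed.  In some of the smoothings \<open>Y\<close> is a small circle on its own, in all others its arcs lie on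
  longer curves.  Splitting \<open>\<A>\<close> for that circle into its two generators gives a complex of cyclic
  modules over the variables outside \<open>Y\<close> (\<open>presents_model\<close>), in which the surgeries that attach the
  small circle have entries \<open>1\<close>.  Gaussian elimination along these entries
  (\<open>gaussian_elimination\<close>, \<open>site_elimination\<close>) removes all summands with the small circle.  After a
  first move one of the two smoothings of the kink remains (\<open>chord_elimination\<close>), after a second move the
  smoothing that pulls the strands apart (\<open>square_elimination\<close>); both are the complex of the
  diagram without the additional chords.

  In a third move, the crossings of the strand \<open>0\<close> with the two other strands have opposite signs with
  respect to the cyclic direction of the triangle, because the three sides of a triangle add up to zero
  (\<open>triangle_closing\<close>).  So the smoothings with the small circle again form one corner of a square,
  and elimination leaves five smoothings of the triangle with one additional differential, the zigzag
  through the removed corner (\<open>triangle_reduction\<close>).  These five smoothings join the ends of the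
  fragment in the same way before and after the move, once the roles of two of them are exchanged
  (\<open>joined_ends_flip\<close>), and the remaining signs are absorbed by changing generators.  The ordering of the
  chords is immaterial, as two sign rules for a cube with anticommuting faces differ by such
  a change (\<open>change_signs\<close>).
\<close>

section \<open>Square-zero polynomial rings\<close>

type_synonym 'v zpoly = "'v multiset \<Rightarrow>\<^sub>0 int"

definition var :: "'v \<Rightarrow> 'v zpoly" where
  "var v = frag_of {#v#}"

lemma frag_of_empty_mset: "frag_of {#} = (1 :: 'v zpoly)"
  by (simp flip: zero_multiset_def)

lemma frag_of_add_mset: "frag_of (add_mset v \<mu>) = var v * frag_of \<mu>"
  by (simp add: var_def mult_single)

lemma zpoly_induct [case_names zero diff one var]:
  assumes "P 0" "\<And>p q. P p ==> P q ==> P (p - q)" "P 1" "\<And>v p. P p ==> P (var v * p)"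
  shows "P (p :: 'v zpoly)"
proof -
  have mono: "P (frag_of \<mu>)" for \<mu>
    by (induction \<mu>) (simp_all add: assms frag_of_empty_mset frag_of_add_mset del: single_one)
  show ?thesis
    by (rule frag_induction[of p UNIV P]) (use assms mono in auto)
qed

inductive_set rel_ideal :: "('v \<times> 'v) set \<Rightarrow> 'v zpoly set" for E where
  square: "p * (var a * var a) \<in> rel_ideal E"
| rel: "(a, b) \<in> E ==> p * (var a - var b) \<in> rel_ideal E"
| outside: "(a, a) \<notin> E ==> p * var a \<in> rel_ideal E"
| add: "p \<in> rel_ideal E ==> q \<in> rel_ideal E ==> p + q \<in> rel_ideal E"

lemma rel_ideal_0 [simp]: "0 \<in> rel_ideal E"
  using rel_ideal.square[of 0] by simp

lemma rel_ideal_mult_left: "p \<in> rel_ideal E ==> r * p \<in> rel_ideal E"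
proof (induction rule: rel_ideal.induct)
  case (square p a)
  then show ?case using rel_ideal.square[of "r * p" a E] by (simp add: mult.assoc)
next
  case (rel a b p)
  then show ?case using rel_ideal.rel[of a b E "r * p"] by (simp add: mult.assoc)
next
  case (outside a p)
  then show ?case using rel_ideal.outside[of a E "r * p"] by (simp add: mult.assoc)
next
  case (add p q)
  then show ?case by (simp add: distrib_left rel_ideal.add)
qed

lemma rel_ideal_mult_right: "p \<in> rel_ideal E ==> p * r \<in> rel_ideal E"
  using rel_ideal_mult_left[of p E r] by (simp add: mult.commute)

lemma rel_ideal_uminus: "p \<in> rel_ideal E ==> - p \<in> rel_ideal E"
  using rel_ideal_mult_left[of p E "-1"] by simp

lemma rel_ideal_diff: "p \<in> rel_ideal E ==> q \<in> rel_ideal E ==> p - q \<in> rel_ideal E"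
  using rel_ideal.add[of p E "- q"] by (simp add: rel_ideal_uminus)

lemma rel_ideal_sum: "(\<And>i. i \<in> A ==> f i \<in> rel_ideal E) ==> sum f A \<in> rel_ideal E"
  by (induction A rule: infinite_finite_induct) (auto intro: rel_ideal.add)

lemma rel_ideal_scale:
  assumes "p \<in> rel_ideal E"
    and sq: "\<And>a. r * (var a * var a) \<in> rel_ideal E'"
    and rl: "\<And>a b. (a, b) \<in> E ==> r * (var a - var b) \<in> rel_ideal E'"
    and ou: "\<And>a. (a, a) \<notin> E ==> r * var a \<in> rel_ideal E'"
  shows "r * p \<in> rel_ideal E'"
  using assms(1)
proof (induction rule: rel_ideal.induct)
  case (square p a)
  then show ?case using rel_ideal_mult_left[OF sq[of a], of p] by (simp add: mult.left_commute)
next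
  case (rel a b p)
  then show ?case using rel_ideal_mult_left[OF rl[of a b], of p] by (simp add: mult.left_commute)
next
  case (outside a p)
  then show ?case using rel_ideal_mult_left[OF ou[of a], of p] by (simp add: mult.left_commute)
next
  case (add p q)
  then show ?case by (simp add: distrib_left rel_ideal.add)
qed

lemma var_square: "var a * var a \<in> rel_ideal E"
  using rel_ideal.square[of 1] by simp

lemma var_rel: "(a, b) \<in> E ==> var a - var b \<in> rel_ideal E"
  using rel_ideal.rel[of a b E 1] by simp

lemma var_outside: "(a, a) \<notin> E ==> var a \<in> rel_ideal E"
  using rel_ideal.outside[of a E 1] by simp

section \<open>Saddles between partitions\<close>

definition fuse :: "('v \<times> 'v) set \<Rightarrow> 'v \<Rightarrow> 'v \<Rightarrow> ('v \<times> 'v) set" where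
  "fuse E u v = E \<union> (E `` {u} \<union> E `` {v}) \<times> (E `` {u} \<union> E `` {v})"

lemma fuse_sep:
  assumes "equiv V E" "(a, b) \<in> fuse E u v" "(a, b) \<notin> E"
  shows "(a, u) \<in> E \<and> (b, v) \<in> E \<or> (a, v) \<in> E \<and> (b, u) \<in> E"
  using assms unfolding fuse_def equiv_def by (auto dest: symD transD)

lemma fuse_mem [simp]:
  assumes "equiv V E" "u \<in> V" "v \<in> V"
  shows "(u, v) \<in> fuse E u v" "(v, u) \<in> fuse E u v"
  using assms unfolding fuse_def equiv_def refl_on_def by auto

lemma subset_fuse: "E \<subseteq> fuse E u v"
  by (auto simp: fuse_def)

lemma fuse_same:
  assumes "equiv V E" "(u, v) \<in> E"
  shows "fuse E u v = E"
proof -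
  have "E `` {u} = E `` {v}" using assms by (metis equiv_class_eq)
  then show ?thesis using assms unfolding fuse_def equiv_def by (auto dest: symD transD)
qed

lemma fuse_least:
  assumes "equiv V E'" "E \<subseteq> E'" "(u, v) \<in> E'"
  shows "fuse E u v \<subseteq> E'"
proof -
  have s: "sym E'" and t: "trans E'" using assms(1) by (auto simp: equiv_def)
  have "(u, x) \<in> E'" if "x \<in> E `` {u} \<union> E `` {v}" for x
    using that assms(2,3) by (auto intro: transD[OF t])
  then have "(x, y) \<in> E'" if "x \<in> E `` {u} \<union> E `` {v}" "y \<in> E `` {u} \<union> E `` {v}" for x y
    using that by (meson symD[OF s] transD[OF t])
  then show ?thesis using assms(2) unfolding fuse_def by blast
qed

lemma equiv_fuse:
  assumes "equiv V E" "u \<in> V" "v \<in> V"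
  shows "equiv V (fuse E u v)"
proof -
  have s: "sym E" and t: "trans E" and r: "refl_on V E" and sub: "E \<subseteq> V \<times> V"
    using assms by (auto simp: equiv_def)
  have st: "(x, y) \<in> E ==> (y, x) \<in> E" "(x, y) \<in> E ==> (y, z) \<in> E ==> (x, z) \<in> E" for x y z
    using s t by (auto dest: symD transD)
  show ?thesis
  proof (rule equivI)
    show "refl_on V (fuse E u v)" using r unfolding refl_on_def fuse_def by auto
    show "fuse E u v \<subseteq> V \<times> V" using sub unfolding fuse_def by auto
    show "sym (fuse E u v)" using st unfolding sym_def fuse_def by blast
    show "trans (fuse E u v)"
    proof (rule transI)
      fix x y z assume xy: "(x, y) \<in> fuse E u v" and yz: "(y, z) \<in> fuse E u v"
      let ?C = "E `` {u} \<union> E `` {v}"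
      have C: "x \<in> ?C \<longleftrightarrow> y \<in> ?C" if "(x, y) \<in> E" for x y using that st by blast
      show "(x, z) \<in> fuse E u v"
        using xy yz C[of x y] C[of y z] st(2)[of x y z] unfolding fuse_def by blast
    qed
  qed
qed

definition surgered :: "'v set \<Rightarrow> ('v \<times> 'v) set \<Rightarrow> ('v \<times> 'v) set \<Rightarrow> 'v \<Rightarrow> 'v \<Rightarrow> bool" where
  "surgered V E E' u v \<longleftrightarrow> equiv V E \<and> equiv V E' \<and> u \<in> V \<and> v \<in> V \<and>
     fuse E u v = fuse E' u v \<and> ((u, v) \<in> E \<longleftrightarrow> (u, v) \<notin> E')"

lemma surgered_cases:
  assumes "surgered V E E' u v"
  obtains (merge) "(u, v) \<notin> E" "E' = fuse E u v" | (split) "(u, v) \<notin> E'" "E = fuse E' u v"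
  using assms unfolding surgered_def by (metis fuse_same)

definition saddle :: "('v \<times> 'v) set \<Rightarrow> ('v \<times> 'v) set \<Rightarrow> 'v zpoly" where
  "saddle E E' = (if E \<subseteq> E' then 1
     else (case SOME e. e \<in> E - E' of (u, v) \<Rightarrow> var u + var v))"

lemma saddle_merge: "E \<subseteq> E' ==> saddle E E' = 1"
  by (simp add: saddle_def)

lemma saddle_split:
  assumes E': "equiv V E'" and uv: "u \<in> V" "v \<in> V" "(u, v) \<notin> E'" and E: "E = fuse E' u v"
  shows "saddle E E' - (var u + var v) \<in> rel_ideal E'"
proof -
  have "(u, v) \<in> E - E'" using assms by auto
  then have n: "\<not> E \<subseteq> E'" by auto
  obtain a b where ab: "(SOME e. e \<in> E - E') = (a, b)" by fastforce
  then have "(a, b) \<in> E - E'" using \<open>(u, v) \<in> E - E'\<close> by (metis someI_ex)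
  then have "(a, u) \<in> E' \<and> (b, v) \<in> E' \<or> (a, v) \<in> E' \<and> (b, u) \<in> E'"
    using fuse_sep[OF E'] E by auto
  then have "var a + var b - (var u + var v) \<in> rel_ideal E'"
  proof
    assume "(a, u) \<in> E' \<and> (b, v) \<in> E'"
    then have "(var a - var u) + (var b - var v) \<in> rel_ideal E'"
      by (intro rel_ideal.add var_rel) auto
    then show ?thesis by (simp add: algebra_simps)
  next
    assume "(a, v) \<in> E' \<and> (b, u) \<in> E'"
    then have "(var a - var v) + (var b - var u) \<in> rel_ideal E'"
      by (intro rel_ideal.add var_rel) auto
    then show ?thesis by (simp add: algebra_simps)
  qed
  then show ?thesis using n ab by (simp add: saddle_def)
qed

lemma rel_ideal_mono_equiv:
  assumes "equiv V E" "equiv V E'" "E \<subseteq> E'" "p \<in> rel_ideal E"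
  shows "p \<in> rel_ideal E'"
proof -
  have "(a, a) \<notin> E'" if "(a, a) \<notin> E" for a
    using that assms(1,2) by (auto simp: equiv_def refl_on_def)
  then have "1 * p \<in> rel_ideal E'"
    by (intro rel_ideal_scale[OF assms(4)]) (use assms in \<open>auto intro: var_square var_rel var_outside\<close>)
  then show ?thesis by simp
qed

lemma split_rel_ideal:
  assumes E': "equiv V E'" and uv: "u \<in> V" "v \<in> V" and E: "E = fuse E' u v" and p: "p \<in> rel_ideal E"
  shows "(var u + var v) * p \<in> rel_ideal E'"
proof (rule rel_ideal_scale[OF p])
  fix a show "(var u + var v) * (var a * var a) \<in> rel_ideal E'" by (rule rel_ideal.square)
next
  fix a b assume ab: "(a, b) \<in> E"
  have key: "(var u + var v) * (var a - var b) \<in> rel_ideal E'" if "(a, u) \<in> E'" "(b, v) \<in> E'" for a b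
  proof -
    have "(var u + var v) * (var a - var u) - (var u + var v) * (var b - var v)
        + (var u * var u - var v * var v) \<in> rel_ideal E'"
      by (intro rel_ideal.add rel_ideal_diff rel_ideal.rel var_square that)
    then show ?thesis by (simp add: algebra_simps)
  qed
  show "(var u + var v) * (var a - var b) \<in> rel_ideal E'"
  proof (cases "(a, b) \<in> E'")
    case True then show ?thesis by (rule rel_ideal.rel)
  next
    case False
    then consider "(a, u) \<in> E'" "(b, v) \<in> E'" | "(a, v) \<in> E'" "(b, u) \<in> E'"
      using fuse_sep[OF E'] ab E by blast
    then show ?thesis
    proof cases
      case 1 then show ?thesis by (rule key)
    next
      case 2 then show ?thesis using rel_ideal_uminus[OF key[of b a]] by (simp add: algebra_simps)
    qed
  qed
next
  fix a assume "(a, a) \<notin> E"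
  then have "(a, a) \<notin> E'" using E by (auto simp: fuse_def)
  then show "(var u + var v) * var a \<in> rel_ideal E'" by (rule rel_ideal.outside)
qed

lemma saddle_rel_ideal:
  assumes s: "surgered V E E' u v" and p: "p \<in> rel_ideal E"
  shows "saddle E E' * p \<in> rel_ideal E'"
  using s
proof (cases rule: surgered_cases)
  case merge
  then show ?thesis using rel_ideal_mono_equiv[of V E E' p] s p subset_fuse[of E u v]
    by (simp add: saddle_merge surgered_def)
next
  case split
  have e: "equiv V E'" "u \<in> V" "v \<in> V" using s by (auto simp: surgered_def)
  have "(saddle E E' - (var u + var v)) * p + (var u + var v) * p \<in> rel_ideal E'"
    by (intro rel_ideal.add rel_ideal_mult_right saddle_split[OF e split] split_rel_ideal[OF e split(2) p])
  then show ?thesis by (simp add: algebra_simps)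
qed

definition surgery_factor :: "('v \<times> 'v) set \<Rightarrow> 'v \<Rightarrow> 'v \<Rightarrow> 'v zpoly" where
  "surgery_factor E u v = (if (u, v) \<in> E then var u + var v else 1)"

lemma saddle_surgery_factor:
  assumes "surgered V E E' u v"
  shows "saddle E E' - surgery_factor E u v \<in> rel_ideal E'"
  using assms
proof (cases rule: surgered_cases)
  case merge
  then show ?thesis using subset_fuse[of E u v] by (simp add: surgery_factor_def saddle_merge)
next
  case split
  have "(u, v) \<in> E" using split assms unfolding surgered_def by blast
  then show ?thesis using saddle_split[of V E' u v E] split assms
    by (simp add: surgery_factor_def surgered_def)
qed

text \<open>
  Two saddles at different chords commute up to diffeomorphism of the cobordism; algebraically
  both composites are multiplication by the same factor, where in the cases in which one path
  first splits and then merges, or conversely, the two sums of variables agree as they run over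
  the same components.
\<close>

lemma surgery_factor_exchange:
  assumes s1: "surgered V E00 E10 u v" and s2: "surgered V E10 E11 u' v'"
    and s3: "surgered V E00 E01 u' v'" and s4: "surgered V E01 E11 u v"
  shows "surgery_factor E00 u v * surgery_factor E10 u' v'
    - surgery_factor E00 u' v' * surgery_factor E01 u v \<in> rel_ideal E11"
proof -
  have eq: "equiv V E00" "equiv V E10" "equiv V E01" "equiv V E11"
    using s1 s2 s3 s4 by (auto simp: surgered_def)
  have V: "u \<in> V" "v \<in> V" "u' \<in> V" "v' \<in> V" using s1 s2 by (auto simp: surgered_def)
  have st: "(x, y) \<in> E ==> (y, x) \<in> E" "(x, y) \<in> E ==> (y, z) \<in> E ==> (x, z) \<in> E"
    if "equiv V E" for x y z E
    using that by (auto simp: equiv_def dest: symD transD)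
  have b1: "(u, v) \<in> E00 \<longleftrightarrow> (u, v) \<notin> E10" and b2: "(u', v') \<in> E10 \<longleftrightarrow> (u', v') \<notin> E11"
    and b3: "(u', v') \<in> E00 \<longleftrightarrow> (u', v') \<notin> E01" and b4: "(u, v) \<in> E01 \<longleftrightarrow> (u, v) \<notin> E11"
    using s1 s2 s3 s4 by (simp_all add: surgered_def)
  have up: "(u, v) \<notin> E ==> E' = fuse E u v" "(u, v) \<notin> E' ==> E = fuse E' u v"
    if "surgered V E E' u v" for E E' u v
    using that unfolding surgered_def by (metis fuse_same)+
  note f1 = up[OF s1] and f2 = up[OF s2] and f3 = up[OF s3] and f4 = up[OF s4]
  have sub: "E \<subseteq> fuse E u v" for E u v by (rule subset_fuse)
  have swap: "(u, v) \<in> fuse E u' v'" if "equiv V E" "(u', v') \<in> fuse E u v" "(u', v') \<notin> E" for E u v u' v'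
    using fuse_sep[OF that] st[OF that(1)] unfolding fuse_def by blast
  have zero: "0 \<in> rel_ideal E11" by simp
  show ?thesis
  proof (cases "(u, v) \<in> E00"; cases "(u, v) \<in> E01")
    assume h: "(u, v) \<in> E00" "(u, v) \<in> E01"
    have E00: "E00 = fuse E10 u v" and E01: "E01 = fuse E11 u v" using f1 f4 b1 b4 h by auto
    have "(u', v') \<in> E00 \<longleftrightarrow> (u', v') \<in> E10"
    proof (cases "(u', v') \<in> E00")
      case True
      have False if n: "(u', v') \<notin> E10"
      proof -
        have e: "E11 = fuse E10 u' v'" by (rule f2(1)[OF n])
        have "(u, v) \<in> E11" using swap[OF eq(2), of u' v' u v] True E00 n e by simp
        then show False using b4 h by simp
      qed
      then show ?thesis using True by blast
    next
      case False
      then show ?thesis using sub[of E10 u v] E00 by auto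
    qed
    then show ?thesis using h by (simp add: surgery_factor_def mult.commute)
  next
    assume h: "(u, v) \<notin> E00" "(u, v) \<notin> E01"
    have E10: "E10 = fuse E00 u v" and E11: "E11 = fuse E01 u v" using f1 f4 b1 b4 h by auto
    have "(u', v') \<in> E00 \<longleftrightarrow> (u', v') \<in> E10"
    proof (cases "(u', v') \<in> E00")
      case True
      then show ?thesis using sub[of E00 u v] E10 by auto
    next
      case False
      have False if n: "(u', v') \<in> E10"
      proof -
        have "E01 = fuse E00 u' v'" by (rule f3(1)[OF False])
        then have "(u, v) \<in> E01" using swap[OF eq(1), of u' v' u v] n E10 False by simp
        then show False using h by simp
      qed
      then show ?thesis using False by blast
    qed
    then show ?thesis using h by (simp add: surgery_factor_def)
  next
    assume h: "(u, v) \<in> E00" "(u, v) \<notin> E01"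
    have a: "(u, v) \<notin> E10" "(u, v) \<in> E11" using b1 b4 h by auto
    have E00: "E00 = fuse E10 u v" using f1 a by auto
    have c: "(u', v') \<in> E00"
    proof (rule ccontr)
      assume n: "(u', v') \<notin> E00"
      then have "E01 = fuse E00 u' v'" by (rule f3(1))
      then show False using h sub[of E00 u' v'] by auto
    qed
    have d: "(u', v') \<notin> E10"
    proof
      assume n: "(u', v') \<in> E10"
      then have "E10 = fuse E11 u' v'" using f2(2) b2 by blast
      then show False using a sub[of E11 u' v'] by auto
    qed
    have E11: "E11 = fuse E10 u' v'" by (rule f2(1)[OF d])
    have p: "(u', v') \<in> E11" using b2 d by auto
    have "(u', u) \<in> E10 \<and> (v', v) \<in> E10 \<or> (u', v) \<in> E10 \<and> (v', u) \<in> E10"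
      using fuse_sep[OF eq(2), of u' v' u v] c d E00 by simp
    then have q: "(u', u) \<in> E11 \<and> (v', v) \<in> E11 \<or> (u', v) \<in> E11 \<and> (v', u) \<in> E11"
      using sub[of E10 u' v'] E11 by auto
    then have q: "(u, u') \<in> E11" "(v, v') \<in> E11" using st[OF eq(4)] a(2) p by blast+
    have "(var u - var u') + (var v - var v') \<in> rel_ideal E11"
      by (intro rel_ideal.add var_rel q)
    then show ?thesis using h c d by (simp add: surgery_factor_def algebra_simps)
  next
    assume h: "(u, v) \<notin> E00" "(u, v) \<in> E01"
    have a: "(u, v) \<in> E10" "(u, v) \<notin> E11" using b1 b4 h by auto
    have E10: "E10 = fuse E00 u v" and E01: "E01 = fuse E11 u v" using f1 f4 a h by auto
    have c: "(u', v') \<notin> E00"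
    proof
      assume n: "(u', v') \<in> E00"
      then have "E00 = fuse E01 u' v'" using f3(2) b3 by blast
      then show False using h sub[of E01 u' v'] by auto
    qed
    have d: "(u', v') \<in> E10"
    proof (rule ccontr)
      assume n: "(u', v') \<notin> E10"
      then have "E11 = fuse E10 u' v'" using f2(1) by blast
      then show False using a sub[of E10 u' v'] by auto
    qed
    have p: "(u', v') \<notin> E11" using b2 d by auto
    have "(u', v') \<in> E01" using b3 c by auto
    then have "(u', u) \<in> E11 \<and> (v', v) \<in> E11 \<or> (u', v) \<in> E11 \<and> (v', u) \<in> E11"
      using fuse_sep[OF eq(4), of u' v' u v] p E01 by simp
    then have "var u' + var v' - (var u + var v) \<in> rel_ideal E11"
    proof
      assume "(u', u) \<in> E11 \<and> (v', v) \<in> E11"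
      then have "(var u' - var u) + (var v' - var v) \<in> rel_ideal E11" by (intro rel_ideal.add var_rel) auto
      then show ?thesis by (simp add: algebra_simps)
    next
      assume "(u', v) \<in> E11 \<and> (v', u) \<in> E11"
      then have "(var u' - var v) + (var v' - var u) \<in> rel_ideal E11" by (intro rel_ideal.add var_rel) auto
      then show ?thesis by (simp add: algebra_simps)
    qed
    then show ?thesis using h c d by (simp add: surgery_factor_def)
  qed
qed

lemma saddle_exchange:
  assumes s1: "surgered V E00 E10 u v" and s2: "surgered V E10 E11 u' v'"
    and s3: "surgered V E00 E01 u' v'" and s4: "surgered V E01 E11 u v"
  shows "saddle E00 E10 * saddle E10 E11 - saddle E00 E01 * saddle E01 E11 \<in> rel_ideal E11"
proof -
  have comp: "saddle E0 E1 * saddle E1 E2 - surgery_factor E0 u v * surgery_factor E1 u' v' \<in> rel_ideal E2"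
    if a: "surgered V E0 E1 u v" and b: "surgered V E1 E2 u' v'" for E0 E1 E2 u v u' v'
  proof -
    have "saddle E1 E2 * (saddle E0 E1 - surgery_factor E0 u v)
        + surgery_factor E0 u v * (saddle E1 E2 - surgery_factor E1 u' v') \<in> rel_ideal E2"
      by (intro rel_ideal.add rel_ideal_mult_left saddle_rel_ideal[OF b] saddle_surgery_factor[OF a]
          saddle_surgery_factor[OF b])
    then show ?thesis by (simp add: algebra_simps)
  qed
  have "(saddle E00 E10 * saddle E10 E11 - surgery_factor E00 u v * surgery_factor E10 u' v')
      - (saddle E00 E01 * saddle E01 E11 - surgery_factor E00 u' v' * surgery_factor E01 u v)
      + (surgery_factor E00 u v * surgery_factor E10 u' v'
        - surgery_factor E00 u' v' * surgery_factor E01 u v) \<in> rel_ideal E11"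
    by (rule rel_ideal.add[OF rel_ideal_diff[OF comp[OF s1 s2] comp[OF s3 s4]]
          surgery_factor_exchange[OF assms]])
  then show ?thesis by (simp add: algebra_simps)
qed

section \<open>Polynomials acting on labellings\<close>

definition poly_act :: "('v \<Rightarrow> ('b \<Rightarrow>\<^sub>0 int) \<Rightarrow> ('b \<Rightarrow>\<^sub>0 int)) \<Rightarrow> 'v zpoly \<Rightarrow> ('b \<Rightarrow>\<^sub>0 int) \<Rightarrow> ('b \<Rightarrow>\<^sub>0 int)" where
  "poly_act act p z = frag_extend (\<lambda>\<mu>. fold_mset act z \<mu>) p"

lemma poly_act_0 [simp]: "poly_act act 0 z = 0"
  by (simp add: poly_act_def)

lemma poly_act_diff: "poly_act act (p - q) z = poly_act act p z - poly_act act q z"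
  by (simp add: poly_act_def frag_extend_diff)

lemma poly_act_add: "poly_act act (p + q) z = poly_act act p z + poly_act act q z"
  by (simp add: poly_act_def frag_extend_add)

lemma poly_act_1 [simp]: "poly_act act 1 z = z"
  unfolding poly_act_def frag_of_empty_mset[symmetric] by (subst frag_extend_of) simp

locale commuting_actions =
  fixes act :: "'v \<Rightarrow> ('b \<Rightarrow>\<^sub>0 int) \<Rightarrow> ('b \<Rightarrow>\<^sub>0 int)"
  assumes act_commute: "act a (act b z) = act b (act a z)"
    and act_diff: "act a (x - y) = act a x - act a y"

begin

lemma act_0 [simp]: "act a 0 = 0"
  using act_diff[of a 0 0] by simp

lemma poly_act_var_mult: "poly_act act (var a * p) z = act a (poly_act act p z)"
proof -
  interpret comp_fun_commute act by standard (auto simp: act_commute)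
  show ?thesis
  proof (rule frag_induction[of p UNIV])
    fix \<mu>
    show "poly_act act (var a * frag_of \<mu>) z = act a (poly_act act (frag_of \<mu>) z)"
      unfolding frag_of_add_mset[symmetric] by (simp add: poly_act_def)
  qed (simp_all add: right_diff_distrib poly_act_diff act_diff)
qed

lemma poly_act_var [simp]: "poly_act act (var a) z = act a z"
  using poly_act_var_mult[of a 1 z] by simp

lemma poly_act_diff_right: "poly_act act p (x - y) = poly_act act p x - poly_act act p y"
  by (induction p rule: zpoly_induct) (simp_all add: poly_act_diff poly_act_var_mult act_diff)

lemma poly_act_0_right [simp]: "poly_act act p 0 = 0"
  using poly_act_diff_right[of p 0 0] by simp

lemma poly_act_add_right: "poly_act act p (x + y) = poly_act act p x + poly_act act p y"
  using poly_act_diff_right[of p "x + y" y] by simp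

lemma poly_act_mult: "poly_act act (p * q) z = poly_act act p (poly_act act q z)"
  by (induction p rule: zpoly_induct)
    (simp_all add: poly_act_diff poly_act_var_mult left_diff_distrib mult.assoc)

lemma poly_act_rel_ideal:
  assumes p: "p \<in> rel_ideal E"
    and sq: "\<And>a. act a (act a z) = 0"
    and rl: "\<And>a b. (a, b) \<in> E ==> act a z = act b z"
    and ou: "\<And>a. (a, a) \<notin> E ==> act a z = 0"
  shows "poly_act act p z = 0"
  using p
  by (induction rule: rel_ideal.induct)
    (simp_all add: poly_act_mult poly_act_diff poly_act_add poly_act_var_mult sq rl ou)

end

lemma poly_act_intertwine:
  assumes "commuting_actions act" "commuting_actions act'"
    and diff: "\<And>x y. f (x - y) = f x - f y" and f: "\<And>a z. f (act a z) = act' a (f z)"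
  shows "f (poly_act act p z) = poly_act act' p (f z)"
proof -
  have "f 0 = 0" using diff[of 0 0] by simp
  then show ?thesis using assms(1,2)
    by (induction p rule: zpoly_induct)
      (simp_all add: poly_act_diff diff f commuting_actions.poly_act_var_mult)
qed

definition label_op :: "'k \<Rightarrow> ('n \<times> ('k \<Rightarrow> kh_gen) \<Rightarrow>\<^sub>0 int) \<Rightarrow> ('n \<times> ('k \<Rightarrow> kh_gen) \<Rightarrow>\<^sub>0 int)" where
  "label_op K = frag_extend (\<lambda>(N, l). if l K = Gen1 then frag_of (N, l(K := GenX)) else 0)"

lemma label_op_of: "label_op K (frag_of (N, l)) = (if l K = Gen1 then frag_of (N, l(K := GenX)) else 0)"
  by (simp add: label_op_def)

lemma label_op_diff: "label_op K (x - y) = label_op K x - label_op K y"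
  by (simp add: label_op_def frag_extend_diff)

lemma label_op_add: "label_op K (x + y) = label_op K x + label_op K y"
  by (simp add: label_op_def frag_extend_add)

lemma label_op_0 [simp]: "label_op K 0 = 0"
  by (simp add: label_op_def)

lemma label_op_commute: "label_op K (label_op L z) = label_op L (label_op K z)"
proof (rule frag_induction[of z UNIV])
  fix x :: "'a \<times> ('b \<Rightarrow> kh_gen)"
  obtain N l where "x = (N, l)" by fastforce
  then show "label_op K (label_op L (frag_of x)) = label_op L (label_op K (frag_of x))"
    by (cases "K = L") (simp_all add: label_op_of fun_upd_twist)
qed (simp_all add: label_op_diff)

lemma label_op_square: "label_op K (label_op K z) = 0"
proof (rule frag_induction[of z UNIV])
  fix x :: "'a \<times> ('b \<Rightarrow> kh_gen)"
  obtain N l where "x = (N, l)" by fastforce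
  then show "label_op K (label_op K (frag_of x)) = 0"
    by (simp add: label_op_of)
qed (simp_all add: label_op_diff)

section \<open>The partial differentials\<close>

definition smoothing_rel :: "('p, 'a, 'z) signed_chord_diagram_scheme \<Rightarrow> 'p set set \<Rightarrow> ('a \<times> 'a) set" where
  "smoothing_rel D N = equiv_closure (glued D N) \<inter> arcs D \<times> arcs D"

lemma equiv_closure_sym: "(a, b) \<in> equiv_closure r ==> (b, a) \<in> equiv_closure r"
proof -
  have "(r \<union> converse r)\<inverse> = r \<union> converse r" by auto
  then show "(a, b) \<in> equiv_closure r ==> (b, a) \<in> equiv_closure r"
    unfolding equiv_closure_def by (metis rtrancl_converseI)
qed

lemma equiv_closure_trans:
  "(a, b) \<in> equiv_closure r ==> (b, c) \<in> equiv_closure r ==> (a, c) \<in> equiv_closure r"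
  unfolding equiv_closure_def by (rule rtrancl_trans)

lemma equiv_closure_refl [simp]: "(a, a) \<in> equiv_closure r"
  by (simp add: equiv_closure_def)

lemma equiv_closure_incl: "(a, b) \<in> r ==> (a, b) \<in> equiv_closure r"
  by (auto simp: equiv_closure_def)

lemma equiv_closure_induct [consumes 1, case_names refl step]:
  assumes "(a, b) \<in> equiv_closure r" "P a"
    and "\<And>x y. (a, x) \<in> equiv_closure r ==> (x, y) \<in> r \<or> (y, x) \<in> r ==> P x ==> P y"
  shows "P b"
  using assms(1) unfolding equiv_closure_def
  by (induction rule: rtrancl_induct) (use assms(2,3) in \<open>auto simp: equiv_closure_def\<close>)

lemma equiv_closure_map:
  assumes "(a, b) \<in> equiv_closure r" "\<And>x y. (x, y) \<in> r ==> (f x, f y) \<in> equiv_closure s"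
  shows "(f a, f b) \<in> equiv_closure s"
  using assms(1)
proof (induction rule: equiv_closure_induct)
  case (step x y)
  then show ?case using assms(2) equiv_closure_sym equiv_closure_trans by metis
qed simp

lemma equiv_smoothing_rel: "equiv (arcs D) (smoothing_rel D N)"
proof (rule equivI)
  show "refl_on (arcs D) (smoothing_rel D N)" by (auto simp: refl_on_def smoothing_rel_def)
  show "smoothing_rel D N \<subseteq> arcs D \<times> arcs D" by (auto simp: smoothing_rel_def)
  show "sym (smoothing_rel D N)" by (auto simp: sym_def smoothing_rel_def intro: equiv_closure_sym)
  show "trans (smoothing_rel D N)"
    by (auto simp: trans_def smoothing_rel_def intro: equiv_closure_trans)
qed

lemma arc_in_arcs: "is_chord_diagram D ==> p \<in> points D ==> arc_in D p \<in> arcs D"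
  and arc_out_arcs: "is_chord_diagram D ==> p \<in> points D ==> arc_out D p \<in> arcs D"
  by (auto simp: is_chord_diagram_def)

lemma glued_arcs: "is_chord_diagram D ==> glued D N \<subseteq> arcs D \<times> arcs D"
proof -
  assume D: "is_chord_diagram D"
  have "p \<in> points D \<and> q \<in> points D" if "{p, q} \<in> chords D" for p q
    using that by (auto simp: points_def)
  then show ?thesis
    using arc_in_arcs[OF D] arc_out_arcs[OF D] by (auto simp: glued_def split: if_splits)
qed

lemma equiv_closure_arcs:
  assumes "is_chord_diagram D" "(a, b) \<in> equiv_closure (glued D N)" "a \<in> arcs D"
  shows "b \<in> arcs D"
  using assms(2,3) by (induction rule: equiv_closure_induct) (use glued_arcs[OF assms(1)] in auto)

lemma components_smoothing_rel:
  assumes "is_chord_diagram D"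
  shows "components D N = arcs D // smoothing_rel D N"
proof -
  have "equiv_closure (glued D N) `` {a} = smoothing_rel D N `` {a}" if "a \<in> arcs D" for a
    using that equiv_closure_arcs[OF assms _ that] by (auto simp: smoothing_rel_def)
  then show ?thesis by (auto simp: components_def quotient_def)
qed

lemma merges_unique:
  assumes "merges D N M (C1, C2, C)" "merges D N M (C1', C2', C')"
  shows "C' = C \<and> (C1' = C1 \<and> C2' = C2 \<or> C1' = C2 \<and> C2' = C1)"
  using assms unfolding merges_def by (auto simp: doubleton_eq_iff)

lemma merges_asym: "merges D N M T ==> \<not> merges D M N T'"
  unfolding merges_def by (auto split: prod.splits)

lemma kh_partial_merge:
  assumes "merges D N M (C1, C2, C)"
  shows "kh_partial D N M l = (if l C1 = GenX \<and> l C2 = GenX then 0 else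
    frag_of (M, restrict (l(C := if l C1 = GenX \<or> l C2 = GenX then GenX else Gen1)) (components D M)))"
proof -
  obtain C1' C2' C' where T: "(SOME T. merges D N M T) = (C1', C2', C')"
    using prod_cases3 by blast
  then have "merges D N M (C1', C2', C')" using assms by (metis someI_ex)
  from merges_unique[OF assms this]
  show ?thesis
    using assms T by (cases "l C1"; cases "l C2") (auto simp: kh_partial_def)
qed

lemma kh_partial_split:
  assumes "merges D M N (C1, C2, C)"
  shows "kh_partial D N M l = (if l C = GenX
    then frag_of (M, restrict (l(C1 := GenX, C2 := GenX)) (components D M))
    else frag_of (M, restrict (l(C1 := GenX, C2 := Gen1)) (components D M)) +
      frag_of (M, restrict (l(C1 := Gen1, C2 := GenX)) (components D M)))"
proof -
  have n: "\<not> (\<exists>T. merges D N M T)" using assms merges_asym by blast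
  have ne: "C1 \<noteq> C2" using assms by (auto simp: merges_def)
  obtain C1' C2' C' where T: "(SOME T. merges D M N T) = (C1', C2', C')"
    using prod_cases3 by blast
  then have "merges D M N (C1', C2', C')" using assms by (metis someI_ex)
  from merges_unique[OF assms this]
  moreover have "l(C2 := g, C1 := h) = l(C1 := h, C2 := g)" for g h
    using ne by (metis fun_upd_twist)
  moreover have "\<exists>T. merges D M N T" using assms by blast
  ultimately show ?thesis
    using T n by (cases "l C") (auto simp: kh_partial_def frag_extend_add add.commute simp del: split_paired_Ex)
qed

definition kh_edge :: "('p, 'a, 'z) signed_chord_diagram_scheme \<Rightarrow> 'p set set \<Rightarrow> 'p set set \<Rightarrow>
    (('p, 'a) kh_basis \<Rightarrow>\<^sub>0 int) \<Rightarrow> (('p, 'a) kh_basis \<Rightarrow>\<^sub>0 int)" where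
  "kh_edge D N M = frag_extend (\<lambda>(N', l). kh_partial D N M l)"

lemma kh_edge_of [simp]: "kh_edge D N M (frag_of (N', l)) = kh_partial D N M l"
  by (simp add: kh_edge_def)

lemma kh_edge_diff: "kh_edge D N M (x - y) = kh_edge D N M x - kh_edge D N M y"
  by (simp add: kh_edge_def frag_extend_diff)

lemma kh_edge_0 [simp]: "kh_edge D N M 0 = 0"
  by (simp add: kh_edge_def)

lemma restrict_upd_inside: "K \<in> A ==> (restrict l A)(K := g) = restrict (l(K := g)) A"
  by (auto simp: restrict_def)

lemma kh_edge_merge_label_op:
  fixes D :: "('p, 'a, 'z) signed_chord_diagram_scheme"
  assumes m: "merges D N M (C1, C2, C)"
    and K: "K \<in> {C1, C2} \<and> K' = C \<or> K' = K \<and> K \<in> components D N \<inter> components D M"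
  shows "kh_edge D N M (label_op K z) = label_op K' (kh_edge D N M z)"
proof (rule frag_induction[of z UNIV])
  fix x :: "('p, 'a) kh_basis"
  obtain N' l where x: "x = (N', l)" by fastforce
  have ne: "C1 \<noteq> C2" and P: "C1 \<in> components D N" "C2 \<in> components D N" "C \<notin> components D N"
    and Q: "C1 \<notin> components D M" "C2 \<notin> components D M" "C \<in> components D M"
    using m by (auto simp: merges_def)
  have gen: "g \<noteq> GenX \<longleftrightarrow> g = Gen1" for g by (cases g) auto
  show "kh_edge D N M (label_op K (frag_of x)) = label_op K' (kh_edge D N M (frag_of x))"
  proof (cases "K \<in> {C1, C2}")
    case True
    then have K': "K' = C" using K Q by auto
    have CC: "C \<noteq> C1" "C \<noteq> C2" using P by auto
    have r: "restrict (l(C1 := g, C := h)) (components D M) = restrict (l(C := h)) (components D M)"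
      "restrict (l(C2 := g, C := h)) (components D M) = restrict (l(C := h)) (components D M)" for g h
      using CC Q by (auto simp: restrict_def)
    show ?thesis using True ne P Q CC r unfolding x K'
      by (cases "l C1"; cases "l C2")
        (auto simp: label_op_of kh_partial_merge[OF m] restrict_upd_inside)
  next
    case False
    then have K': "K' = K" "K \<in> components D M" "K \<noteq> C" "K \<noteq> C1" "K \<noteq> C2" using K P by auto
    show ?thesis using K' unfolding x
      by (cases "l C1"; cases "l C2"; cases "l K")
        (auto simp: label_op_of kh_partial_merge[OF m] restrict_upd_inside fun_upd_twist)
  qed
qed (simp_all add: label_op_diff kh_edge_diff)

lemma kh_edge_split_label_op:
  fixes D :: "('p, 'a, 'z) signed_chord_diagram_scheme"
  assumes m: "merges D M N (C1, C2, C)"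
    and K: "K' \<in> {C1, C2} \<and> K = C \<or> K' = K \<and> K \<in> components D N \<inter> components D M"
  shows "kh_edge D N M (label_op K z) = label_op K' (kh_edge D N M z)"
proof (rule frag_induction[of z UNIV])
  fix x :: "('p, 'a) kh_basis"
  obtain N' l where x: "x = (N', l)" by fastforce
  have ne: "C1 \<noteq> C2" and P: "C1 \<notin> components D N" "C2 \<notin> components D N" "C \<in> components D N"
    and Q: "C1 \<in> components D M" "C2 \<in> components D M" "C \<notin> components D M"
    using m by (auto simp: merges_def)
  have CC: "C \<noteq> C1" "C \<noteq> C2" using P by auto
  show "kh_edge D N M (label_op K (frag_of x)) = label_op K' (kh_edge D N M (frag_of x))"
  proof (cases "K' \<in> {C1, C2}")
    case True
    then have K': "K = C" using K P by auto
    have r: "restrict (l(C := g, C1 := h, C2 := h')) (components D M) = restrict (l(C1 := h, C2 := h')) (components D M)" for g h h'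
      using CC Q by (auto simp: restrict_def)
    show ?thesis using True ne P Q CC r unfolding x K'
      by (cases "l C")
        (auto simp: label_op_of kh_partial_split[OF m] restrict_upd_inside label_op_add fun_upd_twist)
  next
    case False
    then have K': "K' = K" "K \<in> components D M" "K \<noteq> C" "K \<noteq> C1" "K \<noteq> C2" using K P Q by auto
    show ?thesis using K' unfolding x
      by (cases "l C"; cases "l K")
        (auto simp: label_op_of kh_partial_split[OF m] restrict_upd_inside fun_upd_twist label_op_add)
  qed
qed (simp_all add: label_op_diff kh_edge_diff)

section \<open>Smoothings as cycles of permutations\<close>

text \<open>
  Follow the composite \<open>\<pi> \<circ> transpose u v\<close> from \<open>v\<close>: it runs along the cycle of \<open>u\<close> under
  \<open>\<pi>\<close> until this cycle hits \<open>u\<close> or \<open>v\<close> for the first time.  In the first case \<open>u\<close> has been reached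
  and the two cycles have merged, in the second case the walk has returned to its start without
  meeting \<open>u\<close>.
\<close>

lemma orbit_transpose:
  assumes \<pi>: "permutation \<pi>" and uv: "u \<noteq> v"
  shows "v \<in> orbit (\<pi> \<circ> transpose u v) u \<longleftrightarrow> v \<notin> orbit \<pi> u"
proof -
  define \<rho> where "\<rho> = \<pi> \<circ> transpose u v"
  have \<rho>: "permutation \<rho>" unfolding \<rho>_def
    using \<pi> by (intro permutation_compose permutation_swap_id) auto
  have self: "x \<in> orbit \<rho> x" "x \<in> orbit \<pi> x" for x
    using \<rho> \<pi> by (auto intro: permutation_self_in_orbit)
  have sw: "x \<in> orbit \<rho> y \<longleftrightarrow> y \<in> orbit \<rho> x" for x y using self by (metis orbit_swap)
  let ?P = "\<lambda>k. 0 < k \<and> (\<pi> ^^ k) u \<in> {u, v}"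
  obtain n where n: "u = (\<pi> ^^ n) u" "0 < n" using self(2)[of u] unfolding orbit_altdef by blast
  then have "?P n" by simp
  define k where "k = (LEAST k. ?P k)"
  have k: "?P k" unfolding k_def using \<open>?P n\<close> by (rule LeastI)
  have least: "(\<pi> ^^ i) u \<notin> {u, v}" if "0 < i" "i < k" for i
    using not_less_Least[of i ?P] that k_def by auto
  have walk: "(\<rho> ^^ Suc i) v = (\<pi> ^^ Suc i) u" if "Suc i \<le> k" for i
    using that
  proof (induction i)
    case 0 then show ?case by (simp add: \<rho>_def)
  next
    case (Suc i)
    then show ?case using least[of "Suc i"] by (simp add: \<rho>_def transpose_def)
  qed
  have walk': "(\<rho> ^^ i) v = (\<pi> ^^ i) u" if "0 < i" "i \<le> k" for i
    using walk[of "i - 1"] that by simp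
  show ?thesis
  proof (cases "(\<pi> ^^ k) u = u")
    case True
    have "v \<notin> orbit \<pi> u"
    proof
      assume "v \<in> orbit \<pi> u"
      then obtain n where "(\<pi> ^^ n) u = v" unfolding orbit_altdef by auto
      then have "(\<pi> ^^ (n mod k)) u = v" using funpow_mod_eq[OF True] by simp
      then show False using least[of "n mod k"] k uv by (cases "n mod k = 0") auto
    qed
    moreover have "u \<in> orbit \<rho> v" using walk'[of k] k True unfolding orbit_altdef by force
    ultimately show ?thesis using sw by (simp add: \<rho>_def)
  next
    case False
    then have v: "(\<pi> ^^ k) u = v" using k by auto
    have per: "(\<rho> ^^ k) v = v" using walk'[of k] k v by simp
    have "u \<notin> orbit \<rho> v"
    proof
      assume "u \<in> orbit \<rho> v"
      then obtain n where "(\<rho> ^^ n) v = u" unfolding orbit_altdef by auto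
      then have "(\<rho> ^^ (n mod k)) v = u" using funpow_mod_eq[OF per] by simp
      then show False using walk'[of "n mod k"] least[of "n mod k"] k uv
        by (cases "n mod k = 0") auto
    qed
    moreover have "v \<in> orbit \<pi> u" using v k unfolding orbit_altdef by force
    ultimately show ?thesis using sw by (simp add: \<rho>_def)
  qed
qed

lemma glued_iff:
  "(a, b) \<in> glued D N \<longleftrightarrow> (\<exists>p q. {p, q} \<in> chords D \<and> p \<noteq> q \<and>
     (if marker N {p, q} = sign D {p, q} then a = arc_in D p \<and> b = arc_out D q
      else a = arc_in D p \<and> b = arc_in D q \<or> a = arc_out D p \<and> b = arc_out D q))"
  (is "?L \<longleftrightarrow> (\<exists>p q. ?R p q)")
proof
  assume ?L
  then obtain c p q where "c = {p, q}" and R: "c \<in> chords D" "p \<noteq> q" "if marker N c = sign D c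
      then a = arc_in D p \<and> b = arc_out D q
      else a = arc_in D p \<and> b = arc_in D q \<or> a = arc_out D p \<and> b = arc_out D q"
    unfolding glued_def by blast
  then have "?R p q" by blast
  then show "\<exists>p q. ?R p q" by blast
next
  assume "\<exists>p q. ?R p q"
  then obtain p q where "?R p q" by blast
  then show ?L unfolding glued_def by blast
qed

lemma glued_same:
  assumes "{p, q} \<in> chords D" "p \<noteq> q" "marker N {p, q} = sign D {p, q}"
  shows "(arc_in D p, arc_out D q) \<in> glued D N" "(arc_in D q, arc_out D p) \<in> glued D N"
proof -
  have "{q, p} \<in> chords D" "marker N {q, p} = sign D {q, p}" using assms by (simp_all add: insert_commute)
  then show "(arc_in D p, arc_out D q) \<in> glued D N" "(arc_in D q, arc_out D p) \<in> glued D N"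
    using assms unfolding glued_iff by metis+
qed

lemma glued_opposite:
  assumes "{p, q} \<in> chords D" "p \<noteq> q" "marker N {p, q} \<noteq> sign D {p, q}"
  shows "(arc_in D p, arc_in D q) \<in> glued D N" "(arc_out D p, arc_out D q) \<in> glued D N"
  using assms unfolding glued_iff by metis+

lemma smoothing_rel_least:
  assumes "equiv (arcs D) E" "\<And>a b. (a, b) \<in> glued D N ==> (a, b) \<in> E"
  shows "smoothing_rel D N \<subseteq> E"
proof -
  have r: "(a, a) \<in> E" if "a \<in> arcs D" for a
    using assms(1) that by (auto simp: equiv_def refl_on_def)
  have s: "sym E" and t: "trans E" using assms(1) by (auto simp: equiv_def)
  have "(a, b) \<in> E" if "a \<in> arcs D" "(a, b) \<in> equiv_closure (glued D N)" for a b
    using that(2)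
  proof (induction rule: equiv_closure_induct)
    case (step x y)
    then have "(x, y) \<in> E" using assms(2) symD[OF s] by blast
    then show ?case using step(3) transD[OF t] by blast
  qed (rule r[OF that(1)])
  then show ?thesis by (auto simp: smoothing_rel_def)
qed

lemma glued_smoothing_rel:
  assumes "is_chord_diagram D" "(a, b) \<in> glued D N"
  shows "(a, b) \<in> smoothing_rel D N" "(b, a) \<in> smoothing_rel D N"
  using assms glued_arcs[OF assms(1)]
  by (auto simp: smoothing_rel_def intro: equiv_closure_incl equiv_closure_sym)

definition mate :: "('p, 'a, 'z) chord_diagram_scheme \<Rightarrow> 'p \<Rightarrow> 'p" where
  "mate D p = (THE q. q \<noteq> p \<and> {p, q} \<in> chords D)"

context
  fixes D :: "('p, 'a, 'z) signed_chord_diagram_scheme" and ori :: "'a \<Rightarrow> bool"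
  assumes D: "is_chord_diagram D" and ori: "is_orientation D ori"

begin

lemma mate_eq:
  assumes "{p, q} \<in> chords D" "p \<noteq> q"
  shows "mate D p = q"
  unfolding mate_def
proof (rule the_equality)
  fix q' assume q': "q' \<noteq> p \<and> {p, q'} \<in> chords D"
  have "{p, q} \<inter> {p, q'} \<noteq> {}" by simp
  then have "{p, q} = {p, q'}" using D assms q' unfolding is_chord_diagram_def by metis
  then show "q' = q" using q' assms by (auto simp: doubleton_eq_iff)
qed (use assms in auto)

lemma chord_ends: "{p, q} \<in> chords D ==> p \<in> points D \<and> q \<in> points D"
  by (auto simp: points_def)

lemma point_mate:
  assumes "p \<in> points D"
  shows "{p, mate D p} \<in> chords D" "mate D p \<noteq> p" "mate D (mate D p) = p"
proof -
  obtain c where c: "c \<in> chords D" "p \<in> c" using assms by (auto simp: points_def)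
  then have "card c = 2" using D by (auto simp: is_chord_diagram_def)
  then obtain q where q: "c = {p, q}" "p \<noteq> q" using c(2) by (auto simp: card_2_iff)
  then have "{p, q} \<in> chords D" "{q, p} \<in> chords D" using c by (auto simp: insert_commute)
  then show "{p, mate D p} \<in> chords D" "mate D p \<noteq> p" "mate D (mate D p) = p"
    using mate_eq[of p q] mate_eq[of q p] q by auto
qed

lemma attractive_mate:
  assumes "{p, q} \<in> chords D"
  shows "attractive D ori p \<longleftrightarrow> repulsive D ori q"
proof -
  obtain p' q' where "{p, q} = {p', q'}" "attractive D ori p'" "repulsive D ori q'"
    using ori assms unfolding is_orientation_def by blast
  moreover have "\<not> (attractive D ori x \<and> repulsive D ori x)" for x
    by (auto simp: attractive_def repulsive_def)
  ultimately show ?thesis by (auto simp: doubleton_eq_iff)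
qed

text \<open>
  With respect to the orientation of the diagram, the arcs before and after an attractive point
  both have their head there, and every arc with end points has exactly one head.  Dually for
  repulsive points and tails.
\<close>

definition heads :: "('p \<times> bool) set" where
  "heads = {p \<in> points D. attractive D ori p} \<times> UNIV"

definition head_arc :: "'p \<times> bool \<Rightarrow> 'a" where
  "head_arc = (\<lambda>(p, b). if b then arc_in D p else arc_out D p)"

lemma inj_ends: "inj_on (arc_in D) (points D)" "inj_on (arc_out D) (points D)"
  "arc_in D ` points D = arc_out D ` points D"
  using D by (auto simp: is_chord_diagram_def)

lemma arc_out_in: "p \<in> points D ==> arc_out D p \<in> arc_in D ` points D"
  using inj_ends(3) by blast

lemma attractive_or_repulsive: "p \<in> points D ==> attractive D ori p \<or> repulsive D ori p"
  using ori by (auto simp: is_orientation_def)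

lemma bij_heads: "bij_betw head_arc heads (arc_in D ` points D)"
  unfolding bij_betw_def
proof
  have ne: "arc_in D p \<noteq> arc_out D p'" if "attractive D ori p" "attractive D ori p'" for p p'
    using that by (auto simp: attractive_def)
  show "inj_on head_arc heads"
  proof (rule inj_onI)
    fix x y assume xy: "x \<in> heads" "y \<in> heads" "head_arc x = head_arc y"
    then show "x = y" using ne ne[symmetric] inj_ends
      by (cases x; cases y) (auto simp: heads_def head_arc_def inj_on_def split: if_splits)
  qed
  show "head_arc ` heads = arc_in D ` points D"
  proof
    show "head_arc ` heads \<subseteq> arc_in D ` points D"
      using arc_out_in by (auto simp: heads_def head_arc_def)
    show "arc_in D ` points D \<subseteq> head_arc ` heads"
    proof
      fix a assume a: "a \<in> arc_in D ` points D"
      show "a \<in> head_arc ` heads"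
      proof (cases "ori a")
        case True
        from a obtain p where p: "p \<in> points D" "a = arc_in D p" by auto
        then have "(p, True) \<in> heads" "a = head_arc (p, True)"
          using True attractive_or_repulsive[of p] by (auto simp: heads_def head_arc_def repulsive_def)
        then show ?thesis by blast
      next
        case False
        from a obtain p where p: "p \<in> points D" "a = arc_out D p" using inj_ends(3) by auto
        then have "(p, False) \<in> heads" "a = head_arc (p, False)"
          using False attractive_or_repulsive[of p] by (auto simp: heads_def head_arc_def repulsive_def)
        then show ?thesis by blast
      qed
    qed
  qed
qed

definition tail_arc :: "'p set set \<Rightarrow> 'p \<times> bool \<Rightarrow> 'a" where
  "tail_arc N = (\<lambda>(p, b). if (marker N {p, mate D p} = sign D {p, mate D p}) = b
     then arc_out D (mate D p) else arc_in D (mate D p))"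

lemma bij_tails: "bij_betw (tail_arc N) heads (arc_in D ` points D)"
  unfolding bij_betw_def
proof
  have ne: "arc_in D p \<noteq> arc_out D p'" if "repulsive D ori p" "repulsive D ori p'" for p p'
    using that by (auto simp: repulsive_def)
  have m: "mate D p \<in> points D" "repulsive D ori (mate D p)"
    if "p \<in> points D" "attractive D ori p" for p
    using that point_mate[of p] attractive_mate[of p "mate D p"] chord_ends by auto
  have mi: "mate D p = mate D p' ==> p = p'" if "p \<in> points D" "p' \<in> points D" for p p'
    using point_mate(3) that by metis
  show "inj_on (tail_arc N) heads"
  proof (rule inj_onI)
    fix x y assume xy: "x \<in> heads" "y \<in> heads" "tail_arc N x = tail_arc N y"
    obtain p b p' b' where x: "x = (p, b)" and y: "y = (p', b')" by fastforce
    have p: "p \<in> points D" "attractive D ori p" "p' \<in> points D" "attractive D ori p'"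
      using xy by (auto simp: x y heads_def)
    have "mate D p = mate D p'" using xy(3) m[OF p(1,2)] m[OF p(3,4)] ne[of "mate D p" "mate D p'"]
        ne[of "mate D p'" "mate D p"] inj_ends
      by (auto simp: x y tail_arc_def inj_on_def split: if_splits)
    then have "p = p'" using mi p by blast
    moreover have "b = b'" using xy(3) m[OF p(1,2)] ne[of "mate D p" "mate D p"] \<open>p = p'\<close>
      by (auto simp: x y tail_arc_def split: if_splits)
    ultimately show "x = y" by (simp add: x y)
  qed
  show "tail_arc N ` heads = arc_in D ` points D"
  proof
    show "tail_arc N ` heads \<subseteq> arc_in D ` points D"
    proof
      fix a assume "a \<in> tail_arc N ` heads"
      then obtain p b where p: "p \<in> points D" "attractive D ori p" "a = tail_arc N (p, b)"
        by (auto simp: heads_def)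
      then show "a \<in> arc_in D ` points D"
        using m[OF p(1,2)] arc_out_in by (auto simp: tail_arc_def split: if_splits)
    qed
    show "arc_in D ` points D \<subseteq> tail_arc N ` heads"
    proof
      fix a assume a: "a \<in> arc_in D ` points D"
      have key: "a \<in> tail_arc N ` heads" if q: "q \<in> points D" "repulsive D ori q"
        "a = (if b then arc_out D q else arc_in D q)" for q b
      proof -
        let ?p = "mate D q"
        have "{q, ?p} \<in> chords D" using point_mate[OF q(1)] by simp
        then have p: "?p \<in> points D" "attractive D ori ?p" "mate D ?p = q"
          using attractive_mate[of ?p q] q chord_ends point_mate[OF q(1)] by (auto simp: insert_commute)
        let ?o = "marker N {?p, q} = sign D {?p, q}"
        have "a = tail_arc N (?p, ?o = b)" using q p by (auto simp: tail_arc_def)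
        then show ?thesis using p by (auto simp: heads_def)
      qed
      show "a \<in> tail_arc N ` heads"
      proof (cases "ori a")
        case True
        from a obtain p where p: "p \<in> points D" "a = arc_out D p" using inj_ends(3) by auto
        then show ?thesis using True attractive_or_repulsive[of p] key[of p True]
          by (auto simp: attractive_def)
      next
        case False
        from a obtain p where p: "p \<in> points D" "a = arc_in D p" by auto
        then show ?thesis using False attractive_or_repulsive[of p] key[of p False]
          by (auto simp: attractive_def)
      qed
    qed
  qed
qed

definition next_arc :: "'p set set \<Rightarrow> 'a \<Rightarrow> 'a" where
  "next_arc N a = (if a \<in> arc_in D ` points D then tail_arc N (inv_into heads head_arc a) else a)"

lemma next_arc_head: "x \<in> heads ==> next_arc N (head_arc x) = tail_arc N x"
  using bij_heads by (auto simp: next_arc_def bij_betw_def inv_into_f_f)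

lemma head_arc_cases:
  assumes "a \<in> arc_in D ` points D"
  obtains p b where "(p, b) \<in> heads" "a = head_arc (p, b)"
proof -
  have "a \<in> head_arc ` heads" using assms bij_heads by (simp add: bij_betw_def)
  then obtain x where "x \<in> heads" "a = head_arc x" by blast
  then show ?thesis using that by (cases x) blast
qed

lemma next_arc_permutes: "next_arc N permutes (arc_in D ` points D)"
proof (rule bij_imp_permutes)
  have "bij_betw (tail_arc N \<circ> inv_into heads head_arc) (arc_in D ` points D) (arc_in D ` points D)"
    using bij_betw_inv_into[OF bij_heads] bij_tails by (rule bij_betw_trans)
  then show "bij_betw (next_arc N) (arc_in D ` points D) (arc_in D ` points D)"
    by (rule bij_betw_cong[THEN iffD1, rotated]) (simp add: next_arc_def)
qed (simp add: next_arc_def)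

lemma next_arc_permutation: "permutation (next_arc N)"
proof -
  have "finite (arc_in D ` points D)"
    using D unfolding is_chord_diagram_def by (metis finite_subset)
  then show ?thesis using next_arc_permutes permutation_permutes by blast
qed

lemma orbit_next_arc_sym: "a \<in> orbit (next_arc N) b ==> b \<in> orbit (next_arc N) a"
  using permutation_self_in_orbit[OF next_arc_permutation] by (metis orbit_swap)

lemma next_arc_arcs: "a \<in> arcs D ==> next_arc N a \<in> arcs D"
proof (cases "a \<in> arc_in D ` points D")
  case True
  then have "next_arc N a \<in> arc_in D ` points D" using next_arc_permutes permutes_in_image by metis
  then show ?thesis using arc_in_arcs[OF D] by auto
qed (simp add: next_arc_def)

lemma smoothing_rel_next_arc:
  assumes "a \<in> arcs D"
  shows "(a, next_arc N a) \<in> smoothing_rel D N"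
proof (cases "a \<in> arc_in D ` points D")
  case True
  then obtain p b where x: "(p, b) \<in> heads" "a = head_arc (p, b)"
    by (rule head_arc_cases)
  let ?q = "mate D p"
  have p: "{p, ?q} \<in> chords D" "?q \<noteq> p" "{?q, p} \<in> chords D" "p \<noteq> ?q" "{?q, p} = {p, ?q}"
    using x point_mate[of p] by (auto simp: heads_def insert_commute)
  have "(a, next_arc N a) \<in> glued D N \<or> (next_arc N a, a) \<in> glued D N"
    unfolding x(2) next_arc_head[OF x(1)]
    using glued_same[OF p(1,4), of N] glued_opposite[OF p(1,4), of N]
    by (auto simp: head_arc_def tail_arc_def)
  then show ?thesis using glued_smoothing_rel[OF D] by blast
next
  case False
  then show ?thesis using assms by (simp add: next_arc_def smoothing_rel_def)
qed

lemma smoothing_rel_orbit: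
  assumes "a \<in> arcs D"
  shows "(a, b) \<in> smoothing_rel D N \<longleftrightarrow> b \<in> orbit (next_arc N) a"
proof
  assume "b \<in> orbit (next_arc N) a"
  then have "b \<in> arcs D \<and> (a, b) \<in> smoothing_rel D N"
  proof (induction rule: orbit.induct)
    case base
    then show ?case using assms smoothing_rel_next_arc next_arc_arcs by blast
  next
    case (step b)
    then show ?case using smoothing_rel_next_arc next_arc_arcs equiv_smoothing_rel[of D N]
      unfolding equiv_def by (meson transD)
  qed
  then show "(a, b) \<in> smoothing_rel D N" by simp
next
  assume ab: "(a, b) \<in> smoothing_rel D N"
  let ?E = "{(a, b). a \<in> arcs D \<and> b \<in> arcs D \<and> b \<in> orbit (next_arc N) a}"
  have "equiv (arcs D) ?E"
  proof (rule equivI)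
    show "refl_on (arcs D) ?E"
      by (auto simp: refl_on_def intro: permutation_self_in_orbit[OF next_arc_permutation])
    show "sym ?E" by (auto simp: sym_def intro: orbit_next_arc_sym)
    show "trans ?E" unfolding trans_def by (auto intro: orbit_trans)
  qed auto
  then have "smoothing_rel D N \<subseteq> ?E"
  proof (rule smoothing_rel_least)
    fix a b assume g: "(a, b) \<in> glued D N"
    have "b \<in> orbit (next_arc N) a"
    proof -
      have main: "tail_arc N x \<in> orbit (next_arc N) (head_arc x)" if "x \<in> heads" for x
        using next_arc_head[OF that, of N] orbit.base[of "next_arc N" "head_arc x"] by simp
      have main2: "(if (marker N {p, q} = sign D {p, q}) = b then arc_out D q else arc_in D q) \<in>
          orbit (next_arc N) (if b then arc_in D p else arc_out D p)"
        if "{p, q} \<in> chords D" "p \<noteq> q" "attractive D ori p" for p q b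
      proof -
        have "(p, b) \<in> heads" using that chord_ends[OF that(1)] by (simp add: heads_def)
        from main[OF this] show ?thesis
          unfolding tail_arc_def head_arc_def prod.case mate_eq[OF that(1,2)] .
      qed
      from g obtain p q where pq: "{p, q} \<in> chords D" "p \<noteq> q" and
        ab: "if marker N {p, q} = sign D {p, q} then a = arc_in D p \<and> b = arc_out D q
          else a = arc_in D p \<and> b = arc_in D q \<or> a = arc_out D p \<and> b = arc_out D q"
        unfolding glued_iff by blast
      have qp: "{q, p} \<in> chords D" "{q, p} = {p, q}" using pq by (auto simp: insert_commute)
      show ?thesis
      proof (cases "attractive D ori p")
        case True
        show ?thesis using main2[OF pq True, of True] main2[OF pq True, of False] ab
          by (auto split: if_splits)
      next
        case False
        then have "repulsive D ori p" using attractive_or_repulsive chord_ends[OF pq(1)] by auto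
        then have t: "attractive D ori q" using attractive_mate[of q p] qp by simp
        show ?thesis
          using main2[OF qp(1) pq(2)[symmetric] t, of True] main2[OF qp(1) pq(2)[symmetric] t, of False] ab
          unfolding qp(2) by (auto intro: orbit_next_arc_sym split: if_splits)
      qed
    qed
    then show "(a, b) \<in> ?E" using g glued_arcs[OF D] by auto
  qed
  then show "b \<in> orbit (next_arc N) a" using ab by auto
qed

lemma fuse_smoothing_rel_le:
  assumes pq: "{p, q} \<in> chords D" "p \<noteq> q" and same: "\<And>c. c \<noteq> {p, q} ==> c \<in> N \<longleftrightarrow> c \<in> M"
  shows "fuse (smoothing_rel D N) (arc_in D p) (arc_out D p)
    \<subseteq> fuse (smoothing_rel D M) (arc_in D p) (arc_out D p)" (is "_ \<subseteq> ?F")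
proof (rule fuse_least)
  have P: "p \<in> points D" "q \<in> points D" using chord_ends[OF pq(1)] by auto
  have A: "arc_in D p \<in> arcs D" "arc_out D p \<in> arcs D" using P arc_in_arcs[OF D] arc_out_arcs[OF D] by auto
  show F: "equiv (arcs D) ?F" using equiv_fuse[OF equiv_smoothing_rel A] .
  have s: "sym ?F" and t: "trans ?F" using F by (auto simp: equiv_def)
  show io: "(arc_in D p, arc_out D p) \<in> ?F" using fuse_mem[OF equiv_smoothing_rel A] by blast
  have oi: "(arc_out D p, arc_in D p) \<in> ?F" using fuse_mem[OF equiv_smoothing_rel A] by blast
  have g: "(a, b) \<in> ?F" if "(a, b) \<in> glued D M" for a b
    by (rule subsetD[OF subset_fuse glued_smoothing_rel(1)[OF D that]])
  show "smoothing_rel D N \<subseteq> ?F"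
  proof (rule smoothing_rel_least[OF F])
    fix a b assume "(a, b) \<in> glued D N"
    then obtain p' q' where pq': "{p', q'} \<in> chords D" "p' \<noteq> q'" and
        ab: "if marker N {p', q'} = sign D {p', q'} then a = arc_in D p' \<and> b = arc_out D q'
          else a = arc_in D p' \<and> b = arc_in D q' \<or> a = arc_out D p' \<and> b = arc_out D q'"
      unfolding glued_iff by blast
    show "(a, b) \<in> ?F"
    proof (cases "{p', q'} = {p, q}")
      case False
      then have "marker N {p', q'} = marker M {p', q'}" using same by (simp add: marker_def)
      then have "(a, b) \<in> glued D M" using pq' ab unfolding glued_iff by metis
      then show ?thesis by (rule g)
    next
      case True
      have qp: "{q, p} \<in> chords D" "{q, p} = {p, q}" using pq by (auto simp: insert_commute)
      have all: "(arc_in D p, arc_in D q) \<in> ?F \<and> (arc_in D p, arc_out D q) \<in> ?F"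
      proof (cases "marker M {p, q} = sign D {p, q}")
        case True
        have "(arc_in D p, arc_out D q) \<in> ?F" "(arc_in D q, arc_out D p) \<in> ?F"
          using glued_same[OF pq True] by (auto intro: g)
        then show ?thesis using io oi by (meson symD[OF s] transD[OF t])
      next
        case False
        have "(arc_in D p, arc_in D q) \<in> ?F" "(arc_out D p, arc_out D q) \<in> ?F"
          using glued_opposite[OF pq False] by (auto intro: g)
        then show ?thesis using io oi by (meson symD[OF s] transD[OF t])
      qed
      have "x \<in> {arc_in D p, arc_out D p, arc_in D q, arc_out D q} ==> (arc_in D p, x) \<in> ?F" for x
        using all io transD[OF t io oi] by auto
      moreover have "a \<in> {arc_in D p, arc_out D p, arc_in D q, arc_out D q}"
        "b \<in> {arc_in D p, arc_out D p, arc_in D q, arc_out D q}"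
        using ab True by (auto simp: doubleton_eq_iff split: if_splits)
      ultimately show ?thesis by (meson symD[OF s] transD[OF t])
    qed
  qed
qed

text \<open>
  Both arcs at the attractive end \<open>p\<close> of a chord are heads, so that changing the marker of the
  chord composes the permutation with their transposition.
\<close>

lemma smoothing_rel_surgered:
  assumes sg: "sign D {p, q} \<in> {1, -1}"
    and pq: "{p, q} \<in> chords D" "p \<noteq> q" "attractive D ori p" and N: "{p, q} \<notin> N"
  shows "surgered (arcs D) (smoothing_rel D N) (smoothing_rel D (insert {p, q} N)) (arc_in D p) (arc_out D p)"
proof -
  let ?M = "insert {p, q} N" and ?u = "arc_in D p" and ?v = "arc_out D p"
  have P: "p \<in> points D" "q \<in> points D" using chord_ends[OF pq(1)] by auto
  have A: "?u \<in> arcs D" "?v \<in> arcs D" using P arc_in_arcs[OF D] arc_out_arcs[OF D] by auto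
  have h: "(p, b) \<in> heads" for b using P pq(3) by (simp add: heads_def)
  have m: "mate D p = q" by (rule mate_eq[OF pq(1,2)])
  have uv: "?u \<noteq> ?v" using pq(3) by (auto simp: attractive_def)
  have flip: "tail_arc ?M (p, b) = tail_arc N (p, \<not> b)" for b
    using sg N m by (auto simp: tail_arc_def marker_def)
  have keep: "tail_arc ?M (p', b) = tail_arc N (p', b)" if "(p', b) \<in> heads" "p' \<noteq> p" for p' b
  proof -
    have p': "{p', mate D p'} \<in> chords D" "attractive D ori p'" using that point_mate[of p'] by (auto simp: heads_def)
    have "{p', mate D p'} \<noteq> {p, q}"
    proof
      assume "{p', mate D p'} = {p, q}"
      then have "p' = q" using that by (auto simp: doubleton_eq_iff)
      then show False using attractive_mate[OF pq(1)] pq(3) p' by (auto simp: attractive_def repulsive_def)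
    qed
    then show ?thesis by (simp add: tail_arc_def marker_def)
  qed
  have next_eq: "next_arc ?M = next_arc N \<circ> transpose ?u ?v"
  proof
    fix a
    show "next_arc ?M a = (next_arc N \<circ> transpose ?u ?v) a"
    proof (cases "a \<in> arc_in D ` points D")
      case True
      then obtain p' b where x: "(p', b) \<in> heads" "a = head_arc (p', b)"
        by (rule head_arc_cases)
      show ?thesis
      proof (cases "p' = p")
        case True
        have "transpose ?u ?v a = head_arc (p, \<not> b)"
          using x True uv by (auto simp: head_arc_def transpose_def)
        then show ?thesis using next_arc_head[OF x(1)] next_arc_head[OF h] x True flip by simp
      next
        case False
        then have "a \<noteq> head_arc (p, True)" "a \<noteq> head_arc (p, False)"
          using bij_heads x h unfolding bij_betw_def inj_on_def by blast+
        then have "transpose ?u ?v a = a" by (simp add: head_arc_def)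
        then show ?thesis using next_arc_head[OF x(1)] x keep[OF x(1) False] by simp
      qed
    next
      case False
      have "?u \<in> arc_in D ` points D" "?v \<in> arc_in D ` points D" using P arc_out_in by auto
      then have "transpose ?u ?v a = a" using False by (auto simp: transpose_def)
      then show ?thesis using False by (simp add: next_arc_def)
    qed
  qed
  have x: "(?u, ?v) \<in> smoothing_rel D N \<longleftrightarrow> (?u, ?v) \<notin> smoothing_rel D ?M"
    using orbit_transpose[OF next_arc_permutation uv, of N] smoothing_rel_orbit[OF A(1)] next_eq by auto
  have "fuse (smoothing_rel D N) ?u ?v = fuse (smoothing_rel D ?M) ?u ?v"
    by (intro equalityI fuse_smoothing_rel_le[OF pq(1,2)]) auto
  then show ?thesis using x A equiv_smoothing_rel unfolding surgered_def by blast
qed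

end

section \<open>Complexes presented by generators and relations\<close>

record 'x presented =
  gr :: "int \<Rightarrow> int \<Rightarrow> 'x set"
  null :: "'x set"
  dif :: "'x \<Rightarrow> 'x"

definition additive_map :: "('x::ab_group_add \<Rightarrow> 'y::ab_group_add) \<Rightarrow> bool" where
  "additive_map f \<longleftrightarrow> (\<forall>x y. f (x - y) = f x - f y)"

lemma additive_map_diff: "additive_map f ==> f (x - y) = f x - f y"
  by (simp add: additive_map_def)

lemma additive_map_0: "additive_map f ==> f 0 = 0"
  using additive_map_diff[of f 0 0] by simp

lemma additive_map_add: "additive_map f ==> f (x + y) = f x + f y"
  using additive_map_diff[of f "x + y" y] by (simp add: eq_diff_eq)

lemma additive_map_uminus: "additive_map f ==> f (- x) = - f x"
  using additive_map_diff[of f 0 x] additive_map_0[of f] by simp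

definition pc_hom :: "int \<Rightarrow> 'x presented \<Rightarrow> 'y presented \<Rightarrow> ('x::ab_group_add \<Rightarrow> 'y::ab_group_add) \<Rightarrow> bool" where
  "pc_hom k C C' f \<longleftrightarrow> additive_map f \<and> (\<forall>x\<in>null C. f x \<in> null C') \<and>
     (\<forall>i j. \<forall>x\<in>gr C i j. f x \<in> gr C' (i + k) j)"

definition presented_complex :: "'x::ab_group_add presented \<Rightarrow> bool" where
  "presented_complex C \<longleftrightarrow> pc_hom 1 C C (dif C) \<and>
     0 \<in> null C \<and> (\<forall>x\<in>null C. \<forall>y\<in>null C. x - y \<in> null C) \<and>
     (\<forall>i j. 0 \<in> gr C i j \<and> (\<forall>x\<in>gr C i j. \<forall>y\<in>gr C i j. x - y \<in> gr C i j))"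

definition pc_eq :: "'x presented \<Rightarrow> 'x::ab_group_add \<Rightarrow> 'x \<Rightarrow> bool" where
  "pc_eq C x y \<longleftrightarrow> x - y \<in> null C"

lemma pc_eq_refl [simp]: "presented_complex C ==> pc_eq C x x"
  by (simp add: pc_eq_def presented_complex_def)

lemma null_uminus: "presented_complex C ==> x \<in> null C ==> - x \<in> null C"
  unfolding presented_complex_def by (metis diff_0)

lemma null_add: "presented_complex C ==> x \<in> null C ==> y \<in> null C ==> x + y \<in> null C"
  using null_uminus[of C y] unfolding presented_complex_def by (metis diff_minus_eq_add)

lemma pc_eq_sym: "presented_complex C ==> pc_eq C x y ==> pc_eq C y x"
  unfolding pc_eq_def using null_uminus by fastforce

lemma pc_eq_trans: "presented_complex C ==> pc_eq C x y ==> pc_eq C y z ==> pc_eq C x z"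
  unfolding pc_eq_def using null_add[of C "x - y" "y - z"] by simp

lemma pc_eq_diff:
  assumes "presented_complex C" "pc_eq C x x'" "pc_eq C y y'"
  shows "pc_eq C (x - y) (x' - y')"
proof -
  have "(x - x') - (y - y') \<in> null C" using assms unfolding pc_eq_def presented_complex_def by blast
  then show ?thesis by (simp add: pc_eq_def algebra_simps)
qed

lemma pc_eq_add:
  assumes "presented_complex C" "pc_eq C x x'" "pc_eq C y y'"
  shows "pc_eq C (x + y) (x' + y')"
proof -
  have "(x - x') + (y - y') \<in> null C" using assms unfolding pc_eq_def by (intro null_add)
  then show ?thesis by (simp add: pc_eq_def algebra_simps)
qed

lemma pc_hom_additive: "pc_hom k C C' f ==> additive_map f"
  and pc_hom_gr: "pc_hom k C C' f ==> x \<in> gr C i j ==> f x \<in> gr C' (i + k) j"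
  by (auto simp: pc_hom_def)

lemma pc_hom_cong: "pc_hom k C C' f ==> pc_eq C x y ==> pc_eq C' (f x) (f y)"
  unfolding pc_hom_def pc_eq_def by (metis additive_map_diff)

lemma presented_complex_dif: "presented_complex C ==> pc_hom 1 C C (dif C)"
  by (simp add: presented_complex_def)

lemma gr_0: "presented_complex C ==> 0 \<in> gr C i j"
  and gr_diff: "presented_complex C ==> x \<in> gr C i j ==> y \<in> gr C i j ==> x - y \<in> gr C i j"
  by (auto simp: presented_complex_def)

lemma gr_uminus: "presented_complex C ==> x \<in> gr C i j ==> - x \<in> gr C i j"
  using gr_diff[of C 0 i j x] gr_0[of C i j] by simp

lemma gr_add: "presented_complex C ==> x \<in> gr C i j ==> y \<in> gr C i j ==> x + y \<in> gr C i j"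
  using gr_diff[of C x i j "- y"] gr_uminus[of C y i j] by simp

lemma pc_hom_comp:
  assumes "pc_hom k C C' f" "pc_hom l C' C'' g"
  shows "pc_hom (k + l) C C'' (g \<circ> f)"
  using assms by (auto simp: pc_hom_def additive_map_def add.assoc[symmetric])

lemma pc_hom_add:
  assumes "presented_complex C'" "pc_hom k C C' f" "pc_hom k C C' g"
  shows "pc_hom k C C' (\<lambda>x. f x + g x)"
  using assms by (auto simp: pc_hom_def additive_map_def null_add gr_add)

lemma pc_hom_uminus:
  assumes "presented_complex C'" "pc_hom k C C' f"
  shows "pc_hom k C C' (\<lambda>x. - f x)"
  using assms by (auto simp: pc_hom_def additive_map_def null_uminus gr_uminus)

lemma pc_hom_diff:
  assumes "presented_complex C'" "pc_hom k C C' f" "pc_hom k C C' g"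
  shows "pc_hom k C C' (\<lambda>x. f x - g x)"
  using pc_hom_add[OF assms(1,2) pc_hom_uminus[OF assms(1,3)]] by simp

lemma pc_hom_zero:
  assumes "presented_complex C'"
  shows "pc_hom k C C' (\<lambda>x. 0)"
  using assms by (auto simp: pc_hom_def additive_map_def presented_complex_def)

definition pc_chain :: "'x::ab_group_add presented \<Rightarrow> 'y::ab_group_add presented \<Rightarrow> ('x \<Rightarrow> 'y) \<Rightarrow> bool" where
  "pc_chain C C' f \<longleftrightarrow> pc_hom 0 C C' f \<and>
     (\<forall>i j. \<forall>x\<in>gr C i j. pc_eq C' (f (dif C x)) (dif C' (f x)))"

definition pc_homotopy :: "'x::ab_group_add presented \<Rightarrow> ('x \<Rightarrow> 'x) \<Rightarrow> ('x \<Rightarrow> 'x) \<Rightarrow> bool" where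
  "pc_homotopy C f h \<longleftrightarrow> pc_hom (- 1) C C h \<and>
     (\<forall>i j. \<forall>x\<in>gr C i j. pc_eq C (f x) (x + (dif C (h x) + h (dif C x))))"

lemma pc_chain_dif: "pc_chain C C' f ==> x \<in> gr C i j ==> pc_eq C' (f (dif C x)) (dif C' (f x))"
  by (auto simp: pc_chain_def)

lemma pc_homotopy_eq:
  "pc_homotopy C f h ==> x \<in> gr C i j ==> pc_eq C (f x) (x + (dif C (h x) + h (dif C x)))"
  by (auto simp: pc_homotopy_def)

definition pc_equiv :: "'x::ab_group_add presented \<Rightarrow> 'y::ab_group_add presented \<Rightarrow> bool" where
  "pc_equiv C C' \<longleftrightarrow> presented_complex C \<and> presented_complex C' \<and>
     (\<exists>f g h h'. pc_chain C C' f \<and> pc_chain C' C g \<and>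
       pc_homotopy C (g \<circ> f) h \<and> pc_homotopy C' (f \<circ> g) h')"

lemma pc_equiv_sym: "pc_equiv C C' ==> pc_equiv C' C"
  by (auto simp: pc_equiv_def)

lemma pc_chain_comp:
  assumes "presented_complex C''" "pc_chain C C' f" "pc_chain C' C'' g"
  shows "pc_chain C C'' (g \<circ> f)"
proof -
  have "pc_eq C'' (g (f (dif C x))) (dif C'' (g (f x)))" if x: "x \<in> gr C i j" for x i j
  proof (rule pc_eq_trans[OF assms(1)])
    have h: "pc_hom 0 C C' f" "pc_hom 0 C' C'' g" using assms by (auto simp: pc_chain_def)
    have fx: "f x \<in> gr C' i j" using pc_hom_gr[OF h(1) x] by simp
    show "pc_eq C'' (g (f (dif C x))) (g (dif C' (f x)))"
      by (rule pc_hom_cong[OF h(2) pc_chain_dif[OF assms(2) x]])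
    show "pc_eq C'' (g (dif C' (f x))) (dif C'' (g (f x)))" by (rule pc_chain_dif[OF assms(3) fx])
  qed
  then show ?thesis using assms pc_hom_comp[of 0 C C' f 0 C'' g] by (auto simp: pc_chain_def)
qed

lemma pc_homotopy_comp:
  assumes C: "presented_complex C" and C': "presented_complex C'"
    and f: "pc_chain C C' f" and g: "pc_chain C' C g"
    and h: "pc_homotopy C (g \<circ> f) h" and k: "pc_homotopy C' k l"
  shows "pc_homotopy C (g \<circ> k \<circ> f) (\<lambda>x. h x + g (l (f x)))"
proof -
  have hf: "pc_hom 0 C C' f" and hg: "pc_hom 0 C' C g" and hl: "pc_hom (-1) C' C' l"
    and hh: "pc_hom (-1) C C h"
    using f g k h by (auto simp: pc_chain_def pc_homotopy_def)
  have d: "additive_map (dif C)" using presented_complex_dif[OF C] by (rule pc_hom_additive)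
  have gl: "pc_hom (-1) C C (\<lambda>x. g (l (f x)))"
    using pc_hom_comp[OF pc_hom_comp[OF hf hl] hg] by (simp add: o_def)
  have "pc_eq C (g (k (f x))) (x + (dif C (h x + g (l (f x))) + (h (dif C x) + g (l (f (dif C x))))))"
    if x: "x \<in> gr C i j" for x i j
  proof -
    have fx: "f x \<in> gr C' i j" using pc_hom_gr[OF hf x] by simp
    have "pc_eq C (g (k (f x))) (g (f x + (dif C' (l (f x)) + l (dif C' (f x)))))"
      by (rule pc_hom_cong[OF hg pc_homotopy_eq[OF k fx]])
    also have "g (f x + (dif C' (l (f x)) + l (dif C' (f x)))) = g (f x) + (g (dif C' (l (f x))) + g (l (dif C' (f x))))"
      by (simp add: additive_map_add[OF pc_hom_additive[OF hg]])
    finally have 1: "pc_eq C (g (k (f x))) (g (f x) + (g (dif C' (l (f x))) + g (l (dif C' (f x)))))" .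
    have 2: "pc_eq C (g (f x)) (x + (dif C (h x) + h (dif C x)))"
      using pc_homotopy_eq[OF h x] by simp
    have 3: "pc_eq C (g (dif C' (l (f x)))) (dif C (g (l (f x))))"
      by (rule pc_chain_dif[OF g pc_hom_gr[OF hl fx]])
    have 4: "pc_eq C (g (l (dif C' (f x)))) (g (l (f (dif C x))))"
      by (rule pc_hom_cong[OF hg pc_hom_cong[OF hl pc_eq_sym[OF C' pc_chain_dif[OF f x]]]])
    have "pc_eq C (g (k (f x))) (x + (dif C (h x) + h (dif C x)) + (dif C (g (l (f x))) + g (l (f (dif C x)))))"
      using pc_eq_trans[OF C 1 pc_eq_add[OF C 2 pc_eq_add[OF C 3 4]]] .
    then show ?thesis by (simp add: additive_map_add[OF d] algebra_simps)
  qed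
  then show ?thesis using pc_hom_add[OF C hh gl] by (auto simp: pc_homotopy_def)
qed

lemma pc_equiv_trans:
  assumes "pc_equiv C C'" "pc_equiv C' C''"
  shows "pc_equiv C C''"
proof -
  obtain f g h h' where 1: "pc_chain C C' f" "pc_chain C' C g"
    "pc_homotopy C (g \<circ> f) h" "pc_homotopy C' (f \<circ> g) h'"
    using assms(1) unfolding pc_equiv_def by blast
  obtain f' g' k k' where 2: "pc_chain C' C'' f'" "pc_chain C'' C' g'"
    "pc_homotopy C' (g' \<circ> f') k" "pc_homotopy C'' (f' \<circ> g') k'"
    using assms(2) unfolding pc_equiv_def by blast
  have C: "presented_complex C" "presented_complex C'" "presented_complex C''"
    using assms by (auto simp: pc_equiv_def)
  have "pc_homotopy C (g \<circ> (g' \<circ> f') \<circ> f) (\<lambda>x. h x + g (k (f x)))"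
    by (rule pc_homotopy_comp[OF C(1,2) 1(1,2,3) 2(3)])
  moreover have "pc_homotopy C'' (f' \<circ> (f \<circ> g) \<circ> g') (\<lambda>x. k' x + f' (h' (g' x)))"
    by (rule pc_homotopy_comp[OF C(3,2) 2(2,1) 2(4) 1(4)])
  ultimately show ?thesis
    unfolding pc_equiv_def using C pc_chain_comp[OF C(3) 1(1) 2(1)] pc_chain_comp[OF C(1) 2(2) 1(2)]
    by (intro conjI exI[of _ "f' \<circ> f"] exI[of _ "g \<circ> g'"] exI[of _ "\<lambda>x. h x + g (k (f x))"]
        exI[of _ "\<lambda>x. k' x + f' (h' (g' x))"]) (simp_all only: comp_assoc)
qed

text \<open>
  Gaussian elimination: \<open>P\<close> and \<open>Q\<close> project to summands between which a component of the
  differential is invertible, with inverse \<open>\<psi>\<close>; \<open>b\<close> and \<open>r\<close> identify \<open>C'\<close> with the remaining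
  summand.  The differential of \<open>C'\<close> acquires a zigzag through the cancelled summands.
\<close>

lemma gaussian_elimination:
  assumes C: "presented_complex C" and C': "presented_complex C'"
    and dd: "\<And>i j x. x \<in> gr C i j ==> dif C (dif C x) \<in> null C"
    and P: "pc_hom 0 C C P" and Q: "pc_hom 0 C C Q" and \<psi>: "pc_hom (- 1) C C \<psi>"
    and r: "pc_hom 0 C C' r" and b: "pc_hom 0 C' C b"
    and \<psi>b: "\<And>y. \<psi> (b y) = 0" and r\<psi>: "\<And>x. r (\<psi> x) = 0" and \<psi>\<psi>: "\<And>x. \<psi> (\<psi> x) = 0"
    and P\<psi>: "\<And>x. P (\<psi> x) = \<psi> x"
    and rb: "\<And>i j y. y \<in> gr C' i j ==> pc_eq C' (r (b y)) y"
    and br: "\<And>i j x. x \<in> gr C i j ==> pc_eq C (b (r x)) (x - P x - Q x)"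
    and \<psi>dP: "\<And>i j x. x \<in> gr C i j ==> pc_eq C (\<psi> (dif C (P x))) (P x)"
    and Qd\<psi>: "\<And>i j x. x \<in> gr C i j ==> pc_eq C (Q (dif C (\<psi> x))) (Q x)"
    and d': "\<And>i j y. y \<in> gr C' i j ==> pc_eq C' (dif C' y) (r (dif C (b y) - dif C (\<psi> (dif C (b y)))))"
  shows "pc_equiv C C'"
proof -
  let ?d = "dif C"
  note sym = pc_eq_sym[OF C] and trans [trans] = pc_eq_trans[OF C]
  note sym' = pc_eq_sym[OF C'] and trans' [trans] = pc_eq_trans[OF C']
  have hd: "pc_hom 1 C C ?d" by (rule presented_complex_dif[OF C])
  note cong = pc_hom_cong[OF hd] pc_hom_cong[OF \<psi>]
  note add = additive_map_diff[OF pc_hom_additive[OF hd]] additive_map_diff[OF pc_hom_additive[OF \<psi>]]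
    additive_map_diff[OF pc_hom_additive[OF P]] additive_map_diff[OF pc_hom_additive[OF Q]]
    additive_map_diff[OF pc_hom_additive[OF r]] additive_map_diff[OF pc_hom_additive[OF b]]
  note zero = additive_map_0[OF pc_hom_additive[OF hd]] additive_map_0[OF pc_hom_additive[OF \<psi>]]
    additive_map_0[OF pc_hom_additive[OF r]]
  define f where "f x = r (x - ?d (\<psi> x))" for x
  define g where "g y = b y - \<psi> (?d (b y))" for y
  have gd: "?d x \<in> gr C (i + 1) j" if "x \<in> gr C i j" for x i j using pc_hom_gr[OF hd that] .
  have g\<psi>: "\<psi> x \<in> gr C (i - 1) j" if "x \<in> gr C i j" for x i j using pc_hom_gr[OF \<psi> that] by simp
  have gb: "b y \<in> gr C i j" if "y \<in> gr C' i j" for y i j using pc_hom_gr[OF b that] by simp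
  have hd\<psi>: "pc_hom 0 C C (\<lambda>x. ?d (\<psi> x))" and h\<psi>d: "pc_hom 0 C C (\<lambda>x. \<psi> (?d x))"
    using pc_hom_comp[OF \<psi> hd] pc_hom_comp[OF hd \<psi>] by (simp_all add: o_def)
  have id: "pc_hom 0 C C (\<lambda>x. x)" by (simp add: pc_hom_def additive_map_def)
  have hf: "pc_hom 0 C C' f"
    using pc_hom_comp[OF pc_hom_diff[OF C id hd\<psi>] r] by (simp add: o_def f_def[abs_def])
  have hg: "pc_hom 0 C' C g"
    using pc_hom_diff[OF C b] pc_hom_comp[OF b h\<psi>d] by (simp add: o_def g_def[abs_def])
  have gf: "f x \<in> gr C' i j" if "x \<in> gr C i j" for x i j using pc_hom_gr[OF hf that] by simp
  have gg: "g y \<in> gr C i j" if "y \<in> gr C' i j" for y i j using pc_hom_gr[OF hg that] by simp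
  have ddz: "pc_eq C (?d (?d x)) 0" if "x \<in> gr C i j" for x i j
    using dd[OF that] by (simp add: pc_eq_def)
  have \<psi>d\<psi>: "pc_eq C (\<psi> (?d (\<psi> x))) (\<psi> x)" if "x \<in> gr C i j" for x i j
    using \<psi>dP[OF g\<psi>[OF that]] by (simp add: P\<psi>)
  have fg: "pc_eq C' (f (g y)) y" if "y \<in> gr C' i j" for y i j
    using rb[OF that] by (simp add: f_def g_def add \<psi>b \<psi>\<psi> r\<psi> zero)
  have gf_eq: "pc_eq C (g (f x)) (x - (?d (\<psi> x) + \<psi> (?d x)))" if x: "x \<in> gr C i j" for x i j
  proof -
    let ?w = "x - ?d (\<psi> x)"
    have dx: "?d (\<psi> x) \<in> gr C i j" using gd[OF g\<psi>[OF x]] by simp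
    have w: "?w \<in> gr C i j" using gr_diff[OF C x dx] .
    have "pc_eq C (Q ?w) 0" using pc_eq_diff[OF C pc_eq_refl[OF C, of "Q x"] Qd\<psi>[OF x]] by (simp add: add)
    then have "pc_eq C (?w - P ?w - Q ?w) (?w - P ?w)"
      using pc_eq_diff[OF C pc_eq_refl[OF C, of "?w - P ?w"], of "Q ?w" 0] by simp
    with br[OF w] have brw: "pc_eq C (b (r ?w)) (?w - P ?w)" by (rule trans)
    have "pc_eq C (g (f x)) (?w - P ?w - \<psi> (?d (?w - P ?w)))"
      unfolding g_def f_def by (intro pc_eq_diff[OF C] brw pc_hom_cong[OF h\<psi>d])
    also have "?w - P ?w - \<psi> (?d (?w - P ?w)) = ?w - \<psi> (?d ?w) - (P ?w - \<psi> (?d (P ?w)))"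
      by (simp only: add) (simp only: algebra_simps)
    also have "pc_eq C \<dots> (?w - \<psi> (?d ?w) - (P ?w - P ?w))"
      by (intro pc_eq_diff[OF C] pc_eq_refl[OF C] \<psi>dP[OF w])
    also have "?w - \<psi> (?d ?w) - (P ?w - P ?w) = ?w - (\<psi> (?d x) - \<psi> (?d (?d (\<psi> x))))"
      by (simp add: add)
    also have "pc_eq C \<dots> (?w - (\<psi> (?d x) - \<psi> 0))"
      by (intro pc_eq_diff[OF C] pc_eq_refl[OF C] pc_hom_cong[OF \<psi>] ddz[OF g\<psi>[OF x]])
    finally show ?thesis by (simp add: zero algebra_simps)
  qed
  have d'_eq: "pc_eq C' (dif C' y) (f (?d (g y)))" if y: "y \<in> gr C' i j" for y i j
  proof -
    let ?z = "?d (b y)"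
    have z: "?z \<in> gr C (i + 1) j" using gd[OF gb[OF y]] .
    have pz: "\<psi> ?z \<in> gr C i j" using g\<psi>[OF z] by simp
    have "f (?d (g y)) = r (?z - ?d (\<psi> ?z) - (?d (\<psi> ?z) - ?d (\<psi> (?d (\<psi> ?z)))))"
      by (simp only: f_def g_def add)
    also have "pc_eq C' \<dots> (r (?z - ?d (\<psi> ?z) - (?d (\<psi> ?z) - ?d (\<psi> ?z))))"
      by (intro pc_hom_cong[OF r] pc_eq_diff[OF C] pc_eq_refl[OF C] cong(1) \<psi>d\<psi>[OF z])
    finally have "pc_eq C' (f (?d (g y))) (r (?z - ?d (\<psi> ?z)))" by simp
    then show ?thesis by (rule trans'[OF d'[OF y] sym'])
  qed
  have fd\<psi>: "pc_eq C' (f (?d (\<psi> x))) 0" if x: "x \<in> gr C i j" for x i j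
  proof -
    have "pc_eq C' (r (?d (\<psi> x) - ?d (\<psi> (?d (\<psi> x))))) (r (?d (\<psi> x) - ?d (\<psi> x)))"
      by (intro pc_hom_cong[OF r] pc_eq_diff[OF C] pc_eq_refl[OF C] cong(1) \<psi>d\<psi>[OF x])
    then show ?thesis by (simp add: f_def zero)
  qed
  have chain_f: "pc_chain C C' f"
    unfolding pc_chain_def
  proof (intro conjI allI ballI hf)
    fix i j x assume x: "x \<in> gr C i j"
    have "pc_eq C' (dif C' (f x)) (f (?d (g (f x))))" by (rule d'_eq[OF gf[OF x]])
    also have "pc_eq C' \<dots> (f (?d (x - (?d (\<psi> x) + \<psi> (?d x)))))"
      by (intro pc_hom_cong[OF hf] cong(1) gf_eq[OF x])
    also have "f (?d (x - (?d (\<psi> x) + \<psi> (?d x)))) = f (?d x) - (f (?d (?d (\<psi> x))) + f (?d (\<psi> (?d x))))"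
      by (simp add: add additive_map_add[OF pc_hom_additive[OF hd]]
          additive_map_add[OF pc_hom_additive[OF hf]] additive_map_diff[OF pc_hom_additive[OF hf]])
    also have "pc_eq C' \<dots> (f (?d x) - (f 0 + 0))"
      by (intro pc_eq_diff[OF C'] pc_eq_add[OF C'] pc_eq_refl[OF C'] pc_hom_cong[OF hf] ddz[OF g\<psi>[OF x]] fd\<psi>[OF gd[OF x]])
    finally have "pc_eq C' (dif C' (f x)) (f (?d x))"
      by (simp add: additive_map_0[OF pc_hom_additive[OF hf]])
    then show "pc_eq C' (f (?d x)) (dif C' (f x))" by (rule sym')
  qed
  have chain_g: "pc_chain C' C g"
    unfolding pc_chain_def
  proof (intro conjI allI ballI hg)
    fix i j y assume y: "y \<in> gr C' i j"
    let ?x = "?d (g y)" and ?z = "?d (b y)"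
    have x: "?x \<in> gr C (i + 1) j" using gd[OF gg[OF y]] .
    have z: "?z \<in> gr C (i + 1) j" using gd[OF gb[OF y]] .
    have "pc_eq C (\<psi> ?z - \<psi> (?d (\<psi> ?z))) (\<psi> ?z - \<psi> ?z)"
      by (intro pc_eq_diff[OF C] pc_eq_refl[OF C] \<psi>d\<psi>[OF z])
    then have \<psi>x: "pc_eq C (\<psi> ?x) 0" by (simp add: g_def add)
    have "pc_eq C (g (dif C' y)) (g (f ?x))" by (intro pc_hom_cong[OF hg] d'_eq[OF y])
    also have "pc_eq C \<dots> (?x - (?d (\<psi> ?x) + \<psi> (?d ?x)))" by (rule gf_eq[OF x])
    also have "pc_eq C \<dots> (?x - (?d 0 + \<psi> 0))"
      by (intro pc_eq_diff[OF C] pc_eq_add[OF C] pc_eq_refl[OF C] cong \<psi>x ddz[OF gg[OF y]])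
    finally show "pc_eq C (g (dif C' y)) (?d (g y))" by (simp add: zero)
  qed
  have "pc_homotopy C (g \<circ> f) (\<lambda>x. - \<psi> x)"
    unfolding pc_homotopy_def using pc_hom_uminus[OF C \<psi>] gf_eq
    by (auto simp: additive_map_uminus[OF pc_hom_additive[OF hd]] algebra_simps)
  moreover have "pc_homotopy C' (f \<circ> g) (\<lambda>y. 0)"
    unfolding pc_homotopy_def using pc_hom_zero[OF C'] fg
    by (auto simp: additive_map_0[OF pc_hom_additive[OF presented_complex_dif[OF C']]])
  ultimately show ?thesis using C C' chain_f chain_g unfolding pc_equiv_def by blast
qed

definition presents :: "('b \<Rightarrow>\<^sub>0 int) bigraded \<Rightarrow> 'x::ab_group_add presented \<Rightarrow> ('x \<Rightarrow> 'b \<Rightarrow>\<^sub>0 int) \<Rightarrow> bool" where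
  "presents K C \<rho> \<longleftrightarrow> presented_complex C \<and> additive_map \<rho> \<and>
     (\<exists>B. grp K = (\<lambda>i j. free_Abelian_group (B i j))) \<and>
     (\<forall>i j. carrier (grp K i j) = \<rho> ` gr C i j \<and>
        (\<forall>x\<in>gr C i j. (\<rho> x = 0 \<longleftrightarrow> x \<in> null C) \<and> \<rho> (dif C x) = diff K i j (\<rho> x)))"

lemma presents_complex:
  assumes p: "presents K C \<rho>" and dd: "\<And>i j x. x \<in> gr C i j ==> dif C (dif C x) \<in> null C"
  shows "is_bigraded_complex K"
  unfolding is_bigraded_complex_def
proof (intro allI conjI ballI)
  fix i j
  obtain B where B: "grp K = (\<lambda>i j. free_Abelian_group (B i j))" using p by (auto simp: presents_def)
  have C: "presented_complex C" and \<rho>: "additive_map \<rho>" using p by (auto simp: presents_def)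
  have car: "carrier (grp K i j) = \<rho> ` gr C i j" for i j using p by (auto simp: presents_def)
  have d: "\<rho> (dif C x) = diff K i j (\<rho> x)" if "x \<in> gr C i j" for x i j using p that by (auto simp: presents_def)
  have gd: "dif C x \<in> gr C (i + 1) j" if "x \<in> gr C i j" for x i j
    using pc_hom_gr[OF presented_complex_dif[OF C] that] .
  have da: "additive_map (dif C)" using pc_hom_additive[OF presented_complex_dif[OF C]] .
  show "comm_group (grp K i j)" by (simp add: B abelian_free_Abelian_group)
  show "diff K i j \<in> hom (grp K i j) (grp K (i + 1) j)"
  proof (rule homI)
    fix x assume "x \<in> carrier (grp K i j)"
    then show "diff K i j x \<in> carrier (grp K (i + 1) j)" using d gd unfolding car by force
  next
    fix x y assume "x \<in> carrier (grp K i j)" "y \<in> carrier (grp K i j)"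
    then obtain x' y' where x: "x' \<in> gr C i j" "y' \<in> gr C i j" "x = \<rho> x'" "y = \<rho> y'" unfolding car by auto
    then have "diff K i j (x + y) = diff K i j x + diff K i j y"
      using d[OF gr_add[OF C x(1,2)]] d[OF x(1)] d[OF x(2)]
      by (simp add: additive_map_add[OF \<rho>] additive_map_add[OF da])
    then show "diff K i j (x \<otimes>\<^bsub>grp K i j\<^esub> y) = diff K i j x \<otimes>\<^bsub>grp K (i + 1) j\<^esub> diff K i j y"
      by (simp add: B)
  qed
  fix x assume "x \<in> carrier (grp K i j)"
  then obtain x' where x: "x' \<in> gr C i j" "x = \<rho> x'" unfolding car by auto
  have "diff K (i + 1) j (diff K i j x) = \<rho> (dif C (dif C x'))" using x d[OF x(1)] d[OF gd[OF x(1)]] by simp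
  also have "\<dots> = 0" using p gd[OF gd[OF x(1)]] dd[OF x(1)] unfolding presents_def by blast
  finally show "diff K (i + 1) j (diff K i j x) = \<one>\<^bsub>grp K (i + 1 + 1) j\<^esub>" by (simp add: B)
qed

definition lift :: "'x presented \<Rightarrow> ('x \<Rightarrow> 'b) \<Rightarrow> ('x \<Rightarrow> 'c) \<Rightarrow> int \<Rightarrow> int \<Rightarrow> 'b \<Rightarrow> 'c" where
  "lift C \<rho> \<phi> i j z = \<phi> (SOME x. x \<in> gr C i j \<and> \<rho> x = z)"

lemma lift_eq:
  assumes p: "presents K C \<rho>" and p': "presents K' C' \<rho>'" and f: "pc_hom k C C' f" and x: "x \<in> gr C i j"
  shows "lift C \<rho> (\<rho>' \<circ> f) i j (\<rho> x) = \<rho>' (f x)"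
proof -
  let ?y = "SOME y. y \<in> gr C i j \<and> \<rho> y = \<rho> x"
  have y: "?y \<in> gr C i j \<and> \<rho> ?y = \<rho> x" by (rule someI[of _ x]) (use x in simp)
  have C: "presented_complex C" "additive_map \<rho>" and C': "additive_map \<rho>'"
    using p p' by (auto simp: presents_def)
  have g: "?y - x \<in> gr C i j" using gr_diff[OF C(1)] y x by blast
  moreover have "\<rho> (?y - x) = 0" using y additive_map_diff[OF C(2)] by simp
  ultimately have "?y - x \<in> null C" using p unfolding presents_def by blast
  then have "f (?y - x) \<in> null C'" using f unfolding pc_hom_def by blast
  moreover have "f (?y - x) \<in> gr C' (i + k) j" by (rule pc_hom_gr[OF f g])
  ultimately have "\<rho>' (f (?y - x)) = 0" using p' unfolding presents_def by blast
  then show ?thesis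
    by (simp add: lift_def additive_map_diff[OF pc_hom_additive[OF f]] additive_map_diff[OF C'])
qed

lemma lift_hom:
  assumes p: "presents K C \<rho>" and p': "presents K' C' \<rho>'" and f: "pc_hom k C C' f"
  shows "lift C \<rho> (\<rho>' \<circ> f) i j \<in> hom (grp K i j) (grp K' (i + k) j)"
proof (rule homI)
  have car: "carrier (grp K i j) = \<rho> ` gr C i j" "carrier (grp K' (i + k) j) = \<rho>' ` gr C' (i + k) j"
    using p p' by (auto simp: presents_def)
  have C: "presented_complex C" "additive_map \<rho>" and C': "additive_map \<rho>'"
    using p p' by (auto simp: presents_def)
  obtain B where B: "grp K = (\<lambda>i j. free_Abelian_group (B i j))" using p by (auto simp: presents_def)
  obtain B' where B': "grp K' = (\<lambda>i j. free_Abelian_group (B' i j))" using p' by (auto simp: presents_def)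
  {
    fix z assume "z \<in> carrier (grp K i j)"
    then show "lift C \<rho> (\<rho>' \<circ> f) i j z \<in> carrier (grp K' (i + k) j)"
      using lift_eq[OF p p' f] pc_hom_gr[OF f] unfolding car by force
  next
    fix y z assume "y \<in> carrier (grp K i j)" "z \<in> carrier (grp K i j)"
    then obtain y' z' where x: "y' \<in> gr C i j" "z' \<in> gr C i j" "y = \<rho> y'" "z = \<rho> z'" unfolding car by auto
    have "lift C \<rho> (\<rho>' \<circ> f) i j (\<rho> y' + \<rho> z') = \<rho>' (f y') + \<rho>' (f z')"
      using lift_eq[OF p p' f gr_add[OF C(1) x(1,2)]]
      by (simp add: additive_map_add[OF C(2)] additive_map_add[OF C'] additive_map_add[OF pc_hom_additive[OF f]])
    then show "lift C \<rho> (\<rho>' \<circ> f) i j (y \<otimes>\<^bsub>grp K i j\<^esub> z)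
        = lift C \<rho> (\<rho>' \<circ> f) i j y \<otimes>\<^bsub>grp K' (i + k) j\<^esub> lift C \<rho> (\<rho>' \<circ> f) i j z"
      using lift_eq[OF p p' f] x by (simp add: B B')
  }
qed

lemma presents_eq:
  assumes "presents K C \<rho>" "pc_eq C x y" "x \<in> gr C i j" "y \<in> gr C i j"
  shows "\<rho> x = \<rho> y"
proof -
  have C: "presented_complex C" "additive_map \<rho>" using assms by (auto simp: presents_def)
  have "\<rho> (x - y) = 0" using assms gr_diff[OF C(1) assms(3,4)] unfolding presents_def pc_eq_def by blast
  then show ?thesis by (simp add: additive_map_diff[OF C(2)])
qed

lemma lift_chain_map:
  assumes p: "presents K C \<rho>" and p': "presents K' C' \<rho>'" and f: "pc_chain C C' f"
  shows "chain_map K K' (lift C \<rho> (\<rho>' \<circ> f))"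
  unfolding chain_map_def
proof (intro allI conjI ballI)
  fix i j
  have hf: "pc_hom 0 C C' f" using f by (simp add: pc_chain_def)
  have C: "presented_complex C" "presented_complex C'" using p p' by (auto simp: presents_def)
  show "lift C \<rho> (\<rho>' \<circ> f) i j \<in> hom (grp K i j) (grp K' i j)" using lift_hom[OF p p' hf, of i j] by simp
  fix z assume "z \<in> carrier (grp K i j)"
  then obtain x where x: "x \<in> gr C i j" "z = \<rho> x" using p unfolding presents_def by auto
  have dx: "dif C x \<in> gr C (i + 1) j" using pc_hom_gr[OF presented_complex_dif[OF C(1)] x(1)] .
  have fx: "f x \<in> gr C' i j" using pc_hom_gr[OF hf x(1)] by simp
  have dfx: "dif C' (f x) \<in> gr C' (i + 1) j" using pc_hom_gr[OF presented_complex_dif[OF C(2)] fx] .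
  have fdx: "f (dif C x) \<in> gr C' (i + 1) j" using pc_hom_gr[OF hf dx] by simp
  have "diff K i j z = \<rho> (dif C x)" "diff K' i j (\<rho>' (f x)) = \<rho>' (dif C' (f x))"
    using p p' x fx by (auto simp: presents_def)
  moreover have "\<rho>' (f (dif C x)) = \<rho>' (dif C' (f x))"
    by (rule presents_eq[OF p' pc_chain_dif[OF f x(1)] fdx dfx])
  ultimately show "lift C \<rho> (\<rho>' \<circ> f) (i + 1) j (diff K i j z) = diff K' i j (lift C \<rho> (\<rho>' \<circ> f) i j z)"
    using lift_eq[OF p p' hf x(1)] lift_eq[OF p p' hf dx] x by simp
qed

lemma lift_homotopic:
  assumes p: "presents K C \<rho>" and p': "presents K' C' \<rho>'" and f: "pc_chain C C' f" and g: "pc_chain C' C g"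
    and h: "pc_homotopy C (g \<circ> f) h"
  shows "chain_homotopic K K (\<lambda>i j. lift C' \<rho>' (\<rho> \<circ> g) i j \<circ> lift C \<rho> (\<rho>' \<circ> f) i j) (\<lambda>i j x. x)"
  unfolding chain_homotopic_def
proof (intro exI allI conjI ballI)
  fix i j
  have hf: "pc_hom 0 C C' f" and hg: "pc_hom 0 C' C g" and hh: "pc_hom (-1) C C h"
    using f g h by (auto simp: pc_chain_def pc_homotopy_def)
  have C: "presented_complex C" "additive_map \<rho>" using p by (auto simp: presents_def)
  obtain B where B: "grp K = (\<lambda>i j. free_Abelian_group (B i j))" using p by (auto simp: presents_def)
  show "lift C \<rho> (\<rho> \<circ> h) i j \<in> hom (grp K i j) (grp K (i - 1) j)" using lift_hom[OF p p hh, of i j] by simp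
  fix z assume "z \<in> carrier (grp K i j)"
  then obtain x where x: "x \<in> gr C i j" "z = \<rho> x" using p unfolding presents_def by auto
  note hd = presented_complex_dif[OF C(1)]
  have dx: "dif C x \<in> gr C (i + 1) j" using pc_hom_gr[OF hd x(1)] .
  have hx: "h x \<in> gr C (i - 1) j" using pc_hom_gr[OF hh x(1)] by simp
  have dhx: "dif C (h x) \<in> gr C i j" using pc_hom_gr[OF hd hx] by simp
  have hdx: "h (dif C x) \<in> gr C i j" using pc_hom_gr[OF hh dx] by simp
  have fx: "f x \<in> gr C' i j" using pc_hom_gr[OF hf x(1)] by simp
  have gfx: "g (f x) \<in> gr C i j" using pc_hom_gr[OF hg fx] by simp
  have "\<rho> (g (f x)) = \<rho> (x + (dif C (h x) + h (dif C x)))"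
    using presents_eq[OF p _ gfx gr_add[OF C(1) x(1) gr_add[OF C(1) dhx hdx]]] pc_homotopy_eq[OF h x(1)]
    by simp
  moreover have "diff K (i - 1) j (\<rho> (h x)) = \<rho> (dif C (h x))" "diff K i j z = \<rho> (dif C x)"
    using p hx x unfolding presents_def by auto
  ultimately show "(lift C' \<rho>' (\<rho> \<circ> g) i j \<circ> lift C \<rho> (\<rho>' \<circ> f) i j) z = z \<otimes>\<^bsub>grp K i j\<^esub>
      (diff K (i - 1) j (lift C \<rho> (\<rho> \<circ> h) i j z) \<otimes>\<^bsub>grp K i j\<^esub> lift C \<rho> (\<rho> \<circ> h) (i + 1) j (diff K i j z))"
    using lift_eq[OF p p' hf x(1)] lift_eq[OF p' p hg fx] lift_eq[OF p p hh x(1)] lift_eq[OF p p hh dx] x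
    by (simp add: B additive_map_add[OF C(2)])
qed

lemma presents_equiv:
  assumes p: "presents K C \<rho>" and p': "presents K' C' \<rho>'" and e: "pc_equiv C C'"
  shows "homotopy_equivalent_complexes K K'"
proof -
  obtain f g h h' where "pc_chain C C' f" "pc_chain C' C g"
    "pc_homotopy C (g \<circ> f) h" "pc_homotopy C' (f \<circ> g) h'"
    using e unfolding pc_equiv_def by blast
  then show ?thesis
    using lift_chain_map[OF p p'] lift_chain_map[OF p' p] lift_homotopic[OF p p'] lift_homotopic[OF p' p]
    unfolding homotopy_equivalent_complexes_def by blast
qed

section \<open>Complexes of cyclic modules\<close>

record ('s, 'v) sites =
  support :: "'s set"
  srel :: "'s \<Rightarrow> ('v \<times> 'v) set"
  sdeg :: "'s \<Rightarrow> int \<times> int"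
  entry :: "'s \<Rightarrow> 's \<Rightarrow> 'v zpoly"

definition site_complex :: "('s, 'v) sites \<Rightarrow> ('s \<Rightarrow> 'v zpoly) presented" where
  "site_complex S = \<lparr>
     gr = (\<lambda>i j. {f. \<forall>s. \<forall>\<mu>\<in>Poly_Mapping.keys (f s). s \<in> support S \<and> sdeg S s = (i, j + 2 * int (size \<mu>))}),
     null = {f. \<forall>s\<in>support S. f s \<in> rel_ideal (srel S s)},
     dif = (\<lambda>f t. if t \<in> support S then (\<Sum>s\<in>support S. entry S t s * f s) else 0)\<rparr>"

text \<open>
  Entries must be homogeneous, multiplication by a variable shifting the second degree by 2, and must respect the
  relations.
\<close>

definition valid_sites :: "('s, 'v) sites \<Rightarrow> bool" where
  "valid_sites S \<longleftrightarrow> finite (support S) \<and>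
     (\<forall>s\<in>support S. \<forall>t\<in>support S.
        (\<forall>\<nu>\<in>Poly_Mapping.keys (entry S t s). sdeg S t = (fst (sdeg S s) + 1, snd (sdeg S s) + 2 * int (size \<nu>))) \<and>
        (\<forall>p\<in>rel_ideal (srel S s). entry S t s * p \<in> rel_ideal (srel S t)))"

lemma keys_mult_size:
  fixes p q :: "'v zpoly"
  assumes "\<kappa> \<in> Poly_Mapping.keys (p * q)"
  obtains \<mu> \<nu> where "\<mu> \<in> Poly_Mapping.keys p" "\<nu> \<in> Poly_Mapping.keys q" "size \<kappa> = size \<mu> + size \<nu>"
proof -
  obtain \<mu> \<nu> where "\<mu> \<in> Poly_Mapping.keys p" "\<nu> \<in> Poly_Mapping.keys q" "\<kappa> = \<mu> + \<nu>"
    using assms keys_mult[of p q] by blast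
  then show ?thesis using that by simp
qed

lemma keys_zpoly_one: "Poly_Mapping.keys (1 :: 'v zpoly) = {{#}}"
  by (metis frag_of_empty_mset keys_frag_of)

lemma gr_support:
  assumes "f \<in> gr (site_complex S) i j" "s \<notin> support S"
  shows "f s = 0"
proof -
  have "\<mu> \<notin> Poly_Mapping.keys (f s)" for \<mu> using assms by (auto simp: site_complex_def)
  then have "Poly_Mapping.keys (f s) = {}" by blast
  then show ?thesis by simp
qed

lemma presented_site_complex:
  assumes v: "valid_sites S"
  shows "presented_complex (site_complex S)"
proof -
  let ?C = "site_complex S"
  have add: "additive_map (dif ?C)"
    by (auto simp: additive_map_def site_complex_def fun_eq_iff right_diff_distrib sum_subtractf)
  have nl: "dif ?C f \<in> null ?C" if "f \<in> null ?C" for f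
    using that v by (auto simp: site_complex_def valid_sites_def intro!: rel_ideal_sum)
  have gd: "dif ?C f \<in> gr ?C (i + 1) j" if f: "f \<in> gr ?C i j" for f i j
  proof -
    have "t \<in> support S \<and> sdeg S t = (i + 1, j + 2 * int (size \<kappa>))"
      if \<kappa>: "\<kappa> \<in> Poly_Mapping.keys (dif ?C f t)" for t \<kappa>
    proof -
      have t: "t \<in> support S" using \<kappa> by (auto simp: site_complex_def split: if_splits)
      then obtain s where s: "s \<in> support S" "\<kappa> \<in> Poly_Mapping.keys (entry S t s * f s)"
        using \<kappa> keys_sum[of "\<lambda>s. entry S t s * f s" "support S"] by (auto simp: site_complex_def)
      then obtain \<nu> \<mu> where "\<nu> \<in> Poly_Mapping.keys (entry S t s)" "\<mu> \<in> Poly_Mapping.keys (f s)"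
        "size \<kappa> = size \<nu> + size \<mu>" using keys_mult_size by blast
      then show ?thesis using v f s t by (force simp: site_complex_def valid_sites_def)
    qed
    then show ?thesis by (auto simp: site_complex_def)
  qed
  have gdiff: "f - g \<in> gr ?C i j" if "f \<in> gr ?C i j" "g \<in> gr ?C i j" for f g i j
  proof -
    have "Poly_Mapping.keys ((f - g) s) \<subseteq> Poly_Mapping.keys (f s) \<union> Poly_Mapping.keys (g s)" for s
      by (simp add: keys_diff)
    then show ?thesis using that unfolding site_complex_def by fastforce
  qed
  have zero: "0 \<in> null ?C" "0 \<in> gr ?C i j" for i j by (simp_all add: site_complex_def)
  have nd: "f - g \<in> null ?C" if "f \<in> null ?C" "g \<in> null ?C" for f g
    using that by (simp add: site_complex_def rel_ideal_diff)
  show ?thesis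
    unfolding presented_complex_def pc_hom_def
    by (intro conjI allI ballI add nl gd gdiff zero nd)
qed

definition relocate :: "'t set \<Rightarrow> ('t \<Rightarrow> 's) \<Rightarrow> ('t \<Rightarrow> int) \<Rightarrow> ('s \<Rightarrow> 'v zpoly) \<Rightarrow> ('t \<Rightarrow> 'v zpoly)" where
  "relocate T \<sigma> c f = (\<lambda>t. if t \<in> T then of_int (c t) * f (\<sigma> t) else 0)"

lemma relocate_hom:
  assumes T: "T \<subseteq> support S'" and c: "\<And>t. t \<in> T ==> c t \<in> {1, -1}"
    and \<sigma>: "\<And>t. t \<in> T ==> \<sigma> t \<in> support S \<and> srel S' t = srel S (\<sigma> t) \<and>
      sdeg S' t = (fst (sdeg S (\<sigma> t)) + k, snd (sdeg S (\<sigma> t)))"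
  shows "pc_hom k (site_complex S) (site_complex S') (relocate T \<sigma> c)"
proof -
  have "additive_map (relocate T \<sigma> c)"
    by (auto simp: additive_map_def relocate_def fun_eq_iff right_diff_distrib)
  moreover have "relocate T \<sigma> c f \<in> null (site_complex S')" if "f \<in> null (site_complex S)" for f
    using that \<sigma> by (auto simp: site_complex_def relocate_def intro: rel_ideal_mult_left)
  moreover have "relocate T \<sigma> c f \<in> gr (site_complex S') (i + k) j" if f: "f \<in> gr (site_complex S) i j" for f i j
  proof -
    have k: "Poly_Mapping.keys (relocate T \<sigma> c f t) \<subseteq> (if t \<in> T then Poly_Mapping.keys (f (\<sigma> t)) else {})" for t
      using c[of t] by (auto simp: relocate_def)
    have "t \<in> support S' \<and> sdeg S' t = (i + k, j + 2 * int (size \<mu>))"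
      if "\<mu> \<in> Poly_Mapping.keys (relocate T \<sigma> c f t)" for t \<mu>
    proof -
      have t: "t \<in> T" "\<mu> \<in> Poly_Mapping.keys (f (\<sigma> t))" using that k[of t] by (auto split: if_splits)
      then show ?thesis using f T \<sigma>[OF t(1)] by (auto simp: site_complex_def)
    qed
    then show ?thesis by (auto simp: site_complex_def)
  qed
  ultimately show ?thesis by (simp add: pc_hom_def)
qed

lemma site_elimination:
  fixes S :: "('s, 'v) sites" and Z :: "('z, 'v) sites"
  assumes S: "valid_sites S" and Z: "valid_sites Z"
    and dd: "\<And>i j f. f \<in> gr (site_complex S) i j ==> dif (site_complex S) (dif (site_complex S) f) \<in> null (site_complex S)"
    and PQ: "P \<subseteq> support S" "Q \<subseteq> support S" "P \<inter> Q = {}"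
    and m: "bij_betw m P Q" and \<beta>: "bij_betw \<beta> (support Z) (support S - P - Q)"
    and u: "\<And>s. s \<in> P ==> u s \<in> {1, -1} \<and> entry S (m s) s = of_int (u s) \<and> srel S (m s) = srel S s"
    and off: "\<And>s t. s \<in> P ==> t \<in> Q ==> t \<noteq> m s ==> entry S t s = 0"
    and \<tau>: "\<And>z. z \<in> support Z ==> \<tau> z \<in> {1, -1} \<and> srel Z z = srel S (\<beta> z) \<and> sdeg Z z = sdeg S (\<beta> z)"
    and dZ: "\<And>z z'. z \<in> support Z ==> z' \<in> support Z ==>
      entry Z z z' - of_int (\<tau> z * \<tau> z') * (entry S (\<beta> z) (\<beta> z')
        - (\<Sum>s\<in>P. entry S (\<beta> z) s * of_int (u s) * entry S (m s) (\<beta> z'))) \<in> rel_ideal (srel Z z)"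
  shows "pc_equiv (site_complex S) (site_complex Z)"
proof -
  let ?C = "site_complex S" and ?C' = "site_complex Z"
  let ?d = "dif ?C"
  have fin: "finite (support S)" "finite (support Z)" "finite P"
    using S Z PQ by (auto simp: valid_sites_def intro: finite_subset)
  define \<gamma> where "\<gamma> = inv_into (support Z) \<beta>"
  have \<beta>Z: "\<beta> z \<in> support S" "\<beta> z \<notin> P" "\<beta> z \<notin> Q" "\<gamma> (\<beta> z) = z" if "z \<in> support Z" for z
    using that \<beta> unfolding bij_betw_def \<gamma>_def by (auto simp: inv_into_f_f)
  have \<gamma>S: "\<gamma> s \<in> support Z" "\<beta> (\<gamma> s) = s" if "s \<in> support S" "s \<notin> P" "s \<notin> Q" for s
    using that \<beta> unfolding bij_betw_def \<gamma>_def by (auto simp: f_inv_into_f inv_into_into)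
  have mP: "m s \<in> Q" if "s \<in> P" for s using m that by (auto simp: bij_betw_def)
  have mS: "m s \<in> support S" if "s \<in> P" for s using mP that PQ by blast
  have minj: "m s = m s' \<longleftrightarrow> s = s'" if "s \<in> P" "s' \<in> P" for s s'
    using m that by (auto simp: bij_betw_def inj_on_def)
  define P' where "P' = (relocate P (\<lambda>s. s) (\<lambda>_. 1) :: ('s \<Rightarrow> 'v zpoly) \<Rightarrow> _)"
  define Q' where "Q' = (relocate Q (\<lambda>s. s) (\<lambda>_. 1) :: ('s \<Rightarrow> 'v zpoly) \<Rightarrow> _)"
  define \<psi> where "\<psi> = (relocate P m u :: ('s \<Rightarrow> 'v zpoly) \<Rightarrow> _)"
  define r where "r = (relocate (support Z) \<beta> \<tau> :: ('s \<Rightarrow> 'v zpoly) \<Rightarrow> _)"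
  define b where "b = (relocate (support S - P - Q) \<gamma> (\<tau> \<circ> \<gamma>) :: ('z \<Rightarrow> 'v zpoly) \<Rightarrow> _)"
  note defs = P'_def Q'_def \<psi>_def r_def b_def relocate_def
  have sgn: "of_int x * (of_int x * p) = (p :: 'v zpoly)" if "x \<in> {1, -1 :: int}" for x p
    using that by auto
  have dif_S: "?d f t = (if t \<in> support S then (\<Sum>s\<in>support S. entry S t s * f s) else 0)" for f t
    by (simp add: site_complex_def)
  have degm: "sdeg S (m s) = (fst (sdeg S s) + 1, snd (sdeg S s))" if s: "s \<in> P" for s
  proof -
    have "entry S (m s) s = 1 \<or> entry S (m s) s = - 1" using u[OF s] by auto
    then have "Poly_Mapping.keys (entry S (m s) s) = {{#}}"
      by (metis keys_minus keys_zpoly_one)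
    then have "{#} \<in> Poly_Mapping.keys (entry S (m s) s)" by simp
    moreover have "m s \<in> support S" "s \<in> support S" using mP[OF s] PQ s by auto
    ultimately show ?thesis using S unfolding valid_sites_def by fastforce
  qed
  show ?thesis
  proof (rule gaussian_elimination[where P = P' and Q = Q' and \<psi> = \<psi> and r = r and b = b])
    show "presented_complex ?C" "presented_complex ?C'"
      using S Z by (auto intro: presented_site_complex)
    show "?d (?d f) \<in> null ?C" if "f \<in> gr ?C i j" for i j f using dd that .
    show "pc_hom 0 ?C ?C P'" "pc_hom 0 ?C ?C Q'"
      unfolding P'_def Q'_def by (rule relocate_hom; use PQ in auto)+
    show "pc_hom (-1) ?C ?C \<psi>"
      unfolding \<psi>_def using PQ u mP degm by (intro relocate_hom) (auto; force)+
    show "pc_hom 0 ?C ?C' r"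
      unfolding r_def using \<tau> \<beta>Z by (intro relocate_hom) auto
    show "pc_hom 0 ?C' ?C b"
      unfolding b_def using \<tau> \<gamma>S by (intro relocate_hom) (auto; fail)+
    show "\<psi> (b y) = 0" for y using mP PQ by (auto simp: defs fun_eq_iff)
    show "r (\<psi> x) = 0" for x using \<beta>Z by (auto simp: defs fun_eq_iff)
    show "\<psi> (\<psi> x) = 0" for x using mP PQ by (auto simp: defs fun_eq_iff)
    show "P' (\<psi> x) = \<psi> x" for x by (auto simp: defs fun_eq_iff)
    have rfl: "pc_eq ?C x x" "pc_eq ?C' y y" for x y using S Z by (simp_all add: presented_site_complex)
    show "pc_eq ?C' (r (b y)) y" if y: "y \<in> gr ?C' i j" for i j y
    proof -
      have "r (b y) = y"
        using \<beta>Z \<tau> sgn gr_support[OF y] by (force simp: defs fun_eq_iff)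
      then show ?thesis by (simp add: rfl)
    qed
    show "pc_eq ?C (b (r x)) (x - P' x - Q' x)" if x: "x \<in> gr ?C i j" for i j x
    proof -
      have "b (r x) s = (x - P' x - Q' x) s" for s
        using \<gamma>S[of s] \<tau>[of "\<gamma> s"] sgn[of "\<tau> (\<gamma> s)"] gr_support[OF x, of s] PQ by (auto simp: defs)
      then have "b (r x) = x - P' x - Q' x" by (rule ext)
      then show ?thesis by (simp add: rfl)
    qed
    show "pc_eq ?C (\<psi> (?d (P' x))) (P' x)" if x: "x \<in> gr ?C i j" for i j x
    proof -
      have "\<psi> (?d (P' x)) t = P' x t" for t
      proof (cases "t \<in> P")
        case True
        have "?d (P' x) (m t) = (\<Sum>s\<in>support S. if s = t then of_int (u t) * x t else 0)"
          unfolding dif_S using mP[OF True] PQ True u[OF True] off minj mP mS[OF True]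
          by (auto simp: defs intro!: sum.cong)
        also have "\<dots> = of_int (u t) * x t" using fin PQ True by (auto simp: sum.delta)
        finally show ?thesis using True u[OF True] sgn by (simp add: defs)
      qed (simp add: defs)
      then have "\<psi> (?d (P' x)) = P' x" by (rule ext)
      then show ?thesis by (simp add: rfl)
    qed
    show "pc_eq ?C (Q' (?d (\<psi> x))) (Q' x)" if x: "x \<in> gr ?C i j" for i j x
    proof -
      have "Q' (?d (\<psi> x)) t = Q' x t" for t
      proof (cases "t \<in> Q")
        case True
        then obtain s0 where s0: "s0 \<in> P" "t = m s0" using m by (auto simp: bij_betw_def)
        have "?d (\<psi> x) t = (\<Sum>s\<in>support S. if s = s0 then x t else 0)"
          unfolding dif_S using True PQ s0 u[OF s0(1)] off[OF _ True] sgn[of "u s0"] minj[OF s0(1)]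
          by (auto simp: defs intro!: sum.cong)
        also have "\<dots> = x t" using fin PQ s0 by (auto simp: sum.delta)
        finally show ?thesis using True by (simp add: defs)
      qed (simp add: defs)
      then have "Q' (?d (\<psi> x)) = Q' x" by (rule ext)
      then show ?thesis by (simp add: rfl)
    qed
    show "pc_eq ?C' (dif ?C' y) (r (?d (b y) - ?d (\<psi> (?d (b y)))))" if y: "y \<in> gr ?C' i j" for i j y
    proof -
      have db: "?d (b y) t = (\<Sum>z'\<in>support Z. entry S t (\<beta> z') * (of_int (\<tau> z') * y z'))"
        if t: "t \<in> support S" for t
      proof -
        have "?d (b y) t = (\<Sum>s\<in>support S - P - Q. entry S t s * b y s)"
        proof -
          have "(\<Sum>s\<in>support S. entry S t s * b y s) = (\<Sum>s\<in>support S - P - Q. entry S t s * b y s)"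
            using fin by (intro sum.mono_neutral_right) (auto simp: b_def relocate_def)
          then show ?thesis unfolding dif_S using t by simp
        qed
        also have "\<dots> = (\<Sum>z'\<in>support Z. entry S t (\<beta> z') * b y (\<beta> z'))"
          using sum.reindex_bij_betw[OF \<beta>, of "\<lambda>s. entry S t s * b y s"] by simp
        also have "\<dots> = (\<Sum>z'\<in>support Z. entry S t (\<beta> z') * (of_int (\<tau> z') * y z'))"
          using \<beta>Z by (intro sum.cong) (auto simp: defs)
        finally show ?thesis .
      qed
      have d\<psi>: "?d (\<psi> (?d (b y))) t = (\<Sum>z'\<in>support Z.
          (\<Sum>s\<in>P. entry S t s * of_int (u s) * entry S (m s) (\<beta> z')) * (of_int (\<tau> z') * y z'))"
        if t: "t \<in> support S" for t
      proof -
        have "?d (\<psi> (?d (b y))) t = (\<Sum>s\<in>P. entry S t s * \<psi> (?d (b y)) s)"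
        proof -
          have "(\<Sum>s\<in>support S. entry S t s * \<psi> (?d (b y)) s) = (\<Sum>s\<in>P. entry S t s * \<psi> (?d (b y)) s)"
            using fin PQ by (intro sum.mono_neutral_right) (auto simp: \<psi>_def relocate_def)
          then show ?thesis unfolding dif_S[of "\<psi> (?d (b y))"] using t by simp
        qed
        also have "\<dots> = (\<Sum>s\<in>P. entry S t s * (of_int (u s) *
            (\<Sum>z'\<in>support Z. entry S (m s) (\<beta> z') * (of_int (\<tau> z') * y z'))))"
        proof (rule sum.cong)
          fix s assume s: "s \<in> P"
          then have "m s \<in> support S" using mP PQ by auto
          then show "entry S t s * \<psi> (?d (b y)) s = entry S t s * (of_int (u s) *
            (\<Sum>z'\<in>support Z. entry S (m s) (\<beta> z') * (of_int (\<tau> z') * y z')))"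
            using s db by (simp add: \<psi>_def relocate_def)
        qed simp
        also have "\<dots> = (\<Sum>s\<in>P. \<Sum>z'\<in>support Z.
            entry S t s * of_int (u s) * entry S (m s) (\<beta> z') * (of_int (\<tau> z') * y z'))"
          by (simp add: sum_distrib_left mult.assoc)
        also have "\<dots> = (\<Sum>z'\<in>support Z. \<Sum>s\<in>P.
            entry S t s * of_int (u s) * entry S (m s) (\<beta> z') * (of_int (\<tau> z') * y z'))"
          by (rule sum.swap)
        finally show ?thesis by (simp add: sum_distrib_right)
      qed
      define W where "W t z' = (\<Sum>s\<in>P. entry S t s * of_int (u s) * entry S (m s) (\<beta> z'))" for t z'
      have "(dif ?C' y - r (?d (b y) - ?d (\<psi> (?d (b y))))) z \<in> rel_ideal (srel Z z)"
        if z: "z \<in> support Z" for z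
      proof -
        define W where "W t z' = (\<Sum>s\<in>P. entry S t s * of_int (u s) * entry S (m s) (\<beta> z'))" for t z'
      have "(dif ?C' y - r (?d (b y) - ?d (\<psi> (?d (b y))))) z
          = (\<Sum>z'\<in>support Z. entry Z z z' * y z') - of_int (\<tau> z) * (?d (b y) (\<beta> z) - ?d (\<psi> (?d (b y))) (\<beta> z))"
          using z by (simp add: site_complex_def r_def relocate_def)
        also have "\<dots> = (\<Sum>z'\<in>support Z. (entry Z z z' - of_int (\<tau> z * \<tau> z') * (entry S (\<beta> z) (\<beta> z')
            - W (\<beta> z) z')) * y z')"
          unfolding db[OF \<beta>Z(1)[OF z]] d\<psi>[OF \<beta>Z(1)[OF z]] W_def[symmetric]
          by (simp only: sum_subtractf[symmetric] sum_distrib_left left_diff_distrib right_diff_distrib of_int_mult)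
            (simp only: algebra_simps)
        also have "\<dots> \<in> rel_ideal (srel Z z)"
          unfolding W_def by (intro rel_ideal_sum rel_ideal_mult_right dZ z)
        finally show ?thesis .
      qed
      then show ?thesis by (simp add: pc_eq_def site_complex_def)
    qed
  qed
qed

section \<open>Circle models of the Khovanov complex\<close>

lemma fuse_class:
  assumes E: "equiv A E" and uv: "u \<in> A" "v \<in> A"
  shows "fuse E u v `` {a} = (if a \<in> E `` {u} \<union> E `` {v} then E `` {u} \<union> E `` {v} else E `` {a})"
proof -
  let ?C = "E `` {u} \<union> E `` {v}"
  have t: "trans E" using E by (auto simp: equiv_def)
  have "E `` {a} \<subseteq> ?C" if "a \<in> ?C" using that by (auto intro: transD[OF t])
  moreover have "fuse E u v `` {a} = E `` {a} \<union> (if a \<in> ?C then ?C else {})"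
    by (auto simp: fuse_def)
  ultimately show ?thesis by auto
qed

lemma fuse_quotient:
  assumes E: "equiv A E" and uv: "u \<in> A" "v \<in> A" "(u, v) \<notin> E"
  shows "A // E - A // fuse E u v = {E `` {u}, E `` {v}}"
    and "A // fuse E u v - A // E = {E `` {u} \<union> E `` {v}}"
    and "E `` {u} \<noteq> E `` {v}"
proof -
  let ?C = "E `` {u} \<union> E `` {v}"
  have ne: "E `` {u} \<noteq> E `` {v}" using eq_equiv_class_iff[OF E uv(1,2)] uv(3) by blast
  have self: "a \<in> E `` {a}" if "a \<in> A" for a using E that by (auto simp: equiv_def refl_on_def)
  have cls: "E `` {a} = E `` {b}" if "b \<in> E `` {a}" for a b
    using that E by (metis Image_singleton_iff equiv_class_eq)
  have disj: "E `` {u} \<inter> E `` {v} = {}" using cls ne by blast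
  have C: "?C \<noteq> E `` {a}" if "a \<in> A" for a
  proof
    assume "?C = E `` {a}"
    then have "u \<in> E `` {a}" "v \<in> E `` {a}" using self uv by blast+
    then show False using cls ne by metis
  qed
  note fc = fuse_class[OF E uv(1,2)]
  have eq: "A // E = (\<lambda>a. E `` {a}) ` A" "A // fuse E u v = (\<lambda>a. fuse E u v `` {a}) ` A"
    by (auto simp: quotient_def)
  have CF: "?C \<in> A // fuse E u v" unfolding eq using fc[of u] self[OF uv(1)] uv(1) by (metis UnI1 imageI)
  have nF: "E `` {x} \<notin> A // fuse E u v" if x: "x \<in> {u, v}" for x
  proof
    assume "E `` {x} \<in> A // fuse E u v"
    then obtain a where a: "a \<in> A" "E `` {x} = fuse E u v `` {a}" unfolding eq by auto
    show False
    proof (cases "a \<in> ?C")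
      case True
      then have "E `` {x} = ?C" using a fc[of a] by simp
      then show False using C[of x] x uv by blast
    next
      case False
      then have "E `` {x} = E `` {a}" using a fc[of a] by simp
      then have "a \<in> E `` {x}" using self[OF a(1)] by simp
      then show False using False x by auto
    qed
  qed
  show "A // E - A // fuse E u v = {E `` {u}, E `` {v}}"
  proof
    show "{E `` {u}, E `` {v}} \<subseteq> A // E - A // fuse E u v"
      using nF uv unfolding eq(1) by auto
    show "A // E - A // fuse E u v \<subseteq> {E `` {u}, E `` {v}}"
    proof
      fix K assume K: "K \<in> A // E - A // fuse E u v"
      then obtain a where a: "a \<in> A" "K = E `` {a}" unfolding eq by auto
      have "a \<in> ?C"
      proof (rule ccontr)
        assume "a \<notin> ?C"
        then have "K = fuse E u v `` {a}" using a fc[of a] by simp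
        then show False using K a unfolding eq by blast
      qed
      then show "K \<in> {E `` {u}, E `` {v}}" using a cls by blast
    qed
  qed
  show "A // fuse E u v - A // E = {?C}"
  proof
    show "{?C} \<subseteq> A // fuse E u v - A // E" using CF C unfolding eq(1) by auto
    show "A // fuse E u v - A // E \<subseteq> {?C}"
    proof
      fix K assume K: "K \<in> A // fuse E u v - A // E"
      then obtain a where a: "a \<in> A" "K = fuse E u v `` {a}" unfolding eq by auto
      then show "K \<in> {?C}" using fc[of a] K unfolding eq by (cases "a \<in> ?C") auto
    qed
  qed
  show "E `` {u} \<noteq> E `` {v}" by (rule ne)
qed

text \<open>
  A circle model describes the complex by polynomials in variables from \<open>V\<close>, which stand, via
  \<open>\<theta>\<close>, for all arcs outside of a set \<open>Y\<close>.  In some states \<open>Y\<close> is a component, and then the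
  module splits into two summands, according to the label of this circle.
\<close>

definition vrel :: "('p, 'a, 'z) signed_chord_diagram_scheme \<Rightarrow> 'v set \<Rightarrow> ('v \<Rightarrow> 'a) \<Rightarrow> 'p set set \<Rightarrow> ('v \<times> 'v) set" where
  "vrel D V \<theta> N = {(u, v). u \<in> V \<and> v \<in> V \<and> (\<theta> u, \<theta> v) \<in> smoothing_rel D N}"

definition partner :: "('p, 'a, 'z) signed_chord_diagram_scheme \<Rightarrow> 'v set \<Rightarrow> ('v \<Rightarrow> 'a) \<Rightarrow> 'a set \<Rightarrow> 'p set set \<Rightarrow> 'v" where
  "partner D V \<theta> Y N = (SOME z. z \<in> V \<and> (\<exists>y\<in>Y. (y, \<theta> z) \<in> smoothing_rel D N))"

definition model_factor :: "('p, 'a, 'z) signed_chord_diagram_scheme \<Rightarrow> 'v set \<Rightarrow> ('v \<Rightarrow> 'a) \<Rightarrow> 'a set \<Rightarrow>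
    'p set set \<times> bool \<Rightarrow> 'p set set \<times> bool \<Rightarrow> 'v zpoly" where
  "model_factor D V \<theta> Y = (\<lambda>(M, \<tau>') (N, \<tau>).
     if Y \<in> components D N then
       if Y \<in> components D M then (if \<tau> = \<tau>' then saddle (vrel D V \<theta> N) (vrel D V \<theta> M) else 0)
       else (if \<tau> then var (partner D V \<theta> Y M) else 1)
     else
       if Y \<in> components D M then (if \<tau>' then 1 else var (partner D V \<theta> Y N))
       else saddle (vrel D V \<theta> N) (vrel D V \<theta> M))"

definition model_sites :: "('p, 'a, 'z) signed_chord_diagram_scheme \<Rightarrow> 'v set \<Rightarrow> ('v \<Rightarrow> 'a) \<Rightarrow> 'a set \<Rightarrow>
    ('p set set \<Rightarrow> 'p set \<Rightarrow> int) \<Rightarrow> ('p set set \<times> bool, 'v) sites" where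
  "model_sites D V \<theta> Y sg = \<lparr>
     support = {(N, \<tau>). N \<subseteq> chords D \<and> (\<tau> \<longrightarrow> Y \<in> components D N)},
     srel = (\<lambda>(N, \<tau>). vrel D V \<theta> N),
     sdeg = (\<lambda>(N, \<tau>). ((writhe D - num_pos D N + num_neg D N) div 2,
       int (card (components D N)) - (if \<tau> then 2 else 0) + (3 * writhe D - num_pos D N + num_neg D N) div 2)),
     entry = (\<lambda>t s. if \<exists>c\<in>chords D - fst s. fst t = insert c (fst s)
       then of_int (sg (fst s) (THE c. c \<notin> fst s \<and> fst t = insert c (fst s))) * model_factor D V \<theta> Y t s
       else 0)\<rparr>"

definition base_gen :: "('p, 'a, 'z) signed_chord_diagram_scheme \<Rightarrow> 'a set \<Rightarrow> 'p set set \<times> bool \<Rightarrow> (('p, 'a) kh_basis \<Rightarrow>\<^sub>0 int)" where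
  "base_gen D Y = (\<lambda>(N, \<tau>). frag_of (N, \<lambda>K\<in>components D N. if \<tau> \<and> K = Y then GenX else Gen1))"

definition var_op :: "('p, 'a, 'z) signed_chord_diagram_scheme \<Rightarrow> 'v set \<Rightarrow> ('v \<Rightarrow> 'a) \<Rightarrow> 'p set set \<Rightarrow> 'v \<Rightarrow>
    (('p, 'a) kh_basis \<Rightarrow>\<^sub>0 int) \<Rightarrow> (('p, 'a) kh_basis \<Rightarrow>\<^sub>0 int)" where
  "var_op D V \<theta> N v = (if v \<in> V then label_op (smoothing_rel D N `` {\<theta> v}) else (\<lambda>_. 0))"

lemma entry_model_sites:
  assumes "c \<in> chords D" "c \<notin> N"
  shows "entry (model_sites D V \<theta> Y sg) (insert c N, \<tau>') (N, \<tau>) =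
    of_int (sg N c) * model_factor D V \<theta> Y (insert c N, \<tau>') (N, \<tau>)"
proof -
  have "(THE c'. c' \<notin> N \<and> insert c N = insert c' N) = c" using assms by (intro the_equality) auto
  then show ?thesis using assms by (auto simp: model_sites_def)
qed

lemma entry_model_sites_0:
  "\<not> (\<exists>c\<in>chords D - N. M = insert c N) ==> entry (model_sites D V \<theta> Y sg) (M, \<tau>') (N, \<tau>) = 0"
  by (auto simp: model_sites_def)

locale circle_model =
  fixes D :: "('p, 'a, 'z) signed_chord_diagram_scheme" and V :: "'v set" and \<theta> :: "'v \<Rightarrow> 'a" and Y :: "'a set"
  assumes signed: "is_signed_chord_diagram D" and orientable: "orientable D"
    and \<theta>V: "\<theta> ` V = arcs D - Y"
    and Y: "\<And>N K. N \<subseteq> chords D ==> K \<in> components D N ==> K \<subseteq> Y ==> K = Y"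

begin

abbreviation "R \<equiv> smoothing_rel D"

abbreviation "comps \<equiv> components D"

abbreviation "E \<equiv> vrel D V \<theta>"

abbreviation "act \<equiv> var_op D V \<theta>"

abbreviation "mf \<equiv> model_factor D V \<theta> Y"

abbreviation "base \<equiv> base_gen D Y"

abbreviation "cmp N v \<equiv> smoothing_rel D N `` {\<theta> v}"

lemma diagram: "is_chord_diagram D"
  using signed by (simp add: is_signed_chord_diagram_def)

lemma comps_eq: "comps N = arcs D // R N"
  by (rule components_smoothing_rel[OF diagram])

lemma equiv_R: "equiv (arcs D) (R N)"
  by (rule equiv_smoothing_rel)

lemma finite_comps: "finite (comps N)"
proof -
  have "finite (arcs D)" using diagram by (simp add: is_chord_diagram_def)
  then show ?thesis unfolding comps_eq quotient_def by auto
qed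

lemma finite_chords: "finite (chords D)"
  using diagram by (simp add: is_chord_diagram_def)

lemma R_self: "a \<in> arcs D ==> a \<in> R N `` {a}"
  by (simp add: smoothing_rel_def)

lemma R_class: "a \<in> arcs D ==> R N `` {a} \<in> comps N"
  by (auto simp: comps_eq quotient_def)

lemma comps_cases:
  assumes "K \<in> comps N" obtains a where "a \<in> arcs D" "K = R N `` {a}"
  using assms by (auto simp: comps_eq quotient_def)

lemma class_mem: "K \<in> comps N ==> a \<in> K ==> a \<in> arcs D \<and> R N `` {a} = K"
  by (metis comps_cases equiv_R equiv_class_eq Image_singleton_iff smoothing_rel_def IntE mem_Sigma_iff)

lemma \<theta>_arcs: "v \<in> V ==> \<theta> v \<in> arcs D" and \<theta>_Y: "v \<in> V ==> \<theta> v \<notin> Y"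
  using \<theta>V by auto

lemma cmp_comps: "v \<in> V ==> cmp N v \<in> comps N"
  using R_class \<theta>_arcs by blast

lemma cmp_Y: "v \<in> V ==> cmp N v \<noteq> Y"
  using R_self[OF \<theta>_arcs] \<theta>_Y by blast

lemma comp_var:
  assumes "N \<subseteq> chords D" "K \<in> comps N" "K \<noteq> Y"
  obtains v where "v \<in> V" "\<theta> v \<in> K" "cmp N v = K"
proof -
  have "\<not> K \<subseteq> Y" using Y[OF assms(1,2)] assms(3) by blast
  then obtain a where a: "a \<in> K" "a \<notin> Y" by blast
  then have "a \<in> \<theta> ` V" using class_mem[OF assms(2)] \<theta>V by blast
  then show ?thesis using that a class_mem[OF assms(2)] by blast
qed

lemma E_iff: "(u, v) \<in> E N \<longleftrightarrow> u \<in> V \<and> v \<in> V \<and> cmp N u = cmp N v"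
  using eq_equiv_class_iff[OF equiv_R \<theta>_arcs \<theta>_arcs] by (auto simp: vrel_def)

lemma equiv_E: "equiv V (E N)"
  by (rule equivI) (auto simp: refl_on_def sym_def trans_def E_iff)

lemma commuting_act: "commuting_actions (act N)"
  by standard (auto simp: var_op_def label_op_commute label_op_diff)

lemma poly_act_E: "p \<in> rel_ideal (E N) ==> poly_act (act N) p z = 0"
  by (erule commuting_actions.poly_act_rel_ideal[OF commuting_act])
    (auto simp: var_op_def label_op_square E_iff)

lemma poly_act_cong: "p - q \<in> rel_ideal (E N) ==> poly_act (act N) p z = poly_act (act N) q z"
  using poly_act_E[of "p - q" N z] by (simp add: poly_act_diff)

subsection \<open>Edges of the cube\<close>

definition merge_edge :: "'p set set \<Rightarrow> 'p set set \<Rightarrow> 'a \<Rightarrow> 'a \<Rightarrow> bool" where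
  "merge_edge N M a b \<longleftrightarrow> N \<subseteq> chords D \<and> M \<subseteq> chords D \<and> a \<in> arcs D \<and> b \<in> arcs D \<and>
     (a, b) \<notin> R N \<and> R M = fuse (R N) a b"

lemma chord_surgered:
  assumes "c \<in> chords D"
  obtains u v where "\<And>N. c \<notin> N ==> surgered (arcs D) (R N) (R (insert c N)) u v"
proof -
  obtain ori where ori: "is_orientation D ori" using orientable by (auto simp: orientable_def)
  then obtain p q where pq: "c = {p, q}" "attractive D ori p" "repulsive D ori q"
    using assms unfolding is_orientation_def by blast
  then have "p \<noteq> q" by (auto simp: attractive_def repulsive_def)
  moreover have "sign D {p, q} \<in> {1, -1}" using signed assms pq by (simp add: is_signed_chord_diagram_def)
  ultimately have "surgered (arcs D) (R N) (R (insert c N)) (arc_in D p) (arc_out D p)" if "c \<notin> N" for N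
    using smoothing_rel_surgered[OF diagram ori, of p q N] assms pq that by simp
  then show ?thesis using that by blast
qed

lemma edge_cases:
  assumes "N \<subseteq> chords D" "c \<in> chords D" "c \<notin> N"
  obtains (merge) a b where "merge_edge N (insert c N) a b" | (split) a b where "merge_edge (insert c N) N a b"
proof -
  obtain u v where s: "surgered (arcs D) (R N) (R (insert c N)) u v"
    using chord_surgered[OF assms(2)] assms(3) by metis
  then have uv: "u \<in> arcs D" "v \<in> arcs D" by (auto simp: surgered_def)
  from s show ?thesis
    by (cases rule: surgered_cases) (use that uv assms in \<open>auto simp: merge_edge_def\<close>)
qed

lemma merge_edge_sym: "merge_edge N M a b ==> merge_edge N M b a"
  using equiv_R[of N] unfolding merge_edge_def fuse_def equiv_def by (auto dest: symD simp: Un_commute)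

lemma merge_edge_merges:
  assumes "merge_edge N M a b"
  shows "merges D N M (R N `` {a}, R N `` {b}, R N `` {a} \<union> R N `` {b})"
  using assms fuse_quotient[OF equiv_R, of a b N] by (simp add: merge_edge_def merges_def comps_eq)

lemma merge_edge_class:
  assumes "merge_edge N M a b"
  shows "R M `` {x} = (if x \<in> R N `` {a} \<union> R N `` {b} then R N `` {a} \<union> R N `` {b} else R N `` {x})"
  using assms fuse_class[OF equiv_R, of a b N x] by (simp add: merge_edge_def)

lemma merge_edge_card:
  assumes "merge_edge N M a b"
  shows "card (comps N) = card (comps M) + 1"
proof -
  have m: "merges D N M (R N `` {a}, R N `` {b}, R N `` {a} \<union> R N `` {b})" by (rule merge_edge_merges[OF assms])
  have f: "finite (comps N)" "finite (comps M)" by (rule finite_comps)+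
  have "card (comps N - comps M) = 2" "card (comps M - comps N) = 1"
    using m by (auto simp: merges_def card_insert_if)
  moreover have "card (comps N) = card (comps N \<inter> comps M) + card (comps N - comps M)"
    "card (comps M) = card (comps M \<inter> comps N) + card (comps M - comps N)"
    using f by (metis card_Int_Diff add.commute)+
  ultimately show ?thesis by (simp add: Int_commute)
qed

lemma merge_edge_act:
  assumes m: "merge_edge N M a b"
  shows "kh_edge D N M (act N v z) = act M v (kh_edge D N M z)"
    and "kh_edge D M N (act M v z) = act N v (kh_edge D M N z)"
proof -
  let ?C1 = "R N `` {a}" and ?C2 = "R N `` {b}"
  have K: "cmp N v \<in> {?C1, ?C2} \<and> cmp M v = ?C1 \<union> ?C2 \<or> cmp M v = cmp N v \<and> cmp N v \<in> comps N \<inter> comps M"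
    if "v \<in> V"
  proof (cases "\<theta> v \<in> ?C1 \<union> ?C2")
    case True
    have C: "?C1 \<in> comps N" "?C2 \<in> comps N" using m R_class by (auto simp: merge_edge_def)
    then have "cmp N v \<in> {?C1, ?C2}"
      using True class_mem[OF C(1), of "\<theta> v"] class_mem[OF C(2), of "\<theta> v"] by blast
    then show ?thesis using True merge_edge_class[OF m, of "\<theta> v"] by simp
  next
    case False
    then have "cmp M v = cmp N v" using merge_edge_class[OF m, of "\<theta> v"] by simp
    then show ?thesis using cmp_comps[OF that, of N] cmp_comps[OF that, of M] by simp
  qed
  show "kh_edge D N M (act N v z) = act M v (kh_edge D N M z)"
  proof (cases "v \<in> V")
    case True
    from kh_edge_merge_label_op[OF merge_edge_merges[OF m] K[OF this]] True
    show ?thesis by (simp add: var_op_def)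
  qed (simp add: var_op_def)
  have "cmp N v \<in> {?C1, ?C2} \<and> cmp M v = ?C1 \<union> ?C2 \<or> cmp N v = cmp M v \<and> cmp M v \<in> comps M \<inter> comps N"
    if "v \<in> V" using K[OF that] by (metis Int_commute)
  note K' = this
  show "kh_edge D M N (act M v z) = act N v (kh_edge D M N z)"
  proof (cases "v \<in> V")
    case True
    from kh_edge_split_label_op[OF merge_edge_merges[OF m] K'[OF this]] True
    show ?thesis by (simp add: var_op_def)
  qed (simp add: var_op_def)
qed

lemma merge_edge_circle_cases:
  assumes m: "merge_edge N M a b"
  obtains (keep) u v where "u \<in> V" "v \<in> V" "(u, v) \<notin> E N" "E M = fuse (E N) u v"
      "cmp N u = R N `` {a}" "cmp N v = R N `` {b}"
      "R N `` {a} \<noteq> Y" "R N `` {b} \<noteq> Y" "R N `` {a} \<union> R N `` {b} \<noteq> Y" "Y \<in> comps N \<longleftrightarrow> Y \<in> comps M"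
  | (circle) a' b' where "merge_edge N M a' b'" "R N `` {a'} = Y" "Y \<in> comps N" "Y \<notin> comps M" "E N = E M"
      "partner D V \<theta> Y M \<in> V" "cmp N (partner D V \<theta> Y M) = R N `` {b'}"
      "cmp M (partner D V \<theta> Y M) = Y \<union> R N `` {b'}"
proof (cases "R N `` {a} = Y \<or> R N `` {b} = Y")
  case False
  let ?C1 = "R N `` {a}" and ?C2 = "R N `` {b}"
  have NM: "N \<subseteq> chords D" "M \<subseteq> chords D" "a \<in> arcs D" "b \<in> arcs D" "(a, b) \<notin> R N"
    using m by (auto simp: merge_edge_def)
  have C: "?C1 \<in> comps N" "?C2 \<in> comps N" using NM R_class by auto
  obtain u where u: "u \<in> V" "\<theta> u \<in> ?C1" "cmp N u = ?C1" using comp_var[OF NM(1) C(1)] False by blast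
  obtain v where v: "v \<in> V" "\<theta> v \<in> ?C2" "cmp N v = ?C2" using comp_var[OF NM(1) C(2)] False by blast
  have Cn: "?C1 \<union> ?C2 \<noteq> Y" using Y[OF NM(1) C(1)] False by blast
  have ms: "merges D N M (?C1, ?C2, ?C1 \<union> ?C2)" by (rule merge_edge_merges[OF m])
  have "(u, v) \<notin> E N" using u v ms by (auto simp: E_iff merges_def)
  moreover have "E M = fuse (E N) u v"
  proof -
    have "(x, y) \<in> E M \<longleftrightarrow> (x, y) \<in> fuse (E N) u v" for x y
    proof -
      have mem: "x \<in> E N `` {u} \<union> E N `` {v} \<longleftrightarrow> x \<in> V \<and> \<theta> x \<in> ?C1 \<union> ?C2" for x
      proof (cases "x \<in> V")
        case True
        then have "\<theta> x \<in> ?C1 \<longleftrightarrow> cmp N x = ?C1" "\<theta> x \<in> ?C2 \<longleftrightarrow> cmp N x = ?C2"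
          using class_mem[OF C(1)] class_mem[OF C(2)] R_self[OF \<theta>_arcs] by blast+
        then show ?thesis using True u v by (auto simp: E_iff)
      qed (auto simp: E_iff)
      have "\<theta> x \<in> arcs D" if "x \<in> V" using \<theta>_arcs that .
      have "(x, y) \<in> E M \<longleftrightarrow> x \<in> V \<and> y \<in> V \<and> (\<theta> x, \<theta> y) \<in> fuse (R N) a b"
        using m by (simp add: vrel_def merge_edge_def)
      also have "\<dots> \<longleftrightarrow> x \<in> V \<and> y \<in> V \<and> ((x, y) \<in> E N \<or> \<theta> x \<in> ?C1 \<union> ?C2 \<and> \<theta> y \<in> ?C1 \<union> ?C2)"
        by (auto simp: fuse_def vrel_def)
      also have "\<dots> \<longleftrightarrow> (x, y) \<in> fuse (E N) u v"
        unfolding fuse_def using mem[of x] mem[of y] E_iff[of x y N] by blast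
      finally show ?thesis .
    qed
    then show ?thesis by auto
  qed
  moreover have "Y \<in> comps N \<longleftrightarrow> Y \<in> comps M" using ms False Cn unfolding merges_def by auto
  ultimately show ?thesis using keep u v False Cn by blast
next
  case True
  then obtain a' b' where m': "merge_edge N M a' b'" and Ya: "R N `` {a'} = Y"
    using m merge_edge_sym by metis
  let ?C2 = "R N `` {b'}"
  have NM: "N \<subseteq> chords D" "M \<subseteq> chords D" "a' \<in> arcs D" "b' \<in> arcs D" "(a', b') \<notin> R N"
    using m' by (auto simp: merge_edge_def)
  have ms: "merges D N M (Y, ?C2, Y \<union> ?C2)" using merge_edge_merges[OF m'] Ya by simp
  then have C: "Y \<in> comps N" "Y \<notin> comps M" "?C2 \<in> comps N" "?C2 \<noteq> Y" "Y \<union> ?C2 \<in> comps M"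
    by (auto simp: merges_def)
  have "E N = E M"
  proof -
    have 1: "cmp M x = (if \<theta> x \<in> ?C2 then Y \<union> ?C2 else cmp N x)" if "x \<in> V" for x
      using merge_edge_class[OF m', of "\<theta> x"] Ya \<theta>_Y[OF that] by auto
    have 2: "\<theta> x \<in> ?C2 \<longleftrightarrow> cmp N x = ?C2" if "x \<in> V" for x
      using class_mem[OF C(3)] R_self[OF \<theta>_arcs[OF that]] by blast
    have 3: "cmp N x \<noteq> Y \<union> ?C2" if "x \<in> V" for x
      using ms cmp_comps[OF that, of N] by (auto simp: merges_def)
    have "(x, y) \<in> E N \<longleftrightarrow> (x, y) \<in> E M" for x y
    proof (cases "x \<in> V \<and> y \<in> V")
      case True
      then have x: "x \<in> V" and y: "y \<in> V" by auto
      show ?thesis unfolding E_iff using x y 1[OF x] 1[OF y] 2[OF x] 2[OF y] 3[OF x] 3[OF y] by metis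
    qed (auto simp: E_iff)
    then show ?thesis by auto
  qed
  let ?z = "partner D V \<theta> Y M"
  have z: "?z \<in> V \<and> (\<exists>y\<in>Y. (y, \<theta> ?z) \<in> R M)"
  proof -
    obtain v where v: "v \<in> V" "\<theta> v \<in> ?C2" using comp_var[OF NM(1) C(3,4)] by blast
    have "a' \<in> Y" using Ya R_self NM by blast
    moreover have "(a', \<theta> v) \<in> R M" using merge_edge_class[OF m', of a'] v Ya \<open>a' \<in> Y\<close> by auto
    ultimately have "v \<in> V \<and> (\<exists>y\<in>Y. (y, \<theta> v) \<in> R M)" using v by blast
    then show ?thesis unfolding partner_def by (rule someI)
  qed
  then obtain y where y: "y \<in> Y" "(y, \<theta> ?z) \<in> R M" by blast
  have "\<theta> ?z \<in> Y \<union> ?C2" using y merge_edge_class[OF m', of y] Ya by auto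
  then have z2: "\<theta> ?z \<in> ?C2" using \<theta>_Y z by blast
  then have "cmp N ?z = ?C2" "cmp M ?z = Y \<union> ?C2"
    using class_mem[OF C(3)] merge_edge_class[OF m', of "\<theta> ?z"] Ya by auto
  then show ?thesis using circle m' Ya C \<open>E N = E M\<close> z by blast
qed

end

definition order_sign :: "('p set \<Rightarrow> nat) \<Rightarrow> 'p set set \<Rightarrow> 'p set \<Rightarrow> int" where
  "order_sign num N c = (-1) ^ card {c'\<in>N. num c < num c'}"

lemma surgered_fuse:
  assumes "equiv V E" "u \<in> V" "v \<in> V" "(u, v) \<notin> E"
  shows "surgered V E (fuse E u v) u v" "surgered V (fuse E u v) E u v"
  using assms fuse_same[OF equiv_fuse[OF assms(1-3)] fuse_mem(1)[OF assms(1-3)]]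
  by (auto simp: surgered_def equiv_fuse)

lemma fuse_not_subset: "equiv V E ==> u \<in> V ==> v \<in> V ==> (u, v) \<notin> E ==> \<not> fuse E u v \<subseteq> E"
  by (meson fuse_mem(1) subsetD)

lemma saddle_not_subset:
  assumes "\<not> E \<subseteq> E'" "\<nu> \<in> Poly_Mapping.keys (saddle E E')"
  shows "size \<nu> = 1"
proof -
  obtain a b where "(SOME e. e \<in> E - E') = (a, b)" by fastforce
  then have "saddle E E' = var a + var b" using assms(1) by (simp add: saddle_def)
  then have "\<nu> \<in> Poly_Mapping.keys (var a) \<union> Poly_Mapping.keys (var b)"
    using assms(2) keys_add[of "var a" "var b"] by auto
  then show ?thesis by (auto simp: var_def keys_frag_of)
qed

context circle_model

begin

lemma base_eqI:
  assumes "\<And>K. K \<in> comps N ==> l K = (if \<tau> \<and> K = Y then GenX else Gen1)"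
  shows "frag_of (N, restrict l (comps N)) = base (N, \<tau>)"
proof -
  have "restrict l (comps N) = (\<lambda>K\<in>comps N. if \<tau> \<and> K = Y then GenX else Gen1)"
    using assms by (intro restrict_ext) auto
  then show ?thesis by (simp add: base_gen_def)
qed

lemma act_base:
  assumes "v \<in> V"
  shows "act N v (base (N, \<tau>)) = frag_of (N, (\<lambda>K\<in>comps N. if \<tau> \<and> K = Y then GenX else Gen1)(cmp N v := GenX))"
  using assms cmp_comps[OF assms, of N] cmp_Y[OF assms, of N]
  by (simp add: var_op_def base_gen_def label_op_of)

lemma act_base_eqI:
  assumes "v \<in> V" "\<And>K. K \<in> comps N ==> l K = (if \<tau> \<and> K = Y \<or> K = cmp N v then GenX else Gen1)"
  shows "frag_of (N, restrict l (comps N)) = act N v (base (N, \<tau>))"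
proof -
  have "restrict l (comps N) = (\<lambda>K\<in>comps N. if \<tau> \<and> K = Y then GenX else Gen1)(cmp N v := GenX)"
    using assms(2) cmp_comps[OF assms(1), of N] by (auto simp: restrict_def)
  then show ?thesis using act_base[OF assms(1), of N] by simp
qed

lemma poly_act_var_act [simp]: "poly_act (act N) (var v) z = act N v z"
  by (rule commuting_actions.poly_act_var[OF commuting_act])

lemma merges_mem:
  assumes "merges D N M (C1, C2, C)"
  shows "C1 \<in> comps N" "C2 \<in> comps N" "C \<notin> comps N" "C \<in> comps M" "C1 \<notin> comps M" "C2 \<notin> comps M"
    "C1 \<noteq> C2" "K \<in> comps M ==> K \<noteq> C ==> K \<in> comps N"
    "K \<in> comps N ==> K \<noteq> C1 ==> K \<noteq> C2 ==> K \<in> comps M"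
  using assms unfolding merges_def by auto

abbreviation "base_label N \<tau> \<equiv> (\<lambda>K\<in>comps N. if \<tau> \<and> K = Y then GenX else Gen1)"

lemma kh_partial_base_merge:
  assumes ms: "merges D N M (C1, C2, C)" and ne: "C1 \<noteq> Y" "C2 \<noteq> Y" "C \<noteq> Y"
  shows "kh_partial D N M (base_label N \<tau>) = base (M, \<tau>)"
proof -
  have "frag_of (M, restrict ((base_label N \<tau>)(C := Gen1)) (comps M)) = base (M, \<tau>)"
    by (rule base_eqI) (use merges_mem(8)[OF ms] ne in auto)
  then show ?thesis using merges_mem(1,2)[OF ms] ne by (simp add: kh_partial_merge[OF ms])
qed

lemma kh_partial_base_merge_circle:
  assumes ms: "merges D N M (Y, C2, C)" and z: "z \<in> V" "cmp M z = C"
  shows "kh_partial D N M (base_label N \<tau>) = (if \<tau> then act M z (base (M, False)) else base (M, False))"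
proof -
  note mem = merges_mem[OF ms]
  have "frag_of (M, restrict ((base_label N True)(C := GenX)) (comps M)) = act M z (base (M, False))"
    by (rule act_base_eqI[OF z(1)]) (use mem(5) mem(8) z in auto)
  moreover have "frag_of (M, restrict ((base_label N False)(C := Gen1)) (comps M)) = base (M, False)"
    by (rule base_eqI) (use mem(8) in auto)
  ultimately show ?thesis using mem(1,2,7) by (cases \<tau>) (simp_all add: kh_partial_merge[OF ms])
qed

lemma kh_partial_base_split:
  assumes ms: "merges D M N (C1, C2, C)" and ne: "C1 \<noteq> Y" "C2 \<noteq> Y" "C \<noteq> Y"
    and uv: "u \<in> V" "cmp M u = C1" "v \<in> V" "cmp M v = C2"
  shows "kh_partial D N M (base_label N \<tau>) = act M u (base (M, \<tau>)) + act M v (base (M, \<tau>))"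
proof -
  note mem = merges_mem[OF ms]
  have "frag_of (M, restrict ((base_label N \<tau>)(C1 := GenX, C2 := Gen1)) (comps M)) = act M u (base (M, \<tau>))"
    by (rule act_base_eqI[OF uv(1)]) (use mem(7,9) ne uv in auto)
  moreover have "frag_of (M, restrict ((base_label N \<tau>)(C1 := Gen1, C2 := GenX)) (comps M)) = act M v (base (M, \<tau>))"
    by (rule act_base_eqI[OF uv(3)]) (use mem(7,9) ne uv in auto)
  ultimately show ?thesis using mem(4) ne by (simp add: kh_partial_split[OF ms])
qed

lemma kh_partial_base_split_circle:
  assumes ms: "merges D M N (Y, C2, C)" and z: "z \<in> V" "cmp M z = C2"
  shows "kh_partial D N M (base_label N False) = base (M, True) + act M z (base (M, False))"
proof -
  note mem = merges_mem[OF ms]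
  have "frag_of (M, restrict ((base_label N False)(Y := GenX, C2 := Gen1)) (comps M)) = base (M, True)"
    by (rule base_eqI) (use mem(7,9) in auto)
  moreover have "frag_of (M, restrict ((base_label N False)(Y := Gen1, C2 := GenX)) (comps M)) = act M z (base (M, False))"
    by (rule act_base_eqI[OF z(1)]) (use mem(7,9) z in auto)
  ultimately show ?thesis using mem(4) by (simp add: kh_partial_split[OF ms])
qed

lemma kh_edge_base:
  assumes N: "N \<subseteq> chords D" "c \<in> chords D" "c \<notin> N" and M: "M = insert c N" and \<tau>: "\<tau> \<longrightarrow> Y \<in> comps N"
  shows "kh_edge D N M (base (N, \<tau>)) = poly_act (act M) (mf (M, False) (N, \<tau>)) (base (M, False)) +
    (if Y \<in> comps M then poly_act (act M) (mf (M, True) (N, \<tau>)) (base (M, True)) else 0)"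
proof -
  let ?l = "\<lambda>K\<in>comps N. if \<tau> \<and> K = Y then GenX else Gen1"
  have lhs: "kh_edge D N M (base (N, \<tau>)) = kh_partial D N M ?l" by (simp add: base_gen_def)
  have keep_rhs: ?thesis if "Y \<in> comps N \<longleftrightarrow> Y \<in> comps M"
    "kh_edge D N M (base (N, \<tau>)) = poly_act (act M) (saddle (E N) (E M)) (base (M, \<tau>))"
    using that \<tau> by (cases \<tau>) (auto simp: model_factor_def)
  from N show ?thesis
  proof (cases rule: edge_cases)
    case (merge a b)
    then have m: "merge_edge N M a b" using M by simp
    then show ?thesis
    proof (cases rule: merge_edge_circle_cases)
      case (keep u v)
      note ms = merge_edge_merges[OF m]
      have "kh_partial D N M ?l = base (M, \<tau>)"
        by (rule kh_partial_base_merge[OF ms keep(7,8,9)])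
      then show ?thesis using keep_rhs keep(4,10) lhs subset_fuse[of "E N" u v]
        by (simp add: saddle_merge)
    next
      case (circle a b)
      note ms = merge_edge_merges[OF circle(1), unfolded circle(2)]
      let ?z = "partner D V \<theta> Y M"
      show ?thesis using kh_partial_base_merge_circle[OF ms circle(6,8), of \<tau>] lhs circle(3,4)
        by (simp add: model_factor_def)
    qed
  next
    case (split a b)
    then have m: "merge_edge M N a b" using M by simp
    then show ?thesis
    proof (cases rule: merge_edge_circle_cases)
      case (keep u v)
      note ms = merge_edge_merges[OF m]
      have "kh_partial D N M ?l = act M u (base (M, \<tau>)) + act M v (base (M, \<tau>))"
        by (rule kh_partial_base_split[OF ms keep(7,8,9,1,5,2,6)])
      also have "\<dots> = poly_act (act M) (var u + var v) (base (M, \<tau>))" by (simp add: poly_act_add)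
      also have "\<dots> = poly_act (act M) (saddle (E N) (E M)) (base (M, \<tau>))"
        using saddle_split[OF equiv_E keep(1,2,3,4)] by (rule poly_act_cong[symmetric])
      finally show ?thesis using keep_rhs keep(10) lhs by simp
    next
      case (circle a b)
      note ms = merge_edge_merges[OF circle(1), unfolded circle(2)]
      let ?z = "partner D V \<theta> Y N"
      have \<tau>F: "\<not> \<tau>" using \<tau> circle(4) by simp
      show ?thesis using kh_partial_base_split_circle[OF ms circle(6,7)] lhs circle(3,4) \<tau>F
        by (simp add: model_factor_def add.commute)
    qed
  qed
qed

lemma model_factor_ideal:
  assumes N: "N \<subseteq> chords D" "c \<in> chords D" "c \<notin> N" and M: "M = insert c N" and p: "p \<in> rel_ideal (E N)"
  shows "mf (M, \<tau>') (N, \<tau>) * p \<in> rel_ideal (E M)"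
proof -
  have keep_case: ?thesis if "Y \<in> comps N \<longleftrightarrow> Y \<in> comps M" "surgered V (E N) (E M) u v" for u v
    using that saddle_rel_ideal[OF that(2) p] by (auto simp: model_factor_def)
  from N show ?thesis
  proof (cases rule: edge_cases)
    case (merge a b)
    then have m: "merge_edge N M a b" using M by simp
    then show ?thesis
    proof (cases rule: merge_edge_circle_cases)
      case (keep u v)
      then show ?thesis using keep_case surgered_fuse(1)[OF equiv_E keep(1,2,3)] by auto
    next
      case (circle a b)
      then show ?thesis using p by (simp add: rel_ideal_mult_left)
    qed
  next
    case (split a b)
    then have m: "merge_edge M N a b" using M by simp
    then show ?thesis
    proof (cases rule: merge_edge_circle_cases)
      case (keep u v)
      then show ?thesis using keep_case surgered_fuse(2)[OF equiv_E keep(1,2,3)] by auto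
    next
      case (circle a b)
      then show ?thesis using p by (simp add: rel_ideal_mult_left)
    qed
  qed
qed

lemma model_factor_degree:
  assumes N: "N \<subseteq> chords D" "c \<in> chords D" "c \<notin> N" and M: "M = insert c N"
    and \<tau>: "\<tau> \<longrightarrow> Y \<in> comps N" "\<tau>' \<longrightarrow> Y \<in> comps M"
    and \<nu>: "\<nu> \<in> Poly_Mapping.keys (mf (M, \<tau>') (N, \<tau>))"
  shows "int (card (comps M)) - (if \<tau>' then 2 else 0) + 1
    = int (card (comps N)) - (if \<tau> then 2 else 0) + 2 * int (size \<nu>)"
proof -
  have one: "\<nu> \<in> Poly_Mapping.keys (1 :: 'v zpoly) ==> size \<nu> = 0" by (simp add: keys_zpoly_one del: keys_one)
  have vr: "\<nu> \<in> Poly_Mapping.keys (var v) ==> size \<nu> = 1" for v by (simp add: var_def keys_frag_of)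
  from N show ?thesis
  proof (cases rule: edge_cases)
    case (merge a b)
    then have m: "merge_edge N M a b" using M by simp
    note card = merge_edge_card[OF m]
    from m show ?thesis
    proof (cases rule: merge_edge_circle_cases)
      case (keep u v)
      have "saddle (E N) (E M) = 1" using keep(4) by (simp add: saddle_merge subset_fuse)
      then have "\<nu> \<in> Poly_Mapping.keys (1 :: 'v zpoly)" "\<tau> = \<tau>'"
        using \<nu> \<tau> keep(10) by (auto simp: model_factor_def split: if_splits)
      then show ?thesis using one card by simp
    next
      case (circle a b)
      then show ?thesis using \<nu> \<tau> one vr card by (auto simp: model_factor_def)
    qed
  next
    case (split a b)
    then have m: "merge_edge M N a b" using M by simp
    note card = merge_edge_card[OF m]
    from m show ?thesis
    proof (cases rule: merge_edge_circle_cases)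
      case (keep u v)
      have "\<not> E N \<subseteq> E M" using keep(4) fuse_not_subset[OF equiv_E keep(1,2,3)] by simp
      moreover have "\<nu> \<in> Poly_Mapping.keys (saddle (E N) (E M))" "\<tau> = \<tau>'"
        using \<nu> \<tau> keep(10) by (auto simp: model_factor_def split: if_splits)
      ultimately show ?thesis using saddle_not_subset card by simp
    next
      case (circle a b)
      then show ?thesis using \<nu> \<tau> one vr card by (auto simp: model_factor_def split: if_splits)
    qed
  qed
qed

lemma num_neg_pos:
  assumes "N \<subseteq> chords D"
  shows "num_neg D N = int (card N)" "num_pos D N = int (card (chords D)) - int (card N)"
proof -
  have "{c \<in> chords D. marker N c = - 1} = N" "{c \<in> chords D. marker N c = 1} = chords D - N"
    using assms by (auto simp: marker_def split: if_splits)
  then show "num_neg D N = int (card N)" "num_pos D N = int (card (chords D)) - int (card N)"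
    using card_Diff_subset[OF finite_subset[OF assms finite_chords] assms] card_mono[OF finite_chords assms]
    by (auto simp: num_neg_def num_pos_def)
qed

abbreviation "sites sg \<equiv> model_sites D V \<theta> Y sg"

lemma support_sites: "(N, \<tau>) \<in> support (sites sg) \<longleftrightarrow> N \<subseteq> chords D \<and> (\<tau> \<longrightarrow> Y \<in> comps N)"
  by (simp add: model_sites_def)

lemma srel_sites [simp]: "srel (sites sg) (N, \<tau>) = E N"
  by (simp add: model_sites_def)

lemma sdeg_sites:
  assumes "N \<subseteq> chords D" "c \<in> chords D" "c \<notin> N" "M = insert c N"
  shows "fst (sdeg (sites sg) (M, \<tau>')) = fst (sdeg (sites sg) (N, \<tau>)) + 1"
    and "snd (sdeg (sites sg) (M, \<tau>')) - (int (card (comps M)) - (if \<tau>' then 2 else 0))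
      = snd (sdeg (sites sg) (N, \<tau>)) - (int (card (comps N)) - (if \<tau> then 2 else 0)) + 1"
proof -
  have "finite N" using assms(1) finite_chords by (rule finite_subset)
  then have c: "card M = card N + 1" using assms by simp
  have M: "M \<subseteq> chords D" using assms by simp
  show "fst (sdeg (sites sg) (M, \<tau>')) = fst (sdeg (sites sg) (N, \<tau>)) + 1"
    "snd (sdeg (sites sg) (M, \<tau>')) - (int (card (comps M)) - (if \<tau>' then 2 else 0))
      = snd (sdeg (sites sg) (N, \<tau>)) - (int (card (comps N)) - (if \<tau> then 2 else 0)) + 1"
    unfolding model_sites_def using c by (simp_all add: num_neg_pos[OF assms(1)] num_neg_pos[OF M])
qed

lemma finite_support: "finite (support (sites sg))"
proof -
  have "support (sites sg) \<subseteq> Pow (chords D) \<times> UNIV" by (auto simp: model_sites_def)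
  then show ?thesis using finite_chords by (meson finite_Pow_iff finite_SigmaI finite_UNIV finite_subset)
qed

lemma valid_model_sites:
  assumes sg: "\<And>N c. N \<subseteq> chords D ==> c \<in> chords D ==> c \<notin> N ==> sg N c \<in> {1, -1}"
  shows "valid_sites (sites sg)"
  unfolding valid_sites_def
proof (intro conjI ballI finite_support)
  fix s t assume s: "s \<in> support (sites sg)" and t: "t \<in> support (sites sg)"
  obtain N \<tau> M \<tau>' where st: "s = (N, \<tau>)" "t = (M, \<tau>')" by fastforce
  have N: "N \<subseteq> chords D" "\<tau> \<longrightarrow> Y \<in> comps N" "\<tau>' \<longrightarrow> Y \<in> comps M"
    using s t by (auto simp: st support_sites)
  {
    fix \<nu> assume \<nu>: "\<nu> \<in> Poly_Mapping.keys (entry (sites sg) t s)"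
    have "\<exists>c\<in>chords D - N. M = insert c N"
    proof (rule ccontr)
      assume "\<not> ?thesis"
      from entry_model_sites_0[OF this, of V \<theta> Y sg \<tau>' \<tau>] \<nu> show False by (simp add: st)
    qed
    then obtain c where c: "c \<in> chords D" "c \<notin> N" "M = insert c N" by blast
    have e: "entry (sites sg) t s = of_int (sg N c) * mf (M, \<tau>') (N, \<tau>)"
      unfolding st c(3) by (rule entry_model_sites[OF c(1,2)])
    have "sg N c = 1 \<or> sg N c = - 1" using sg[OF N(1) c(1,2)] by simp
    then have "\<nu> \<in> Poly_Mapping.keys (mf (M, \<tau>') (N, \<tau>))" using \<nu> unfolding e by auto
    from model_factor_degree[OF N(1) c N(2,3) this] sdeg_sites[OF N(1) c, of sg \<tau>' \<tau>]
    show "sdeg (sites sg) t = (fst (sdeg (sites sg) s) + 1, snd (sdeg (sites sg) s) + 2 * int (size \<nu>))"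
      by (simp add: st prod_eq_iff)
  next
    fix p assume p: "p \<in> rel_ideal (srel (sites sg) s)"
    show "entry (sites sg) t s * p \<in> rel_ideal (srel (sites sg) t)"
    proof (cases "\<exists>c\<in>chords D - N. M = insert c N")
      case True
      then obtain c where c: "c \<in> chords D" "c \<notin> N" "M = insert c N" by blast
      have "entry (sites sg) t s = of_int (sg N c) * mf t s"
        unfolding st c(3) by (rule entry_model_sites[OF c(1,2)])
      then show ?thesis using rel_ideal_mult_left[OF model_factor_ideal[OF N(1) c], of p] p
        by (simp add: st mult.assoc)
    next
      case False
      from entry_model_sites_0[OF this, of V \<theta> Y sg \<tau>' \<tau>] show ?thesis by (simp add: st)
    qed
  }
qed

end

lemma order_sign_cases: "order_sign num N c \<in> {1, -1}"
  unfolding order_sign_def by (simp add: minus_one_power_iff)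

lemma order_sign_anticommute:
  assumes "inj_on num C" "finite N" "N \<subseteq> C" "c \<in> C - N" "c' \<in> C - N" "c \<noteq> c'"
  shows "order_sign num N c * order_sign num (insert c N) c' = - (order_sign num N c' * order_sign num (insert c' N) c)"
proof -
  have ins: "order_sign num (insert x N) y = (if num y < num x then -1 else 1) * order_sign num N y"
    if "x \<notin> N" for x y
  proof -
    have "{z \<in> insert x N. num y < num z} = (if num y < num x then insert x {z \<in> N. num y < num z} else {z \<in> N. num y < num z})"
      by auto
    then show ?thesis using that assms(2) by (simp add: order_sign_def)
  qed
  have "num c \<noteq> num c'" using assms by (auto simp: inj_on_def)
  then show ?thesis using ins[of c c'] ins[of c' c] assms by auto
qed

lemma keys_poly_act: "Poly_Mapping.keys (poly_act act p z) \<subseteq> (\<Union>\<mu>\<in>Poly_Mapping.keys p. Poly_Mapping.keys (poly_act act (frag_of \<mu>) z))"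
  unfolding poly_act_def using keys_frag_extend[of "\<lambda>\<mu>. fold_mset act z \<mu>" p] by simp

lemma frag_cmul_diff: "frag_cmul c (x - y) = frag_cmul c x - frag_cmul c y"
  using frag_cmul_distrib2[of c "x - y" y] by (simp only: eq_diff_eq diff_add_cancel)

lemma kh_diff_state:
  fixes D :: "('p, 'a, 'z) signed_chord_diagram_scheme"
  assumes N: "N \<subseteq> chords D" and z: "Poly_Mapping.keys z \<subseteq> {N} \<times> UNIV"
  shows "kh_diff D num z = (\<Sum>c\<in>chords D - N. frag_cmul (order_sign num N c) (kh_edge D N (insert c N) z))"
  using z
proof (induction rule: frag_induction)
  case (one x)
  then obtain l where x: "x = (N, l)" by auto
  have "{c \<in> chords D. marker N c = 1} = chords D - N" by (auto simp: marker_def split: if_splits)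
  moreover have "{c' \<in> chords D. marker N c' = - 1 \<and> num c < num c'} = {c' \<in> N. num c < num c'}" for c
    using N by (auto simp: marker_def split: if_splits)
  ultimately show ?case by (simp add: x kh_diff_def order_sign_def)
next
  case (diff x y)
  then show ?case
    by (simp add: kh_diff_def frag_extend_diff kh_edge_diff frag_cmul_diff sum_subtractf)
qed (simp add: kh_diff_def)

context circle_model

begin

definition gens_at :: "'p set set \<Rightarrow> int \<Rightarrow> ('p, 'a) kh_basis set" where
  "gens_at N k = {(N, l) | l. l \<in> comps N \<rightarrow>\<^sub>E UNIV \<and> j_grading D (N, l) = k}"

lemma act_gens_at:
  assumes x: "x \<in> gens_at N k"
  shows "act N v (frag_of x) \<in> {0} \<union> frag_of ` gens_at N (k - 2)"
proof (cases "v \<in> V")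
  case True
  obtain l where l: "x = (N, l)" "l \<in> comps N \<rightarrow>\<^sub>E UNIV" "j_grading D (N, l) = k"
    using x by (auto simp: gens_at_def)
  let ?K = "cmp N v"
  have K: "?K \<in> comps N" by (rule cmp_comps[OF True])
  show ?thesis
  proof (cases "l ?K")
    case Gen1
    have "l(?K := GenX) \<in> comps N \<rightarrow>\<^sub>E UNIV" using l(2) K by (auto simp: PiE_def extensional_def)
    moreover have "j_grading D (N, l(?K := GenX)) = k - 2"
    proof -
      have "(\<Sum>L\<in>comps N - {?K}. kh_degree ((l(?K := GenX)) L)) = (\<Sum>L\<in>comps N - {?K}. kh_degree (l L))"
        by (rule sum.cong) auto
      then show ?thesis using l(3) Gen1 unfolding j_grading_def prod.case sum.remove[OF finite_comps K] by simp
    qed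
    ultimately show ?thesis using True Gen1 l(1) by (auto simp: var_op_def label_op_of gens_at_def)
  qed (use True l in \<open>simp add: var_op_def label_op_of\<close>)
qed (simp add: var_op_def)

lemma base_gens_at:
  assumes "(N, \<tau>) \<in> support (sites sg)"
  shows "base (N, \<tau>) \<in> frag_of ` gens_at N (snd (sdeg (sites sg) (N, \<tau>)))"
proof -
  have "(\<Sum>K\<in>comps N. kh_degree (base_label N \<tau> K)) = (\<Sum>K\<in>comps N. 1 - (if K = Y then if \<tau> then 2 else 0 else 0))"
    by (rule sum.cong) auto
  also have "\<dots> = int (card (comps N)) - (if \<tau> then 2 else 0)"
    using assms finite_comps[of N] by (simp add: sum_subtractf sum.delta support_sites)
  finally have "j_grading D (N, base_label N \<tau>) = snd (sdeg (sites sg) (N, \<tau>))"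
    by (simp add: j_grading_def model_sites_def)
  then show ?thesis unfolding base_gen_def gens_at_def by (auto intro!: imageI)
qed

lemma monomial_gens_at:
  assumes "(N, \<tau>) \<in> support (sites sg)"
  shows "poly_act (act N) (frag_of \<mu>) (base (N, \<tau>)) \<in>
    {0} \<union> frag_of ` gens_at N (snd (sdeg (sites sg) (N, \<tau>)) - 2 * int (size \<mu>))"
proof (induction \<mu>)
  case empty
  then show ?case using base_gens_at[OF assms] by (simp add: frag_of_empty_mset del: single_one)
next
  case (add v \<mu>)
  have e: "poly_act (act N) (frag_of (add_mset v \<mu>)) (base (N, \<tau>)) = act N v (poly_act (act N) (frag_of \<mu>) (base (N, \<tau>)))"
    unfolding frag_of_add_mset by (rule commuting_actions.poly_act_var_mult[OF commuting_act])
  have k: "snd (sdeg (sites sg) (N, \<tau>)) - 2 * int (size (add_mset v \<mu>))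
    = snd (sdeg (sites sg) (N, \<tau>)) - 2 * int (size \<mu>) - 2" by simp
  from add.IH show ?case
  proof
    assume "poly_act (act N) (frag_of \<mu>) (base (N, \<tau>)) \<in> {0}"
    then show ?thesis unfolding e by (simp add: commuting_actions.act_0[OF commuting_act])
  next
    assume "poly_act (act N) (frag_of \<mu>) (base (N, \<tau>)) \<in> frag_of ` gens_at N (snd (sdeg (sites sg) (N, \<tau>)) - 2 * int (size \<mu>))"
    then obtain x where x: "x \<in> gens_at N (snd (sdeg (sites sg) (N, \<tau>)) - 2 * int (size \<mu>))"
      "poly_act (act N) (frag_of \<mu>) (base (N, \<tau>)) = frag_of x" by auto
    show ?thesis unfolding e k x(2) by (rule act_gens_at[OF x(1)])
  qed
qed

lemma poly_act_keys:
  assumes "(N, \<tau>) \<in> support (sites sg)"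
  shows "Poly_Mapping.keys (poly_act (act N) p (base (N, \<tau>))) \<subseteq>
    (\<Union>\<mu>\<in>Poly_Mapping.keys p. gens_at N (snd (sdeg (sites sg) (N, \<tau>)) - 2 * int (size \<mu>)))"
proof -
  have "Poly_Mapping.keys (poly_act (act N) (frag_of \<mu>) (base (N, \<tau>))) \<subseteq> gens_at N (snd (sdeg (sites sg) (N, \<tau>)) - 2 * int (size \<mu>))" for \<mu>
    using monomial_gens_at[OF assms, of \<mu>] by (auto simp: keys_frag_of)
  then show ?thesis by (rule order_trans[OF keys_poly_act UN_mono[OF subset_refl]])
qed

definition rho :: "('p set set \<times> bool \<Rightarrow> 'v zpoly) \<Rightarrow> ('p, 'a) kh_basis \<Rightarrow>\<^sub>0 int" where
  "rho f = (\<Sum>s\<in>{(N, \<tau>). N \<subseteq> chords D \<and> (\<tau> \<longrightarrow> Y \<in> comps N)}. poly_act (act (fst s)) (f s) (base s))"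

lemma rho_sites: "rho f = (\<Sum>s\<in>support (sites sg). poly_act (act (fst s)) (f s) (base s))"
  by (simp add: rho_def model_sites_def)

lemma additive_rho: "additive_map rho"
  by (simp add: additive_map_def rho_def poly_act_diff sum_subtractf)

lemma rho_single:
  assumes "s \<in> support (sites sg)"
  shows "rho ((\<lambda>_. 0)(s := p)) = poly_act (act (fst s)) p (base s)"
proof -
  have "rho ((\<lambda>_. 0)(s := p)) = (\<Sum>t\<in>support (sites sg). if t = s then poly_act (act (fst s)) p (base s) else 0)"
    unfolding rho_sites[of _ sg] by (rule sum.cong) auto
  then show ?thesis using assms finite_support[of sg] by (simp add: sum.delta)
qed

text \<open>
  A section of \<open>rho\<close>: a labelling is represented by the product of variables on its components
  with label \<open>x\<close>.
\<close>

definition rep :: "'p set set \<Rightarrow> 'a set \<Rightarrow> 'v" where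
  "rep N K = (SOME v. v \<in> V \<and> cmp N v = K)"

lemma rep: "N \<subseteq> chords D ==> K \<in> comps N ==> K \<noteq> Y ==> rep N K \<in> V \<and> cmp N (rep N K) = K"
  unfolding rep_def by (rule someI_ex) (metis comp_var)

definition mon :: "'p set set \<Rightarrow> ('a set \<Rightarrow> kh_gen) \<Rightarrow> 'v zpoly" where
  "mon N l = (\<Prod>K\<in>{K \<in> comps N. K \<noteq> Y \<and> l K = GenX}. var (rep N K))"

definition sec :: "'p set set \<times> bool \<Rightarrow> (('p, 'a) kh_basis \<Rightarrow>\<^sub>0 int) \<Rightarrow> 'v zpoly" where
  "sec s = frag_extend (\<lambda>(N, l). if s = (N, Y \<in> comps N \<and> l Y = GenX) then mon N l else 0)"

lemma sec_diff: "sec s (x - y) = sec s x - sec s y"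
  by (simp add: sec_def frag_extend_diff)

lemma sec_of: "sec s (frag_of (N, l)) = (if s = (N, Y \<in> comps N \<and> l Y = GenX) then mon N l else 0)"
  by (simp add: sec_def)

lemma sec_0 [simp]: "sec s 0 = 0"
  by (simp add: sec_def)

lemma sec_act_of:
  assumes N: "N \<subseteq> chords D"
  shows "sec s (act N v (frag_of (N, l))) - var v * sec s (frag_of (N, l)) \<in> rel_ideal (E N)"
proof (cases "v \<in> V")
  case True
  let ?K = "cmp N v" and ?A = "{K \<in> comps N. K \<noteq> Y \<and> l K = GenX}"
  have K: "?K \<in> comps N" "?K \<noteq> Y" using cmp_comps[OF True] cmp_Y[OF True] by auto
  have r: "(v, rep N ?K) \<in> E N" using rep[OF N K] True by (simp add: E_iff)
  have fin: "finite ?A" using finite_comps by simp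
  show ?thesis
  proof (cases "l ?K")
    case GenX
    then have m: "mon N l = var (rep N ?K) * (\<Prod>K\<in>?A - {?K}. var (rep N K))"
      unfolding mon_def using K fin by (intro prod.remove) auto
    have q: "var v * var (rep N ?K) \<in> rel_ideal (E N)"
    proof -
      have "var (rep N ?K) * (var v - var (rep N ?K)) + var (rep N ?K) * var (rep N ?K) \<in> rel_ideal (E N)"
        by (intro rel_ideal.add rel_ideal.rel r var_square)
      then show ?thesis by (simp add: algebra_simps)
    qed
    have "var v * mon N l \<in> rel_ideal (E N)"
      unfolding m mult.assoc[symmetric] by (rule rel_ideal_mult_right[OF q])
    then show ?thesis using True GenX
      by (simp add: var_op_def label_op_of sec_of sec_0 rel_ideal_uminus)
  next
    case Gen1
    have "{K' \<in> comps N. K' \<noteq> Y \<and> (l(?K := GenX)) K' = GenX} = insert ?K ?A" using K by auto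
    then have "mon N (l(?K := GenX)) = var (rep N ?K) * mon N l"
      unfolding mon_def using fin Gen1 by simp
    moreover have "var (rep N ?K) * mon N l - var v * mon N l \<in> rel_ideal (E N)"
    proof -
      have "- (mon N l * (var v - var (rep N ?K))) \<in> rel_ideal (E N)"
        by (intro rel_ideal_uminus rel_ideal.rel r)
      then show ?thesis by (simp add: algebra_simps)
    qed
    ultimately show ?thesis using True Gen1 K(2) by (simp add: var_op_def label_op_of sec_of)
  qed
next
  case False
  then have "var v * sec s (frag_of (N, l)) \<in> rel_ideal (E N)"
    by (intro rel_ideal_mult_right var_outside) (simp add: E_iff)
  then show ?thesis using False by (simp add: var_op_def sec_def rel_ideal_uminus)
qed

lemma sec_act:
  assumes N: "N \<subseteq> chords D" and z: "Poly_Mapping.keys z \<subseteq> {N} \<times> UNIV"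
  shows "sec s (act N v z) - var v * sec s z \<in> rel_ideal (E N)"
  using z
proof (induction rule: frag_induction)
  case (one x)
  then obtain l where "x = (N, l)" by auto
  then show ?case using sec_act_of[OF N, of s v l] by simp
next
  case (diff x y)
  then show ?case using rel_ideal_diff[OF diff]
    by (simp add: sec_diff commuting_actions.act_diff[OF commuting_act] algebra_simps)
qed (simp add: sec_def commuting_actions.act_0[OF commuting_act])

lemma gens_at_state: "gens_at N k \<subseteq> {N} \<times> UNIV"
  by (auto simp: gens_at_def)

lemma poly_act_state:
  assumes "(N, \<tau>) \<in> support (sites sg)"
  shows "Poly_Mapping.keys (poly_act (act N) p (base (N, \<tau>))) \<subseteq> {N} \<times> UNIV"
  by (intro order_trans[OF poly_act_keys[OF assms]] UN_least gens_at_state)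

lemma sec_other:
  assumes "Poly_Mapping.keys z \<subseteq> {N} \<times> UNIV" "fst s \<noteq> N"
  shows "sec s z = 0"
  unfolding sec_def
proof (rule frag_extend_eq_0)
  fix x assume "x \<in> Poly_Mapping.keys z"
  then obtain l where x: "x = (N, l)" using assms(1) by auto
  have "s \<noteq> (N, \<tau>)" for \<tau> using assms(2) by auto
  then show "(case x of (N, l) \<Rightarrow> if s = (N, Y \<in> comps N \<and> l Y = GenX) then mon N l else 0) = 0"
    by (simp add: x)
qed

lemma sec_poly_act:
  assumes s': "(N, \<tau>) \<in> support (sites sg)"
  shows "sec s (poly_act (act N) p (base (N, \<tau>))) - (if s = (N, \<tau>) then p else 0) \<in> rel_ideal (E (fst s))"
proof (cases "fst s = N")
  case False
  then have "s \<noteq> (N, \<tau>)" by auto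
  then show ?thesis using sec_other[OF poly_act_state[OF s'] False] by simp
next
  case True
  have N: "N \<subseteq> chords D" "\<tau> \<longrightarrow> Y \<in> comps N" using s' by (auto simp: support_sites)
  have "sec s (poly_act (act N) p (base (N, \<tau>))) - (if s = (N, \<tau>) then p else 0) \<in> rel_ideal (E N)"
  proof (induction p rule: zpoly_induct)
    case zero
    then show ?case by (simp add: sec_def)
  next
    case (diff p q)
    then show ?case using rel_ideal_diff[OF diff] by (simp add: poly_act_diff sec_diff algebra_simps split: if_splits)
  next
    case one
    have e: "{K \<in> comps N. K \<noteq> Y \<and> base_label N \<tau> K = GenX} = {}" by auto
    have "mon N (base_label N \<tau>) = 1" unfolding mon_def e by (rule prod.empty)
    moreover have "(Y \<in> comps N \<and> base_label N \<tau> Y = GenX) = \<tau>" using N(2) by auto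
    ultimately show ?case by (simp add: base_gen_def sec_of)
  next
    case (var v p)
    let ?z = "poly_act (act N) p (base (N, \<tau>))"
    have "sec s (act N v ?z) - var v * sec s ?z + var v * (sec s ?z - (if s = (N, \<tau>) then p else 0)) \<in> rel_ideal (E N)"
      by (rule rel_ideal.add[OF sec_act[OF N(1) poly_act_state[OF s']] rel_ideal_mult_left[OF var]])
    then show ?case
      unfolding commuting_actions.poly_act_var_mult[OF commuting_act] by (simp add: algebra_simps split: if_splits)
  qed
  then show ?thesis using True by simp
qed

lemma rho_kernel:
  assumes f: "f \<in> gr (site_complex (sites sg)) i j"
  shows "rho f = 0 \<longleftrightarrow> f \<in> null (site_complex (sites sg))"
proof
  assume 0: "rho f = 0"
  have "f s \<in> rel_ideal (E (fst s))" if s: "s \<in> support (sites sg)" for s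
  proof -
    have "sec s (rho f) = (\<Sum>t\<in>support (sites sg). sec s (poly_act (act (fst t)) (f t) (base t)))"
      unfolding rho_sites[of f sg] sec_def by (rule frag_extend_sum[unfolded o_def, OF finite_support])
    then have "(\<Sum>t\<in>support (sites sg). sec s (poly_act (act (fst t)) (f t) (base t))) = 0" using 0 by (simp add: sec_def)
    moreover have "(\<Sum>t\<in>support (sites sg). sec s (poly_act (act (fst t)) (f t) (base t)) - (if s = t then f t else 0)) \<in> rel_ideal (E (fst s))"
    proof (rule rel_ideal_sum)
      fix t assume t: "t \<in> support (sites sg)"
      obtain N \<tau> where st: "t = (N, \<tau>)" by fastforce
      show "sec s (poly_act (act (fst t)) (f t) (base t)) - (if s = t then f t else 0) \<in> rel_ideal (E (fst s))"
        using sec_poly_act[of N \<tau> sg s "f t"] t unfolding st fst_conv by simp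
    qed
    ultimately have "- f s \<in> rel_ideal (E (fst s))"
      using s finite_support[of sg] by (simp add: sum_subtractf sum.delta)
    then show ?thesis using rel_ideal_uminus by force
  qed
  then show "f \<in> null (site_complex (sites sg))" by (auto simp: site_complex_def)
next
  assume "f \<in> null (site_complex (sites sg))"
  then show "rho f = 0" unfolding rho_sites[of f sg]
    by (intro sum.neutral) (auto simp: site_complex_def intro!: poly_act_E)
qed

lemma prod_var_monomial: "finite A ==> \<exists>\<mu>. (\<Prod>K\<in>A. var (g K)) = (frag_of \<mu> :: 'v zpoly)"
proof (induction A rule: finite_induct)
  case empty
  have "frag_of {#} = (1 :: 'v zpoly)" by (rule frag_of_empty_mset)
  then show ?case by (metis prod.empty)
next
  case (insert x A)
  then show ?case by (metis prod.insert frag_of_add_mset)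
qed

lemma poly_act_reps:
  assumes N: "N \<subseteq> chords D" and A: "finite A" "A \<subseteq> comps N - {Y}"
  shows "poly_act (act N) (\<Prod>K\<in>A. var (rep N K)) (base (N, \<tau>))
    = frag_of (N, \<lambda>K\<in>comps N. if K \<in> A \<or> \<tau> \<and> K = Y then GenX else Gen1)"
  using A
proof (induction A rule: finite_induct)
  case empty
  then show ?case by (simp add: base_gen_def restrict_def)
next
  case (insert K A)
  have K: "K \<in> comps N" "K \<noteq> Y" using insert by auto
  have r: "rep N K \<in> V" "cmp N (rep N K) = K" using rep[OF N K] by auto
  have "poly_act (act N) (\<Prod>K\<in>insert K A. var (rep N K)) (base (N, \<tau>))
    = act N (rep N K) (frag_of (N, \<lambda>K\<in>comps N. if K \<in> A \<or> \<tau> \<and> K = Y then GenX else Gen1))"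
    using insert by (simp add: commuting_actions.poly_act_var_mult[OF commuting_act] restrict_def)
  also have "\<dots> = frag_of (N, (\<lambda>K\<in>comps N. if K \<in> A \<or> \<tau> \<and> K = Y then GenX else Gen1)(K := GenX))"
    using r K insert(2) by (simp add: var_op_def label_op_of)
  also have "(\<lambda>K\<in>comps N. if K \<in> A \<or> \<tau> \<and> K = Y then GenX else Gen1)(K := GenX)
    = (\<lambda>K'\<in>comps N. if K' \<in> insert K A \<or> \<tau> \<and> K' = Y then GenX else Gen1)"
    using K by (auto simp: restrict_def)
  finally show ?case .
qed

lemma poly_act_mon:
  assumes N: "N \<subseteq> chords D" and l: "l \<in> comps N \<rightarrow>\<^sub>E UNIV"
  shows "poly_act (act N) (mon N l) (base (N, Y \<in> comps N \<and> l Y = GenX)) = frag_of (N, l)"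
proof -
  let ?A = "{K \<in> comps N. K \<noteq> Y \<and> l K = GenX}"
  have "(\<lambda>K\<in>comps N. if K \<in> ?A \<or> (Y \<in> comps N \<and> l Y = GenX) \<and> K = Y then GenX else Gen1) = l"
  proof
    fix K
    show "(\<lambda>K\<in>comps N. if K \<in> ?A \<or> (Y \<in> comps N \<and> l Y = GenX) \<and> K = Y then GenX else Gen1) K = l K"
      using l by (cases "l K") (auto simp: PiE_def extensional_def)
  qed
  note eq = this
  have "finite ?A" "?A \<subseteq> comps N - {Y}" using finite_comps by auto
  from poly_act_reps[OF N this, of "Y \<in> comps N \<and> l Y = GenX"] show ?thesis
    unfolding mon_def eq .
qed

end

lemma gr_sdeg:
  "f \<in> gr (site_complex S) i j ==> \<mu> \<in> Poly_Mapping.keys (f s) ==> sdeg S s = (i, j + 2 * int (size \<mu>))"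
  by (simp add: site_complex_def)

lemma poly_act_sum: "poly_act act (sum f A) z = (\<Sum>i\<in>A. poly_act act (f i) z)"
  by (induction A rule: infinite_finite_induct) (simp_all add: poly_act_add)

lemma kh_diff_diff: "kh_diff D num (x - y) = kh_diff D num x - kh_diff D num y"
  by (simp add: kh_diff_def frag_extend_diff)

lemma kh_diff_0 [simp]: "kh_diff D num 0 = 0"
  by (simp add: kh_diff_def)

lemma kh_diff_sum: "kh_diff D num (sum f A) = (\<Sum>i\<in>A. kh_diff D num (f i))"
  by (induction A rule: infinite_finite_induct) (simp_all add: kh_diff_def frag_extend_add)

context circle_model

begin

lemma rho_gr_keys:
  assumes f: "f \<in> gr (site_complex (sites sg)) i j"
  shows "Poly_Mapping.keys (rho f) \<subseteq> {e \<in> kh_generators D. i_grading D e = i \<and> j_grading D e = j}"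
proof -
  have "Poly_Mapping.keys (poly_act (act (fst s)) (f s) (base s)) \<subseteq> {e \<in> kh_generators D. i_grading D e = i \<and> j_grading D e = j}"
    if s: "s \<in> support (sites sg)" for s
  proof -
    obtain N \<tau> where st: "s = (N, \<tau>)" by fastforce
    have N: "N \<subseteq> chords D" using s by (simp add: st support_sites)
    have "gens_at N (snd (sdeg (sites sg) (N, \<tau>)) - 2 * int (size \<mu>)) \<subseteq> {e \<in> kh_generators D. i_grading D e = i \<and> j_grading D e = j}"
      if \<mu>: "\<mu> \<in> Poly_Mapping.keys (f s)" for \<mu>
    proof -
      have d: "sdeg (sites sg) s = (i, j + 2 * int (size \<mu>))" by (rule gr_sdeg[OF f \<mu>])
      have "i_grading D (N, l) = i" for l
      proof -
        have "i_grading D (N, l) = fst (sdeg (sites sg) s)" by (simp add: st i_grading_def model_sites_def)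
        then show ?thesis using d by simp
      qed
      then show ?thesis using N d by (auto simp: st gens_at_def kh_generators_def states_def)
    qed
    then have "(\<Union>\<mu>\<in>Poly_Mapping.keys (f s). gens_at N (snd (sdeg (sites sg) (N, \<tau>)) - 2 * int (size \<mu>)))
        \<subseteq> {e \<in> kh_generators D. i_grading D e = i \<and> j_grading D e = j}" by (rule UN_least)
    moreover have "Poly_Mapping.keys (poly_act (act (fst s)) (f s) (base s)) \<subseteq>
        (\<Union>\<mu>\<in>Poly_Mapping.keys (f s). gens_at N (snd (sdeg (sites sg) (N, \<tau>)) - 2 * int (size \<mu>)))"
      unfolding st fst_conv by (rule poly_act_keys) (use s in \<open>simp add: st\<close>)
    ultimately show ?thesis by (rule order_trans[rotated])
  qed
  then have "(\<Union>s\<in>support (sites sg). Poly_Mapping.keys (poly_act (act (fst s)) (f s) (base s)))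
      \<subseteq> {e \<in> kh_generators D. i_grading D e = i \<and> j_grading D e = j}" by (rule UN_least)
  then show ?thesis unfolding rho_sites[of f sg] by (rule order_trans[OF keys_sum])
qed

lemma rho_surj:
  assumes "presented_complex (site_complex (sites sg))"
    and z: "Poly_Mapping.keys z \<subseteq> {e \<in> kh_generators D. i_grading D e = i \<and> j_grading D e = j}"
  shows "z \<in> rho ` gr (site_complex (sites sg)) i j"
  using z
proof (induction rule: frag_induction)
  case zero
  show ?case using gr_0[OF assms(1), of i j] additive_map_0[OF additive_rho] by force
next
  case (one x)
  then obtain N l where x: "x = (N, l)" and N: "N \<subseteq> chords D" and l: "l \<in> comps N \<rightarrow>\<^sub>E UNIV"
    and ij: "i_grading D (N, l) = i" "j_grading D (N, l) = j"
    by (auto simp: kh_generators_def states_def)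
  let ?s = "(N, Y \<in> comps N \<and> l Y = GenX)"
  have s: "?s \<in> support (sites sg)" using N by (simp add: support_sites)
  obtain \<mu> where \<mu>: "mon N l = frag_of \<mu>"
    using prod_var_monomial[of "{K \<in> comps N. K \<noteq> Y \<and> l K = GenX}" "rep N"] finite_comps[of N] unfolding mon_def by auto
  have eq: "poly_act (act N) (frag_of \<mu>) (base ?s) = frag_of (N, l)" using poly_act_mon[OF N l] \<mu> by simp
  have "frag_of (N, l) \<in> {0} \<union> frag_of ` gens_at N (snd (sdeg (sites sg) ?s) - 2 * int (size \<mu>))"
    using monomial_gens_at[OF s, of \<mu>] unfolding eq .
  then have "j = snd (sdeg (sites sg) ?s) - 2 * int (size \<mu>)"
    using ij by (auto simp: gens_at_def frag_of_eq)
  moreover have "fst (sdeg (sites sg) ?s) = i" using ij by (simp add: i_grading_def model_sites_def)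
  ultimately have d: "sdeg (sites sg) ?s = (i, j + 2 * int (size \<mu>))" by (simp add: prod_eq_iff)
  have "(\<lambda>_. 0)(?s := frag_of \<mu>) \<in> gr (site_complex (sites sg)) i j"
    using s d by (simp add: site_complex_def keys_frag_of)
  moreover have "rho ((\<lambda>_. 0)(?s := frag_of \<mu>)) = frag_of x"
    using rho_single[OF s, of "frag_of \<mu>"] eq by (simp add: x)
  ultimately show ?case by (metis imageI)
next
  case (diff x y)
  then obtain f g where fg: "f \<in> gr (site_complex (sites sg)) i j" "x = rho f"
    "g \<in> gr (site_complex (sites sg)) i j" "y = rho g" by blast
  then have "x - y = rho (f - g)" using additive_map_diff[OF additive_rho, of f g] by simp
  then show ?case using gr_diff[OF assms(1) fg(1,3)] by blast
qed

lemma sum_support: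
  "(\<Sum>t\<in>support (sites sg). g t) = (\<Sum>M\<in>Pow (chords D). g (M, False) + (if Y \<in> comps M then g (M, True) else 0))"
proof -
  have "support (sites sg) = (SIGMA M:Pow (chords D). if Y \<in> comps M then UNIV else {False})"
    by (auto simp: model_sites_def split: if_splits)
  moreover have "(\<Sum>t\<in>(SIGMA M:Pow (chords D). if Y \<in> comps M then UNIV else {False}). g t)
    = (\<Sum>M\<in>Pow (chords D). \<Sum>\<tau>\<in>(if Y \<in> comps M then UNIV else {False}). g (M, \<tau>))"
    using finite_chords sum.Sigma[of "Pow (chords D)" "\<lambda>M. if Y \<in> comps M then UNIV else {False}" "\<lambda>M \<tau>. g (M, \<tau>)"]
    by simp
  ultimately show ?thesis by (simp add: UNIV_bool add.commute if_distrib cong: sum.cong if_cong)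
qed

lemma poly_act_kh_edge:
  assumes "N \<subseteq> chords D" "c \<in> chords D" "c \<notin> N"
  shows "kh_edge D N (insert c N) (poly_act (act N) p z) = poly_act (act (insert c N)) p (kh_edge D N (insert c N) z)"
proof (rule poly_act_intertwine[OF commuting_act commuting_act kh_edge_diff])
  fix v z
  from assms show "kh_edge D N (insert c N) (act N v z) = act (insert c N) v (kh_edge D N (insert c N) z)"
    by (cases rule: edge_cases) (auto intro: merge_edge_act)
qed

lemma rho_dif_single:
  assumes s: "(N, \<tau>) \<in> support (sites sg)" and sg: "sg = order_sign num"
  shows "kh_diff D num (poly_act (act N) p (base (N, \<tau>)))
    = (\<Sum>t\<in>support (sites sg). poly_act (act (fst t)) (entry (sites sg) t (N, \<tau>) * p) (base t))"
proof -
  have N: "N \<subseteq> chords D" and \<tau>: "\<tau> \<longrightarrow> Y \<in> comps N" using s by (auto simp: support_sites)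
  define g where "g t = poly_act (act (fst t)) (entry (sites sg) t (N, \<tau>) * p) (base t)" for t
  have smult: "poly_act (act M) (of_int k * q) z = frag_cmul k (poly_act (act M) q z)" if "k \<in> {1, -1}" for M k q z
    using that poly_act_diff[of "act M" 0 q z] by auto
  have g: "g (insert c N, \<tau>') = frag_cmul (sg N c) (poly_act (act (insert c N)) p
      (poly_act (act (insert c N)) (mf (insert c N, \<tau>') (N, \<tau>)) (base (insert c N, \<tau>'))))"
    if "c \<in> chords D - N" for c \<tau>'
  proof -
    have "entry (sites sg) (insert c N, \<tau>') (N, \<tau>) * p = of_int (sg N c) * (p * mf (insert c N, \<tau>') (N, \<tau>))"
      using that entry_model_sites[of c D N V \<theta> Y sg \<tau>' \<tau>] by (simp add: algebra_simps)
    then show ?thesis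
      using smult[of "sg N c"] order_sign_cases[of num N c]
      by (simp add: g_def sg commuting_actions.poly_act_mult[OF commuting_act])
  qed
  have "kh_diff D num (poly_act (act N) p (base (N, \<tau>)))
    = (\<Sum>c\<in>chords D - N. frag_cmul (sg N c) (kh_edge D N (insert c N) (poly_act (act N) p (base (N, \<tau>)))))"
    unfolding sg by (rule kh_diff_state[OF N poly_act_state[OF s]])
  also have "\<dots> = (\<Sum>c\<in>chords D - N. g (insert c N, False) + (if Y \<in> comps (insert c N) then g (insert c N, True) else 0))"
  proof (rule sum.cong)
    fix c assume c: "c \<in> chords D - N"
    then have c': "c \<in> chords D" "c \<notin> N" by auto
    show "frag_cmul (sg N c) (kh_edge D N (insert c N) (poly_act (act N) p (base (N, \<tau>))))
      = g (insert c N, False) + (if Y \<in> comps (insert c N) then g (insert c N, True) else 0)"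
      unfolding poly_act_kh_edge[OF N c'] kh_edge_base[OF N c' refl \<tau>] g[OF c]
      by (simp add: commuting_actions.poly_act_add_right[OF commuting_act]
          commuting_actions.poly_act_0_right[OF commuting_act] frag_cmul_distrib2)
  qed simp
  also have "\<dots> = (\<Sum>M\<in>(\<lambda>c. insert c N) ` (chords D - N). g (M, False) + (if Y \<in> comps M then g (M, True) else 0))"
    by (subst sum.reindex) (auto simp: inj_on_def)
  also have "\<dots> = (\<Sum>M\<in>Pow (chords D). g (M, False) + (if Y \<in> comps M then g (M, True) else 0))"
  proof (rule sum.mono_neutral_left)
    show "finite (Pow (chords D))" using finite_chords by simp
    show "(\<lambda>c. insert c N) ` (chords D - N) \<subseteq> Pow (chords D)" using N by auto
    show "\<forall>M\<in>Pow (chords D) - (\<lambda>c. insert c N) ` (chords D - N).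
      g (M, False) + (if Y \<in> comps M then g (M, True) else 0) = 0"
    proof
      fix M assume "M \<in> Pow (chords D) - (\<lambda>c. insert c N) ` (chords D - N)"
      then have "\<not> (\<exists>c\<in>chords D - N. M = insert c N)" by auto
      from entry_model_sites_0[OF this, of V \<theta> Y sg _ \<tau>] show "g (M, False) + (if Y \<in> comps M then g (M, True) else 0) = 0"
        by (simp add: g_def)
    qed
  qed
  also have "\<dots> = (\<Sum>t\<in>support (sites sg). g t)" by (rule sum_support[symmetric])
  finally show ?thesis by (simp add: g_def)
qed

lemma rho_dif:
  assumes sg: "sg = order_sign num"
  shows "rho (dif (site_complex (sites sg)) f) = kh_diff D num (rho f)"
proof -
  let ?S = "support (sites sg)"
  have "rho (dif (site_complex (sites sg)) f)
    = (\<Sum>t\<in>?S. poly_act (act (fst t)) (\<Sum>s\<in>?S. entry (sites sg) t s * f s) (base t))"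
    unfolding rho_sites[of _ sg] by (rule sum.cong) (auto simp: site_complex_def)
  also have "\<dots> = (\<Sum>t\<in>?S. \<Sum>s\<in>?S. poly_act (act (fst t)) (entry (sites sg) t s * f s) (base t))"
    by (simp add: poly_act_sum)
  also have "\<dots> = (\<Sum>s\<in>?S. \<Sum>t\<in>?S. poly_act (act (fst t)) (entry (sites sg) t s * f s) (base t))"
    by (rule sum.swap)
  also have "\<dots> = (\<Sum>s\<in>?S. kh_diff D num (poly_act (act (fst s)) (f s) (base s)))"
  proof (rule sum.cong)
    fix s assume s: "s \<in> ?S"
    obtain N \<tau> where st: "s = (N, \<tau>)" by fastforce
    show "(\<Sum>t\<in>?S. poly_act (act (fst t)) (entry (sites sg) t s * f s) (base t))
      = kh_diff D num (poly_act (act (fst s)) (f s) (base s))"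
      using rho_dif_single[of N \<tau> sg num "f s", OF _ sg] s by (simp add: st)
  qed simp
  finally show ?thesis by (simp add: rho_sites[of f sg] kh_diff_sum)
qed

lemma presented_sites: "presented_complex (site_complex (sites (order_sign num)))"
  by (intro presented_site_complex valid_model_sites order_sign_cases)

theorem presents_model:
  "presents (khovanov_complex D num) (site_complex (sites (order_sign num))) rho"
  unfolding presents_def
proof (intro conjI allI ballI additive_rho presented_sites)
  let ?C = "site_complex (sites (order_sign num))"
  show "\<exists>B. grp (khovanov_complex D num) = (\<lambda>i j. free_Abelian_group (B i j))"
    by (auto simp: khovanov_complex_def)
  fix i j
  show "carrier (grp (khovanov_complex D num) i j) = rho ` gr ?C i j"
  proof (intro equalityI subsetI)
    fix z assume "z \<in> carrier (grp (khovanov_complex D num) i j)"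
    then show "z \<in> rho ` gr ?C i j" using rho_surj[OF presented_sites] by (simp add: khovanov_complex_def)
  next
    fix z assume "z \<in> rho ` gr ?C i j"
    then obtain f where f: "f \<in> gr ?C i j" "z = rho f" by blast
    then show "z \<in> carrier (grp (khovanov_complex D num) i j)"
      using rho_gr_keys[OF f(1)] by (simp add: khovanov_complex_def)
  qed
  fix f assume f: "f \<in> gr ?C i j"
  show "(rho f = 0) = (f \<in> null ?C)" by (rule rho_kernel[OF f])
  show "rho (dif ?C f) = diff (khovanov_complex D num) i j (rho f)"
    by (simp add: khovanov_complex_def rho_dif)
qed

end

theorem kh_diff_square:
  fixes D :: "('p, 'a, 'z) signed_chord_diagram_scheme"
  assumes D: "is_signed_chord_diagram D" "orientable D" and num: "inj_on num (chords D)"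
    and z: "Poly_Mapping.keys z \<subseteq> kh_generators D"
  shows "kh_diff D num (kh_diff D num z) = 0"
proof -
  have cd: "is_chord_diagram D" using D by (simp add: is_signed_chord_diagram_def)
  have Y: "K = {}" if "K \<in> components D N" "K \<subseteq> {}" for K N using that by simp
  interpret circle_model D "arcs D" "\<lambda>a. a" "{}"
    by standard (use D in auto)
  have R: "E N = R N" for N by (auto simp: vrel_def smoothing_rel_def)
  have circ: "{} \<notin> comps N" for N
  proof
    assume "{} \<in> comps N"
    then obtain a where "a \<in> arcs D" "{} = R N `` {a}" by (rule comps_cases)
    then show False using R_self by blast
  qed
  have mf: "mf (M, False) (N, False) = saddle (R N) (R M)" for N M
    using circ by (simp add: model_factor_def R)
  have edge: "kh_edge D N (insert c N) (poly_act (act N) p (base (N, False)))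
      = poly_act (act (insert c N)) (p * saddle (R N) (R (insert c N))) (base (insert c N, False))"
    if "N \<subseteq> chords D" "c \<in> chords D" "c \<notin> N" for N c p
    using that circ mf[of "insert c N" N]
    by (simp add: poly_act_kh_edge kh_edge_base[OF that refl] commuting_actions.poly_act_mult[OF commuting_act])
  have exch: "kh_edge D (insert c N) (insert c' (insert c N)) (kh_edge D N (insert c N) (frag_of (N, l)))
      = kh_edge D (insert c' N) (insert c (insert c' N)) (kh_edge D N (insert c' N) (frag_of (N, l)))"
    if N: "N \<subseteq> chords D" and l: "l \<in> comps N \<rightarrow>\<^sub>E UNIV" and c: "c \<in> chords D - N" "c' \<in> chords D - N" "c \<noteq> c'" for N l c c'
  proof -
    let ?M = "insert c N" and ?M' = "insert c' N" and ?L = "insert c (insert c' N)"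
    have L: "insert c' ?M = ?L" by auto
    have b: "frag_of (N, l) = poly_act (act N) (mon N l) (base (N, False))"
      using poly_act_mon[OF N l] circ[of N] by simp
    obtain u v where uv: "\<And>N. c \<notin> N ==> surgered (arcs D) (R N) (R (insert c N)) u v"
      using chord_surgered c(1) by blast
    obtain u' v' where uv': "\<And>N. c' \<notin> N ==> surgered (arcs D) (R N) (R (insert c' N)) u' v'"
      using chord_surgered c(2) by blast
    have "saddle (R N) (R ?M) * saddle (R ?M) (R ?L) - saddle (R N) (R ?M') * saddle (R ?M') (R ?L) \<in> rel_ideal (R ?L)"
      using saddle_exchange[OF uv[of N] uv'[of ?M, unfolded L] uv'[of N] uv[of ?M']] c by simp
    then have "mon N l * (saddle (R N) (R ?M) * saddle (R ?M) (R ?L) - saddle (R N) (R ?M') * saddle (R ?M') (R ?L)) \<in> rel_ideal (E ?L)"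
      unfolding R by (rule rel_ideal_mult_left)
    then have "poly_act (act ?L) (mon N l * saddle (R N) (R ?M) * saddle (R ?M) (R ?L)) (base (?L, False))
      = poly_act (act ?L) (mon N l * saddle (R N) (R ?M') * saddle (R ?M') (R ?L)) (base (?L, False))"
      by (intro poly_act_cong) (simp add: algebra_simps)
    moreover have "kh_edge D ?M (insert c' ?M) (kh_edge D N ?M (frag_of (N, l)))
      = poly_act (act ?L) (mon N l * saddle (R N) (R ?M) * saddle (R ?M) (R ?L)) (base (?L, False))"
      unfolding b using edge[OF N, of c] edge[of ?M c'] N c by (simp add: L)
    moreover have "kh_edge D ?M' ?L (kh_edge D N ?M' (frag_of (N, l)))
      = poly_act (act ?L) (mon N l * saddle (R N) (R ?M') * saddle (R ?M') (R ?L)) (base (?L, False))"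
      unfolding b using edge[OF N, of c'] edge[of ?M' c] N c by simp
    ultimately show ?thesis by simp
  qed
  have one: "kh_diff D num (kh_diff D num (frag_of (N, l))) = 0"
    if N: "N \<subseteq> chords D" and l: "l \<in> comps N \<rightarrow>\<^sub>E UNIV" for N l
  proof -
    let ?sg = "order_sign num"
    let ?A = "SIGMA c:chords D - N. chords D - insert c N"
    define T where "T = (\<lambda>(c, c'). frag_cmul (?sg N c * ?sg (insert c N) c')
      (kh_edge D (insert c N) (insert c' (insert c N)) (kh_edge D N (insert c N) (frag_of (N, l)))))"
    have st: "Poly_Mapping.keys (kh_edge D N (insert c N) (frag_of (N, l))) \<subseteq> {insert c N} \<times> UNIV"
      if "c \<in> chords D - N" for c
    proof -
      have "frag_of (N, l) = poly_act (act N) (mon N l) (base (N, False))"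
        using poly_act_mon[OF N l] circ[of N] by simp
      then have "kh_edge D N (insert c N) (frag_of (N, l))
        = poly_act (act (insert c N)) (mon N l * saddle (R N) (R (insert c N))) (base (insert c N, False))"
        using edge[OF N, of c] that by simp
      then show ?thesis using poly_act_state[of "insert c N" False ?sg] N that by (simp add: support_sites)
    qed
    have "kh_diff D num (frag_of (N, l)) = (\<Sum>c\<in>chords D - N. frag_cmul (?sg N c) (kh_edge D N (insert c N) (frag_of (N, l))))"
      by (rule kh_diff_state[OF N]) (simp add: keys_frag_of)
    then have "kh_diff D num (kh_diff D num (frag_of (N, l)))
      = (\<Sum>c\<in>chords D - N. kh_diff D num (frag_cmul (?sg N c) (kh_edge D N (insert c N) (frag_of (N, l)))))"
      by (simp only: kh_diff_sum)
    also have "\<dots> = (\<Sum>c\<in>chords D - N. \<Sum>c'\<in>chords D - insert c N. T (c, c'))"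
    proof (rule sum.cong)
      fix c assume c: "c \<in> chords D - N"
      have "kh_diff D num (frag_cmul (?sg N c) (kh_edge D N (insert c N) (frag_of (N, l))))
        = frag_cmul (?sg N c) (kh_diff D num (kh_edge D N (insert c N) (frag_of (N, l))))"
        by (simp add: kh_diff_def frag_extend_cmul)
      also have "kh_diff D num (kh_edge D N (insert c N) (frag_of (N, l))) = (\<Sum>c'\<in>chords D - insert c N.
          frag_cmul (?sg (insert c N) c') (kh_edge D (insert c N) (insert c' (insert c N)) (kh_edge D N (insert c N) (frag_of (N, l)))))"
        by (rule kh_diff_state[OF _ st[OF c]]) (use N c in auto)
      finally show "kh_diff D num (frag_cmul (?sg N c) (kh_edge D N (insert c N) (frag_of (N, l))))
        = (\<Sum>c'\<in>chords D - insert c N. T (c, c'))"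
        by (simp add: frag_cmul_sum T_def o_def)
    qed simp
    also have "\<dots> = sum T ?A" using finite_chords by (simp add: sum.Sigma)
    finally have dd: "kh_diff D num (kh_diff D num (frag_of (N, l))) = sum T ?A" .
    have anti: "T (c', c) = - T (c, c')" if "(c, c') \<in> ?A" for c c'
    proof -
      have c: "c \<in> chords D - N" "c' \<in> chords D - N" "c \<noteq> c'" using that by auto
      have "?sg N c' * ?sg (insert c' N) c = - (?sg N c * ?sg (insert c N) c')"
        using order_sign_anticommute[OF num finite_subset[OF N finite_chords] N c] by simp
      then show ?thesis using exch[OF N l c] by (simp add: T_def)
    qed
    have "sum (T \<circ> prod.swap) ?A = sum (\<lambda>x. - T x) ?A"
    proof (rule sum.cong)
      fix x assume x: "x \<in> ?A"
      obtain c c' where cc: "x = (c, c')" by fastforce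
      show "(T \<circ> prod.swap) x = - T x" using anti[of c c'] x unfolding cc by simp
    qed simp
    then have "sum (T \<circ> prod.swap) ?A = - sum T ?A" by (simp add: sum_negf)
    moreover have "sum (T \<circ> prod.swap) ?A = sum T (prod.swap ` ?A)"
      by (rule sum.reindex[symmetric]) (simp add: inj_on_def)
    moreover have "prod.swap ` ?A = ?A" by force
    ultimately have "sum T ?A = - sum T ?A" by simp
    then have "sum T ?A + sum T ?A = 0" by (simp only: eq_neg_iff_add_eq_0)
    then have "frag_cmul 2 (sum T ?A) = 0" using frag_cmul_distrib[of 1 1 "sum T ?A"] by simp
    then show ?thesis unfolding dd by simp
  qed
  show ?thesis
    using z
  proof (induction rule: frag_induction)
    case (one x)
    then show ?case using \<open>\<And>N l. N \<subseteq> chords D ==> l \<in> comps N \<rightarrow>\<^sub>E UNIV ==> kh_diff D num (kh_diff D num (frag_of (N, l))) = 0\<close>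
      by (auto simp: kh_generators_def states_def)
  qed (simp_all add: kh_diff_diff)
qed

context circle_model

begin

lemma model_dif_dif:
  assumes num: "inj_on num (chords D)" and f: "f \<in> gr (site_complex (sites (order_sign num))) i j"
  shows "dif (site_complex (sites (order_sign num))) (dif (site_complex (sites (order_sign num))) f)
    \<in> null (site_complex (sites (order_sign num)))"
proof -
  let ?C = "site_complex (sites (order_sign num))"
  have h: "pc_hom 1 ?C ?C (dif ?C)" by (rule presented_complex_dif[OF presented_sites])
  have "Poly_Mapping.keys (rho f) \<subseteq> kh_generators D" using rho_gr_keys[OF f] by blast
  then have "rho (dif ?C (dif ?C f)) = 0"
    using kh_diff_square[OF signed orientable num] by (simp add: rho_dif)
  then show ?thesis using rho_kernel[OF pc_hom_gr[OF h pc_hom_gr[OF h f]]] by simp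
qed

end

section \<open>Signs\<close>

definition sign_assignment :: "'c set \<Rightarrow> ('c set \<Rightarrow> 'c \<Rightarrow> int) \<Rightarrow> bool" where
  "sign_assignment C sg \<longleftrightarrow> (\<forall>N c. N \<subseteq> C \<and> c \<in> C - N \<longrightarrow> sg N c \<in> {1, -1}) \<and>
     (\<forall>N c c'. N \<subseteq> C \<and> c \<in> C - N \<and> c' \<in> C - N \<and> c \<noteq> c' \<longrightarrow>
        sg N c * sg (insert c N) c' = - (sg N c' * sg (insert c' N) c))"

lemma sign_assignment_value: "sign_assignment C sg ==> N \<subseteq> C ==> c \<in> C - N ==> sg N c = 1 \<or> sg N c = - 1"
  by (simp add: sign_assignment_def)

lemma sign_assignment_anti: "sign_assignment C sg ==> N \<subseteq> C ==> c \<in> C - N ==> c' \<in> C - N ==> c \<noteq> c' ==>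
    sg N c * sg (insert c N) c' = - (sg N c' * sg (insert c' N) c)"
  unfolding sign_assignment_def by blast

lemma sign_assignment_order_sign: "finite C ==> inj_on num C ==> sign_assignment C (order_sign num)"
  unfolding sign_assignment_def
proof (intro conjI allI impI order_sign_cases)
  assume C: "finite C" "inj_on num C"
  fix N c c' assume a: "N \<subseteq> C \<and> c \<in> C - N \<and> c' \<in> C - N \<and> c \<noteq> c'"
  then have "finite N" using C finite_subset by blast
  then show "order_sign num N c * order_sign num (insert c N) c' = - (order_sign num N c' * order_sign num (insert c' N) c)"
    using order_sign_anticommute[OF C(2)] a by blast
qed

text \<open>
  The ratio of two sign assignments is a cocycle on a cube, hence a coboundary: the sign of a
  vertex is the product of the ratios along the path that adds the chords in a fixed order.
\<close>

lemma cube_coboundary: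
  fixes \<eta> :: "'c set \<Rightarrow> 'c \<Rightarrow> int" and num :: "'c \<Rightarrow> nat"
  assumes C: "finite C" "inj_on num C"
    and \<eta>: "\<And>N c c'. N \<subseteq> C ==> c \<in> C - N ==> c' \<in> C - N ==> c \<noteq> c' ==>
      \<eta> N c * \<eta> (insert c N) c' = \<eta> N c' * \<eta> (insert c' N) c"
    and t: "\<And>N. t N = (\<Prod>c\<in>N. \<eta> {c' \<in> N. num c' < num c} c)"
  shows "N \<subseteq> C ==> c \<in> C - N ==> t (insert c N) = t N * \<eta> N c"
proof (induction "card N" arbitrary: N c rule: less_induct)
  case less
  have fin: "finite N" using less.prems(1) C(1) by (rule finite_subset)
  have top: "t (insert m M) = t M * \<eta> M m" if "finite M" "m \<notin> M" "\<forall>x\<in>M. num x < num m" for M m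
  proof -
    have "{c' \<in> insert m M. num c' < num m} = M" using that by auto
    moreover have "{c' \<in> insert m M. num c' < num c} = {c' \<in> M. num c' < num c}" if "c \<in> M" for c
      using that \<open>\<forall>x\<in>M. num x < num m\<close> by force
    ultimately show ?thesis using that by (simp add: t)
  qed
  show ?case
  proof (cases "\<forall>x\<in>N. num x < num c")
    case True
    then show ?thesis using top fin less.prems by auto
  next
    case False
    then obtain x where x: "x \<in> N" "num c \<le> num x" by (auto simp: not_less)
    define m where "m = (ARG_MAX num y. y \<in> N)"
    have m: "m \<in> N" "\<And>y. y \<in> N ==> num y \<le> num m"
    proof -
      have "\<forall>y. y \<in> N \<longrightarrow> num y \<le> Max (num ` N)" using fin by simp
      then show "m \<in> N" "\<And>y. y \<in> N ==> num y \<le> num m"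
        using arg_max_nat_lemma[of "\<lambda>y. y \<in> N" x num "Suc (Max (num ` N))"] x fin
        unfolding m_def by (auto simp: less_Suc_eq_le)
    qed
    have cm: "c \<noteq> m" "num c < num m"
    proof -
      show "c \<noteq> m" using m less.prems by auto
      then have "num c \<noteq> num m" using C(2) m less.prems by (auto simp: inj_on_def)
      then show "num c < num m" using x m(2)[OF x(1)] by simp
    qed
    let ?M = "N - {m}"
    have N: "N = insert m ?M" using m by auto
    have lt: "num y < num m" if "y \<in> ?M" for y
    proof -
      have "num y \<noteq> num m" using that m(1) C(2) less.prems by (auto simp: inj_on_def)
      then show ?thesis using m(2)[of y] that by simp
    qed
    have "card ?M < card N" by (rule card_Diff1_less[OF fin m(1)])
    moreover have "?M \<subseteq> C" "c \<in> C - ?M" using less.prems by auto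
    ultimately have "t (insert c ?M) = t ?M * \<eta> ?M c" by (rule less.hyps)
    moreover have "t (insert m (insert c ?M)) = t (insert c ?M) * \<eta> (insert c ?M) m"
      using top[of "insert c ?M" m] fin cm lt by auto
    moreover have "t (insert m ?M) = t ?M * \<eta> ?M m" using top[of ?M m] fin lt by auto
    moreover have "\<eta> ?M c * \<eta> (insert c ?M) m = \<eta> ?M m * \<eta> (insert m ?M) c"
      using \<eta>[of ?M c m] less.prems m cm by auto
    moreover have "insert m (insert c ?M) = insert c N" using N by auto
    ultimately show ?thesis using N by (metis mult.assoc)
  qed
qed

context circle_model

begin

lemma valid_sites_sign: "sign_assignment (chords D) sg ==> valid_sites (sites sg)"
  by (rule valid_model_sites) (auto simp: sign_assignment_def)

text \<open>
  Rescaling the generators by the function from \<open>cube_coboundary\<close> turns one sign rule into the other.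
\<close>

theorem change_signs:
  assumes num: "inj_on num (chords D)" and sg: "sign_assignment (chords D) sg"
  shows "pc_equiv (site_complex (sites (order_sign num))) (site_complex (sites sg))"
proof -
  let ?os = "order_sign num"
  have os: "sign_assignment (chords D) ?os" by (rule sign_assignment_order_sign[OF finite_chords num])
  define \<eta> where "\<eta> N c = sg N c * ?os N c" for N c
  define t where "t N = (\<Prod>c\<in>N. \<eta> {c' \<in> N. num c' < num c} c)" for N
  have \<eta>1: "\<eta> N c \<in> {1, -1}" if "N \<subseteq> chords D" "c \<in> chords D - N" for N c
    using sign_assignment_value[OF sg that] sign_assignment_value[OF os that] by (auto simp: \<eta>_def)
  have "\<eta> N c * \<eta> (insert c N) c' = \<eta> N c' * \<eta> (insert c' N) c"
    if a: "N \<subseteq> chords D" "c \<in> chords D - N" "c' \<in> chords D - N" "c \<noteq> c'" for N c c'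
  proof -
    have "\<eta> N c * \<eta> (insert c N) c' = (sg N c * sg (insert c N) c') * (?os N c * ?os (insert c N) c')"
      by (simp add: \<eta>_def)
    also have "\<dots> = (- (sg N c' * sg (insert c' N) c)) * (- (?os N c' * ?os (insert c' N) c))"
      by (simp only: sign_assignment_anti[OF sg a] sign_assignment_anti[OF os a])
    finally show ?thesis by (simp add: \<eta>_def)
  qed
  from cube_coboundary[OF finite_chords num this t_def]
  have step: "t (insert c N) = t N * \<eta> N c" if "N \<subseteq> chords D" "c \<in> chords D - N" for N c
    using that by blast
  have t1: "t N \<in> {1, -1}" if "N \<subseteq> chords D" for N
  proof -
    have "finite N" using that finite_chords by (rule finite_subset)
    then show ?thesis using that
    proof (induction N rule: finite_induct)
      case (insert c N)
      then show ?case using step[of N c] \<eta>1[of N c] by auto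
    qed (simp add: t_def)
  qed
  show ?thesis
  proof (rule site_elimination[where P = "{}" and Q = "{}" and m = "\<lambda>s. s" and \<beta> = "\<lambda>s. s" and u = "\<lambda>s. 1"
        and \<tau> = "\<lambda>s. t (fst s)"])
    show "valid_sites (sites ?os)" "valid_sites (sites sg)" using os sg by (auto intro: valid_sites_sign)
    show "bij_betw (\<lambda>s. s) (support (sites sg)) (support (sites ?os) - {} - {})"
      by (simp add: model_sites_def bij_betw_def)
    fix z assume "z \<in> support (sites sg)"
    then have z: "fst z \<subseteq> chords D" by (auto simp: model_sites_def)
    show "t (fst z) \<in> {1, -1} \<and> srel (sites sg) z = srel (sites ?os) z \<and> sdeg (sites sg) z = sdeg (sites ?os) z"
      using t1[OF z] by (simp add: model_sites_def)
    fix z' assume "z' \<in> support (sites sg)"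
    then have z': "fst z' \<subseteq> chords D" by (auto simp: model_sites_def)
    obtain M \<tau>' N \<tau> where zz: "z = (M, \<tau>')" "z' = (N, \<tau>)" by fastforce
    have "entry (sites sg) z z' = of_int (t (fst z) * t (fst z')) * entry (sites ?os) z z'"
    proof (cases "\<exists>c\<in>chords D - N. M = insert c N")
      case True
      then obtain c where c: "c \<in> chords D" "c \<notin> N" "M = insert c N" by blast
      have "t M * t N * ?os N c = sg N c"
      proof -
        have N: "N \<subseteq> chords D" "c \<in> chords D - N" using z' c by (auto simp: zz)
        show ?thesis using step[OF N] t1[OF N(1)] sign_assignment_value[OF os N]
          by (auto simp: c(3) \<eta>_def)
      qed
      then show ?thesis unfolding zz fst_conv c(3) entry_model_sites[OF c(1,2)]
        by (metis mult.assoc of_int_mult)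
    next
      case False
      then show ?thesis using entry_model_sites_0[OF False, of V \<theta> Y _ \<tau>' \<tau>] by (simp add: zz)
    qed
    then show "entry (sites sg) z z' - of_int (t (fst z) * t (fst z')) * (entry (sites ?os) z z'
        - (\<Sum>s\<in>{}. entry (sites ?os) z s * of_int 1 * entry (sites ?os) s z')) \<in> rel_ideal (srel (sites sg) z)"
      by simp
  qed (use model_dif_dif[OF num] in \<open>auto simp: bij_betw_def\<close>)
qed

lemma circle_edge_rel:
  assumes "N \<subseteq> chords D" "c \<in> chords D - N" "Y \<in> comps N \<longleftrightarrow> Y \<notin> comps (insert c N)"
  shows "E (insert c N) = E N"
proof -
  have c: "c \<in> chords D" "c \<notin> N" using assms(2) by auto
  from assms(1) c show ?thesis
  proof (cases rule: edge_cases)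
    case (merge a b)
    then show ?thesis by (cases rule: merge_edge_circle_cases) (use assms(3) in auto)
  next
    case (split a b)
    then show ?thesis by (cases rule: merge_edge_circle_cases) (use assms(3) in auto)
  qed
qed

lemma entry_edge:
  assumes "c \<in> chords D - N"
  shows "entry (sites sg) (insert c N, \<tau>') (N, \<tau>) = of_int (sg N c) * mf (insert c N, \<tau>') (N, \<tau>)"
  using entry_model_sites assms by blast

lemma entry_nonzero:
  assumes "entry (sites sg) t s \<noteq> 0"
  obtains c where "c \<in> chords D - fst s" "fst t = insert c (fst s)" "entry (sites sg) t s = of_int (sg (fst s) c) * mf t s"
proof -
  obtain M \<tau>' N \<tau> where ts: "t = (M, \<tau>')" "s = (N, \<tau>)" by fastforce
  have "\<exists>c\<in>chords D - N. M = insert c N" using assms entry_model_sites_0[of D N M V \<theta> Y sg \<tau>' \<tau>] unfolding ts by blast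
  then show ?thesis using that entry_edge unfolding ts by auto
qed

text \<open>
  A square of the cube at \<open>cw\<close> and \<open>cs\<close> in which adding \<open>cw\<close> splits off the circle \<open>Y\<close>, which is
  then merged by adding \<open>cs\<close>: the state without both chords cancels against the circle with label
  \<open>x\<close>, and the circle with label \<open>1\<close> against the state with both chords.
\<close>

definition square_source :: "('p set set \<Rightarrow> bool) \<Rightarrow> 'p set \<Rightarrow> ('p set set \<times> bool) set" where
  "square_source CC cs = {(M, \<tau>). M \<subseteq> chords D \<and> CC M \<and> cs \<notin> M \<and> \<not> \<tau>}"

definition square_match :: "'p set \<Rightarrow> 'p set \<Rightarrow> 'p set set \<times> bool \<Rightarrow> 'p set set \<times> bool" where
  "square_match cw cs = (\<lambda>(M, \<tau>). if cw \<in> M then (insert cs M, False) else (insert cw M, True))"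

definition square_sign :: "('p set set \<Rightarrow> 'p set \<Rightarrow> int) \<Rightarrow> 'p set \<Rightarrow> 'p set \<Rightarrow> 'p set set \<times> bool \<Rightarrow> int" where
  "square_sign sg cw cs = (\<lambda>(M, \<tau>). sg M (if cw \<in> M then cs else cw))"

definition square_rest :: "('p set set \<Rightarrow> bool) \<Rightarrow> 'p set \<Rightarrow> 'p set \<Rightarrow> ('p set set \<times> bool) set" where
  "square_rest CC cw cs = {(M, \<tau>). M \<subseteq> chords D \<and> \<not> \<tau> \<and> (CC M \<longrightarrow> cs \<in> M \<and> cw \<notin> M)}"

text \<open>
  Both pairs of summands with the circle cancel along entries \<open>1\<close> or \<open>-1\<close>.  The zigzags that are
  created run through the states of \<open>square_source\<close> only.
\<close>

theorem square_elimination: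
  assumes num: "inj_on num (chords D)"
    and ch: "cw \<in> chords D" "cs \<in> chords D" "cw \<noteq> cs"
    and CC: "\<And>M. CC (insert cw M) = CC M" "\<And>M. CC (insert cs M) = CC M"
    and circ: "\<And>M. M \<subseteq> chords D ==> Y \<in> comps M \<longleftrightarrow> CC M \<and> cw \<in> M \<and> cs \<notin> M"
    and sg: "sg = order_sign num"
    and Z: "valid_sites Z" and \<beta>: "bij_betw \<beta> (support Z) (square_rest CC cw cs)"
    and \<tau>: "\<And>z. z \<in> support Z ==> \<tau> z \<in> {1, -1} \<and> srel Z z = E (fst (\<beta> z)) \<and> sdeg Z z = sdeg (sites sg) (\<beta> z)"
    and dZ: "\<And>z z'. z \<in> support Z ==> z' \<in> support Z ==>
      entry Z z z' = of_int (\<tau> z * \<tau> z') * (entry (sites sg) (\<beta> z) (\<beta> z')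
        - (\<Sum>s\<in>square_source CC cs. entry (sites sg) (\<beta> z) s * of_int (square_sign sg cw cs s)
            * entry (sites sg) (square_match cw cs s) (\<beta> z')))"
  shows "pc_equiv (site_complex (sites sg)) (site_complex Z)"
proof -
  let ?P = "square_source CC cs" and ?m = "square_match cw cs"
  let ?Q = "{(M, \<tau>). M \<subseteq> chords D \<and> CC M \<and> cw \<in> M \<and> (\<tau> \<longleftrightarrow> cs \<notin> M)}"
  have sgn: "sign_assignment (chords D) sg" unfolding sg by (rule sign_assignment_order_sign[OF finite_chords num])
  have sg1: "sg M c \<in> {1, -1}" if "M \<subseteq> chords D" "c \<in> chords D - M" for M c
    using sign_assignment_value[OF sgn that] by simp
  have bm: "bij_betw ?m ?P ?Q"
  proof (rule bij_betw_byWitness[where f' = "\<lambda>(M, \<tau>). if \<tau> then (M - {cw}, False) else (M - {cs}, False)"])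
    have CC': "CC (M - {cs}) = CC M" "CC (M - {cw}) = CC M" for M
      using CC(2)[of "M - {cs}"] CC(2)[of M] CC(1)[of "M - {cw}"] CC(1)[of M] by simp_all
    show "\<forall>s\<in>?P. (\<lambda>(M, \<tau>). if \<tau> then (M - {cw}, False) else (M - {cs}, False)) (?m s) = s"
      by (auto simp: square_source_def square_match_def)
    show "\<forall>t\<in>?Q. ?m ((\<lambda>(M, \<tau>). if \<tau> then (M - {cw}, False) else (M - {cs}, False)) t) = t"
      using ch by (auto simp: square_match_def insert_absorb)
    show "?m ` ?P \<subseteq> ?Q"
    proof
      fix t assume "t \<in> ?m ` ?P"
      then obtain M where M: "M \<subseteq> chords D" "CC M" "cs \<notin> M" "t = ?m (M, False)" by (auto simp: square_source_def)
      show "t \<in> ?Q"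
        using M CC ch by (cases "cw \<in> M") (simp_all add: square_match_def)
    qed
    show "(\<lambda>(M, \<tau>). if \<tau> then (M - {cw}, False) else (M - {cs}, False)) ` ?Q \<subseteq> ?P"
      using CC' ch by (auto simp: square_source_def split: if_splits)
  qed
  have rest: "support (sites sg) - ?P - ?Q = square_rest CC cw cs"
    using circ by (auto simp: model_sites_def square_source_def square_rest_def)
  show ?thesis
  proof (rule site_elimination[where P = ?P and Q = ?Q and m = ?m and \<beta> = \<beta> and u = "square_sign sg cw cs" and \<tau> = \<tau>])
    show "valid_sites (sites sg)" by (rule valid_sites_sign[OF sgn])
    show "valid_sites Z" by (rule Z)
    show "dif (site_complex (sites sg)) (dif (site_complex (sites sg)) f) \<in> null (site_complex (sites sg))"
      if "f \<in> gr (site_complex (sites sg)) i j" for i j f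
      using model_dif_dif[OF num] that unfolding sg by blast
    show "?P \<subseteq> support (sites sg)" "?Q \<subseteq> support (sites sg)" "?P \<inter> ?Q = {}"
      using circ by (auto simp: model_sites_def square_source_def)
    show "bij_betw ?m ?P ?Q" by (rule bm)
    show "bij_betw \<beta> (support Z) (support (sites sg) - ?P - ?Q)" unfolding rest by (rule \<beta>)
  next
    fix s assume s: "s \<in> ?P"
    then obtain M where M: "s = (M, False)" "M \<subseteq> chords D" "CC M" "cs \<notin> M" by (auto simp: square_source_def)
    show "square_sign sg cw cs s \<in> {1, - 1} \<and> entry (sites sg) (?m s) s = of_int (square_sign sg cw cs s) \<and>
        srel (sites sg) (?m s) = srel (sites sg) s"
    proof (cases "cw \<in> M")
      case True
      have c: "cs \<in> chords D - M" using M ch by simp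
      have cc: "Y \<in> comps M" "Y \<notin> comps (insert cs M)" using circ[of M] circ[of "insert cs M"] M True ch by auto
      show ?thesis using True sg1[OF M(2) c] entry_edge[OF c, of sg False False] circle_edge_rel[OF M(2) c] cc
        by (simp add: M(1) square_sign_def square_match_def model_factor_def)
    next
      case False
      have c: "cw \<in> chords D - M" using False ch by simp
      have cc: "Y \<notin> comps M" "Y \<in> comps (insert cw M)"
        using circ[of M] circ[of "insert cw M"] M False ch CC by auto
      show ?thesis using False sg1[OF M(2) c] entry_edge[OF c, of sg True False] circle_edge_rel[OF M(2) c] cc
        by (simp add: M(1) square_sign_def square_match_def model_factor_def)
    qed
  next
    fix s t assume s: "s \<in> ?P" and t: "t \<in> ?Q" and ne: "t \<noteq> ?m s"
    obtain M where M: "s = (M, False)" "M \<subseteq> chords D" "CC M" "cs \<notin> M" using s by (auto simp: square_source_def)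
    obtain M' \<tau>' where t': "t = (M', \<tau>')" "M' \<subseteq> chords D" "CC M'" "cw \<in> M'" "\<tau>' \<longleftrightarrow> cs \<notin> M'" using t by auto
    show "entry (sites sg) t s = 0"
    proof (rule ccontr)
      assume nz: "entry (sites sg) t s \<noteq> 0"
      obtain c where c': "c \<in> chords D - fst s" "fst t = insert c (fst s)"
        "entry (sites sg) t s = of_int (sg (fst s) c) * mf t s"
        using nz by (rule entry_nonzero)
      have e: "mf t s \<noteq> 0" using nz c'(3) by auto
      have c: "c \<in> chords D - M" "M' = insert c M" using c' by (simp_all add: M t')
      show False
      proof (cases "cw \<in> M")
        case True
        have "Y \<in> comps M" using circ[OF M(2)] M True by simp
        moreover have "c \<noteq> cs" using ne True t' c M by (auto simp: square_match_def)
        then have "cs \<notin> M'" using c M by auto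
        moreover have "Y \<in> comps M'" using circ[OF t'(2)] t' \<open>cs \<notin> M'\<close> by simp
        ultimately show False using e t' by (simp add: M(1) model_factor_def)
      next
        case False
        then have "c = cw" using t' c by auto
        then show False using ne False t' c M ch by (auto simp: square_match_def)
      qed
    qed
  next
    fix z assume z: "z \<in> support Z"
    obtain M \<tau>' where "\<beta> z = (M, \<tau>')" by fastforce
    then show "\<tau> z \<in> {1, - 1} \<and> srel Z z = srel (sites sg) (\<beta> z) \<and> sdeg Z z = sdeg (sites sg) (\<beta> z)"
      using \<tau>[OF z] by simp
  next
    fix z z' assume "z \<in> support Z" "z' \<in> support Z"
    from dZ[OF this]
    show "entry Z z z' - of_int (\<tau> z * \<tau> z') * (entry (sites sg) (\<beta> z) (\<beta> z')
        - (\<Sum>s\<in>?P. entry (sites sg) (\<beta> z) s * of_int (square_sign sg cw cs s)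
            * entry (sites sg) (?m s) (\<beta> z'))) \<in> rel_ideal (srel Z z)"
      by simp
  qed
qed

text \<open>A single chord \<open>c\<close> whose smoothings differ by the circle \<open>Y\<close>.\<close>

theorem chord_elimination:
  assumes num: "inj_on num (chords D)" and c: "c \<in> chords D"
    and circ: "\<And>M. M \<subseteq> chords D ==> Y \<in> comps M \<longleftrightarrow> (c \<in> M \<longleftrightarrow> b)"
    and sg: "sg = order_sign num"
    and Z: "valid_sites Z" and \<beta>: "bij_betw \<beta> (support Z) {(M, \<tau>). M \<subseteq> chords D \<and> (c \<in> M \<longleftrightarrow> b) \<and> (\<tau> \<longleftrightarrow> \<not> b)}"
    and \<tau>: "\<And>z. z \<in> support Z ==> srel Z z = E (fst (\<beta> z)) \<and> sdeg Z z = sdeg (sites sg) (\<beta> z)"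
    and dZ: "\<And>z z'. z \<in> support Z ==> z' \<in> support Z ==> entry Z z z' = entry (sites sg) (\<beta> z) (\<beta> z')"
  shows "pc_equiv (site_complex (sites sg)) (site_complex Z)"
proof -
  let ?P = "{(M, \<tau>). M \<subseteq> chords D \<and> c \<notin> M \<and> \<not> \<tau>}"
  let ?Q = "{(M, \<tau>). M \<subseteq> chords D \<and> c \<in> M \<and> (\<tau> \<longleftrightarrow> b)}"
  let ?m = "\<lambda>s. (insert c (fst s), b)"
  have sgn: "sign_assignment (chords D) sg" unfolding sg by (rule sign_assignment_order_sign[OF finite_chords num])
  have rest: "support (sites sg) - ?P - ?Q = {(M, \<tau>). M \<subseteq> chords D \<and> (c \<in> M \<longleftrightarrow> b) \<and> (\<tau> \<longleftrightarrow> \<not> b)}"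
    using circ by (auto simp: model_sites_def)
  have edge: "entry (sites sg) (insert c M, \<tau>) (M, False) = (if \<tau> = b then of_int (sg M c) else entry (sites sg) (insert c M, \<tau>) (M, False))"
    "E (insert c M) = E M" if M: "M \<subseteq> chords D" "c \<notin> M" for M \<tau>
  proof -
    have cM: "c \<in> chords D - M" using M c by simp
    have cc: "Y \<in> comps M \<longleftrightarrow> \<not> b" "Y \<in> comps (insert c M) \<longleftrightarrow> b"
      using circ[of M] circ[of "insert c M"] M c by auto
    show "entry (sites sg) (insert c M, \<tau>) (M, False) = (if \<tau> = b then of_int (sg M c) else entry (sites sg) (insert c M, \<tau>) (M, False))"
      using entry_edge[OF cM, of sg \<tau> False] cc by (auto simp: model_factor_def)
    show "E (insert c M) = E M" using circle_edge_rel[OF M(1) cM] cc by simp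
  qed
  show ?thesis
  proof (rule site_elimination[where P = ?P and Q = ?Q and m = ?m and \<beta> = \<beta> and u = "\<lambda>s. sg (fst s) c" and \<tau> = "\<lambda>_. 1"])
    show "valid_sites (sites sg)" by (rule valid_sites_sign[OF sgn])
    show "valid_sites Z" by (rule Z)
    show "dif (site_complex (sites sg)) (dif (site_complex (sites sg)) f) \<in> null (site_complex (sites sg))"
      if "f \<in> gr (site_complex (sites sg)) i j" for i j f
      using model_dif_dif[OF num] that unfolding sg by blast
    show "?P \<subseteq> support (sites sg)" "?Q \<subseteq> support (sites sg)" "?P \<inter> ?Q = {}"
      using circ by (auto simp: model_sites_def)
    show "bij_betw ?m ?P ?Q"
      by (rule bij_betw_byWitness[where f' = "\<lambda>s. (fst s - {c}, False)"]) (use c in auto)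
    show "bij_betw \<beta> (support Z) (support (sites sg) - ?P - ?Q)" unfolding rest by (rule \<beta>)
  next
    fix s assume "s \<in> ?P"
    then obtain M where M: "s = (M, False)" "M \<subseteq> chords D" "c \<notin> M" by auto
    show "sg (fst s) c \<in> {1, - 1} \<and> entry (sites sg) (?m s) s = of_int (sg (fst s) c) \<and>
        srel (sites sg) (?m s) = srel (sites sg) s"
      using edge(1)[OF M(2,3), of b] edge(2)[OF M(2,3)] sign_assignment_value[OF sgn M(2), of c] M c by simp
  next
    fix s t assume s: "s \<in> ?P" and t: "t \<in> ?Q" and ne: "t \<noteq> ?m s"
    obtain M where M: "s = (M, False)" "M \<subseteq> chords D" "c \<notin> M" using s by auto
    obtain M' where t': "t = (M', b)" "c \<in> M'" using t by auto
    show "entry (sites sg) t s = 0"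
    proof (rule ccontr)
      assume "entry (sites sg) t s \<noteq> 0"
      then obtain c' where c': "c' \<in> chords D - fst s" "fst t = insert c' (fst s)" by (rule entry_nonzero)
      then have "c' = c" using M t' by auto
      then show False using ne c' by (simp add: M t')
    qed
  next
    fix z assume z: "z \<in> support Z"
    obtain M \<tau>' where "\<beta> z = (M, \<tau>')" by fastforce
    then show "1 \<in> {1, - 1 :: int} \<and> srel Z z = srel (sites sg) (\<beta> z) \<and> sdeg Z z = sdeg (sites sg) (\<beta> z)"
      using \<tau>[OF z] by simp
  next
    fix z z' assume zz: "z \<in> support Z" "z' \<in> support Z"
    have "entry (sites sg) (\<beta> z) s * of_int (sg (fst s) c) * entry (sites sg) (?m s) (\<beta> z') = 0" if s: "s \<in> ?P" for s
    proof (rule ccontr)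
      assume "\<not> ?thesis"
      then have n: "entry (sites sg) (\<beta> z) s \<noteq> 0" "entry (sites sg) (?m s) (\<beta> z') \<noteq> 0" by auto
      obtain M where M: "s = (M, False)" "c \<notin> M" using s by auto
      have Ms: "M \<subseteq> chords D" using s M by simp
      obtain N where N1: "\<beta> z = (N, \<not> b)" "c \<in> N \<longleftrightarrow> b" "N \<subseteq> chords D"
        using bij_betw_apply[OF \<beta> zz(1)] by (cases "\<beta> z") auto
      obtain N' where N2: "\<beta> z' = (N', \<not> b)" "c \<in> N' \<longleftrightarrow> b" "N' \<subseteq> chords D"
        using bij_betw_apply[OF \<beta> zz(2)] by (cases "\<beta> z'") auto
      note N = N1 N2
      obtain x where x: "x \<in> chords D - fst s" "fst (\<beta> z) = insert x (fst s)" using n(1) by (rule entry_nonzero)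
      obtain y where y: "y \<in> chords D - fst (\<beta> z')" "fst (?m s) = insert y (fst (\<beta> z'))"
        and e: "entry (sites sg) (?m s) (\<beta> z') = of_int (sg (fst (\<beta> z')) y) * mf (?m s) (\<beta> z')"
        using n(2) by (rule entry_nonzero)
      show False
      proof (cases b)
        case True
        then have "c \<in> N'" "insert c M = insert y N'" "y \<notin> N'" using N y M by auto
        moreover have "Y \<in> comps (insert c M)" "Y \<in> comps N'"
          using circ[of "insert c M"] circ[of N'] True N Ms M c by simp_all
        ultimately show False using n(2) e True N M by (simp add: model_factor_def)
      next
        case False
        then have "c \<notin> N" using N by auto
        have "Y \<in> comps M" "Y \<in> comps N" using circ[of M] circ[of N] False N Ms M c by simp_all
        moreover have "mf (\<beta> z) s \<noteq> 0"
        proof -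
          obtain w where "entry (sites sg) (\<beta> z) s = of_int (sg (fst s) w) * mf (\<beta> z) s"
            using n(1) by (rule entry_nonzero)
          then show ?thesis using n(1) by auto
        qed
        ultimately show False using False N M by (simp add: model_factor_def)
      qed
    qed
    then show "entry Z z z' - of_int (1 * 1) * (entry (sites sg) (\<beta> z) (\<beta> z')
        - (\<Sum>s\<in>?P. entry (sites sg) (\<beta> z) s * of_int (sg (fst s) c) * entry (sites sg) (?m s) (\<beta> z'))) \<in> rel_ideal (srel Z z)"
      using dZ[OF zz] by (simp add: sum.neutral)
  qed
qed

end

section \<open>Erasing chords\<close>

definition erased :: "('q, 'b, 'y) signed_chord_diagram_scheme \<Rightarrow> 'q set set \<Rightarrow> ('p \<Rightarrow> 'q) \<Rightarrow> ('b \<Rightarrow> 'a) \<Rightarrow>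
    ('p, 'a, 'z) signed_chord_diagram_scheme \<Rightarrow> bool" where
  "erased D' X f g D \<longleftrightarrow>
     X \<subseteq> chords D' \<and> bij_betw f (points D) (points D' - \<Union> X) \<and>
     (\<lambda>c. f ` c) ` chords D = chords D' - X \<and>
     (\<forall>c\<in>chords D. sign D' (f ` c) = sign D c) \<and>
     g ` arcs D' = arcs D \<and>
     (\<forall>a\<in>arcs D'. \<forall>b\<in>arcs D'.
        g a = g b \<longleftrightarrow> (a, b) \<in> equiv_closure {(arc_in D' p, arc_out D' p) | p. p \<in> \<Union> X}) \<and>
     (\<forall>p\<in>points D. g (arc_in D' (f p)) = arc_in D p \<and> g (arc_out D' (f p)) = arc_out D p)"

lemma card_quotient_components:
  assumes "circle_model D V \<theta> Y" "N \<subseteq> chords D"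
  shows "card (V // vrel D V \<theta> N) = card (components D N - {Y})"
proof -
  interpret circle_model D V \<theta> Y by (rule assms(1))
  let ?F = "\<lambda>K. {v \<in> V. \<theta> v \<in> K}"
  have F: "?F K = E N `` {v}" if "v \<in> V" "cmp N v = K" for K v
  proof -
    have "\<theta> u \<in> K \<longleftrightarrow> cmp N u = K" if "u \<in> V" for u
      using class_mem[OF cmp_comps[OF \<open>v \<in> V\<close>, of N], of "\<theta> u"] R_self[OF \<theta>_arcs[OF that], of N] \<open>cmp N v = K\<close> by auto
    then show ?thesis using that by (auto simp: E_iff)
  qed
  have "V // E N = ?F ` (comps N - {Y})"
  proof
    show "V // E N \<subseteq> ?F ` (comps N - {Y})"
    proof
      fix C assume "C \<in> V // E N"
      then obtain v where v: "v \<in> V" "C = E N `` {v}" by (auto simp: quotient_def)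
      then show "C \<in> ?F ` (comps N - {Y})" using F[OF v(1) refl] cmp_comps[OF v(1), of N] cmp_Y[OF v(1), of N] by blast
    qed
    show "?F ` (comps N - {Y}) \<subseteq> V // E N"
    proof
      fix C assume "C \<in> ?F ` (comps N - {Y})"
      then obtain K where K: "K \<in> comps N" "K \<noteq> Y" "C = ?F K" by auto
      obtain v where v: "v \<in> V" "cmp N v = K" using comp_var[OF assms(2) K(1,2)] by blast
      then show "C \<in> V // E N" using F[OF v] K(3) by (auto simp: quotient_def)
    qed
  qed
  moreover have "inj_on ?F (comps N - {Y})"
  proof (rule inj_onI)
    fix K K' assume K: "K \<in> comps N - {Y}" "K' \<in> comps N - {Y}" "?F K = ?F K'"
    obtain v where v: "v \<in> V" "\<theta> v \<in> K" "cmp N v = K" using comp_var[OF assms(2)] K(1) by blast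
    then have "\<theta> v \<in> K'" using K(3) by blast
    then show "K = K'" using class_mem[of K' N "\<theta> v"] K(2) v by simp
  qed
  ultimately show ?thesis by (simp add: card_image)
qed

lemma empty_circle_model:
  assumes "is_signed_chord_diagram D" "orientable D" "\<theta> ` V = arcs D"
  shows "circle_model D V \<theta> {}"
  by standard (use assms in auto)

lemma empty_not_component:
  assumes "is_signed_chord_diagram D" shows "{} \<notin> components D N"
proof
  assume "{} \<in> components D N"
  moreover have "is_chord_diagram D" using assms by (simp add: is_signed_chord_diagram_def)
  ultimately have "{} \<in> arcs D // smoothing_rel D N" using components_smoothing_rel by blast
  then show False using in_quotient_imp_non_empty[OF equiv_smoothing_rel] by blast
qed

locale erasure = D': circle_model D' "arcs D' - Y" "\<lambda>a. a" Y
  for D' :: "('q, 'b, 'y) signed_chord_diagram_scheme" and Y :: "'b set" +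
  fixes D :: "('p, 'a, 'z) signed_chord_diagram_scheme" and f :: "'p \<Rightarrow> 'q" and g :: "'b \<Rightarrow> 'a"
    and X L :: "'q set set" and r :: "'b \<Rightarrow> 'b" and g2 :: "'b \<Rightarrow> 'a"
  assumes signed_D: "is_signed_chord_diagram D" and orientable_D: "orientable D"
    and er: "erased D' X f g D" and L: "L \<subseteq> X"
    and Yends: "\<And>p. p \<in> points D' - \<Union> X ==> arc_in D' p \<notin> Y \<and> arc_out D' p \<notin> Y"
    and g2: "\<And>a. a \<in> arcs D' - Y ==> g2 a = g a"
    and g2_glued: "\<And>M p q. M \<subseteq> chords D' ==> M \<inter> X = L ==> {p, q} \<in> X ==> p \<noteq> q ==>
      if marker M {p, q} = sign D' {p, q} then g2 (arc_in D' p) = g2 (arc_out D' q)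
      else g2 (arc_in D' p) = g2 (arc_in D' q) \<and> g2 (arc_out D' p) = g2 (arc_out D' q)"
    and r: "\<And>a. a \<in> arcs D' - Y ==> r a = a" "\<And>a. a \<in> arcs D' ==> r a \<in> arcs D' - Y \<and> g (r a) = g a"
    and r_rel: "\<And>M p. M \<subseteq> chords D' ==> M \<inter> X = L ==> p \<in> \<Union> X ==>
      (r (arc_in D' p), r (arc_out D' p)) \<in> smoothing_rel D' M"

begin

abbreviation "V \<equiv> arcs D' - Y"

definition \<phi> :: "'p set \<Rightarrow> 'q set" where "\<phi> c = f ` c"

definition st :: "'p set set \<Rightarrow> 'q set set" where "st N = \<phi> ` N \<union> L"

lemma chord_D: "is_chord_diagram D"
  using signed_D by (simp add: is_signed_chord_diagram_def)

lemma X: "X \<subseteq> chords D'" and f_bij: "bij_betw f (points D) (points D' - \<Union> X)"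
  and \<phi>_image: "\<phi> ` chords D = chords D' - X" and \<phi>_sign: "c \<in> chords D ==> sign D' (\<phi> c) = sign D c"
  and g_image: "g ` arcs D' = arcs D"
  and g_eq: "a \<in> arcs D' ==> b \<in> arcs D' ==>
    g a = g b \<longleftrightarrow> (a, b) \<in> equiv_closure {(arc_in D' p, arc_out D' p) | p. p \<in> \<Union> X}"
  and g_ends: "p \<in> points D ==> g (arc_in D' (f p)) = arc_in D p \<and> g (arc_out D' (f p)) = arc_out D p"
  using er unfolding erased_def \<phi>_def by auto

lemma f_inj: "inj_on f (points D)" and f_points: "p \<in> points D ==> f p \<in> points D' - \<Union> X"
  using f_bij by (auto simp: bij_betw_def)

lemma \<phi>_inj: "inj_on \<phi> (chords D)"
proof (rule inj_onI)
  fix c c' assume c: "c \<in> chords D" "c' \<in> chords D" "\<phi> c = \<phi> c'"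
  then have "c \<subseteq> points D" "c' \<subseteq> points D" by (auto simp: points_def)
  then show "c = c'" using c(3) inj_on_image_eq_iff[OF f_inj] by (simp add: \<phi>_def)
qed

lemma \<phi>_chord: "c \<in> chords D ==> \<phi> c \<in> chords D' \<and> \<phi> c \<notin> X"
  using \<phi>_image by blast

lemma \<phi>_mem: "N \<subseteq> chords D ==> c \<in> chords D ==> \<phi> c \<in> st N \<longleftrightarrow> c \<in> N"
  using \<phi>_chord[of c] L inj_on_image_mem_iff[OF \<phi>_inj, of c N] by (auto simp: st_def)

lemma st_chords: "N \<subseteq> chords D ==> st N \<subseteq> chords D'" and st_X: "N \<subseteq> chords D ==> st N \<inter> X = L"
  using \<phi>_chord L X by (auto simp: st_def)

lemma marker_\<phi>: "N \<subseteq> chords D ==> c \<in> chords D ==> marker (st N) (\<phi> c) = marker N c"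
  by (simp add: marker_def \<phi>_mem)

lemma ends_V: "p \<in> points D ==> arc_in D' (f p) \<in> V \<and> arc_out D' (f p) \<in> V"
  using f_points Yends arc_in_arcs[OF D'.diagram] arc_out_arcs[OF D'.diagram] by blast

lemma chord_pair: "{p, q} \<in> chords D ==> p \<in> points D \<and> q \<in> points D"
  by (auto simp: points_def)

lemma forward:
  assumes N: "N \<subseteq> chords D" and ab: "(a, b) \<in> glued D' (st N)"
  shows "(g2 a, g2 b) \<in> equiv_closure (glued D N)"
proof -
  obtain p q where pq: "{p, q} \<in> chords D'" "p \<noteq> q" and
    glue: "if marker (st N) {p, q} = sign D' {p, q} then a = arc_in D' p \<and> b = arc_out D' q
      else a = arc_in D' p \<and> b = arc_in D' q \<or> a = arc_out D' p \<and> b = arc_out D' q"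
    using ab unfolding glued_iff by blast
  show ?thesis
  proof (cases "{p, q} \<in> X")
    case True
    have "g2 a = g2 b"
      using g2_glued[OF st_chords[OF N] st_X[OF N] True pq(2)] glue by (auto split: if_splits)
    then show ?thesis by simp
  next
    case False
    then obtain c where c: "c \<in> chords D" "{p, q} = \<phi> c" using \<phi>_image pq(1) by blast
    then obtain p0 q0 where p0: "p0 \<in> c" "p = f p0" "q0 \<in> c" "q = f q0" unfolding \<phi>_def by blast
    have "card c = 2" using chord_D c by (simp add: is_chord_diagram_def)
    moreover have "p0 \<noteq> q0" using p0 pq by auto
    ultimately have cc: "c = {p0, q0}" using p0 by (auto simp: card_2_iff)
    have P: "p0 \<in> points D" "q0 \<in> points D" using chord_pair c cc by auto
    have ge: "g2 (arc_in D' p) = arc_in D p0" "g2 (arc_out D' p) = arc_out D p0"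
      "g2 (arc_in D' q) = arc_in D q0" "g2 (arc_out D' q) = arc_out D q0"
      using g2 ends_V g_ends P p0 by auto
    have mk: "marker (st N) {p, q} = sign D' {p, q} \<longleftrightarrow> marker N {p0, q0} = sign D {p0, q0}"
      using marker_\<phi>[OF N c(1)] \<phi>_sign[OF c(1)] c cc by simp
    have "(g2 a, g2 b) \<in> glued D N"
    proof (cases "marker N {p0, q0} = sign D {p0, q0}")
      case True
      then show ?thesis using glue mk ge glued_same[of p0 q0 D N] c cc \<open>p0 \<noteq> q0\<close> by auto
    next
      case False
      then show ?thesis using glue mk ge glued_opposite[of p0 q0 D N] c cc \<open>p0 \<noteq> q0\<close> by auto
    qed
    then show ?thesis by (rule equiv_closure_incl)
  qed
qed

lemma same_strand:
  assumes N: "N \<subseteq> chords D" and a: "a \<in> V" "b \<in> V" "g a = g b"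
  shows "(a, b) \<in> smoothing_rel D' (st N)"
proof -
  have "(a, b) \<in> equiv_closure {(arc_in D' p, arc_out D' p) | p. p \<in> \<Union> X}" using a g_eq by blast
  then have "(r a, r b) \<in> equiv_closure (glued D' (st N))"
    by (rule equiv_closure_map) (use r_rel[OF st_chords[OF N] st_X[OF N]] in \<open>auto simp: smoothing_rel_def\<close>)
  then show ?thesis using r(1) a by (simp add: smoothing_rel_def)
qed

lemma backward:
  assumes N: "N \<subseteq> chords D" and ab: "(\<alpha>, \<beta>) \<in> equiv_closure (glued D N)" and \<alpha>: "a \<in> V" "g a = \<alpha>"
  shows "\<forall>b. b \<in> V \<and> g b = \<beta> \<longrightarrow> (a, b) \<in> smoothing_rel D' (st N)"
  using ab
proof (induction rule: equiv_closure_induct)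
  case refl
  then show ?case using same_strand[OF N \<alpha>(1)] \<alpha> by simp
next
  case (step x y)
  have lift: "\<exists>a' b'. a' \<in> V \<and> b' \<in> V \<and> g a' = x \<and> g b' = y \<and> (a', b') \<in> smoothing_rel D' (st N)"
    if xy: "(x, y) \<in> glued D N" for x y
  proof -
    obtain p q where pq: "{p, q} \<in> chords D" "p \<noteq> q" and
      glue: "if marker N {p, q} = sign D {p, q} then x = arc_in D p \<and> y = arc_out D q
        else x = arc_in D p \<and> y = arc_in D q \<or> x = arc_out D p \<and> y = arc_out D q"
      using xy unfolding glued_iff by blast
    have P: "p \<in> points D" "q \<in> points D" using chord_pair[OF pq(1)] by auto
    have \<phi>: "\<phi> {p, q} = {f p, f q}" by (simp add: \<phi>_def)
    have c: "{f p, f q} \<in> chords D'" using \<phi>_chord[OF pq(1)] \<phi> by simp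
    have ne: "f p \<noteq> f q" using f_inj P pq(2) by (auto simp: inj_on_def)
    have mk: "marker (st N) {f p, f q} = sign D' {f p, f q} \<longleftrightarrow> marker N {p, q} = sign D {p, q}"
      using marker_\<phi>[OF N pq(1)] \<phi>_sign[OF pq(1)] \<phi> by simp
    note gl = glued_smoothing_rel(1)[OF D'.diagram]
    show ?thesis
    proof (cases "marker N {p, q} = sign D {p, q}")
      case True
      then show ?thesis using glue gl[OF glued_same(1)[OF c ne]] mk ends_V[OF P(1)] ends_V[OF P(2)] g_ends[OF P(1)] g_ends[OF P(2)]
        by (intro exI[of _ "arc_in D' (f p)"] exI[of _ "arc_out D' (f q)"]) auto
    next
      case False
      then have m: "marker (st N) {f p, f q} \<noteq> sign D' {f p, f q}" using mk by simp
      from False glue consider "x = arc_in D p" "y = arc_in D q" | "x = arc_out D p" "y = arc_out D q" by auto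
      then show ?thesis
      proof cases
        case 1
        then show ?thesis using gl[OF glued_opposite(1)[OF c ne m]] ends_V[OF P(1)] ends_V[OF P(2)] g_ends[OF P(1)] g_ends[OF P(2)]
          by (intro exI[of _ "arc_in D' (f p)"] exI[of _ "arc_in D' (f q)"]) auto
      next
        case 2
        then show ?thesis using gl[OF glued_opposite(2)[OF c ne m]] ends_V[OF P(1)] ends_V[OF P(2)] g_ends[OF P(1)] g_ends[OF P(2)]
          by (intro exI[of _ "arc_out D' (f p)"] exI[of _ "arc_out D' (f q)"]) auto
      qed
    qed
  qed
  have s: "sym (smoothing_rel D' (st N))" and t: "trans (smoothing_rel D' (st N))"
    using equiv_smoothing_rel[of D' "st N"] by (auto simp: equiv_def)
  obtain x' y' where xy': "x' \<in> V" "y' \<in> V" "g x' = x" "g y' = y" "(x', y') \<in> smoothing_rel D' (st N)"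
    using step(2) lift[of x y] lift[of y x] symD[OF s] by blast
  show ?case
  proof (intro allI impI)
    fix b assume b: "b \<in> V \<and> g b = y"
    have "(a, x') \<in> smoothing_rel D' (st N)" using step(3) xy' by blast
    moreover have "(y', b) \<in> smoothing_rel D' (st N)" using same_strand[OF N, of y' b] b xy' by simp
    ultimately show "(a, b) \<in> smoothing_rel D' (st N)" using xy'(5) transD[OF t] by blast
  qed
qed

lemma rel_eq: "N \<subseteq> chords D ==> vrel D' V (\<lambda>a. a) (st N) = vrel D V g N"
proof -
  assume N: "N \<subseteq> chords D"
  have "(a, b) \<in> smoothing_rel D' (st N) \<longleftrightarrow> (g a, g b) \<in> smoothing_rel D N" if ab: "a \<in> V" "b \<in> V" for a b
  proof
    assume "(a, b) \<in> smoothing_rel D' (st N)"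
    then have "(g2 a, g2 b) \<in> equiv_closure (glued D N)"
      by (intro equiv_closure_map[of a b "glued D' (st N)" g2]) (auto simp: smoothing_rel_def intro: forward[OF N])
    then show "(g a, g b) \<in> smoothing_rel D N" using g2 ab g_image by (auto simp: smoothing_rel_def)
  next
    assume "(g a, g b) \<in> smoothing_rel D N"
    then show "(a, b) \<in> smoothing_rel D' (st N)" using backward[OF N _ ab(1) refl] ab by (auto simp: smoothing_rel_def)
  qed
  then show ?thesis by (auto simp: vrel_def)
qed

sublocale D: circle_model D V g "{}"
proof (rule empty_circle_model[OF signed_D orientable_D])
  show "g ` V = arcs D"
  proof
    show "g ` V \<subseteq> arcs D" using g_image by auto
    show "arcs D \<subseteq> g ` V"
    proof
      fix \<alpha> assume "\<alpha> \<in> arcs D"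
      then obtain a where "a \<in> arcs D'" "\<alpha> = g a" using g_image by auto
      then have "r a \<in> V" "\<alpha> = g (r a)" using r(2) by auto
      then show "\<alpha> \<in> g ` V" by blast
    qed
  qed
qed

definition lift_sign :: "('q set set \<Rightarrow> 'q set \<Rightarrow> int) \<Rightarrow> 'p set set \<Rightarrow> 'p set \<Rightarrow> int" where
  "lift_sign sg N c = sg (st N) (\<phi> c)"

lemma st_insert: "st (insert c N) = insert (\<phi> c) (st N)"
  by (auto simp: st_def)

lemma lift_sign_assignment:
  assumes "sign_assignment (chords D') sg"
  shows "sign_assignment (chords D) (lift_sign sg)"
  unfolding sign_assignment_def
proof (intro conjI allI impI)
  have mem: "\<phi> c \<in> chords D' - st N" if "N \<subseteq> chords D" "c \<in> chords D - N" for N c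
    using \<phi>_chord \<phi>_mem that by blast
  fix N c c'
  show "lift_sign sg N c \<in> {1, - 1}" if "N \<subseteq> chords D \<and> c \<in> chords D - N"
    using sign_assignment_value[OF assms st_chords mem] that by (auto simp: lift_sign_def)
  assume a: "N \<subseteq> chords D \<and> c \<in> chords D - N \<and> c' \<in> chords D - N \<and> c \<noteq> c'"
  then have ne: "\<phi> c \<noteq> \<phi> c'" using \<phi>_inj by (auto simp: inj_on_def)
  have N: "N \<subseteq> chords D" and c: "c \<in> chords D - N" and c': "c' \<in> chords D - N" using a by auto
  show "lift_sign sg N c * lift_sign sg (insert c N) c' = - (lift_sign sg N c' * lift_sign sg (insert c' N) c)"
    unfolding lift_sign_def st_insert
    by (rule sign_assignment_anti[OF assms st_chords[OF N] mem[OF N c] mem[OF N c'] ne])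
qed

abbreviation "Z sg \<equiv> model_sites D V g {} (lift_sign sg)"

lemma support_Z: "support (Z sg) = {(N, \<tau>). N \<subseteq> chords D \<and> \<not> \<tau>}"
  using empty_not_component[OF signed_D] by (auto simp: model_sites_def)

lemma st_bij: "bij_betw (\<lambda>z. (st (fst z), \<tau>0)) (support (Z sg)) {(M, \<tau>). M \<subseteq> chords D' \<and> M \<inter> X = L \<and> (\<tau> \<longleftrightarrow> \<tau>0)}"
  unfolding bij_betw_def
proof
  show "inj_on (\<lambda>z. (st (fst z), \<tau>0)) (support (Z sg))"
  proof (rule inj_onI)
    fix x y assume xy: "x \<in> support (Z sg)" "y \<in> support (Z sg)" "(st (fst x), \<tau>0) = (st (fst y), \<tau>0)"
    have s: "fst x \<subseteq> chords D" "fst y \<subseteq> chords D" "\<not> snd x" "\<not> snd y" using xy(1,2) by (auto simp: support_Z)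
    have "c \<in> fst x \<longleftrightarrow> c \<in> fst y" for c
      using \<phi>_mem[OF s(1), of c] \<phi>_mem[OF s(2), of c] xy(3) s by auto
    then show "x = y" using s by (intro prod_eqI) auto
  qed
  show "(\<lambda>z. (st (fst z), \<tau>0)) ` support (Z sg) = {(M, \<tau>). M \<subseteq> chords D' \<and> M \<inter> X = L \<and> (\<tau> \<longleftrightarrow> \<tau>0)}"
  proof (intro equalityI subsetI)
    fix t assume "t \<in> (\<lambda>z. (st (fst z), \<tau>0)) ` support (Z sg)"
    then obtain N where N: "N \<subseteq> chords D" and t: "t = (st N, \<tau>0)" by (auto simp: support_Z)
    show "t \<in> {(M, \<tau>). M \<subseteq> chords D' \<and> M \<inter> X = L \<and> (\<tau> \<longleftrightarrow> \<tau>0)}"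
      using st_chords[OF N] st_X[OF N] by (simp add: t)
  next
    fix t assume "t \<in> {(M, \<tau>). M \<subseteq> chords D' \<and> M \<inter> X = L \<and> (\<tau> \<longleftrightarrow> \<tau>0)}"
    then obtain M where M: "t = (M, \<tau>0)" "M \<subseteq> chords D'" "M \<inter> X = L" by auto
    let ?N = "{c \<in> chords D. \<phi> c \<in> M}"
    have "\<phi> ` ?N = \<phi> ` chords D \<inter> M" by auto
    also have "\<dots> = M - X" unfolding \<phi>_image using M(2) by auto
    finally have "st ?N = M - X \<union> L" by (simp add: st_def)
    then have "st ?N = M" using M(3) by auto
    then show "t \<in> (\<lambda>z. (st (fst z), \<tau>0)) ` support (Z sg)"
      using M(1) by (intro image_eqI[of _ _ "(?N, False)"]) (auto simp: support_Z)
  qed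
qed

lemma Z_srel: "z \<in> support (Z sg) ==> srel (Z sg) z = D'.E (st (fst z))"
  using rel_eq by (auto simp: support_Z)

lemma writhe_erased: "writhe D' = writhe D + (\<Sum>c\<in>X. sign D' c)"
proof -
  have "writhe D' = (\<Sum>c\<in>chords D' - X. sign D' c) + (\<Sum>c\<in>X. sign D' c)"
    unfolding writhe_def using X D'.finite_chords by (rule sum.subset_diff)
  also have "(\<Sum>c\<in>chords D' - X. sign D' c) = (\<Sum>c\<in>chords D. sign D' (\<phi> c))"
    unfolding \<phi>_image[symmetric] by (rule sum.reindex[OF \<phi>_inj, unfolded o_def])
  also have "\<dots> = writhe D" unfolding writhe_def by (rule sum.cong) (auto simp: \<phi>_sign)
  finally show ?thesis .
qed

lemma Z_sdeg:
  assumes z: "z \<in> support (Z sg)"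
    and i: "(\<Sum>c\<in>X. sign D' c) - int (card X) + 2 * int (card L) = 0"
    and j: "(\<Sum>c\<in>X. sign D' c) + (if Y \<in> components D' (st (fst z)) then 1 else 0) - (if \<tau>0 then 2 else 0) = 0"
  shows "sdeg (Z sg) z = sdeg (D'.sites sg') (st (fst z), \<tau>0)"
proof -
  obtain N where zN: "z = (N, False)" and N: "N \<subseteq> chords D" using z by (auto simp: support_Z)
  have finN: "finite N" using N D.finite_chords by (rule finite_subset)
  have finL: "finite L" using L X D'.finite_chords by (meson finite_subset)
  have "\<phi> ` N \<inter> L = {}" using \<phi>_chord N L by blast
  then have c1: "card (st N) = card N + card L"
    unfolding st_def using finN finL card_image[OF inj_on_subset[OF \<phi>_inj N]] by (simp add: card_Un_disjoint)
  have c2: "card (chords D') = card (chords D) + card X"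
  proof -
    have "card (chords D' - X) = card (chords D)" using card_image[OF \<phi>_inj] \<phi>_image by simp
    then show ?thesis using card_Diff_subset[OF finite_subset[OF X D'.finite_chords] X] card_mono[OF D'.finite_chords X] by simp
  qed
  have c3: "int (card (components D' (st N))) - (if Y \<in> components D' (st N) then 1 else 0) = int (card (components D N))"
  proof -
    have "card (components D N - {{}}) = card (components D' (st N) - {Y})"
      using card_quotient_components[OF D.circle_model_axioms N] card_quotient_components[OF D'.circle_model_axioms st_chords[OF N]]
        rel_eq[OF N] by simp
    moreover have "components D N - {{}} = components D N"
      by (rule Diff_triv) (use empty_not_component[OF signed_D] in simp)
    ultimately have eq: "card (components D N) = card (components D' (st N) - {Y})" by simp
    have card_pos: "card (components D' (st N)) > 0" if "Y \<in> components D' (st N)"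
      using that D'.finite_comps[of "st N"] by (auto simp: card_gt_0_iff)
    show ?thesis
    proof (cases "Y \<in> components D' (st N)")
      case True
      then have "card (components D' (st N) - {Y}) = card (components D' (st N)) - 1"
        by (rule card_Diff_singleton)
      then show ?thesis using True eq card_pos[OF True] by simp
    next
      case False
      then have "components D' (st N) - {Y} = components D' (st N)" by simp
      then show ?thesis using False eq by simp
    qed
  qed
  let ?x = "writhe D - (int (card (chords D)) - int (card N)) + int (card N)"
  have e1: "writhe D' - num_pos D' (st N) + num_neg D' (st N) = ?x"
    using D'.num_neg_pos[OF st_chords[OF N]] writhe_erased c1 c2 i by simp
  have e2: "3 * writhe D' - num_pos D' (st N) + num_neg D' (st N) = (?x + 2 * writhe D) + (\<Sum>c\<in>X. sign D' c) * 2"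
    using e1 writhe_erased by simp
  have e3: "(3 * writhe D' - num_pos D' (st N) + num_neg D' (st N)) div 2 = (\<Sum>c\<in>X. sign D' c) + (?x + 2 * writhe D) div 2"
    unfolding e2 by (rule div_mult_self1) simp
  have e4: "3 * writhe D - num_pos D N + num_neg D N = ?x + 2 * writhe D" "writhe D - num_pos D N + num_neg D N = ?x"
    using D.num_neg_pos[OF N] by simp_all
  show ?thesis
    using c3 j unfolding zN model_sites_def by (simp add: e1 e3 e4 split: if_splits)
qed

lemma Z_entry:
  assumes z: "z \<in> support (Z sg)" "z' \<in> support (Z sg)"
    and cc: "\<And>M. M \<subseteq> chords D' ==> M \<inter> X = L ==> Y \<in> components D' M \<longleftrightarrow> cc" and \<tau>0: "\<tau>0 \<longrightarrow> cc"
  shows "entry (Z sg) z z' = entry (D'.sites sg) (st (fst z), \<tau>0) (st (fst z'), \<tau>0)"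
proof -
  obtain N1 N0 where zN: "z = (N1, False)" "z' = (N0, False)" and N: "N1 \<subseteq> chords D" "N0 \<subseteq> chords D"
    using z by (auto simp: support_Z)
  have nc: "{} \<notin> components D N" for N by (rule empty_not_component[OF signed_D])
  show ?thesis
  proof (cases "\<exists>c\<in>chords D - N0. N1 = insert c N0")
    case True
    then obtain c where c: "c \<in> chords D - N0" "N1 = insert c N0" by blast
    then have c': "\<phi> c \<in> chords D' - st N0" using \<phi>_chord \<phi>_mem[OF N(2)] by blast
    have "Y \<in> components D' (st N0) \<longleftrightarrow> cc" "Y \<in> components D' (st N1) \<longleftrightarrow> cc"
      using cc st_chords st_X N by auto
    then have "D'.mf (st N1, \<tau>0) (st N0, \<tau>0) = saddle (D'.E (st N0)) (D'.E (st N1))"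
      using \<tau>0 by (simp add: model_factor_def)
    also have "\<dots> = D.mf (N1, False) (N0, False)" using rel_eq N nc by (simp add: model_factor_def)
    finally have "entry (D'.sites sg) (st N1, \<tau>0) (st N0, \<tau>0) = of_int (sg (st N0) (\<phi> c)) * D.mf (N1, False) (N0, False)"
      using D'.entry_edge[OF c', of sg \<tau>0 \<tau>0] c(2) by (simp add: st_insert)
    then show ?thesis using D.entry_edge[OF c(1), of "lift_sign sg" False False] c(2) by (simp add: zN lift_sign_def)
  next
    case False
    have "\<not> (\<exists>c'\<in>chords D' - st N0. st N1 = insert c' (st N0))"
    proof
      assume "\<exists>c'\<in>chords D' - st N0. st N1 = insert c' (st N0)"
      then obtain c' where c': "c' \<in> chords D' - st N0" "st N1 = insert c' (st N0)" by blast
      then have "c' \<in> \<phi> ` N1" by (auto simp: st_def)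
      then obtain c where c: "c \<in> N1" "c' = \<phi> c" by blast
      have "x \<in> N1 \<longleftrightarrow> x \<in> insert c N0" if x: "x \<in> chords D" for x
      proof -
        have "\<phi> x = \<phi> c \<longleftrightarrow> x = c" using \<phi>_inj x c N by (auto simp: inj_on_def)
        then show ?thesis using \<phi>_mem[OF N(1) x] \<phi>_mem[OF N(2) x] c' c(2) by auto
      qed
      then have "N1 = insert c N0" using N c by blast
      moreover have "c \<in> chords D - N0" using c N c'(1) \<phi>_mem[OF N(2), of c] by blast
      ultimately show False using False by blast
    qed
    then show ?thesis using entry_model_sites_0[of D' "st N0" "st N1" V "\<lambda>a. a" Y sg \<tau>0 \<tau>0]
        entry_model_sites_0[OF False, of V g "{}" "lift_sign sg" False False] by (simp add: zN)
  qed
qed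

lemma valid_Z: "sign_assignment (chords D') sg ==> valid_sites (Z sg)"
  by (rule D.valid_sites_sign[OF lift_sign_assignment])

lemma homotopy_equivalent_erased:
  assumes num: "inj_on num (chords D)" and num': "inj_on num' (chords D')"
    and e: "pc_equiv (site_complex (D'.sites (order_sign num'))) (site_complex (Z (order_sign num')))"
  shows "homotopy_equivalent_complexes (khovanov_complex D num) (khovanov_complex D' num')"
proof -
  have "sign_assignment (chords D') (order_sign num')"
    by (rule sign_assignment_order_sign[OF D'.finite_chords num'])
  then have "pc_equiv (site_complex (D.sites (order_sign num))) (site_complex (Z (order_sign num')))"
    by (rule D.change_signs[OF num lift_sign_assignment])
  from pc_equiv_trans[OF this pc_equiv_sym[OF e]]
  show ?thesis by (rule presents_equiv[OF D.presents_model D'.presents_model])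
qed

end

section \<open>The first and the second move\<close>

lemma component_closed:
  assumes "is_chord_diagram D" "K \<in> components D M" "a \<in> K" "(a, b) \<in> smoothing_rel D M"
  shows "b \<in> K"
proof -
  obtain x where "K = smoothing_rel D M `` {x}"
    using assms(1,2) components_smoothing_rel by (metis quotientE)
  then show ?thesis using assms(3,4) equiv_smoothing_rel[of D M] unfolding equiv_def by (auto dest: transD)
qed

lemma component_nonempty:
  assumes "is_chord_diagram D" "K \<in> components D M" shows "K \<noteq> {}"
  using assms in_quotient_imp_non_empty[OF equiv_smoothing_rel] components_smoothing_rel by metis

lemma component_eqI:
  assumes D: "is_chord_diagram D" and Y: "Y \<subseteq> arcs D" "y \<in> Y"
    and inv: "\<And>a b. (a, b) \<in> glued D M ==> a \<in> Y \<longleftrightarrow> b \<in> Y"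
    and con: "\<And>z. z \<in> Y ==> (y, z) \<in> smoothing_rel D M"
  shows "Y \<in> components D M"
proof -
  have "z \<in> Y" if "(y, z) \<in> equiv_closure (glued D M)" for z
    using that by (induction rule: equiv_closure_induct) (use inv Y in auto)
  then have "smoothing_rel D M `` {y} = Y" using con by (auto simp: smoothing_rel_def)
  then show ?thesis using Y unfolding components_smoothing_rel[OF D] by (auto simp: quotient_def)
qed

lemma chord_unique:
  assumes "is_chord_diagram D" "{p, q} \<in> chords D" "{p', q'} \<in> chords D" "p \<in> {p', q'}"
  shows "{p', q'} = {p, q}"
proof (rule ccontr)
  assume "{p', q'} \<noteq> {p, q}"
  then have "{p', q'} \<inter> {p, q} = {}" using assms by (simp add: is_chord_diagram_def)
  then show False using assms(4) by auto
qed

lemma arc_in_eq: "is_chord_diagram D ==> p \<in> points D ==> q \<in> points D ==> arc_in D p = arc_in D q \<longleftrightarrow> p = q"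
  and arc_out_eq: "is_chord_diagram D ==> p \<in> points D ==> q \<in> points D ==> arc_out D p = arc_out D q \<longleftrightarrow> p = q"
  by (auto simp: is_chord_diagram_def inj_on_def)

lemma sign_marker:
  assumes "is_signed_chord_diagram D" "c \<in> chords D"
  shows "marker M c = sign D c \<longleftrightarrow> (c \<in> M \<longleftrightarrow> sign D c = - 1)"
  using assms by (auto simp: is_signed_chord_diagram_def marker_def)

text \<open>
  The arc of the kink is a circle of its own in one of the two smoothings of the additional chord.
  Cancelling it leaves a summand in which the kink is straightened.
\<close>

theorem first_move_equivalence:
  fixes D' :: "('q, 'b, 'y) signed_chord_diagram_scheme" and D :: "('p, 'a, 'z) signed_chord_diagram_scheme"
  assumes D: "is_signed_chord_diagram D" "orientable D" and D': "is_signed_chord_diagram D'" "orientable D'"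
    and pq: "p \<noteq> q" and er: "erased D' {{p, q}} f g D" and e: "arc_out D' p = arc_in D' q"
    and num: "inj_on num (chords D)" "inj_on num' (chords D')"
  shows "homotopy_equivalent_complexes (khovanov_complex D num) (khovanov_complex D' num')"
proof -
  let ?c = "{p, q}" and ?e = "arc_in D' q"
  have cd: "is_chord_diagram D'" using D' by (simp add: is_signed_chord_diagram_def)
  have c: "?c \<in> chords D'" using er by (simp add: erased_def)
  have P: "p \<in> points D'" "q \<in> points D'" using c by (auto simp: points_def)
  have eA: "?e \<in> arcs D'" "arc_in D' p \<in> arcs D'" "arc_out D' q \<in> arcs D'"
    using P arc_in_arcs[OF cd] arc_out_arcs[OF cd] by auto
  have in_e: "arc_in D' x = ?e \<longleftrightarrow> x = q" if "x \<in> points D'" for x using arc_in_eq[OF cd that P(2)] .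
  have out_e: "arc_out D' x = ?e \<longleftrightarrow> x = p" if "x \<in> points D'" for x using arc_out_eq[OF cd that P(1)] e by simp
  define b where "b \<longleftrightarrow> sign D' ?c = - 1"
  have s1: "sign D' ?c = (if b then -1 else 1)"
    using D'(1) c unfolding b_def by (auto simp: is_signed_chord_diagram_def)
  have oriented: "marker M ?c = sign D' ?c \<longleftrightarrow> (?c \<in> M \<longleftrightarrow> b)" for M
    using sign_marker[OF D'(1) c] by (simp add: b_def)
  have circ: "{?e} \<in> components D' M \<longleftrightarrow> (?c \<in> M \<longleftrightarrow> b)" for M
  proof
    assume Y: "{?e} \<in> components D' M"
    show "?c \<in> M \<longleftrightarrow> b"
    proof (rule ccontr)
      assume "\<not> ?thesis"
      then have "(arc_in D' p, ?e) \<in> glued D' M" using glued_opposite(1)[OF c pq] oriented by blast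
      then have "arc_in D' p \<in> {?e}"
        using component_closed[OF cd Y] glued_smoothing_rel(2)[OF cd] by blast
      then show False using in_e[OF P(1)] pq by simp
    qed
  next
    assume h: "?c \<in> M \<longleftrightarrow> b"
    show "{?e} \<in> components D' M"
    proof (rule component_eqI[OF cd])
      fix x y assume "(x, y) \<in> glued D' M"
      then obtain p' q' where pq': "{p', q'} \<in> chords D'" "p' \<noteq> q'" and
        glue: "if marker M {p', q'} = sign D' {p', q'} then x = arc_in D' p' \<and> y = arc_out D' q'
          else x = arc_in D' p' \<and> y = arc_in D' q' \<or> x = arc_out D' p' \<and> y = arc_out D' q'"
        unfolding glued_iff by blast
      have P': "p' \<in> points D'" "q' \<in> points D'" using pq' by (auto simp: points_def)
      show "x \<in> {?e} \<longleftrightarrow> y \<in> {?e}"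
      proof (cases "{p', q'} = ?c")
        case True
        then have "x = arc_in D' p' \<and> y = arc_out D' q'" using glue h oriented[of M] by simp
        then show ?thesis using True in_e[OF P'(1)] out_e[OF P'(2)] by (auto simp: doubleton_eq_iff)
      next
        case False
        then have "p' \<notin> ?c" "q' \<notin> ?c"
          using chord_unique[OF cd pq'(1) c] chord_unique[OF cd, of q' p' p q] pq'(1) c by (auto simp: insert_commute)
        then show ?thesis using glue in_e[OF P'(1)] in_e[OF P'(2)] out_e[OF P'(1)] out_e[OF P'(2)]
          by (auto split: if_splits)
      qed
    qed (use eA in \<open>auto simp: smoothing_rel_def\<close>)
  qed
  have model: "circle_model D' (arcs D' - {?e}) (\<lambda>a. a) {?e}"
  proof
    show "Ka = {?e}" if "Ka \<in> components D' M" "Ka \<subseteq> {?e}" for Ka M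
      using component_nonempty[OF cd that(1)] subset_singletonD[OF that(2)] by blast
  qed (use D' in auto)
  define L where "L = (if b then {?c} else {})"
  have ge: "g (arc_in D' p) = g ?e" "g ?e = g (arc_out D' q)"
  proof -
    have "(arc_in D' p, ?e) \<in> equiv_closure {(arc_in D' p, arc_out D' p) | p. p \<in> \<Union> {?c}}"
      using e by (intro equiv_closure_incl) force
    then show "g (arc_in D' p) = g ?e" using er eA unfolding erased_def by blast
    have "(?e, arc_out D' q) \<in> equiv_closure {(arc_in D' p, arc_out D' p) | p. p \<in> \<Union> {?c}}"
      by (intro equiv_closure_incl) force
    then show "g ?e = g (arc_out D' q)" using er eA unfolding erased_def by blast
  qed
  have pV: "arc_in D' p \<noteq> ?e" "arc_out D' q \<noteq> ?e" using in_e[OF P(1)] out_e[OF P(2)] pq by auto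
  have M_L: "M \<inter> {?c} = L \<longleftrightarrow> (?c \<in> M \<longleftrightarrow> b)" for M by (auto simp: L_def)
  interpret erasure D' "{?e}" D f g "{?c}" L "\<lambda>a. if a = ?e then arc_in D' p else a" g
  proof (rule erasure.intro[OF model], unfold_locales)
    show "is_signed_chord_diagram D" "orientable D" by (rule D)+
    show "erased D' {?c} f g D" by (rule er)
    show "L \<subseteq> {?c}" by (simp add: L_def)
    show "arc_in D' x \<notin> {?e} \<and> arc_out D' x \<notin> {?e}" if "x \<in> points D' - \<Union> {?c}" for x
      using that in_e[of x] out_e[of x] by auto
    show "g a = g a" for a by simp
    show "if marker M {p', q'} = sign D' {p', q'} then g (arc_in D' p') = g (arc_out D' q')
        else g (arc_in D' p') = g (arc_in D' q') \<and> g (arc_out D' p') = g (arc_out D' q')"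
      if "M \<inter> {?c} = L" "{p', q'} \<in> {?c}" for M p' q'
      using that ge e oriented[of M] M_L[of M] by (auto simp: doubleton_eq_iff)
    show "(if a = ?e then arc_in D' p else a) = a" if "a \<in> arcs D' - {?e}" for a using that by auto
    show "(if a = ?e then arc_in D' p else a) \<in> arcs D' - {?e} \<and> g (if a = ?e then arc_in D' p else a) = g a"
      if "a \<in> arcs D'" for a using that ge eA pV by auto
    show "((if arc_in D' x = ?e then arc_in D' p else arc_in D' x), (if arc_out D' x = ?e then arc_in D' p else arc_out D' x))
        \<in> smoothing_rel D' M" if "M \<inter> {?c} = L" "x \<in> \<Union> {?c}" for M x
    proof -
      have "(arc_in D' p, arc_out D' q) \<in> smoothing_rel D' M"
        using glued_same(1)[OF c pq] oriented[of M] M_L[of M] that(1) by (intro glued_smoothing_rel(1)[OF cd]) blast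
      moreover have "(arc_in D' p, arc_in D' p) \<in> smoothing_rel D' M" using eA by (simp add: smoothing_rel_def)
      ultimately show ?thesis using that(2) pV e by auto
    qed
  qed
  let ?sg = "order_sign num'"
  have zst: "st (fst z) \<subseteq> chords D'" "?c \<in> st (fst z) \<longleftrightarrow> b" if "z \<in> support (Z ?sg)" for z
  proof -
    have N: "fst z \<subseteq> chords D" using that by (auto simp: support_Z)
    show "st (fst z) \<subseteq> chords D'" by (rule st_chords[OF N])
    show "?c \<in> st (fst z) \<longleftrightarrow> b" using st_X[OF N] M_L by metis
  qed
  have "pc_equiv (site_complex (D'.sites ?sg)) (site_complex (Z ?sg))"
  proof (rule D'.chord_elimination[OF num(2) c, where b = b and \<beta> = "\<lambda>z. (st (fst z), \<not> b)"])
    show "{?e} \<in> components D' M \<longleftrightarrow> (?c \<in> M \<longleftrightarrow> b)" for M by (rule circ)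
    show "?sg = ?sg" by simp
    show "valid_sites (Z ?sg)"
      by (rule valid_Z[OF sign_assignment_order_sign[OF D'.finite_chords num(2)]])
    show "bij_betw (\<lambda>z. (st (fst z), \<not> b)) (support (Z ?sg)) {(M, \<tau>). M \<subseteq> chords D' \<and> (?c \<in> M \<longleftrightarrow> b) \<and> (\<tau> \<longleftrightarrow> \<not> b)}"
      using st_bij[of "\<not> b" ?sg] by (simp only: M_L)
    show "srel (Z ?sg) z = D'.E (fst (st (fst z), \<not> b)) \<and> sdeg (Z ?sg) z = sdeg (D'.sites ?sg) (st (fst z), \<not> b)"
      if z: "z \<in> support (Z ?sg)" for z
    proof
      show "srel (Z ?sg) z = D'.E (fst (st (fst z), \<not> b))" using Z_srel[OF z] by simp
      show "sdeg (Z ?sg) z = sdeg (D'.sites ?sg) (st (fst z), \<not> b)"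
        by (rule Z_sdeg[OF z]) (use zst[OF z] circ s1 in \<open>auto simp: L_def\<close>)
    qed
    show "entry (Z ?sg) z z' = entry (D'.sites ?sg) (st (fst z), \<not> b) (st (fst z'), \<not> b)"
      if "z \<in> support (Z ?sg)" "z' \<in> support (Z ?sg)" for z z'
      by (rule Z_entry[OF that, of True]) (use circ M_L in auto)
  qed
  then show ?thesis by (rule homotopy_equivalent_erased[OF num])
qed

text \<open>
  The two strands bound a bigon, whose boundary is a circle of its own in exactly one of the four smoothings of
  the two additional chords.  It cancels along the two edges of the square at this smoothing, which leaves
  the smoothing that pulls the strands apart.
\<close>

theorem second_move_equivalence:
  fixes D' :: "('q, 'b, 'y) signed_chord_diagram_scheme" and D :: "('p, 'a, 'z) signed_chord_diagram_scheme"
  assumes D: "is_signed_chord_diagram D" "orientable D" and D': "is_signed_chord_diagram D'" "orientable D'"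
    and dist: "distinct [p1, p2, q1, q2]"
    and cc: "c = {p1, q1} \<and> c' = {p2, q2} \<or> c = {p1, q2} \<and> c' = {p2, q1}"
    and er: "erased D' {c, c'} f g D" and sgn: "sign D' c = - sign D' c'"
    and e: "arc_out D' p1 = arc_in D' p2" and e': "arc_out D' q1 = arc_in D' q2"
    and num: "inj_on num (chords D)" "inj_on num' (chords D')"
  shows "homotopy_equivalent_complexes (khovanov_complex D num) (khovanov_complex D' num')"
proof -
  let ?e = "arc_in D' p2" and ?f = "arc_in D' q2" and ?i = "arc_in D' p1" and ?o = "arc_out D' p2"
  let ?i' = "arc_in D' q1" and ?o' = "arc_out D' q2"
  have cd: "is_chord_diagram D'" using D' by (simp add: is_signed_chord_diagram_def)
  have ch: "c \<in> chords D'" "c' \<in> chords D'" using er by (auto simp: erased_def)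
  have ne: "c \<noteq> c'" using cc dist by (auto simp: doubleton_eq_iff)
  have P: "p1 \<in> points D'" "p2 \<in> points D'" "q1 \<in> points D'" "q2 \<in> points D'"
    using ch cc by (auto simp: points_def)
  have U: "\<Union> {c, c'} = {p1, p2, q1, q2}" using cc by auto
  note inA = arc_in_arcs[OF cd] and outA = arc_out_arcs[OF cd]
  have A: "?e \<in> arcs D'" "?f \<in> arcs D'" "?i \<in> arcs D'" "?o \<in> arcs D'" "?i' \<in> arcs D'" "?o' \<in> arcs D'"
    using P inA outA by auto
  have in_Y: "arc_in D' x \<in> {?e, ?f} \<longleftrightarrow> x \<in> {p2, q2}" if "x \<in> points D'" for x
    using arc_in_eq[OF cd that P(2)] arc_in_eq[OF cd that P(4)] by simp
  have out_Y: "arc_out D' x \<in> {?e, ?f} \<longleftrightarrow> x \<in> {p1, q1}" if "x \<in> points D'" for x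
    using arc_out_eq[OF cd that P(1)] arc_out_eq[OF cd that P(3)] e e' by simp
  have nY: "?i \<notin> {?e, ?f}" "?o \<notin> {?e, ?f}" "?i' \<notin> {?e, ?f}" "?o' \<notin> {?e, ?f}"
    using in_Y[OF P(1)] out_Y[OF P(2)] in_Y[OF P(3)] out_Y[OF P(4)] dist by auto
  have ef: "?e \<noteq> ?f" using arc_in_eq[OF cd P(2,4)] dist by auto
  define par where "par \<longleftrightarrow> c = {p1, q1}"
  have par: "par ==> c = {p1, q1} \<and> c' = {p2, q2}" "\<not> par ==> c = {p1, q2} \<and> c' = {p2, q1}"
    using cc dist unfolding par_def by (auto simp: doubleton_eq_iff)
  define w1 where "w1 = (if par then ?i' else ?o')"
  define w2 where "w2 = (if par then ?o' else ?i')"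
  text \<open>A chord is closing if its smoothing joins the two middle arcs.\<close>
  define K where "K M x \<longleftrightarrow> (marker M x = sign D' x \<longleftrightarrow> \<not> par)" for M x
  have glue_c: "if K M c then (?e, ?f) \<in> smoothing_rel D' M \<and> (?i, w1) \<in> smoothing_rel D' M
      else (?i, ?f) \<in> smoothing_rel D' M \<and> (w1, ?e) \<in> smoothing_rel D' M" for M
  proof -
    note gl = glued_smoothing_rel[OF cd]
    have d: "p1 \<noteq> q1" "p1 \<noteq> q2" using dist by auto
    show ?thesis
      using par ch(1) e e' gl[OF glued_same(1)[of p1 q1 D' M]] gl[OF glued_same(2)[of p1 q1 D' M]]
        gl[OF glued_opposite(1)[of p1 q1 D' M]] gl[OF glued_opposite(2)[of p1 q1 D' M]]
        gl[OF glued_same(1)[of p1 q2 D' M]] gl[OF glued_same(2)[of p1 q2 D' M]]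
        gl[OF glued_opposite(1)[of p1 q2 D' M]] gl[OF glued_opposite(2)[of p1 q2 D' M]] d
      by (cases par; cases "marker M c = sign D' c") (simp_all add: K_def w1_def)
  qed
  have glue_c': "if K M c' then (?e, ?f) \<in> smoothing_rel D' M \<and> (?o, w2) \<in> smoothing_rel D' M
      else (?f, ?o) \<in> smoothing_rel D' M \<and> (?e, w2) \<in> smoothing_rel D' M" for M
  proof -
    note gl = glued_smoothing_rel[OF cd]
    have d: "p2 \<noteq> q1" "p2 \<noteq> q2" using dist by auto
    show ?thesis
      using par ch(2) e e' gl[OF glued_same(1)[of p2 q1 D' M]] gl[OF glued_same(2)[of p2 q1 D' M]]
        gl[OF glued_opposite(1)[of p2 q1 D' M]] gl[OF glued_opposite(2)[of p2 q1 D' M]]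
        gl[OF glued_same(1)[of p2 q2 D' M]] gl[OF glued_same(2)[of p2 q2 D' M]]
        gl[OF glued_opposite(1)[of p2 q2 D' M]] gl[OF glued_opposite(2)[of p2 q2 D' M]] d
      by (cases par; cases "marker M c' = sign D' c'") (simp_all add: K_def w2_def)
  qed
  have w: "w1 \<notin> {?e, ?f}" "w2 \<notin> {?e, ?f}" using nY by (auto simp: w1_def w2_def)
  have closed: "Ka \<in> components D' M ==> a \<in> Ka ==> (a, b) \<in> smoothing_rel D' M ==> b \<in> Ka" for Ka M a b
    using component_closed[OF cd] .
  have sym: "(a, b) \<in> smoothing_rel D' M ==> (b, a) \<in> smoothing_rel D' M" for a b M
    using equiv_smoothing_rel[of D' M] by (auto simp: equiv_def dest: symD)
  have trans: "(a, b) \<in> smoothing_rel D' M ==> (b, x) \<in> smoothing_rel D' M ==> (a, x) \<in> smoothing_rel D' M" for a b x M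
    using equiv_smoothing_rel[of D' M] by (auto simp: equiv_def dest: transD)
  have YK: "Ka = {?e, ?f}" if Ka: "Ka \<in> components D' M" "Ka \<subseteq> {?e, ?f}" for Ka M
  proof -
    have "K M c"
    proof (rule ccontr)
      assume "\<not> K M c"
      then have "?e \<notin> Ka" "?f \<notin> Ka"
        using glue_c[of M] closed[OF Ka(1), of ?e w1] closed[OF Ka(1), of ?f ?i] sym w nY Ka(2) by auto
      then show False using component_nonempty[OF cd Ka(1)] Ka(2) by auto
    qed
    then have "?e \<in> Ka \<longleftrightarrow> ?f \<in> Ka" using glue_c[of M] closed[OF Ka(1)] sym by auto
    then show ?thesis using component_nonempty[OF cd Ka(1)] Ka(2) by auto
  qed
  have circ: "{?e, ?f} \<in> components D' M \<longleftrightarrow> K M c \<and> K M c'" for M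
  proof
    assume Y: "{?e, ?f} \<in> components D' M"
    show "K M c \<and> K M c'"
      using glue_c[of M] glue_c'[of M] closed[OF Y, of ?e w1] closed[OF Y, of ?e w2] sym w by (auto split: if_splits)
  next
    assume h: "K M c \<and> K M c'"
    show "{?e, ?f} \<in> components D' M"
    proof (rule component_eqI[OF cd])
      show "{?e, ?f} \<subseteq> arcs D'" "?e \<in> {?e, ?f}" using A by auto
      show "(?e, z) \<in> smoothing_rel D' M" if "z \<in> {?e, ?f}" for z
        using that h glue_c[of M] A by (auto simp: smoothing_rel_def)
      fix x y assume "(x, y) \<in> glued D' M"
      then obtain p' q' where pq': "{p', q'} \<in> chords D'" "p' \<noteq> q'" and
        glue: "if marker M {p', q'} = sign D' {p', q'} then x = arc_in D' p' \<and> y = arc_out D' q'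
          else x = arc_in D' p' \<and> y = arc_in D' q' \<or> x = arc_out D' p' \<and> y = arc_out D' q'"
        unfolding glued_iff by blast
      have P': "p' \<in> points D'" "q' \<in> points D'" using pq' by (auto simp: points_def)
      note iy = in_Y[OF P'(1)] in_Y[OF P'(2)] out_Y[OF P'(1)] out_Y[OF P'(2)]
      have other: "p' \<notin> d \<and> q' \<notin> d" if "d \<in> {c, c'}" "{p', q'} \<noteq> d" for d
      proof -
        have "d \<in> chords D'" using that ch by auto
        then have "{p', q'} \<inter> d = {}" using cd pq'(1) that(2) by (simp add: is_chord_diagram_def)
        then show ?thesis by auto
      qed
      consider "{p', q'} = c" | "{p', q'} = c'" | "{p', q'} \<noteq> c" "{p', q'} \<noteq> c'" by blast
      then show "x \<in> {?e, ?f} \<longleftrightarrow> y \<in> {?e, ?f}"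
      proof cases
        case 1
        then have k: "(marker M {p', q'} = sign D' {p', q'}) = (\<not> par)" using h by (simp add: K_def)
        show ?thesis
        proof (cases par)
          case True
          then have "{p', q'} = {p1, q1}" using 1 par by simp
          then have "p' \<in> {p1, q1} \<and> q' \<in> {p1, q1}" by auto
          then show ?thesis using glue k True iy dist by auto
        next
          case False
          then have "{p', q'} = {p1, q2}" using 1 par by simp
          then have "p' = p1 \<and> q' = q2 \<or> p' = q2 \<and> q' = p1" by (auto simp: doubleton_eq_iff)
          then show ?thesis using glue k False iy dist by auto
        qed
      next
        case 2
        then have k: "(marker M {p', q'} = sign D' {p', q'}) = (\<not> par)" using h by (simp add: K_def)
        show ?thesis
        proof (cases par)
          case True
          then have "{p', q'} = {p2, q2}" using 2 par by simp
          then have "p' \<in> {p2, q2} \<and> q' \<in> {p2, q2}" by auto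
          then show ?thesis using glue k True iy dist by auto
        next
          case False
          then have "{p', q'} = {p2, q1}" using 2 par by simp
          then have "p' = p2 \<and> q' = q1 \<or> p' = q1 \<and> q' = p2" by (auto simp: doubleton_eq_iff)
          then show ?thesis using glue k False iy dist by auto
        qed
      next
        case 3
        then have "p' \<notin> {p1, p2, q1, q2}" "q' \<notin> {p1, p2, q1, q2}"
          using other[of c] other[of c'] U by blast+
        then show ?thesis using glue iy by (auto split: if_splits)
      qed
    qed
  qed
  have model: "circle_model D' (arcs D' - {?e, ?f}) (\<lambda>a. a) {?e, ?f}"
    by standard (use D' YK in auto)
  define cw where "cw = (if (sign D' c = -1) = (\<not> par) then c else c')"
  define cs where "cs = (if (sign D' c = -1) = (\<not> par) then c' else c)"
  have cws: "cw \<in> chords D'" "cs \<in> chords D'" "cw \<noteq> cs" "{c, c'} = {cw, cs}" using ch ne by (auto simp: cw_def cs_def)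
  have s1: "sign D' c \<in> {1, -1}" using D'(1) ch by (simp add: is_signed_chord_diagram_def)
  have Kcw: "K M cw \<longleftrightarrow> cw \<in> M" and Kcs: "K M cs \<longleftrightarrow> cs \<notin> M" for M
    using sign_marker[OF D'(1) ch(1), of M] sign_marker[OF D'(1) ch(2), of M] s1 sgn
    by (auto simp: K_def cw_def cs_def split: if_splits)
  have KK: "(K M c \<and> K M c') = (cw \<in> M \<and> cs \<notin> M)" "(\<not> K M c \<and> \<not> K M c') = (cw \<notin> M \<and> cs \<in> M)" for M
    using Kcw[of M] Kcs[of M] cws(4) by (metis doubleton_eq_iff)+
  have M_L: "M \<inter> {c, c'} = {cs} \<longleftrightarrow> cw \<notin> M \<and> cs \<in> M" for M using cws(3) unfolding cws(4) by blast
  have ge: "g ?i = g ?e" "g ?e = g ?o" "g ?i' = g ?f" "g ?f = g ?o'"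
  proof -
    have gx: "g (arc_in D' x) = g (arc_out D' x)" if "x \<in> {p1, p2, q1, q2}" for x
    proof -
      have "(arc_in D' x, arc_out D' x) \<in> equiv_closure {(arc_in D' p, arc_out D' p) | p. p \<in> \<Union> {c, c'}}"
        using that unfolding U by (intro equiv_closure_incl) blast
      moreover have "arc_in D' x \<in> arcs D'" "arc_out D' x \<in> arcs D'" using that P inA outA by auto
      ultimately show ?thesis using er unfolding erased_def by blast
    qed
    show "g ?i = g ?e" "g ?e = g ?o" "g ?i' = g ?f" "g ?f = g ?o'"
      using gx[of p1] gx[of p2] gx[of q1] gx[of q2] e e' by simp_all
  qed
  have gw: "g w1 = g ?f" "g w2 = g ?f" using ge by (auto simp: w1_def w2_def)
  let ?r = "\<lambda>a. if a = ?e then ?i else if a = ?f then ?i' else a"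
  let ?g2 = "\<lambda>a. if a = ?e then g ?f else if a = ?f then g ?e else g a"
  interpret erasure D' "{?e, ?f}" D f g "{c, c'}" "{cs}" ?r ?g2
  proof (rule erasure.intro[OF model], unfold_locales)
    show "is_signed_chord_diagram D" "orientable D" by (rule D)+
    show "erased D' {c, c'} f g D" by (rule er)
    show "{cs} \<subseteq> {c, c'}" using cws by simp
    show "arc_in D' x \<notin> {?e, ?f} \<and> arc_out D' x \<notin> {?e, ?f}" if "x \<in> points D' - \<Union> {c, c'}" for x
      using that in_Y[of x] out_Y[of x] unfolding U by auto
    show "?g2 a = g a" if "a \<in> arcs D' - {?e, ?f}" for a using that by auto
    have g2v: "?g2 ?e = g ?f" "?g2 ?f = g ?e" "?g2 ?i = g ?e" "?g2 ?o = g ?e" "?g2 ?i' = g ?f" "?g2 ?o' = g ?f"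
      using nY ef ge by auto
    show "if marker M {p', q'} = sign D' {p', q'} then ?g2 (arc_in D' p') = ?g2 (arc_out D' q')
        else ?g2 (arc_in D' p') = ?g2 (arc_in D' q') \<and> ?g2 (arc_out D' p') = ?g2 (arc_out D' q')"
      if M: "M \<inter> {c, c'} = {cs}" and pq': "{p', q'} \<in> {c, c'}" for M p' q'
    proof -
      have "\<not> K M c \<and> \<not> K M c'" using KK(2) M_L M by blast
      then have k: "(marker M {p', q'} = sign D' {p', q'}) = par" using pq' unfolding K_def by blast
      show ?thesis
      proof (cases par)
        case True
        then have "p' = p1 \<and> q' = q1 \<or> p' = q1 \<and> q' = p1 \<or> p' = p2 \<and> q' = q2 \<or> p' = q2 \<and> q' = p2"
          using pq' par(1) by (auto simp: doubleton_eq_iff)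
        then show ?thesis using k True g2v e e' by (elim disjE) (simp_all only: if_True simp_thms)
      next
        case False
        then have "p' = p1 \<and> q' = q2 \<or> p' = q2 \<and> q' = p1 \<or> p' = p2 \<and> q' = q1 \<or> p' = q1 \<and> q' = p2"
          using pq' par(2) by (auto simp: doubleton_eq_iff)
        then show ?thesis using k False g2v e e' by (elim disjE) (simp_all only: if_False simp_thms)
      qed
    qed
    show "?r a = a" if "a \<in> arcs D' - {?e, ?f}" for a using that by auto
    show "?r a \<in> arcs D' - {?e, ?f} \<and> g (?r a) = g a" if "a \<in> arcs D'" for a
      using that ge A nY by auto
    show "(?r (arc_in D' x), ?r (arc_out D' x)) \<in> smoothing_rel D' M"
      if M: "M \<inter> {c, c'} = {cs}" and x: "x \<in> \<Union> {c, c'}" for M x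
    proof -
      have k: "\<not> K M c" "\<not> K M c'" using KK(2) M_L M by blast+
      have io: "(?i, ?o) \<in> smoothing_rel D' M" using glue_c[of M] glue_c'[of M] k trans by auto
      have "(w1, w2) \<in> smoothing_rel D' M" using glue_c[of M] glue_c'[of M] k trans by auto
      then have io': "(?i', ?o') \<in> smoothing_rel D' M" using sym by (auto simp: w1_def w2_def split: if_splits)
      have rf: "(?i, ?i) \<in> smoothing_rel D' M" "(?i', ?i') \<in> smoothing_rel D' M" using A by (auto simp: smoothing_rel_def)
      have rv: "?r ?e = ?i" "?r ?f = ?i'" "?r ?i = ?i" "?r ?o = ?o" "?r ?i' = ?i'" "?r ?o' = ?o'" using nY ef by auto
      from x have "x = p1 \<or> x = p2 \<or> x = q1 \<or> x = q2" unfolding U by blast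
      then show ?thesis using io io' rf rv e e' by (elim disjE) (simp_all only:)
    qed
  qed
  let ?sg = "order_sign num'"
  have zst: "\<not> (cw \<in> st (fst z) \<and> cs \<notin> st (fst z))" if "z \<in> support (Z ?sg)" for z
  proof -
    have N: "fst z \<subseteq> chords D" using that by (auto simp: support_Z)
    show ?thesis using st_X[OF N] M_L by metis
  qed
  have "pc_equiv (site_complex (D'.sites ?sg)) (site_complex (Z ?sg))"
  proof (rule D'.square_elimination[OF num(2) cws(1,2,3), where CC = "\<lambda>_. True" and \<beta> = "\<lambda>z. (st (fst z), False)" and \<tau> = "\<lambda>_. 1"])
    show "{?e, ?f} \<in> components D' M \<longleftrightarrow> True \<and> cw \<in> M \<and> cs \<notin> M" for M using circ KK(1) by simp
    show "?sg = ?sg" by simp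
    show "valid_sites (Z ?sg)"
      by (rule valid_Z[OF sign_assignment_order_sign[OF D'.finite_chords num(2)]])
    show "bij_betw (\<lambda>z. (st (fst z), False)) (support (Z ?sg)) (D'.square_rest (\<lambda>_. True) cw cs)"
    proof -
      have "{(M, \<tau>). M \<subseteq> chords D' \<and> M \<inter> {c, c'} = {cs} \<and> (\<tau> \<longleftrightarrow> False)} = D'.square_rest (\<lambda>_. True) cw cs"
        by (auto simp: D'.square_rest_def M_L)
      then show ?thesis using st_bij[of False ?sg] by simp
    qed
    show "1 \<in> {1, - 1 :: int} \<and> srel (Z ?sg) z = D'.E (fst (st (fst z), False)) \<and> sdeg (Z ?sg) z = sdeg (D'.sites ?sg) (st (fst z), False)"
      if z: "z \<in> support (Z ?sg)" for z
    proof -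
      have "sdeg (Z ?sg) z = sdeg (D'.sites ?sg) (st (fst z), False)"
        by (rule Z_sdeg[OF z]) (use zst[OF z] circ KK sgn ne in auto)
      then show ?thesis using Z_srel[OF z] by simp
    qed
    fix z z' assume z: "z \<in> support (Z ?sg)" "z' \<in> support (Z ?sg)"
    have "entry (D'.sites ?sg) (st (fst z), False) s * of_int (D'.square_sign ?sg cw cs s)
        * entry (D'.sites ?sg) (D'.square_match cw cs s) (st (fst z'), False) = 0"
      if s: "s \<in> D'.square_source (\<lambda>_. True) cs" for s
    proof (rule ccontr)
      assume "\<not> ?thesis"
      then have n: "entry (D'.sites ?sg) (st (fst z), False) s \<noteq> 0"
        "entry (D'.sites ?sg) (D'.square_match cw cs s) (st (fst z'), False) \<noteq> 0" by auto
      obtain M where M: "s = (M, False)" "cs \<notin> M" using s by (auto simp: D'.square_source_def)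
      have s1: "cw \<notin> st (fst z)" "cs \<in> st (fst z')"
      proof -
        have N: "fst z \<subseteq> chords D" "fst z' \<subseteq> chords D" using z by (auto simp: support_Z)
        show "cw \<notin> st (fst z)" "cs \<in> st (fst z')" using st_X[OF N(1)] st_X[OF N(2)] M_L by metis+
      qed
      obtain x where x: "fst (st (fst z), False) = insert x (fst s)" using n(1) by (rule D'.entry_nonzero)
      obtain y where y: "fst (D'.square_match cw cs s) = insert y (fst (st (fst z'), False))"
        using n(2) by (rule D'.entry_nonzero)
      have "cw \<notin> M" using x M s1 by auto
      then have "cs \<in> insert cw M" using y s1 M by (auto simp: D'.square_match_def)
      then show False using M cws(3) by simp
    qed
    then have "(\<Sum>s\<in>D'.square_source (\<lambda>_. True) cs. entry (D'.sites ?sg) (st (fst z), False) s * of_int (D'.square_sign ?sg cw cs s)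
        * entry (D'.sites ?sg) (D'.square_match cw cs s) (st (fst z'), False)) = 0" by (rule sum.neutral[rule_format])
    moreover have "entry (Z ?sg) z z' = entry (D'.sites ?sg) (st (fst z), False) (st (fst z'), False)"
      by (rule Z_entry[OF z, of False]) (use circ KK M_L in auto)
    ultimately show "entry (Z ?sg) z z' = of_int (1 * 1) * (entry (D'.sites ?sg) (st (fst z), False) (st (fst z'), False)
        - (\<Sum>s\<in>D'.square_source (\<lambda>_. True) cs. entry (D'.sites ?sg) (st (fst z), False) s * of_int (D'.square_sign ?sg cw cs s)
        * entry (D'.sites ?sg) (D'.square_match cw cs s) (st (fst z'), False)))" by simp
  qed simp_all
  then show ?thesis by (rule homotopy_equivalent_erased[OF num])
qed

section \<open>Reduction of a triangle\<close>

text \<open>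
  The triangle has chords \<open>ct\<close>, \<open>cs\<close>, \<open>cw\<close>; the truth value \<open>b\<close> tells which smoothing of \<open>ct\<close>, and
  of the other two always the positive one of \<open>cs\<close> and the negative one of \<open>cw\<close>, runs along the
  cyclic direction of the triangle.  Five states survive the elimination: along the direction run
  only \<open>ct\<close> (index 0), only \<open>cs\<close> (1), no chord (2), \<open>cs\<close> and \<open>cw\<close> (3), only \<open>cw\<close> (4).  The sign that
  the chords of the triangle contribute at the outer chords is \<open>tri_sign\<close>, and \<open>tri_tab\<close> is the table
  of coefficients between the five states, including the zigzag between the indices 0 and 3.
\<close>

definition tri_loc :: "bool \<Rightarrow> 'c \<Rightarrow> 'c \<Rightarrow> 'c \<Rightarrow> nat \<Rightarrow> 'c set" where
  "tri_loc b ct cs cw k = {c. c = ct \<and> (k = 0) = b \<or> c = cs \<and> k \<in> {0, 2, 4} \<or> c = cw \<and> k \<in> {3, 4}}"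

definition tri_sign :: "bool \<Rightarrow> nat \<Rightarrow> int" where
  "tri_sign b k = (if b = (k \<in> {2, 3}) then -1 else 1)"

definition tri_tab :: "bool \<Rightarrow> nat \<Rightarrow> nat \<Rightarrow> int" where
  "tri_tab b k1 k0 = (if k0 = 1 \<and> k1 \<in> {2, 3} \<or> k0 = 2 \<and> k1 = 4 then 1 else if k0 = 3 \<and> k1 = 4 then -1
     else if \<not> b \<and> k0 = 0 \<and> k1 \<in> {2, 3} \<or> b \<and> k0 = 2 \<and> k1 = 0 then -1
     else if b \<and> k0 = 3 \<and> k1 = 0 then 1 else 0)"

definition tri_sites :: "bool \<Rightarrow> 'o set \<Rightarrow> ('o set \<Rightarrow> nat \<Rightarrow> ('v \<times> 'v) set) \<Rightarrow> ('o set \<times> nat \<Rightarrow> int \<times> int) \<Rightarrow>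
    ('o set \<Rightarrow> 'o \<Rightarrow> int) \<Rightarrow> ('o set \<times> nat, 'v) sites" where
  "tri_sites b C0 F dg os = \<lparr>
     support = {(N, k). N \<subseteq> C0 \<and> k < 5},
     srel = (\<lambda>(N, k). F N k),
     sdeg = dg,
     entry = (\<lambda>(N1, k1) (N0, k0).
       if N1 = N0 then of_int (tri_tab b k1 k0) * saddle (F N0 k0) (F N1 k1)
       else if k1 = k0 \<and> (\<exists>x\<in>C0 - N0. N1 = insert x N0)
       then of_int (tri_sign b k0 * os N0 (THE x. x \<notin> N0 \<and> N1 = insert x N0)) * saddle (F N0 k0) (F N1 k1)
       else 0)\<rparr>"

lemma nat_less_5_cases:
  assumes "k < (5 :: nat)" obtains "k = 0" | "k = 1" | "k = 2" | "k = 3" | "k = 4"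
  using assms by (auto simp: less_Suc_eq numeral_eq_Suc)

lemma tri_tab_step:
  assumes "k1 < 5" "k0 < 5" "\<not> (if b then k0 = 3 \<and> k1 = 0 else k0 = 0 \<and> k1 = 3)"
    and "((k1 = 0) = b) \<and> \<not> ((k0 = 0) = b) \<and> (k1 \<in> {0, 2, 4}) = (k0 \<in> {0, 2, 4}) \<and> (k1 \<in> {3, 4}) = (k0 \<in> {3, 4}) \<or>
      ((k1 = 0) = b) = ((k0 = 0) = b) \<and> k1 \<in> {0, 2, 4} \<and> k0 \<notin> {0, 2, 4} \<and> (k1 \<in> {3, 4}) = (k0 \<in> {3, 4}) \<or>
      ((k1 = 0) = b) = ((k0 = 0) = b) \<and> (k1 \<in> {0, 2, 4}) = (k0 \<in> {0, 2, 4}) \<and> k1 \<in> {3, 4} \<and> k0 \<notin> {3, 4}"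
  shows "tri_tab b k1 k0 \<noteq> 0"
proof -
  have all: "\<forall>k1\<in>{0, 1, 2, 3, 4}. \<forall>k0\<in>{0, 1, 2, 3, 4}. \<not> (if b then k0 = 3 \<and> k1 = 0 else k0 = 0 \<and> k1 = 3) \<longrightarrow>
    ((k1 = 0) = b) \<and> \<not> ((k0 = 0) = b) \<and> (k1 \<in> {0, 2, 4}) = (k0 \<in> {0, 2, 4}) \<and> (k1 \<in> {3, 4}) = (k0 \<in> {3, 4}) \<or>
      ((k1 = 0) = b) = ((k0 = 0) = b) \<and> k1 \<in> {0, 2, 4} \<and> k0 \<notin> {0, 2, 4} \<and> (k1 \<in> {3, 4}) = (k0 \<in> {3, 4}) \<or>
      ((k1 = 0) = b) = ((k0 = 0) = b) \<and> (k1 \<in> {0, 2, 4}) = (k0 \<in> {0, 2, 4}) \<and> k1 \<in> {3, 4} \<and> k0 \<notin> {3, 4}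
    \<longrightarrow> tri_tab b k1 k0 \<noteq> 0"
    by (cases b) (simp_all add: tri_tab_def)
  have k: "k1 \<in> {0, 1, 2, 3, 4}" "k0 \<in> {0, 1, 2, 3, 4}" using assms(1,2) by auto
  show ?thesis by (rule bspec[OF bspec[OF all k(1)] k(2), THEN mp, THEN mp, OF assms(3,4)])
qed

lemma sum_eq_single:
  assumes "finite A" "a \<in> A" "\<And>x. x \<in> A ==> x \<noteq> a ==> h x = 0"
  shows "sum h A = h a"
  using sum.remove[OF assms(1,2), of h] sum.neutral[of "A - {a}" h] assms(3) by simp

locale triangle = circle_model D V \<theta> Y
  for D :: "('p, 'a, 'z) signed_chord_diagram_scheme" and V :: "'v set" and \<theta> :: "'v \<Rightarrow> 'a" and Y :: "'a set" +
  fixes ct cs cw :: "'p set" and b :: bool and C0 :: "'o set" and \<phi> :: "'o \<Rightarrow> 'p set" and num :: "'p set \<Rightarrow> nat"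
  assumes chords3: "ct \<in> chords D" "cs \<in> chords D" "cw \<in> chords D" and distinct3: "distinct [ct, cs, cw]"
    and circ: "\<And>M. M \<subseteq> chords D ==> Y \<in> comps M \<longleftrightarrow> (ct \<in> M \<longleftrightarrow> b) \<and> cw \<in> M \<and> cs \<notin> M"
    and \<phi>: "bij_betw \<phi> C0 (chords D - {ct, cs, cw})"
    and num_inj: "inj_on num (chords D)" and num3: "num ct < num cs" "num cs < num cw"
    and num_outer: "\<And>x. x \<in> C0 ==> num (\<phi> x) < num ct"

begin

abbreviation "loc \<equiv> tri_loc b ct cs cw"

abbreviation "CC \<equiv> \<lambda>M. (ct \<in> M) = b"

abbreviation "sg \<equiv> order_sign num"

definition st :: "'o set \<Rightarrow> nat \<Rightarrow> 'p set set" where "st N k = \<phi> ` N \<union> loc k"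

lemma ne3: "ct \<noteq> cs" "ct \<noteq> cw" "cs \<noteq> cw" "cs \<noteq> ct" "cw \<noteq> ct" "cw \<noteq> cs"
  using distinct3 by auto

lemma \<phi>_outer: "x \<in> C0 ==> \<phi> x \<in> chords D \<and> \<phi> x \<noteq> ct \<and> \<phi> x \<noteq> cs \<and> \<phi> x \<noteq> cw"
  using bij_betwE[OF \<phi>] by simp

lemma \<phi>_eq: "x \<in> C0 ==> y \<in> C0 ==> \<phi> x = \<phi> y \<longleftrightarrow> x = y"
  using bij_betw_imp_inj_on[OF \<phi>] by (rule inj_on_eq_iff)

lemma loc_values: "loc 0 = (if b then {ct, cs} else {cs})" "loc 1 = (if b then {} else {ct})" "loc (Suc 0) = (if b then {} else {ct})"
  "loc 2 = (if b then {cs} else {ct, cs})"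
  "loc 3 = (if b then {cw} else {ct, cw})" "loc 4 = (if b then {cs, cw} else {ct, cs, cw})"
  by (auto simp: tri_loc_def)

lemma st_mem:
  assumes "N \<subseteq> C0"
  shows "ct \<in> st N k \<longleftrightarrow> (k = 0) = b" "cs \<in> st N k \<longleftrightarrow> k \<in> {0, 2, 4}" "cw \<in> st N k \<longleftrightarrow> k \<in> {3, 4}"
    and "x \<in> C0 ==> \<phi> x \<in> st N k \<longleftrightarrow> x \<in> N"
proof -
  have o: "ct \<notin> \<phi> ` N" "cs \<notin> \<phi> ` N" "cw \<notin> \<phi> ` N" using assms \<phi>_outer by blast+
  then show "ct \<in> st N k \<longleftrightarrow> (k = 0) = b" "cs \<in> st N k \<longleftrightarrow> k \<in> {0, 2, 4}" "cw \<in> st N k \<longleftrightarrow> k \<in> {3, 4}"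
    using ne3 by (auto simp: st_def tri_loc_def)
  assume x: "x \<in> C0"
  then have "\<phi> x \<in> \<phi> ` N \<longleftrightarrow> x \<in> N" using assms \<phi>_eq by blast
  then show "\<phi> x \<in> st N k \<longleftrightarrow> x \<in> N" using \<phi>_outer[OF x] by (auto simp: st_def tri_loc_def)
qed

lemma st_chords: "N \<subseteq> C0 ==> st N k \<subseteq> chords D"
  using \<phi>_outer chords3 by (auto simp: st_def tri_loc_def)

lemma chord_cases:
  assumes "c \<in> chords D" obtains "c = ct" | "c = cs" | "c = cw" | x where "x \<in> C0" "c = \<phi> x"
proof (cases "c \<in> {ct, cs, cw}")
  case False
  then have "c \<in> \<phi> ` C0" using assms \<phi> by (simp add: bij_betw_def)
  then show ?thesis using that by blast
qed (use that in blast)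

text \<open>States are compared through the four kinds of chords.\<close>

lemma state_eqI:
  assumes "M \<subseteq> chords D" "M' \<subseteq> chords D" "ct \<in> M \<longleftrightarrow> ct \<in> M'" "cs \<in> M \<longleftrightarrow> cs \<in> M'" "cw \<in> M \<longleftrightarrow> cw \<in> M'"
    "\<And>x. x \<in> C0 ==> \<phi> x \<in> M \<longleftrightarrow> \<phi> x \<in> M'"
  shows "M = M'"
proof -
  have "c \<in> M \<longleftrightarrow> c \<in> M'" if "c \<in> chords D" for c
    using that by (cases rule: chord_cases) (use assms in auto)
  then show ?thesis using assms(1,2) by blast
qed

lemma k_eq:
  assumes "k < 5" "k' < 5" "(k = 0) = (k' = 0)" "k \<in> {0, 2, 4} \<longleftrightarrow> k' \<in> {0, 2, 4}" "k \<in> {3, 4} \<longleftrightarrow> k' \<in> {3, 4}"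
  shows "k = (k' :: nat)"
  using assms(1,2) by (elim nat_less_5_cases) (use assms in auto)

lemma state_index_eq:
  assumes N: "N \<subseteq> C0" "N' \<subseteq> C0" and k: "k < 5" "k' < 5"
    and e: "ct \<in> st N k \<longleftrightarrow> ct \<in> st N' k'" "cs \<in> st N k \<longleftrightarrow> cs \<in> st N' k'" "cw \<in> st N k \<longleftrightarrow> cw \<in> st N' k'"
  shows "k = k'"
proof (rule k_eq[OF k])
  show "(k = 0) = (k' = 0)" using e(1) unfolding st_mem(1)[OF N(1)] st_mem(1)[OF N(2)] by (cases b) auto
  show "k \<in> {0, 2, 4} \<longleftrightarrow> k' \<in> {0, 2, 4}" using e(2) unfolding st_mem(2)[OF N(1)] st_mem(2)[OF N(2)] .
  show "k \<in> {3, 4} \<longleftrightarrow> k' \<in> {3, 4}" using e(3) unfolding st_mem(3)[OF N(1)] st_mem(3)[OF N(2)] .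
qed

lemma st_not_circle: "N \<subseteq> C0 ==> Y \<notin> comps (st N k)"
  using circ[OF st_chords] st_mem by auto

lemma st_in_rest: "N \<subseteq> C0 ==> (st N k, False) \<in> square_rest CC cw cs"
  using st_chords[of N k] st_mem[where N=N and k=k] by (auto simp: square_rest_def)

lemma st_bij: "bij_betw (\<lambda>z. (st (fst z) (snd z), False)) {(N, k). N \<subseteq> C0 \<and> k < 5} (square_rest CC cw cs)"
  unfolding bij_betw_def
proof
  show "inj_on (\<lambda>z. (st (fst z) (snd z), False)) {(N, k). N \<subseteq> C0 \<and> k < 5}"
  proof (rule inj_onI)
    fix y z assume "y \<in> {(N, k). N \<subseteq> C0 \<and> k < 5}" "z \<in> {(N, k). N \<subseteq> C0 \<and> k < 5}"
      and eq: "(st (fst y) (snd y), False) = (st (fst z) (snd z), False)"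
    then obtain N k N' k' where yz: "y = (N, k)" "z = (N', k')" and N: "N \<subseteq> C0" "k < 5" "N' \<subseteq> C0" "k' < 5" by auto
    have e: "st N k = st N' k'" using eq by (simp add: yz)
    have "k = k'" by (rule state_index_eq[OF N(1,3,2,4)]) (simp_all add: e)
    moreover have "x \<in> N \<longleftrightarrow> x \<in> N'" if "x \<in> C0" for x
      using st_mem(4)[OF N(1) that, of k] st_mem(4)[OF N(3) that, of k'] e by simp
    ultimately show "y = z" using N yz by blast
  qed
  show "(\<lambda>z. (st (fst z) (snd z), False)) ` {(N, k). N \<subseteq> C0 \<and> k < 5} = square_rest CC cw cs"
  proof (intro equalityI subsetI)
    fix t assume "t \<in> (\<lambda>z. (st (fst z) (snd z), False)) ` {(N, k). N \<subseteq> C0 \<and> k < 5}"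
    then show "t \<in> square_rest CC cw cs" using st_in_rest by auto
  next
    fix t assume "t \<in> square_rest CC cw cs"
    then obtain M where t: "t = (M, False)" and M: "M \<subseteq> chords D" "CC M \<longrightarrow> cs \<in> M \<and> cw \<notin> M"
      by (auto simp: square_rest_def)
    define N where "N = {x \<in> C0. \<phi> x \<in> M}"
    define k :: nat where "k = (if CC M then 0 else if cs \<in> M then if cw \<in> M then 4 else 2 else if cw \<in> M then 3 else 1)"
    have N: "N \<subseteq> C0" by (auto simp: N_def)
    have "st N k = M"
      by (rule state_eqI[OF st_chords[OF N] M(1)])
        (use st_mem[OF N, where k=k] M(2) in \<open>auto simp: k_def N_def split: if_splits\<close>)
    moreover have "k < 5" by (simp add: k_def)
    ultimately show "t \<in> (\<lambda>z. (st (fst z) (snd z), False)) ` {(N, k). N \<subseteq> C0 \<and> k < 5}"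
      using N t by (intro image_eqI[of _ _ "(N, k)"]) auto
  qed
qed

lemma sg_local:
  assumes "N \<subseteq> C0" "c \<in> {ct, cs, cw}" "A \<subseteq> {ct, cs, cw}"
  shows "sg (\<phi> ` N \<union> A) c = (-1) ^ card {c' \<in> A. num c < num c'}"
proof -
  have "\<not> num c < num (\<phi> x)" if "x \<in> N" for x
    using num_outer[of x] num3 assms(1,2) that by (auto simp: subset_iff dest: less_trans)
  then have "{c' \<in> \<phi> ` N \<union> A. num c < num c'} = {c' \<in> A. num c < num c'}" by auto
  then show ?thesis by (simp add: order_sign_def)
qed

lemma finite_C0: "finite C0"
  using \<phi> finite_chords bij_betw_finite by blast

lemma sg_outer:
  assumes N: "N \<subseteq> C0" and x: "x \<in> C0" and k: "k < 5"
  shows "sg (st N k) (\<phi> x) = tri_sign b k * sg (\<phi> ` N) (\<phi> x)"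
proof -
  have big: "num (\<phi> x) < num c" if "c \<in> {ct, cs, cw}" for c
    using num_outer[OF x] num3 that by auto
  have l: "loc k \<subseteq> {ct, cs, cw}" by (auto simp: tri_loc_def)
  have d: "\<phi> ` N \<inter> loc k = {}" using \<phi>_outer N by (force simp: tri_loc_def)
  have e: "{c' \<in> st N k. num (\<phi> x) < num c'} = {c' \<in> \<phi> ` N. num (\<phi> x) < num c'} \<union> loc k"
    using big l by (auto simp: st_def)
  have "finite N" using N finite_C0 by (rule finite_subset)
  then have "card {c' \<in> st N k. num (\<phi> x) < num c'} = card {c' \<in> \<phi> ` N. num (\<phi> x) < num c'} + card (loc k)"
    unfolding e using d l by (intro card_Un_disjoint) (auto intro: finite_subset)
  moreover have "(-1) ^ card (loc k) = tri_sign b k"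
  proof -
    have "loc k = (if (k = 0) = b then {ct} else {}) \<union> (if k \<in> {0, 2, 4} then {cs} else {}) \<union> (if k \<in> {3, 4} then {cw} else {})"
      by (auto simp: tri_loc_def)
    then show ?thesis using k ne3 by (cases b; elim nat_less_5_cases) (auto simp: tri_sign_def)
  qed
  ultimately show ?thesis by (simp add: order_sign_def power_add)
qed

lemma entry_st:
  assumes "M \<subseteq> chords D" "c \<in> chords D" "c \<notin> M" "M' = insert c M" "Y \<notin> comps M" "Y \<notin> comps M'"
  shows "entry (sites sg) (M', False) (M, False) = of_int (sg M c) * saddle (E M) (E M')"
  using entry_edge[of c M sg False False] assms by (simp add: model_factor_def)

abbreviation "zig t s0 \<equiv> (\<Sum>s\<in>square_source CC cs. entry (sites sg) t s * of_int (square_sign sg cw cs s)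
            * entry (sites sg) (square_match cw cs s) s0)"

lemma zig_term:
  assumes N: "N1 \<subseteq> C0" "N0 \<subseteq> C0" and k: "k1 < 5" "k0 < 5" and s: "s \<in> square_source CC cs"
    and nz: "entry (sites sg) (st N1 k1, False) s \<noteq> 0" "entry (sites sg) (square_match cw cs s) (st N0 k0, False) \<noteq> 0"
  shows "N1 = N0 \<and> s = (\<phi> ` N0 \<union> {if b then ct else cw}, False) \<and> (if b then k0 = 3 \<and> k1 = 0 else k0 = 0 \<and> k1 = 3)"
proof -
  obtain A where A: "s = (A, False)" "A \<subseteq> chords D" "CC A" "cs \<notin> A" using s by (auto simp: square_source_def)
  obtain x where x: "x \<in> chords D" "x \<notin> A" "st N1 k1 = insert x A"
    using nz(1) by (rule entry_nonzero) (auto simp: A)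
  obtain y where y: "y \<in> chords D" "y \<notin> st N0 k0" "insert (if cw \<in> A then cs else cw) A = insert y (st N0 k0)"
    using nz(2) by (rule entry_nonzero) (auto simp: A square_match_def split: if_splits)
  note m1 = st_mem[OF N(1), where k=k1] and m0 = st_mem[OF N(2), where k=k0]
  have X: "ct \<in> st N1 k1 \<longleftrightarrow> ct = x \<or> ct \<in> A" "cs \<in> st N1 k1 \<longleftrightarrow> cs = x \<or> cs \<in> A" "cw \<in> st N1 k1 \<longleftrightarrow> cw = x \<or> cw \<in> A"
    using x(3) by auto
  have Yy: "c \<in> insert (if cw \<in> A then cs else cw) A \<longleftrightarrow> c = y \<or> c \<in> st N0 k0" for c
    using y(3) by auto
  have Yt: "ct \<in> A \<longleftrightarrow> ct = y \<or> ct \<in> st N0 k0" using Yy[of ct] ne3 by (auto split: if_splits)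
  have key: "x \<in> {ct, cs, cw} \<and> y \<in> {ct, cs, cw} \<and> (if b then k0 = 3 \<and> k1 = 0 \<and> cw \<notin> A else k0 = 0 \<and> k1 = 3 \<and> cw \<in> A)"
  proof (cases b)
    case True
    then have "ct \<in> A" using A(3) by simp
    then have "k1 = 0" using X(1) m1(1) True by auto
    then have "cs = x" "cw \<notin> A" using X(2,3) m1(2,3) A(4) by auto
    moreover have "k0 \<noteq> 0" using Yy[of cs] \<open>cw \<notin> A\<close> A(4) m0(2) ne3 by auto
    then have "ct = y" using Yt \<open>ct \<in> A\<close> m0(1) True by auto
    moreover have "k0 = 3" using Yy[of cs] Yy[of cw] \<open>cw \<notin> A\<close> \<open>ct = y\<close> A(4) m0(2,3) ne3 by auto
    ultimately show ?thesis using True \<open>k1 = 0\<close> by auto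
  next
    case False
    then have "ct \<notin> A" using A(3) by simp
    then have "ct \<notin> st N0 k0" using Yt by auto
    then have "k0 = 0" using m0(1) False by auto
    then have "cw \<in> A" using Yy[of cs] A(4) m0(2) ne3 by (auto split: if_splits)
    then have "y = cw" using Yy[of cw] m0(3) \<open>k0 = 0\<close> by auto
    have "cw \<in> st N1 k1" using X(3) \<open>cw \<in> A\<close> by simp
    then have "k1 \<in> {3, 4}" using m1(3) by simp
    then have "ct \<in> st N1 k1" using m1(1) False by auto
    then have "x = ct" using X(1) \<open>ct \<notin> A\<close> by auto
    then have "cs \<notin> st N1 k1" using X(2) A(4) ne3 by auto
    then have "k1 = 3" using m1(2) \<open>k1 \<in> {3, 4}\<close> by auto
    then show ?thesis using False \<open>k0 = 0\<close> \<open>cw \<in> A\<close> \<open>x = ct\<close> \<open>y = cw\<close> by simp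
  qed
  have o1: "z \<in> N1 \<longleftrightarrow> \<phi> z \<in> A" and o0: "z \<in> N0 \<longleftrightarrow> \<phi> z \<in> A" if z: "z \<in> C0" for z
  proof -
    have n: "\<phi> z \<noteq> x" "\<phi> z \<noteq> y" "\<phi> z \<noteq> cs" "\<phi> z \<noteq> cw" "\<phi> z \<noteq> ct" using key \<phi>_outer[OF z] by auto
    show "z \<in> N1 \<longleftrightarrow> \<phi> z \<in> A" using m1(4)[OF z] x(3) n by auto
    show "z \<in> N0 \<longleftrightarrow> \<phi> z \<in> A" using m0(4)[OF z] Yy[of "\<phi> z"] n by (auto split: if_splits)
  qed
  have "N1 = N0" using o1 o0 N by blast
  moreover have "A = \<phi> ` N0 \<union> {if b then ct else cw}"
  proof (rule state_eqI[OF A(2)])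
    have out: "ct \<notin> \<phi> ` N0" "cs \<notin> \<phi> ` N0" "cw \<notin> \<phi> ` N0" using \<phi>_outer N(2) by blast+
    show "\<phi> ` N0 \<union> {if b then ct else cw} \<subseteq> chords D" using \<phi>_outer N(2) chords3 by auto
    show "ct \<in> A \<longleftrightarrow> ct \<in> \<phi> ` N0 \<union> {if b then ct else cw}" using A(3) out ne3 by auto
    show "cs \<in> A \<longleftrightarrow> cs \<in> \<phi> ` N0 \<union> {if b then ct else cw}" using A(4) out ne3 by auto
    show "cw \<in> A \<longleftrightarrow> cw \<in> \<phi> ` N0 \<union> {if b then ct else cw}" using key out ne3 by (auto split: if_splits)
    fix z assume z: "z \<in> C0"
    have "\<phi> z \<in> \<phi> ` N0 \<longleftrightarrow> z \<in> N0" using \<phi>_eq z N(2) by blast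
    then show "\<phi> z \<in> A \<longleftrightarrow> \<phi> z \<in> \<phi> ` N0 \<union> {if b then ct else cw}" using o0[OF z] \<phi>_outer[OF z] by auto
  qed
  ultimately show ?thesis using key A(1) by (simp split: if_splits)
qed

lemma zig_zero:
  assumes N: "N1 \<subseteq> C0" "N0 \<subseteq> C0" and k: "k1 < 5" "k0 < 5"
    and n: "\<not> (N1 = N0 \<and> (if b then k0 = 3 \<and> k1 = 0 else k0 = 0 \<and> k1 = 3))"
  shows "zig (st N1 k1, False) (st N0 k0, False) = 0"
proof (rule sum.neutral, rule ballI)
  fix s assume s: "s \<in> square_source CC cs"
  have "entry (sites sg) (st N1 k1, False) s = 0 \<or> entry (sites sg) (square_match cw cs s) (st N0 k0, False) = 0"
    using zig_term[OF N k s] n by blast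
  then show "entry (sites sg) (st N1 k1, False) s * of_int (square_sign sg cw cs s)
      * entry (sites sg) (square_match cw cs s) (st N0 k0, False) = 0" by auto
qed

lemma finite_source: "finite (square_source CC cs)"
proof -
  have "square_source CC cs \<subseteq> support (sites sg)" by (auto simp: square_source_def model_sites_def)
  then show ?thesis using finite_support by (rule finite_subset)
qed

text \<open>The zigzag through the cancelled circle replaces the missing saddle.\<close>

lemma zig_special:
  assumes N: "N \<subseteq> C0" and k: "if b then k0 = 3 \<and> k1 = 0 else k0 = 0 \<and> k1 = 3"
  shows "zig (st N k1, False) (st N k0, False) = (if b then -1 else 1) * saddle (E (st N k0)) (E (st N k1))"
proof -
  let ?A = "\<phi> ` N \<union> {if b then ct else cw}"
  let ?h = "\<lambda>s. entry (sites sg) (st N k1, False) s * of_int (square_sign sg cw cs s)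
    * entry (sites sg) (square_match cw cs s) (st N k0, False)"
  have k5: "k1 < 5" "k0 < 5" using k by (auto split: if_splits)
  have out: "ct \<notin> \<phi> ` N" "cs \<notin> \<phi> ` N" "cw \<notin> \<phi> ` N" using \<phi>_outer N by blast+
  have sub: "\<phi> ` N \<subseteq> chords D" using \<phi>_outer N by blast
  have A: "(?A, False) \<in> square_source CC cs" using sub chords3 out ne3 by (auto simp: square_source_def)
  have "zig (st N k1, False) (st N k0, False) = ?h (?A, False)"
  proof (rule sum_eq_single[OF finite_source A])
    fix s assume "s \<in> square_source CC cs" "s \<noteq> (?A, False)"
    then have "entry (sites sg) (st N k1, False) s = 0 \<or> entry (sites sg) (square_match cw cs s) (st N k0, False) = 0"
      using zig_term[OF N N k5] by blast
    then show "?h s = 0" by auto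
  qed
  also have "?h (?A, False) = (if b then -1 else 1) * saddle (E (st N k0)) (E (st N k1))"
  proof (cases b)
    case True
    let ?B = "\<phi> ` N"
    have kk: "k0 = 3" "k1 = 0" using k True by auto
    have s0: "st N k0 = insert cw ?B" and s1: "st N k1 = insert cs (insert ct ?B)"
      unfolding st_def loc_values kk using True by (simp_all add: insert_commute)
    have Aeq: "?A = insert ct ?B" using True by simp
    have c0: "Y \<notin> comps (insert ct ?B)" "Y \<in> comps (insert cw (insert ct ?B))" "Y \<notin> comps (insert cw ?B)"
      "Y \<notin> comps (insert cs (insert ct ?B))"
      using circ[of "insert ct ?B"] circ[of "insert cw (insert ct ?B)"] circ[of "insert cw ?B"]
        circ[of "insert cs (insert ct ?B)"] sub chords3 out ne3 True by auto
    have comm: "insert cw (insert ct ?B) = insert ct (insert cw ?B)" by auto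
    have e1: "entry (sites sg) (insert cs (insert ct ?B), False) (insert ct ?B, False)
        = of_int (sg (insert ct ?B) cs) * saddle (E (insert ct ?B)) (E (insert cs (insert ct ?B)))"
      by (rule entry_st) (use sub chords3 out ne3 c0 in auto)
    have e2: "entry (sites sg) (insert ct (insert cw ?B), True) (insert cw ?B, False) = of_int (sg (insert cw ?B) ct)"
      using entry_edge[of ct "insert cw ?B" sg True False] chords3 out ne3 c0 by (simp add: model_factor_def comm)
    have r1: "E (insert cw (insert ct ?B)) = E (insert ct ?B)"
      by (rule circle_edge_rel) (use sub chords3 out ne3 c0 in auto)
    have r2: "E (insert ct (insert cw ?B)) = E (insert cw ?B)"
      by (rule circle_edge_rel) (use sub chords3 out ne3 c0 comm in auto)
    have g1: "sg (insert ct ?B) cs = 1" "sg (insert ct ?B) cw = 1" "sg (insert cw ?B) ct = - 1"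
    proof -
      have z: "{c'. c' = ct \<and> num cs < num c'} = {}" "{c'. c' = ct \<and> num cw < num c'} = {}" "{c'. c' = cw \<and> num ct < num c'} = {cw}"
        using num3 by auto
      show "sg (insert ct ?B) cs = 1" using sg_local[OF N, of cs "{ct}"] z by simp
      show "sg (insert ct ?B) cw = 1" using sg_local[OF N, of cw "{ct}"] z by simp
      show "sg (insert cw ?B) ct = - 1" using sg_local[OF N, of ct "{cw}"] z by simp
    qed
    have mt: "square_match cw cs (insert ct ?B, False) = (insert ct (insert cw ?B), True)"
      "square_sign sg cw cs (insert ct ?B, False) = sg (insert ct ?B) cw"
      using out ne3 comm by (auto simp: square_match_def square_sign_def)
    show ?thesis using True r1 r2 comm unfolding Aeq s0 s1 mt e1 e2 g1 by simp
  next
    case False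
    let ?B = "\<phi> ` N"
    have kk: "k0 = 0" "k1 = 3" using k False by auto
    have s0: "st N k0 = insert cs ?B" and s1: "st N k1 = insert ct (insert cw ?B)"
      unfolding st_def loc_values kk using False by (simp_all add: insert_commute)
    have Aeq: "?A = insert cw ?B" using False by simp
    have c0: "Y \<in> comps (insert cw ?B)" "Y \<notin> comps (insert cs ?B)" "Y \<notin> comps (insert cs (insert cw ?B))"
      "Y \<notin> comps (insert ct (insert cw ?B))"
      using circ[of "insert cw ?B"] circ[of "insert cs ?B"] circ[of "insert cs (insert cw ?B)"]
        circ[of "insert ct (insert cw ?B)"] sub chords3 out ne3 False by auto
    have comm: "insert cs (insert cw ?B) = insert cw (insert cs ?B)" by auto
    have e1: "entry (sites sg) (insert ct (insert cw ?B), False) (insert cw ?B, False) = of_int (sg (insert cw ?B) ct)"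
      using entry_edge[of ct "insert cw ?B" sg False False] chords3 out ne3 c0 by (simp add: model_factor_def)
    have e2: "entry (sites sg) (insert cw (insert cs ?B), False) (insert cs ?B, False)
        = of_int (sg (insert cs ?B) cw) * saddle (E (insert cs ?B)) (E (insert cw (insert cs ?B)))"
      by (rule entry_st) (use sub chords3 out ne3 c0 comm in auto)
    have r1: "E (insert cs (insert cw ?B)) = E (insert cw ?B)"
      by (rule circle_edge_rel) (use sub chords3 out ne3 c0 in auto)
    have r2: "E (insert ct (insert cw ?B)) = E (insert cw ?B)"
      by (rule circle_edge_rel) (use sub chords3 out ne3 c0 in auto)
    have g1: "sg (insert cw ?B) ct = - 1" "sg (insert cw ?B) cs = - 1" "sg (insert cs ?B) cw = 1"
    proof -
      have z: "{c'. c' = cw \<and> num cs < num c'} = {cw}" "{c'. c' = cs \<and> num cw < num c'} = {}" "{c'. c' = cw \<and> num ct < num c'} = {cw}"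
        using num3 by auto
      show "sg (insert cw ?B) ct = - 1" using sg_local[OF N, of ct "{cw}"] z by simp
      show "sg (insert cw ?B) cs = - 1" using sg_local[OF N, of cs "{cw}"] z by simp
      show "sg (insert cs ?B) cw = 1" using sg_local[OF N, of cw "{cs}"] z by simp
    qed
    have mt: "square_match cw cs (insert cw ?B, False) = (insert cw (insert cs ?B), False)"
      "square_sign sg cw cs (insert cw ?B, False) = sg (insert cw ?B) cs"
      using comm by (simp_all add: square_match_def square_sign_def)
    show ?thesis using False r1 r2 comm unfolding Aeq s0 s1 mt e1 e2 g1 by simp
  qed
  finally show ?thesis .
qed

lemma entry_local:
  assumes N: "N \<subseteq> C0" and k: "k1 < 5" "k0 < 5"
    and n: "\<not> (if b then k0 = 3 \<and> k1 = 0 else k0 = 0 \<and> k1 = 3)"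
  shows "entry (sites sg) (st N k1, False) (st N k0, False) = of_int (tri_tab b k1 k0) * saddle (E (st N k0)) (E (st N k1))"
proof -
  note m1 = st_mem[OF N, where k=k1] and m0 = st_mem[OF N, where k=k0]
  have edge: "entry (sites sg) (st N k1, False) (st N k0, False) = of_int ((-1) ^ card {c' \<in> loc k0. num c < num c'}) * saddle (E (st N k0)) (E (st N k1))"
    if c: "c \<in> {ct, cs, cw}" "c \<notin> loc k0" "loc k1 = insert c (loc k0)" for c
  proof -
    have cN: "c \<notin> \<phi> ` N" using c(1) \<phi>_outer N by blast
    have "sg (st N k0) c = (-1) ^ card {c' \<in> loc k0. num c < num c'}"
      unfolding st_def by (rule sg_local[OF N c(1)]) (auto simp: tri_loc_def)
    moreover have "entry (sites sg) (st N k1, False) (st N k0, False) = of_int (sg (st N k0) c) * saddle (E (st N k0)) (E (st N k1))"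
    proof (rule entry_st[OF st_chords[OF N] _ _ _ st_not_circle[OF N] st_not_circle[OF N]])
      show "c \<in> chords D" using c(1) chords3 by auto
      show "c \<notin> st N k0" unfolding st_def using c(2) cN by simp
      show "st N k1 = insert c (st N k0)" unfolding st_def c(3) by simp
    qed
    ultimately show ?thesis by simp
  qed
  have non: "entry (sites sg) (st N k1, False) (st N k0, False) = 0" if "tri_tab b k1 k0 = 0"
  proof (rule ccontr)
    assume "entry (sites sg) (st N k1, False) (st N k0, False) \<noteq> 0"
    then obtain c where c: "c \<in> chords D" "c \<notin> st N k0" "st N k1 = insert c (st N k0)"
      by (rule entry_nonzero) auto
    have X: "ct \<in> st N k1 \<longleftrightarrow> ct = c \<or> ct \<in> st N k0" "cs \<in> st N k1 \<longleftrightarrow> cs = c \<or> cs \<in> st N k0" "cw \<in> st N k1 \<longleftrightarrow> cw = c \<or> cw \<in> st N k0"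
      using c(3) by auto
    from c(1) have "c \<in> {ct, cs, cw}"
    proof (cases rule: chord_cases)
      case (4 x)
      have "\<phi> x \<in> st N k1" using c(3) 4(2) by simp
      then have "\<phi> x \<in> st N k0" using m0(4)[OF 4(1)] m1(4)[OF 4(1)] by simp
      then show ?thesis using c(2) 4(2) by simp
    qed auto
    then have "c = ct \<or> c = cs \<or> c = cw" by blast
    moreover have "ct = c \<longrightarrow> ct \<notin> st N k0" "cs = c \<longrightarrow> cs \<notin> st N k0" "cw = c \<longrightarrow> cw \<notin> st N k0" using c(2) by auto
    ultimately have "ct \<in> st N k1 \<and> ct \<notin> st N k0 \<and> (cs \<in> st N k1) = (cs \<in> st N k0) \<and> (cw \<in> st N k1) = (cw \<in> st N k0) \<or>
      (ct \<in> st N k1) = (ct \<in> st N k0) \<and> cs \<in> st N k1 \<and> cs \<notin> st N k0 \<and> (cw \<in> st N k1) = (cw \<in> st N k0) \<or>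
      (ct \<in> st N k1) = (ct \<in> st N k0) \<and> (cs \<in> st N k1) = (cs \<in> st N k0) \<and> cw \<in> st N k1 \<and> cw \<notin> st N k0"
      using X ne3 by metis
    then have "tri_tab b k1 k0 \<noteq> 0" unfolding m1(1-3) m0(1-3) by (rule tri_tab_step[OF k n])
    then show False using that by contradiction
  qed
  note L = loc_values
  have FF: "{c' \<in> insert x A. P c'} = (if P x then insert x {c' \<in> A. P c'} else {c' \<in> A. P c'})"
    "{c'. c' = x \<and> P c'} = (if P x then {x} else {})"
    "{c'. (c' = x \<or> c' = y) \<and> P c'} = (if P x then {x} else {}) \<union> (if P y then {y} else {})" for x y :: "'p set" and A P
    by auto
  have num': "num ct < num cw" using num3 by simp
  have nn: "\<not> num cs < num ct" "\<not> num cw < num cs" "\<not> num cw < num ct" using num3 by auto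
  show ?thesis
  proof (cases "tri_tab b k1 k0 = 0")
    case True then show ?thesis using non by simp
  next
    case False
    then consider "k0 = 1" "k1 = 2" | "k0 = 1" "k1 = 3" | "k0 = 2" "k1 = 4" | "k0 = 3" "k1 = 4"
      | "\<not> b" "k0 = 0" "k1 = 2" | "b" "k0 = 2" "k1 = 0"
      using n by (auto simp: tri_tab_def split: if_splits)
    then show ?thesis
    proof cases
      case 1
      have "cs \<notin> loc k0" "loc k1 = insert cs (loc k0)" "(-1) ^ card {c' \<in> loc k0. num cs < num c'} = tri_tab b k1 k0"
        unfolding 1 loc_values by (simp_all add: insert_commute FF tri_tab_def ne3 num3 num' nn)
      then show ?thesis using edge[of cs] by simp
    next
      case 2
      have "cw \<notin> loc k0" "loc k1 = insert cw (loc k0)" "(-1) ^ card {c' \<in> loc k0. num cw < num c'} = tri_tab b k1 k0"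
        unfolding 2 loc_values by (simp_all add: insert_commute FF tri_tab_def ne3 num3 num' nn)
      then show ?thesis using edge[of cw] by simp
    next
      case 3
      have "cw \<notin> loc k0" "loc k1 = insert cw (loc k0)" "(-1) ^ card {c' \<in> loc k0. num cw < num c'} = tri_tab b k1 k0"
        unfolding 3 loc_values by (simp_all add: insert_commute FF tri_tab_def ne3 num3 num' nn)
      then show ?thesis using edge[of cw] by simp
    next
      case 4
      have "cs \<notin> loc k0" "loc k1 = insert cs (loc k0)" "(-1) ^ card {c' \<in> loc k0. num cs < num c'} = tri_tab b k1 k0"
        unfolding 4 loc_values by (simp_all add: insert_commute FF tri_tab_def ne3 num3 num' nn)
      then show ?thesis using edge[of cs] by simp
    next
      case 5
      have "ct \<notin> loc k0" "loc k1 = insert ct (loc k0)" "(-1) ^ card {c' \<in> loc k0. num ct < num c'} = tri_tab b k1 k0"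
        unfolding 5(2,3) loc_values using 5(1) by (simp_all add: insert_commute FF tri_tab_def ne3 num3 num' nn)
      then show ?thesis using edge[of ct] by simp
    next
      case 6
      have "ct \<notin> loc k0" "loc k1 = insert ct (loc k0)" "(-1) ^ card {c' \<in> loc k0. num ct < num c'} = tri_tab b k1 k0"
        unfolding 6(2,3) loc_values using 6(1) by (simp_all add: insert_commute FF tri_tab_def ne3 num3 num' nn)
      then show ?thesis using edge[of ct] by simp
    qed
  qed
qed

lemma reduced_local:
  assumes N: "N \<subseteq> C0" and k: "k1 < 5" "k0 < 5"
  shows "entry (sites sg) (st N k1, False) (st N k0, False) - zig (st N k1, False) (st N k0, False)
    = of_int (tri_tab b k1 k0) * saddle (E (st N k0)) (E (st N k1))"
proof (cases "if b then k0 = 3 \<and> k1 = 0 else k0 = 0 \<and> k1 = 3")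
  case False
  then show ?thesis using entry_local[OF N k] zig_zero[OF N N k] by simp
next
  case True
  have "entry (sites sg) (st N k1, False) (st N k0, False) = 0"
  proof (rule ccontr)
    assume "entry (sites sg) (st N k1, False) (st N k0, False) \<noteq> 0"
    then obtain c where c: "c \<in> chords D" "c \<notin> st N k0" "st N k1 = insert c (st N k0)"
      by (rule entry_nonzero) auto
    have "cs \<in> st N k0 \<or> cw \<in> st N k0" "cs \<in> st N k0 \<longrightarrow> cs \<in> st N k1" "cw \<in> st N k0 \<longrightarrow> cw \<in> st N k1"
      using c(3) True st_mem[OF N, where k=k0] by (auto split: if_splits)
    then show False using True st_mem[OF N, where k=k0] st_mem[OF N, where k=k1] by (auto split: if_splits)
  qed
  then show ?thesis using zig_special[OF N True] True by (cases b) (simp_all add: tri_tab_def)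
qed

lemma reduced_outer:
  assumes N: "N1 \<subseteq> C0" "N0 \<subseteq> C0" and k: "k1 < 5" "k0 < 5" and ne: "N1 \<noteq> N0"
  shows "entry (sites sg) (st N1 k1, False) (st N0 k0, False) - zig (st N1 k1, False) (st N0 k0, False)
    = (if k1 = k0 \<and> (\<exists>x\<in>C0 - N0. N1 = insert x N0)
       then of_int (tri_sign b k0 * sg (\<phi> ` N0) (\<phi> (THE x. x \<notin> N0 \<and> N1 = insert x N0))) * saddle (E (st N0 k0)) (E (st N1 k1))
       else 0)"
proof -
  have z: "zig (st N1 k1, False) (st N0 k0, False) = 0" by (rule zig_zero[OF N k]) (use ne in simp)
  note m1 = st_mem[OF N(1), where k=k1] and m0 = st_mem[OF N(2), where k=k0]
  show ?thesis
  proof (cases "k1 = k0 \<and> (\<exists>x\<in>C0 - N0. N1 = insert x N0)")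
    case True
    then obtain x where x: "x \<in> C0" "x \<notin> N0" "N1 = insert x N0" and kk: "k1 = k0" by blast
    have the: "(THE x. x \<notin> N0 \<and> N1 = insert x N0) = x" using x by (intro the_equality) auto
    have "entry (sites sg) (st N1 k1, False) (st N0 k0, False) = of_int (sg (st N0 k0) (\<phi> x)) * saddle (E (st N0 k0)) (E (st N1 k1))"
    proof (rule entry_st[OF st_chords[OF N(2)] _ _ _ st_not_circle[OF N(2)] st_not_circle[OF N(1)]])
      show "\<phi> x \<in> chords D" using \<phi>_outer[OF x(1)] by simp
      show "\<phi> x \<notin> st N0 k0" using m0(4)[OF x(1)] x(2) by simp
      show "st N1 k1 = insert (\<phi> x) (st N0 k0)" unfolding st_def kk x(3) by simp
    qed
    then show ?thesis using True z sg_outer[OF N(2) x(1) k(2)] unfolding the by simp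
  next
    case False
    have "entry (sites sg) (st N1 k1, False) (st N0 k0, False) = 0"
    proof (rule ccontr)
      assume "entry (sites sg) (st N1 k1, False) (st N0 k0, False) \<noteq> 0"
      then obtain c where c: "c \<in> chords D" "c \<notin> st N0 k0" "st N1 k1 = insert c (st N0 k0)"
        by (rule entry_nonzero) auto
      have X: "c' \<in> st N1 k1 \<longleftrightarrow> c' = c \<or> c' \<in> st N0 k0" for c' using c(3) by auto
      have loc: "N1 = N0" if "c \<in> {ct, cs, cw}"
      proof -
        have "x \<in> N1 \<longleftrightarrow> x \<in> N0" if "x \<in> C0" for x
        proof -
          have "\<phi> x \<noteq> c" using \<phi>_outer[OF that] \<open>c \<in> {ct, cs, cw}\<close> by blast
          then show ?thesis using X[of "\<phi> x"] m1(4)[OF that] m0(4)[OF that] by simp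
        qed
        then show ?thesis using N by blast
      qed
      from c(1) show False
      proof (cases rule: chord_cases)
        case (4 x)
        have "ct \<noteq> c" "cs \<noteq> c" "cw \<noteq> c" using \<phi>_outer[OF 4(1)] unfolding 4(2) by metis+
        then have "ct \<in> st N1 k1 \<longleftrightarrow> ct \<in> st N0 k0" "cs \<in> st N1 k1 \<longleftrightarrow> cs \<in> st N0 k0" "cw \<in> st N1 k1 \<longleftrightarrow> cw \<in> st N0 k0"
          using X by simp_all
        then have "k1 = k0" by (rule state_index_eq[OF N k])
        moreover have "y \<in> N1 \<longleftrightarrow> y \<in> insert x N0" if "y \<in> C0" for y
          using X[of "\<phi> y"] unfolding m1(4)[OF that] m0(4)[OF that] 4(2) \<phi>_eq[OF that 4(1)] by simp
        then have "N1 = insert x N0" using N 4(1) by blast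
        moreover have "x \<notin> N0" using c(2) 4 m0(4)[OF 4(1)] by simp
        ultimately show False using False 4(1) by blast
      qed (use loc ne in auto)
    qed
    then show ?thesis unfolding z if_not_P[OF False] by simp
  qed
qed

lemma valid_edge:
  assumes s: "M0 \<subseteq> chords D" "c \<in> chords D" "c \<notin> M0" "Y \<notin> comps M0" "Y \<notin> comps (insert c M0)"
    and a: "a \<in> {1, -1}"
  shows "\<nu> \<in> Poly_Mapping.keys (of_int a * saddle (E M0) (E (insert c M0))) ==>
      sdeg (sites sg) (insert c M0, False) = (fst (sdeg (sites sg) (M0, False)) + 1, snd (sdeg (sites sg) (M0, False)) + 2 * int (size \<nu>))"
    and "p \<in> rel_ideal (E M0) ==> of_int a * saddle (E M0) (E (insert c M0)) * p \<in> rel_ideal (E (insert c M0))"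
proof -
  have v: "valid_sites (sites (\<lambda>_ _. a))" by (rule valid_model_sites) (use a in auto)
  have e: "entry (sites (\<lambda>_ _. a)) (insert c M0, False) (M0, False) = of_int a * saddle (E M0) (E (insert c M0))"
    using entry_edge[of c M0 "\<lambda>_ _. a" False False] s by (simp add: model_factor_def)
  have sup: "(M0, False) \<in> support (sites (\<lambda>_ _. a))" "(insert c M0, False) \<in> support (sites (\<lambda>_ _. a))"
    using s by (auto simp: model_sites_def)
  have d: "sdeg (sites (\<lambda>_ _. a)) = sdeg (sites sg)" "srel (sites (\<lambda>_ _. a)) (M, False) = E M" for M
    by (simp_all add: model_sites_def)
  note w = v[unfolded valid_sites_def, THEN conjunct2, rule_format, OF sup, unfolded e d]
  show "\<nu> \<in> Poly_Mapping.keys (of_int a * saddle (E M0) (E (insert c M0))) ==>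
      sdeg (sites sg) (insert c M0, False) = (fst (sdeg (sites sg) (M0, False)) + 1, snd (sdeg (sites sg) (M0, False)) + 2 * int (size \<nu>))"
    using w by blast
  show "p \<in> rel_ideal (E M0) ==> of_int a * saddle (E M0) (E (insert c M0)) * p \<in> rel_ideal (E (insert c M0))"
    using w by blast
qed

lemma degree_eq:
  assumes "M \<subseteq> chords D" "M' \<subseteq> chords D" "Y \<notin> comps M" "Y \<notin> comps M'" "E M = E M'" "card M = card M'"
  shows "sdeg (sites sg) (M, False) = sdeg (sites sg) (M', False)"
proof -
  have "card (comps M) = card (comps M')"
    using card_quotient_components[OF circle_model_axioms assms(1)] card_quotient_components[OF circle_model_axioms assms(2)] assms(3-5) by simp
  then show ?thesis using num_neg_pos[OF assms(1)] num_neg_pos[OF assms(2)] assms(6) by (simp add: model_sites_def)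
qed

text \<open>
  The zigzag entries have the same relations as an edge at the other end of which the circle is
  still attached, so that all entries are homogeneous and well defined.
\<close>

lemma valid_tri_sites:
  assumes F: "\<And>N k. N \<subseteq> C0 ==> k < 5 ==> F N k = E (st N k)"
    and dg: "\<And>N k. N \<subseteq> C0 ==> k < 5 ==> dg (N, k) = sdeg (sites sg) (st N k, False)"
    and os: "\<And>N x. N \<subseteq> C0 ==> x \<in> C0 - N ==> os N x \<in> {1, -1}"
  shows "valid_sites (tri_sites b C0 F dg os)"
proof -
  let ?Z = "tri_sites b C0 F dg os"
  have sup: "support ?Z = {(N, k). N \<subseteq> C0 \<and> k < 5}" by (simp add: tri_sites_def)
  define G where "G t s q \<longleftrightarrow> (\<forall>\<nu>\<in>Poly_Mapping.keys q. dg t = (fst (dg s) + 1, snd (dg s) + 2 * int (size \<nu>)))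
    \<and> (\<forall>p\<in>rel_ideal (srel ?Z s). q * p \<in> rel_ideal (srel ?Z t))" for t s and q :: "'v zpoly"
  have zero: "G t s 0" for t s by (simp add: G_def rel_ideal_0)
  have edge: "G (N1, k1) (N0, k0) (of_int a * saddle (F N0 k0) (F N1 k1))"
    if N: "N0 \<subseteq> C0" "N1 \<subseteq> C0" "k0 < 5" "k1 < 5" and c: "c \<in> chords D" "c \<notin> st N0 k0" "st N1 k1 = insert c (st N0 k0)"
      and a: "a \<in> {1, -1}" for N0 N1 k0 k1 c a
  proof -
    have f: "F N0 k0 = E (st N0 k0)" "F N1 k1 = E (insert c (st N0 k0))" using F N c(3) by simp_all
    have d: "dg (N0, k0) = sdeg (sites sg) (st N0 k0, False)" "dg (N1, k1) = sdeg (sites sg) (insert c (st N0 k0), False)"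
      using dg N c(3) by simp_all
    have Y0: "Y \<notin> comps (st N0 k0)" "Y \<notin> comps (insert c (st N0 k0))"
      using st_not_circle[OF N(1)] st_not_circle[OF N(2), of k1] c(3) by simp_all
    have r: "srel ?Z (N0, k0) = F N0 k0" "srel ?Z (N1, k1) = F N1 k1" by (simp_all add: tri_sites_def)
    note w = valid_edge[OF st_chords[OF N(1)] c(1,2) Y0 a]
    show ?thesis unfolding G_def r f d using w by blast
  qed
  have local: "G (N, k1) (N, k0) (of_int (tri_tab b k1 k0) * saddle (F N k0) (F N k1))" if N: "N \<subseteq> C0" and k: "k1 < 5" "k0 < 5" for N k1 k0
  proof (cases "tri_tab b k1 k0 = 0")
    case True then show ?thesis using zero by simp
  next
    case False
    then have a: "tri_tab b k1 k0 \<in> {1, -1}" by (auto simp: tri_tab_def split: if_splits)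
    have e: ?thesis if "c \<in> {ct, cs, cw}" "c \<notin> loc k0" "loc k1 = insert c (loc k0)" for c
    proof (rule edge[OF N N k(2,1) _ _ _ a])
      show "c \<in> chords D" using that(1) chords3 by auto
      have "c \<notin> \<phi> ` N" using that(1) \<phi>_outer N by blast
      then show "c \<notin> st N k0" unfolding st_def using that(2) by simp
      show "st N k1 = insert c (st N k0)" unfolding st_def that(3) by simp
    qed
    show ?thesis
    proof (cases "if b then k0 = 3 \<and> k1 = 0 else k0 = 0 \<and> k1 = 3")
      case True
      have out: "ct \<notin> \<phi> ` N" "cs \<notin> \<phi> ` N" "cw \<notin> \<phi> ` N" using \<phi>_outer N by blast+
      have sub: "\<phi> ` N \<subseteq> chords D" using \<phi>_outer N by blast
      have r: "srel ?Z (N, k0) = E (st N k0)" "srel ?Z (N, k1) = E (st N k1)"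
        using F[OF N k(2)] F[OF N k(1)] by (simp_all add: tri_sites_def)
      have near: ?thesis if M: "M \<subseteq> chords D" "Y \<notin> comps M" "E M = E (st N k)" "card M = card (st N k)"
          and c: "c \<in> chords D" "c \<notin> M" "Y \<notin> comps (insert c M)" "E (insert c M) = E (st N k')" "card (insert c M) = card (st N k')"
          and kk: "k = k0" "k' = k1" for M c k k'
      proof -
        note w = valid_edge[OF M(1) c(1,2) M(2) c(3) a]
        have "sdeg (sites sg) (M, False) = dg (N, k0)"
          using degree_eq[OF M(1) st_chords[OF N] M(2) st_not_circle[OF N] M(3,4)] dg[OF N k(2)] kk by simp
        moreover have "sdeg (sites sg) (insert c M, False) = dg (N, k1)"
          using degree_eq[OF _ st_chords[OF N] c(3) st_not_circle[OF N] c(4,5)] dg[OF N k(1)] M(1) c(1) kk by simp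
        ultimately show ?thesis using w M(3) c(4) F[OF N k(2)] F[OF N k(1)] unfolding G_def r kk by simp
      qed
      have fin: "finite (\<phi> ` N)" using sub finite_chords by (rule finite_subset)
      show ?thesis
      proof (cases b)
        case bt: True
        let ?B = "\<phi> ` N"
        have kk: "k0 = 3" "k1 = 0" using True bt by auto
        have s0: "st N 3 = insert cw ?B" and s1: "st N 0 = insert cs (insert ct ?B)"
          unfolding st_def loc_values using bt by (simp_all add: insert_commute)
        have c0: "Y \<notin> comps (insert ct ?B)" "Y \<in> comps (insert cw (insert ct ?B))" "Y \<notin> comps (insert cw ?B)"
          "Y \<notin> comps (insert cs (insert ct ?B))"
          using circ[of "insert ct ?B"] circ[of "insert cw (insert ct ?B)"] circ[of "insert cw ?B"]
            circ[of "insert cs (insert ct ?B)"] sub chords3 out ne3 bt by auto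
        have comm: "insert cw (insert ct ?B) = insert ct (insert cw ?B)" by auto
        have r1: "E (insert cw (insert ct ?B)) = E (insert ct ?B)"
          by (rule circle_edge_rel) (use sub chords3 out ne3 c0 in auto)
        have r2: "E (insert ct (insert cw ?B)) = E (insert cw ?B)"
          by (rule circle_edge_rel) (use sub chords3 out ne3 c0 comm in auto)
        show ?thesis
          by (rule near[of "insert ct ?B" 3 cs 0, unfolded s0 s1]) (use sub chords3 out ne3 c0 r1 r2 comm fin kk in simp_all)
      next
        case bf: False
        let ?B = "\<phi> ` N"
        have kk: "k0 = 0" "k1 = 3" using True bf by auto
        have s0: "st N 0 = insert cs ?B" and s1: "st N 3 = insert ct (insert cw ?B)"
          unfolding st_def loc_values using bf by (simp_all add: insert_commute)
        have c0: "Y \<in> comps (insert cw ?B)" "Y \<notin> comps (insert cs ?B)" "Y \<notin> comps (insert cs (insert cw ?B))"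
          "Y \<notin> comps (insert ct (insert cw ?B))"
          using circ[of "insert cw ?B"] circ[of "insert cs ?B"] circ[of "insert cs (insert cw ?B)"]
            circ[of "insert ct (insert cw ?B)"] sub chords3 out ne3 bf by auto
        have comm: "insert cs (insert cw ?B) = insert cw (insert cs ?B)" by auto
        have r1: "E (insert cs (insert cw ?B)) = E (insert cw ?B)"
          by (rule circle_edge_rel) (use sub chords3 out ne3 c0 in auto)
        have r2: "E (insert ct (insert cw ?B)) = E (insert cw ?B)"
          by (rule circle_edge_rel) (use sub chords3 out ne3 c0 in auto)
        show ?thesis
          by (rule near[of "insert cs ?B" 0 cw 3, unfolded s0 s1]) (use sub chords3 out ne3 c0 r1 r2 comm fin kk in simp_all)
      qed
    next
      case False
      then consider "k0 = 1" "k1 = 2" | "k0 = 1" "k1 = 3" | "k0 = 2" "k1 = 4" | "k0 = 3" "k1 = 4"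
        | "\<not> b" "k0 = 0" "k1 = 2" | "b" "k0 = 2" "k1 = 0"
        using \<open>tri_tab b k1 k0 \<noteq> 0\<close> by (auto simp: tri_tab_def split: if_splits)
      then show ?thesis
      proof cases
        case 1
        have "cs \<notin> loc k0" "loc k1 = insert cs (loc k0)" unfolding 1 loc_values by (simp_all add: insert_commute ne3)
        then show ?thesis by (intro e[of cs]) simp_all
      next
        case 2
        have "cw \<notin> loc k0" "loc k1 = insert cw (loc k0)" unfolding 2 loc_values by (simp_all add: insert_commute ne3)
        then show ?thesis by (intro e[of cw]) simp_all
      next
        case 3
        have "cw \<notin> loc k0" "loc k1 = insert cw (loc k0)" unfolding 3 loc_values by (simp_all add: insert_commute ne3)
        then show ?thesis by (intro e[of cw]) simp_all
      next
        case 4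
        have "cs \<notin> loc k0" "loc k1 = insert cs (loc k0)" unfolding 4 loc_values by (simp_all add: insert_commute ne3)
        then show ?thesis by (intro e[of cs]) simp_all
      next
        case 5
        have "ct \<notin> loc k0" "loc k1 = insert ct (loc k0)" unfolding 5(2,3) loc_values using ne3 using 5(1) by (simp_all add: insert_commute)
        then show ?thesis by (intro e[of ct]) simp_all
      next
        case 6
        have "ct \<notin> loc k0" "loc k1 = insert ct (loc k0)" unfolding 6(2,3) loc_values using ne3 using 6(1) by (simp_all add: insert_commute)
        then show ?thesis by (intro e[of ct]) simp_all
      qed
    qed
  qed
  have all: "G (N1, k1) (N0, k0) (entry ?Z (N1, k1) (N0, k0))"
    if N: "N1 \<subseteq> C0" "N0 \<subseteq> C0" and k: "k1 < 5" "k0 < 5" for N1 N0 k1 k0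
  proof (cases "N1 = N0")
    case True
    then show ?thesis using local[OF N(2) k] by (simp add: tri_sites_def)
  next
    case ne: False
    show ?thesis
    proof (cases "k1 = k0 \<and> (\<exists>x\<in>C0 - N0. N1 = insert x N0)")
      case True
      then obtain x where x: "x \<in> C0" "x \<notin> N0" "N1 = insert x N0" and kk: "k1 = k0" by blast
      have the: "(THE x. x \<notin> N0 \<and> N1 = insert x N0) = x" using x by (intro the_equality) auto
      have sa: "tri_sign b k0 * os N0 x \<in> {1, -1}" using os[OF N(2), of x] x(1,2) by (auto simp: tri_sign_def)
      have "G (N1, k1) (N0, k0) (of_int (tri_sign b k0 * os N0 x) * saddle (F N0 k0) (F N1 k1))"
      proof (rule edge[OF N(2,1) k(2,1) _ _ _ sa])
        show "\<phi> x \<in> chords D" using \<phi>_outer[OF x(1)] by simp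
        show "\<phi> x \<notin> st N0 k0" using st_mem(4)[OF N(2) x(1)] x(2) by simp
        show "st N1 k1 = insert (\<phi> x) (st N0 k0)" unfolding st_def kk x(3) by simp
      qed
      then show ?thesis unfolding tri_sites_def sites.simps prod.case if_not_P[OF ne] if_P[OF True] the .
    next
      case False
      show ?thesis unfolding tri_sites_def sites.simps prod.case if_not_P[OF ne] if_not_P[OF False] by (rule zero)
    qed
  qed
  have "{(N, k). N \<subseteq> C0 \<and> k < (5 :: nat)} = Pow C0 \<times> {..<5}" by auto
  then have fin: "finite (support ?Z)" using finite_C0 by (simp add: sup)
  have sd: "sdeg ?Z = dg" by (simp add: tri_sites_def)
  show ?thesis unfolding valid_sites_def
  proof (intro conjI[OF fin] ballI)
    fix s t assume st: "s \<in> support ?Z" "t \<in> support ?Z"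
    obtain N0 k0 where s: "s = (N0, k0)" by (cases s)
    obtain N1 k1 where t: "t = (N1, k1)" by (cases t)
    have "G t s (entry ?Z t s)" using all st unfolding s t sup by simp
    then show "(\<forall>\<nu>\<in>Poly_Mapping.keys (entry ?Z t s). sdeg ?Z t = (fst (sdeg ?Z s) + 1, snd (sdeg ?Z s) + 2 * int (size \<nu>)))
      \<and> (\<forall>p\<in>rel_ideal (srel ?Z s). entry ?Z t s * p \<in> rel_ideal (srel ?Z t))" unfolding G_def sd .
  qed
qed

text \<open>
  The map \<open>\<sigma>\<close> and the signs \<open>t\<close> allow for a renumbering of the five states and a change of generators,
  so that the diagrams on the two sides of a third move can be reduced to literally the same complex.
\<close>

theorem triangle_reduction:
  assumes F: "\<And>N k. N \<subseteq> C0 ==> k < 5 ==> F N k = E (st N (\<sigma> k))"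
    and \<sigma>: "bij_betw \<sigma> {..<5} {..<5}" "\<And>k. k < 5 ==> tri_sign b (\<sigma> k) = tri_sign b k"
    and dg: "\<And>N k. N \<subseteq> C0 ==> k < 5 ==> dg (N, k) = sdeg (sites sg) (st N (\<sigma> k), False)"
    and os: "\<And>N x. N \<subseteq> C0 ==> x \<in> C0 - N ==> os N x = sg (\<phi> ` N) (\<phi> x)"
    and t: "\<And>k. k < 5 ==> t k \<in> {1, -1}"
    and tab: "\<And>k1 k0. k1 < 5 ==> k0 < 5 ==> tri_tab b k1 k0 = t k1 * t k0 * tri_tab b (\<sigma> k1) (\<sigma> k0)"
    and valid: "valid_sites (tri_sites b C0 F dg os)"
  shows "pc_equiv (site_complex (sites sg)) (site_complex (tri_sites b C0 F dg os))"
proof (rule square_elimination[OF num_inj chords3(3,2) ne3(6), where CC = CC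
      and \<beta> = "\<lambda>z. (st (fst z) (\<sigma> (snd z)), False)" and \<tau> = "\<lambda>z. t (snd z)"])
  let ?Z = "tri_sites b C0 F dg os"
  have \<sigma>5: "\<sigma> k < 5" if "k < 5" for k using \<sigma>(1) that by (auto simp: bij_betw_def)
  have sup: "support ?Z = {(N, k). N \<subseteq> C0 \<and> k < 5}" by (simp add: tri_sites_def)
  show "CC (insert cw M) = CC M" "CC (insert cs M) = CC M" for M using ne3 by auto
  show "Y \<in> comps M \<longleftrightarrow> CC M \<and> cw \<in> M \<and> cs \<notin> M" if "M \<subseteq> chords D" for M using circ[OF that] .
  show "sg = sg" by simp
  show "valid_sites ?Z" by (rule valid)
  have b1: "bij_betw (\<lambda>z. (fst z, \<sigma> (snd z))) {(N, k). N \<subseteq> C0 \<and> k < 5} {(N, k). N \<subseteq> C0 \<and> k < 5}"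
  proof -
    have e: "{(N, k). N \<subseteq> C0 \<and> k < (5 :: nat)} = Pow C0 \<times> {..<5}" by auto
    have m: "(\<lambda>z. (fst z, \<sigma> (snd z))) = map_prod (\<lambda>N. N) \<sigma>" by (auto simp: map_prod_def fun_eq_iff)
    have "bij_betw (\<lambda>N. N) (Pow C0) (Pow C0)" by (simp add: bij_betw_def)
    then show ?thesis unfolding e m using \<sigma>(1) by (rule bij_betw_map_prod)
  qed
  show "bij_betw (\<lambda>z. (st (fst z) (\<sigma> (snd z)), False)) (support ?Z) (square_rest CC cw cs)"
    using bij_betw_trans[OF b1 st_bij] unfolding sup by (simp add: o_def)
  show "t (snd z) \<in> {1, - 1} \<and> srel ?Z z = E (fst (st (fst z) (\<sigma> (snd z)), False)) \<and>
      sdeg ?Z z = sdeg (sites sg) (st (fst z) (\<sigma> (snd z)), False)" if zin: "z \<in> support ?Z" for z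
  proof -
    obtain N k where z: "z = (N, k)" "N \<subseteq> C0" "k < 5" using zin unfolding sup by auto
    show ?thesis using t[OF z(3)] F[OF z(2,3)] dg[OF z(2,3)] by (simp add: z(1) tri_sites_def)
  qed
  fix z z' assume zz: "z \<in> support ?Z" "z' \<in> support ?Z"
  obtain N1 k1 where z: "z = (N1, k1)" and N1: "N1 \<subseteq> C0" and k1: "k1 < 5" using zz(1) unfolding sup by auto
  obtain N0 k0 where z': "z' = (N0, k0)" and N0: "N0 \<subseteq> C0" and k0: "k0 < 5" using zz(2) unfolding sup by auto
  have tt: "t k1 * t k1 = 1" using t[OF k1] by auto
  have "entry ?Z z z' = of_int (t k1 * t k0) * (entry (sites sg) (st N1 (\<sigma> k1), False) (st N0 (\<sigma> k0), False)
      - zig (st N1 (\<sigma> k1), False) (st N0 (\<sigma> k0), False))"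
  proof (cases "N1 = N0")
    case True
    show ?thesis unfolding True reduced_local[OF N0 \<sigma>5[OF k1] \<sigma>5[OF k0]]
      using F[OF N0 k1] F[OF N0 k0] tab[OF k1 k0] by (simp add: z z' True tri_sites_def mult.assoc)
  next
    case False
    have keq: "\<sigma> k1 = \<sigma> k0 \<longleftrightarrow> k1 = k0" using \<sigma>(1) k1 k0 by (auto simp: bij_betw_def inj_on_def)
    show ?thesis
    proof (cases "k1 = k0 \<and> (\<exists>x\<in>C0 - N0. N1 = insert x N0)")
      case True
      then obtain x where x: "x \<in> C0 - N0" "N1 = insert x N0" by blast
      have the: "(THE x. x \<notin> N0 \<and> N1 = insert x N0) = x" using x by (intro the_equality) auto
      show ?thesis unfolding reduced_outer[OF N1 N0 \<sigma>5[OF k1] \<sigma>5[OF k0] False] keq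
        using True False F[OF N1 k1] F[OF N0 k0] \<sigma>(2)[OF k0] os[OF N0 x(1)] tt
        by (simp add: z z' tri_sites_def the flip: of_int_mult)
    next
      case False
      with \<open>N1 \<noteq> N0\<close> show ?thesis
        unfolding reduced_outer[OF N1 N0 \<sigma>5[OF k1] \<sigma>5[OF k0] \<open>N1 \<noteq> N0\<close>] keq if_not_P[OF False] z z' tri_sites_def
          sites.simps prod.case if_not_P[OF \<open>N1 \<noteq> N0\<close>] by simp
    qed
  qed
  then show "entry ?Z z z' = of_int (t (snd z) * t (snd z')) * (entry (sites sg) (st (fst z) (\<sigma> (snd z)), False)
      (st (fst z') (\<sigma> (snd z')), False) - zig (st (fst z) (\<sigma> (snd z)), False) (st (fst z') (\<sigma> (snd z')), False))"
    by (simp add: z z')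
qed

end

section \<open>Triangles of strands\<close>

text \<open>
  A strand of the triangle carries two end points; the arc between them is its middle arc.  With
  \<open>\<alpha>\<close> telling which of the two comes first, this is the arc next to \<open>p\<close> on the side chosen by \<open>\<alpha>\<close>.
\<close>

definition near :: "('p, 'a, 'z) chord_diagram_scheme \<Rightarrow> bool \<Rightarrow> 'p \<Rightarrow> 'a" where
  "near D \<alpha> p = (if \<alpha> then arc_in D p else arc_out D p)"

definition chord_pairs :: "'a \<Rightarrow> 'a \<Rightarrow> 'a \<Rightarrow> 'a \<Rightarrow> bool \<Rightarrow> ('a \<times> 'a) set" where
  "chord_pairs i m m' j d = (if d then {(i, j), (m, m')} else {(i, m'), (m, j)})"

lemma glued_chord_pairs:
  assumes c: "{a, r} \<in> chords D" "a \<noteq> r"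
    and d: "d \<longleftrightarrow> ((marker M {a, r} = sign D {a, r}) \<longleftrightarrow> \<alpha> = \<beta>)"
    and xy: "(x, y) \<in> chord_pairs (near D \<alpha> a) (near D (\<not> \<alpha>) a) (near D \<beta> r) (near D (\<not> \<beta>) r) d"
  shows "(x, y) \<in> equiv_closure (glued D M)"
proof (cases "marker M {a, r} = sign D {a, r}")
  case True
  have g: "(arc_in D a, arc_out D r) \<in> equiv_closure (glued D M)" "(arc_in D r, arc_out D a) \<in> equiv_closure (glued D M)"
    using glued_same[OF c True] by (auto intro: equiv_closure_incl)
  show ?thesis using xy g g[THEN equiv_closure_sym] d True
    by (cases \<alpha>; cases \<beta>) (auto simp: near_def chord_pairs_def)
next
  case False
  have g: "(arc_in D a, arc_in D r) \<in> equiv_closure (glued D M)" "(arc_out D a, arc_out D r) \<in> equiv_closure (glued D M)"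
    using glued_opposite[OF c False] by (auto intro: equiv_closure_incl)
  show ?thesis using xy g g[THEN equiv_closure_sym] d False
    by (cases \<alpha>; cases \<beta>) (auto simp: near_def chord_pairs_def)
qed

lemma chord_pairs_glued:
  assumes pq: "{p, q} = {a, r}" "a \<noteq> r"
    and d: "d \<longleftrightarrow> ((marker M {a, r} = sign D {a, r}) \<longleftrightarrow> \<alpha> = \<beta>)"
    and xy: "if marker M {p, q} = sign D {p, q} then x = arc_in D p \<and> y = arc_out D q
      else x = arc_in D p \<and> y = arc_in D q \<or> x = arc_out D p \<and> y = arc_out D q"
  shows "(x, y) \<in> chord_pairs (near D \<alpha> a) (near D (\<not> \<alpha>) a) (near D \<beta> r) (near D (\<not> \<beta>) r) d \<or>
    (y, x) \<in> chord_pairs (near D \<alpha> a) (near D (\<not> \<alpha>) a) (near D \<beta> r) (near D (\<not> \<beta>) r) d"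
proof -
  have "p = a \<and> q = r \<or> p = r \<and> q = a" using pq(1) by (simp add: doubleton_eq_iff)
  then show ?thesis using xy d unfolding pq(1)
    by (elim disjE conjE; cases \<alpha>; cases \<beta>; cases "marker M {a, r} = sign D {a, r}")
      (simp_all add: near_def chord_pairs_def; blast)+
qed

lemma chords_disjoint: "is_chord_diagram D ==> c \<in> chords D ==> d \<in> chords D ==> c \<noteq> d ==> c \<inter> d = {}"
  by (simp add: is_chord_diagram_def)

text \<open>
  The pairs of ends of the fragment that are joined by the three smoothed chords; strand by strand,
  \<open>i\<close> is the arc before the attractive end point and \<open>o\<close> the arc after the repulsive one.
\<close>

definition joined_ends :: "'a \<Rightarrow> 'a \<Rightarrow> 'a \<Rightarrow> 'a \<Rightarrow> 'a \<Rightarrow> 'a \<Rightarrow> nat \<Rightarrow> ('a \<times> 'a) set" where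
  "joined_ends iz oz iu ou iv ov k =
     (if k = 0 then {(iu, ov), (iv, ou), (iz, oz)}
      else if k = 1 then {(iz, ou), (iu, oz), (iv, ov)}
      else if k = 2 then {(iz, ov), (iu, oz), (iv, ou)}
      else if k = 3 then {(iz, ou), (iu, ov), (iv, oz)}
      else {(iv, oz), (iz, ov), (iu, ou)})"

definition outer_glued :: "('p, 'a, 'z) signed_chord_diagram_scheme \<Rightarrow> 'p set set \<Rightarrow> 'p set set \<Rightarrow> ('a \<times> 'a) set" where
  "outer_glued D T M = {(x, y). \<exists>p q. {p, q} \<in> chords D - T \<and> p \<noteq> q \<and>
     (if marker M {p, q} = sign D {p, q} then x = arc_in D p \<and> y = arc_out D q
      else x = arc_in D p \<and> y = arc_in D q \<or> x = arc_out D p \<and> y = arc_out D q)}"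

text \<open>
  The strands \<open>z\<close>, \<open>u\<close>, \<open>v\<close> are run through cyclically: the chord that leaves strand \<open>i\<close> at \<open>ai\<close> arrives
  on the next strand \<open>j\<close> at \<open>rj\<close>.  The truth value \<open>\<alpha>i\<close> tells whether \<open>ai\<close> precedes \<open>ri\<close> on the base, that is,
  whether the middle arc is run through along the base.  The conditions on the signs make the smoothing
  along the cyclic direction positive for the first chord and negative for the last one.
\<close>

locale strands =
  fixes D :: "('p, 'a, 'z) signed_chord_diagram_scheme" and az rz au ru av rv :: 'p and \<alpha>z \<alpha>u \<alpha>v :: bool
  assumes signed: "is_signed_chord_diagram D" and orientable: "orientable D"
    and ends: "{az, ru} \<in> chords D" "{au, rv} \<in> chords D" "{av, rz} \<in> chords D"
    and dist: "distinct [az, rz, au, ru, av, rv]"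
    and mid: "near D (\<not> \<alpha>z) az = near D \<alpha>z rz" "near D (\<not> \<alpha>u) au = near D \<alpha>u ru" "near D (\<not> \<alpha>v) av = near D \<alpha>v rv"
    and signs: "sign D {az, ru} = (if \<alpha>z = \<alpha>u then 1 else -1)" "sign D {av, rz} = (if \<alpha>v = \<alpha>z then -1 else 1)"

begin

abbreviation "cs \<equiv> {az, ru}"

abbreviation "ct \<equiv> {au, rv}"

abbreviation "cw \<equiv> {av, rz}"

abbreviation "T \<equiv> {ct, cs, cw}"

definition "b \<longleftrightarrow> sign D ct \<noteq> (if \<alpha>u = \<alpha>v then 1 else -1)"

abbreviation "iz \<equiv> near D \<alpha>z az"

abbreviation "iu \<equiv> near D \<alpha>u au"

abbreviation "iv \<equiv> near D \<alpha>v av"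

abbreviation "oz \<equiv> near D (\<not> \<alpha>z) rz"

abbreviation "ou \<equiv> near D (\<not> \<alpha>u) ru"

abbreviation "ov \<equiv> near D (\<not> \<alpha>v) rv"

abbreviation "mz \<equiv> near D \<alpha>z rz"

abbreviation "mu \<equiv> near D \<alpha>u ru"

abbreviation "mv \<equiv> near D \<alpha>v rv"

definition "Y = {mz, mu, mv}"

definition lp where "lp M = chord_pairs iz mz mu ou (cs \<notin> M) \<union> chord_pairs iu mu mv ov ((ct \<in> M) = b)
  \<union> chord_pairs iv mv mz oz (cw \<in> M)"

abbreviation "outer \<equiv> outer_glued D T"

lemma diagram: "is_chord_diagram D"
  using signed by (simp add: is_signed_chord_diagram_def)

lemma ends_ne: "az \<noteq> ru" "au \<noteq> rv" "av \<noteq> rz"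
  using dist by auto

lemma pts: "az \<in> points D" "rz \<in> points D" "au \<in> points D" "ru \<in> points D" "av \<in> points D" "rv \<in> points D"
  using ends by (auto simp: points_def)

lemma near_eq: "p \<in> points D ==> q \<in> points D ==> near D \<beta> p = near D \<beta> q \<longleftrightarrow> p = q"
  using arc_in_eq[OF diagram] arc_out_eq[OF diagram] by (simp add: near_def)

lemma near_arcs: "p \<in> points D ==> near D \<beta> p \<in> arcs D"
  using arc_in_arcs[OF diagram] arc_out_arcs[OF diagram] by (simp add: near_def)

lemma near_m:
  assumes "p \<in> points D"
  shows "near D \<beta> p = mz \<longleftrightarrow> p = (if \<beta> = \<alpha>z then rz else az)" "near D \<beta> p = mu \<longleftrightarrow> p = (if \<beta> = \<alpha>u then ru else au)"
    "near D \<beta> p = mv \<longleftrightarrow> p = (if \<beta> = \<alpha>v then rv else av)"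
proof -
  have c: "\<beta> \<noteq> x ==> \<beta> = (\<not> x)" for x by auto
  show "near D \<beta> p = mz \<longleftrightarrow> p = (if \<beta> = \<alpha>z then rz else az)"
  proof (cases "\<beta> = \<alpha>z")
    case False
    show ?thesis using near_eq[OF assms pts(1), of "\<not> \<alpha>z"] False unfolding mid(1) c[OF False] by simp
  qed (use near_eq[OF assms pts(2), of \<alpha>z] in simp)
  show "near D \<beta> p = mu \<longleftrightarrow> p = (if \<beta> = \<alpha>u then ru else au)"
  proof (cases "\<beta> = \<alpha>u")
    case False
    show ?thesis using near_eq[OF assms pts(3), of "\<not> \<alpha>u"] False unfolding mid(2) c[OF False] by simp
  qed (use near_eq[OF assms pts(4), of \<alpha>u] in simp)
  show "near D \<beta> p = mv \<longleftrightarrow> p = (if \<beta> = \<alpha>v then rv else av)"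
  proof (cases "\<beta> = \<alpha>v")
    case False
    show ?thesis using near_eq[OF assms pts(5), of "\<not> \<alpha>v"] False unfolding mid(3) c[OF False] by simp
  qed (use near_eq[OF assms pts(6), of \<alpha>v] in simp)
qed

lemma near_Y: "p \<in> points D ==> near D \<beta> p \<in> Y \<longleftrightarrow>
    p = (if \<beta> = \<alpha>z then rz else az) \<or> p = (if \<beta> = \<alpha>u then ru else au) \<or> p = (if \<beta> = \<alpha>v then rv else av)"
  unfolding Y_def using near_m by simp

lemma ends_Y: "iz \<notin> Y" "iu \<notin> Y" "iv \<notin> Y" "oz \<notin> Y" "ou \<notin> Y" "ov \<notin> Y"
  using near_Y pts dist by (simp_all add: eq_commute)

lemma mid_ne: "mz \<noteq> mu" "mu \<noteq> mv" "mv \<noteq> mz"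
  using near_m(2)[OF pts(2), of \<alpha>z] near_m(3)[OF pts(4), of \<alpha>u] near_m(1)[OF pts(6), of \<alpha>v] dist
  by (auto split: if_splits)

lemma Y_arcs: "Y \<subseteq> arcs D"
  using near_arcs pts by (simp add: Y_def)

lemma ne3: "cs \<noteq> ct" "cs \<noteq> cw" "ct \<noteq> cw"
  using dist by (auto simp: doubleton_eq_iff)

lemma directed:
  "(cs \<notin> M) \<longleftrightarrow> ((marker M cs = sign D cs) \<longleftrightarrow> \<alpha>z = \<alpha>u)"
  "((ct \<in> M) = b) \<longleftrightarrow> ((marker M ct = sign D ct) \<longleftrightarrow> \<alpha>u = \<alpha>v)"
  "(cw \<in> M) \<longleftrightarrow> ((marker M cw = sign D cw) \<longleftrightarrow> \<alpha>v = \<alpha>z)"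
proof -
  have "sign D ct \<in> {1, -1}" using signed ends(2) by (simp add: is_signed_chord_diagram_def)
  then show "((ct \<in> M) = b) \<longleftrightarrow> ((marker M ct = sign D ct) \<longleftrightarrow> \<alpha>u = \<alpha>v)"
    unfolding b_def by (auto simp: marker_def)
  show "(cs \<notin> M) \<longleftrightarrow> ((marker M cs = sign D cs) \<longleftrightarrow> \<alpha>z = \<alpha>u)" by (simp add: signs marker_def)
  show "(cw \<in> M) \<longleftrightarrow> ((marker M cw = sign D cw) \<longleftrightarrow> \<alpha>v = \<alpha>z)" by (simp add: signs marker_def)
qed

lemma lp_glued: "(x, y) \<in> lp M ==> (x, y) \<in> equiv_closure (glued D M)"
  unfolding lp_def Un_iff
  using glued_chord_pairs[OF ends(1) ends_ne(1) directed(1)] glued_chord_pairs[OF ends(2) ends_ne(2) directed(2)]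
    glued_chord_pairs[OF ends(3) ends_ne(3) directed(3)] unfolding mid by blast

lemma outer_incl: "outer M \<subseteq> glued D M"
proof (rule subrelI)
  fix x y assume "(x, y) \<in> outer M"
  then obtain p q where pq: "{p, q} \<in> chords D - T" "p \<noteq> q" and
    glue: "if marker M {p, q} = sign D {p, q} then x = arc_in D p \<and> y = arc_out D q
      else x = arc_in D p \<and> y = arc_in D q \<or> x = arc_out D p \<and> y = arc_out D q"
    unfolding outer_glued_def by blast
  show "(x, y) \<in> glued D M" unfolding glued_iff
    by (intro exI[of _ p] exI[of _ q] conjI[OF _ conjI[OF pq(2) glue]]) (rule DiffD1[OF pq(1)])
qed

lemma glued_cases:
  assumes "(x, y) \<in> glued D M"
  shows "(x, y) \<in> lp M \<or> (y, x) \<in> lp M \<or> (x, y) \<in> outer M"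
proof -
  obtain p q where pq: "{p, q} \<in> chords D" "p \<noteq> q" and
    glue: "if marker M {p, q} = sign D {p, q} then x = arc_in D p \<and> y = arc_out D q
      else x = arc_in D p \<and> y = arc_in D q \<or> x = arc_out D p \<and> y = arc_out D q"
    using assms unfolding glued_iff by blast
  consider "{p, q} = cs" | "{p, q} = ct" | "{p, q} = cw" | "{p, q} \<notin> T" by blast
  then show ?thesis
  proof cases
    case 1
    then show ?thesis using chord_pairs_glued[OF 1 ends_ne(1) directed(1) glue] unfolding mid lp_def by blast
  next
    case 2
    then show ?thesis using chord_pairs_glued[OF 2 ends_ne(2) directed(2) glue] unfolding mid lp_def by blast
  next
    case 3
    then show ?thesis using chord_pairs_glued[OF 3 ends_ne(3) directed(3) glue] unfolding mid lp_def by blast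
  next
    case 4
    then have "(x, y) \<in> outer M" unfolding outer_glued_def mem_Collect_eq prod.case
      using pq glue by (intro exI[of _ p] exI[of _ q]) simp
    then show ?thesis by simp
  qed
qed

lemma outer_Y:
  assumes "(x, y) \<in> outer M" shows "x \<notin> Y" "y \<notin> Y"
proof -
  obtain p q where pq: "{p, q} \<in> chords D - T" "p \<noteq> q" and
    glue: "if marker M {p, q} = sign D {p, q} then x = arc_in D p \<and> y = arc_out D q
      else x = arc_in D p \<and> y = arc_in D q \<or> x = arc_out D p \<and> y = arc_out D q"
    using assms unfolding outer_glued_def by blast
  have P: "p \<in> points D" "q \<in> points D" using DiffD1[OF pq(1)] unfolding points_def by blast+
  have n: "z \<noteq> az \<and> z \<noteq> rz \<and> z \<noteq> au \<and> z \<noteq> ru \<and> z \<noteq> av \<and> z \<noteq> rv" if z: "z \<in> {p, q}" for z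
  proof -
    have "{p, q} \<inter> c = {}" if "c \<in> T" for c
      using that pq ends diagram unfolding is_chord_diagram_def by (metis DiffE insertE singletonD)
    then have "z \<notin> c" if "c \<in> T" for c using that z by blast
    then show ?thesis by blast
  qed
  have "near D \<beta> p \<notin> Y" "near D \<beta> q \<notin> Y" for \<beta>
    using near_Y[OF P(1)] near_Y[OF P(2)] n[of p] n[of q] by simp_all
  from this[of True] this[of False] show "x \<notin> Y" "y \<notin> Y" using glue unfolding near_def by (auto split: if_splits)
qed

lemma component_lp:
  assumes "K \<in> components D M" "(x, y) \<in> lp M" "x \<in> arcs D" "y \<in> arcs D"
  shows "x \<in> K \<longleftrightarrow> y \<in> K"
proof -
  have "(x, y) \<in> smoothing_rel D M" "(y, x) \<in> smoothing_rel D M"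
    using lp_glued[OF assms(2)] equiv_closure_sym assms(3,4) by (auto simp: smoothing_rel_def)
  then show ?thesis using component_closed[OF diagram assms(1)] by blast
qed

lemma all_arcs: "iz \<in> arcs D" "iu \<in> arcs D" "iv \<in> arcs D" "oz \<in> arcs D" "ou \<in> arcs D" "ov \<in> arcs D"
    "mz \<in> arcs D" "mu \<in> arcs D" "mv \<in> arcs D"
  using near_arcs pts by simp_all

lemma component_within:
  assumes K: "K \<in> components D M" "K \<subseteq> Y"
  shows "K = Y \<and> cs \<notin> M \<and> (ct \<in> M) = b \<and> cw \<in> M"
proof -
  note cl = component_lp[OF K(1)]
  have out: "iz \<notin> K" "iu \<notin> K" "iv \<notin> K" "oz \<notin> K" "ou \<notin> K" "ov \<notin> K" using ends_Y K(2) by auto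
  have s: "if cs \<notin> M then mz \<in> K \<longleftrightarrow> mu \<in> K else mu \<notin> K \<and> mz \<notin> K"
    using cl[of mz mu] cl[of iz mu] cl[of mz ou] all_arcs out by (simp add: lp_def chord_pairs_def)
  have t: "if (ct \<in> M) = b then mu \<in> K \<longleftrightarrow> mv \<in> K else mv \<notin> K \<and> mu \<notin> K"
    using cl[of mu mv] cl[of iu mv] cl[of mu ov] all_arcs out by (simp add: lp_def chord_pairs_def)
  have w: "if cw \<in> M then mv \<in> K \<longleftrightarrow> mz \<in> K else mz \<notin> K \<and> mv \<notin> K"
    using cl[of mv mz] cl[of iv mz] cl[of mv oz] all_arcs out by (simp add: lp_def chord_pairs_def)
  have "mz \<in> K \<or> mu \<in> K \<or> mv \<in> K" using component_nonempty[OF diagram K(1)] K(2) unfolding Y_def by blast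
  then have "mz \<in> K \<and> mu \<in> K \<and> mv \<in> K \<and> cs \<notin> M \<and> (ct \<in> M) = b \<and> cw \<in> M" using s t w by metis
  moreover then have "K = Y" using K(2) unfolding Y_def by blast
  ultimately show ?thesis by blast
qed

lemma circle_component: "Y \<in> components D M \<longleftrightarrow> (ct \<in> M) = b \<and> cw \<in> M \<and> cs \<notin> M"
proof
  assume "Y \<in> components D M"
  then show "(ct \<in> M) = b \<and> cw \<in> M \<and> cs \<notin> M" using component_within[of Y M] by blast
next
  assume h: "(ct \<in> M) = b \<and> cw \<in> M \<and> cs \<notin> M"
  then have lpe: "lp M = {(iz, ou), (mz, mu), (iu, ov), (mu, mv), (iv, oz), (mv, mz)}"
    unfolding lp_def chord_pairs_def by auto
  show "Y \<in> components D M"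
  proof (rule component_eqI[OF diagram Y_arcs])
    show "mz \<in> Y" by (simp add: Y_def)
    have l: "x \<in> Y \<longleftrightarrow> y \<in> Y" if "(x, y) \<in> lp M" for x y
    proof -
      have "mz \<in> Y" "mu \<in> Y" "mv \<in> Y" by (simp_all add: Y_def)
      then show ?thesis using that ends_Y unfolding lpe by auto
    qed
    show "x \<in> Y \<longleftrightarrow> y \<in> Y" if "(x, y) \<in> glued D M" for x y
      using glued_cases[OF that] l[of x y] l[of y x] outer_Y[of x y M] by blast
    have e: "(mz, mu) \<in> equiv_closure (glued D M)" "(mv, mz) \<in> equiv_closure (glued D M)"
      by (rule lp_glued, simp add: lpe)+
    show "(mz, z) \<in> smoothing_rel D M" if "z \<in> Y" for z
      using that e(1) equiv_closure_sym[OF e(2)] all_arcs unfolding Y_def smoothing_rel_def by auto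
  qed
qed

lemma circle_model_strands: "\<theta> ` V = arcs D - Y ==> circle_model D V \<theta> Y"
  by (rule circle_model.intro) (use signed orientable component_within in blast)+

text \<open>
  Unless all three chords are smoothed along the direction of the triangle, every middle arc lies on a
  curve that leaves the fragment, and it can be pushed into an outer arc of this curve without
  changing which ends are joined.
\<close>

lemma smoothing_rel_iff:
  assumes k: "k < 5" "(cs \<notin> M) = (k \<in> {1, 3})" "((ct \<in> M) = b) = (k = 0)" "(cw \<in> M) = (k \<in> {3, 4})"
    and xy: "x \<in> arcs D - Y" "y \<in> arcs D - Y"
  shows "(x, y) \<in> smoothing_rel D M \<longleftrightarrow> (x, y) \<in> equiv_closure (outer M \<union> joined_ends iz oz iu ou iv ov k)"
proof -
  let ?S = "outer M \<union> joined_ends iz oz iu ou iv ov k" and ?G = "equiv_closure (glued D M)"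
  let ?J = "joined_ends iz oz iu ou iv ov k"
  have lpk: "lp M = chord_pairs iz mz mu ou (k \<in> {1, 3}) \<union> chord_pairs iu mu mv ov (k = 0) \<union> chord_pairs iv mv mz oz (k \<in> {3, 4})"
    unfolding lp_def k(2-4) ..
  note lpv = lpk[unfolded chord_pairs_def]
  have J: "(p, q) \<in> ?G" if "(p, q) \<in> ?J" for p q
  proof -
    note tr = equiv_closure_trans[of _ _ "glued D M"] and sy = equiv_closure_sym[of _ _ "glued D M"]
    have L: "(p, q) \<in> lp M ==> (p, q) \<in> ?G \<and> (q, p) \<in> ?G" for p q using lp_glued sy by blast
    show ?thesis using k(1)
    proof (cases rule: nat_less_5_cases)
      case 1
      have h: "(iu, ov) \<in> ?G" "(iz, mu) \<in> ?G" "(mz, ou) \<in> ?G" "(mu, mv) \<in> ?G" "(iv, mz) \<in> ?G" "(mv, oz) \<in> ?G"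
        using L by (simp_all add: lpv 1)
      have r: "(iu, ov) \<in> ?G" "(iv, ou) \<in> ?G" "(iz, oz) \<in> ?G" by (rule h(1) tr[OF h(5) h(3)] tr[OF tr[OF h(2) h(4)] h(6)])+
      show ?thesis using that r by (auto simp: joined_ends_def 1)
    next
      case 2
      have h: "(iz, ou) \<in> ?G" "(mz, mu) \<in> ?G" "(iu, mv) \<in> ?G" "(mu, ov) \<in> ?G" "(iv, mz) \<in> ?G" "(mv, oz) \<in> ?G"
        using L by (simp_all add: lpv 2)
      have r: "(iz, ou) \<in> ?G" "(iu, oz) \<in> ?G" "(iv, ov) \<in> ?G" by (rule h(1) tr[OF h(3) h(6)] tr[OF tr[OF h(5) h(2)] h(4)])+
      show ?thesis using that r by (auto simp: joined_ends_def 2)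
    next
      case 3
      have h: "(iz, mu) \<in> ?G" "(mz, ou) \<in> ?G" "(iu, mv) \<in> ?G" "(mu, ov) \<in> ?G" "(iv, mz) \<in> ?G" "(mv, oz) \<in> ?G"
        using L by (simp_all add: lpv 3)
      have r: "(iz, ov) \<in> ?G" "(iu, oz) \<in> ?G" "(iv, ou) \<in> ?G" by (rule tr[OF h(1) h(4)] tr[OF h(3) h(6)] tr[OF h(5) h(2)])+
      show ?thesis using that r by (auto simp: joined_ends_def 3)
    next
      case 4
      have h: "(iz, ou) \<in> ?G" "(mz, mu) \<in> ?G" "(iu, mv) \<in> ?G" "(mu, ov) \<in> ?G" "(iv, oz) \<in> ?G" "(mv, mz) \<in> ?G"
        using L by (simp_all add: lpv 4)
      have r: "(iz, ou) \<in> ?G" "(iu, ov) \<in> ?G" "(iv, oz) \<in> ?G" by (rule h(1) tr[OF tr[OF tr[OF h(3) h(6)] h(2)] h(4)] h(5))+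
      show ?thesis using that r by (auto simp: joined_ends_def 4)
    next
      case 5
      have h: "(iz, mu) \<in> ?G" "(mz, ou) \<in> ?G" "(iu, mv) \<in> ?G" "(mu, ov) \<in> ?G" "(iv, oz) \<in> ?G" "(mv, mz) \<in> ?G"
        using L by (simp_all add: lpv 5)
      have r: "(iv, oz) \<in> ?G" "(iz, ov) \<in> ?G" "(iu, ou) \<in> ?G" by (rule h(5) tr[OF h(1) h(4)] tr[OF tr[OF h(3) h(6)] h(2)])+
      show ?thesis using that r by (auto simp: joined_ends_def 5)
    qed
  qed
  define nz where "nz = (if k = 3 then iu else if k = 4 then iu else iv)"
  define nu where "nu = (if k = 1 then iv else if k = 3 then iu else iz)"
  define nv where "nv = (if k = 0 then iz else iu)"
  define \<rho> where "\<rho> a = (if a = mz then nz else if a = mu then nu else if a = mv then nv else a)" for a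
  have \<rho>m: "\<rho> mz = nz" "\<rho> mu = nu" "\<rho> mv = nv" using mid_ne by (auto simp: \<rho>_def)
  have \<rho>Y: "\<rho> a = a" if "a \<notin> Y" for a using that by (simp add: \<rho>_def Y_def)
  have Jin: "(p, q) \<in> equiv_closure ?S \<and> (q, p) \<in> equiv_closure ?S" if "(p, q) \<in> ?J" for p q
    using that equiv_closure_incl[of p q ?S] equiv_closure_sym[of p q ?S] by blast
  define EE where "EE = equiv_closure ?S"
  have JE: "(p, q) \<in> EE" "(q, p) \<in> EE" if "(p, q) \<in> ?J" for p q using Jin[OF that] by (simp_all add: EE_def)
  have EEr: "(a, a) \<in> EE" for a by (simp add: EE_def)
  note \<rho>v = \<rho>m \<rho>Y[OF ends_Y(1)] \<rho>Y[OF ends_Y(2)] \<rho>Y[OF ends_Y(3)] \<rho>Y[OF ends_Y(4)] \<rho>Y[OF ends_Y(5)] \<rho>Y[OF ends_Y(6)]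
  have \<rho>all: "\<forall>z\<in>lp M. (\<rho> (fst z), \<rho> (snd z)) \<in> EE"
    using k(1)
  proof (cases rule: nat_less_5_cases)
    case 1
    have v: "nz = iv" "nu = iz" "nv = iz" by (simp_all add: nz_def nu_def nv_def 1)
    have r: "(iu, ov) \<in> EE" "(iv, ou) \<in> EE" "(iz, oz) \<in> EE"
      by (rule JE; simp add: joined_ends_def 1)+
    show ?thesis unfolding lpv[unfolded 1, simplified] by (simp add: \<rho>v v r EEr)
  next
    case 2
    have v: "nz = iv" "nu = iv" "nv = iu" by (simp_all add: nz_def nu_def nv_def 2)
    have r: "(iz, ou) \<in> EE" "(iu, oz) \<in> EE" "(iv, ov) \<in> EE"
      by (rule JE; simp add: joined_ends_def 2)+
    show ?thesis unfolding lpv[unfolded 2, simplified] by (simp add: \<rho>v v r EEr)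
  next
    case 3
    have v: "nz = iv" "nu = iz" "nv = iu" by (simp_all add: nz_def nu_def nv_def 3)
    have r: "(iz, ov) \<in> EE" "(iu, oz) \<in> EE" "(iv, ou) \<in> EE"
      by (rule JE; simp add: joined_ends_def 3)+
    show ?thesis unfolding lpv[unfolded 3, simplified] by (simp add: \<rho>v v r EEr)
  next
    case 4
    have v: "nz = iu" "nu = iu" "nv = iu" by (simp_all add: nz_def nu_def nv_def 4)
    have r: "(iz, ou) \<in> EE" "(iu, ov) \<in> EE" "(iv, oz) \<in> EE"
      by (rule JE; simp add: joined_ends_def 4)+
    show ?thesis unfolding lpv[unfolded 4, simplified] by (simp add: \<rho>v v r EEr)
  next
    case 5
    have v: "nz = iu" "nu = iz" "nv = iu" by (simp_all add: nz_def nu_def nv_def 5)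
    have r: "(iv, oz) \<in> EE" "(iz, ov) \<in> EE" "(iu, ou) \<in> EE"
      by (rule JE; simp add: joined_ends_def 5)+
    show ?thesis unfolding lpv[unfolded 5, simplified] by (simp add: \<rho>v v r EEr)
  qed
  have \<rho>l: "(\<rho> p, \<rho> q) \<in> equiv_closure ?S" if "(p, q) \<in> lp M" for p q
    using bspec[OF \<rho>all that] by (simp add: EE_def)
  show ?thesis
  proof
    assume "(x, y) \<in> smoothing_rel D M"
    then have "(x, y) \<in> ?G" by (simp add: smoothing_rel_def)
    then have "(\<rho> x, \<rho> y) \<in> equiv_closure ?S"
    proof (rule equiv_closure_map)
      fix p q assume "(p, q) \<in> glued D M"
      then consider "(p, q) \<in> lp M" | "(q, p) \<in> lp M" | "(p, q) \<in> outer M" using glued_cases by blast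
      then show "(\<rho> p, \<rho> q) \<in> equiv_closure ?S"
      proof cases
        case 2 then show ?thesis using \<rho>l equiv_closure_sym by metis
      next
        case 3
        then have "(p, q) \<in> equiv_closure ?S" by (intro equiv_closure_incl) simp
        then show ?thesis using \<rho>Y outer_Y[OF 3] by simp
      qed (rule \<rho>l)
    qed
    then show "(x, y) \<in> equiv_closure ?S" using \<rho>Y xy by simp
  next
    assume "(x, y) \<in> equiv_closure ?S"
    then have "(id x, id y) \<in> ?G"
    proof (rule equiv_closure_map)
      fix p q assume "(p, q) \<in> ?S"
      then have "(p, q) \<in> ?G"
      proof (rule UnE)
        assume "(p, q) \<in> outer M"
        then show ?thesis by (rule equiv_closure_incl[OF subsetD[OF outer_incl]])
      qed (rule J)
      then show "(id p, id q) \<in> ?G" by simp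
    qed
    then show "(x, y) \<in> smoothing_rel D M" using xy by (simp add: smoothing_rel_def)
  qed
qed

lemma triangle_strands:
  assumes "\<theta> ` V = arcs D - Y" "bij_betw \<phi> C0 (chords D - T)" "inj_on num (chords D)" "num ct < num cs" "num cs < num cw"
    "\<And>x. x \<in> C0 ==> num (\<phi> x) < num ct"
  shows "triangle D V \<theta> Y ct cs cw b C0 \<phi> num"
proof (rule triangle.intro[OF circle_model_strands[OF assms(1)]], rule triangle_axioms.intro)
  show "Y \<in> components D M \<longleftrightarrow> ((ct \<in> M) = b) \<and> cw \<in> M \<and> cs \<notin> M" for M by (rule circle_component)
  show "distinct [ct, cs, cw]" using ne3 by simp
qed (use assms ends in simp_all)

end

context triangle

begin

lemma card_st:
  assumes N: "N \<subseteq> C0"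
  shows "card (st N k) = card N + (if (k = 0) = b then 1 else 0) + (if k \<in> {0, 2, 4} then 1 else 0) + (if k \<in> {3, 4} then 1 else 0)"
proof -
  have o: "ct \<notin> \<phi> ` N" "cs \<notin> \<phi> ` N" "cw \<notin> \<phi> ` N" using N \<phi>_outer by blast+
  have fin: "finite (\<phi> ` N)" using N finite_C0 by (simp add: finite_subset)
  have c: "card (\<phi> ` N) = card N" by (rule card_image) (rule inj_on_subset[OF bij_betw_imp_inj_on[OF \<phi>] N])
  have e: "loc k = (if (k = 0) = b then {ct} else {}) \<union> (if k \<in> {0, 2, 4} then {cs} else {}) \<union> (if k \<in> {3, 4} then {cw} else {})"
    by (auto simp: tri_loc_def)
  show ?thesis unfolding st_def e using o fin c ne3 by simp
qed

end

lemma outer_glued_image: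
  assumes D: "is_chord_diagram D" and inj: "inj_on f (points D)"
    and ch: "chords D' - T' = (\<lambda>c. f ` c) ` (chords D - T)"
    and sg: "\<And>c. c \<in> chords D - T ==> sign D' (f ` c) = sign D c \<and> (f ` c \<in> M' \<longleftrightarrow> c \<in> M)"
    and arc: "\<And>c p. c \<in> chords D - T ==> p \<in> c ==> arc_in D' (f p) = g (arc_in D p) \<and> arc_out D' (f p) = g (arc_out D p)"
  shows "outer_glued D' T' M' = map_prod g g ` outer_glued D T M"
proof (intro equalityI subrelI)
  fix x y assume "(x, y) \<in> outer_glued D' T' M'"
  then obtain p' q' where pq': "{p', q'} \<in> chords D' - T'" "p' \<noteq> q'" and
    glue: "if marker M' {p', q'} = sign D' {p', q'} then x = arc_in D' p' \<and> y = arc_out D' q'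
      else x = arc_in D' p' \<and> y = arc_in D' q' \<or> x = arc_out D' p' \<and> y = arc_out D' q'"
    unfolding outer_glued_def by blast
  obtain c where c: "c \<in> chords D - T" "{p', q'} = f ` c" using pq'(1) unfolding ch by blast
  have "p' \<in> f ` c" "q' \<in> f ` c" using c(2) by blast+
  then obtain p q where pq: "p \<in> c" "q \<in> c" "p' = f p" "q' = f q" by blast
  have ne: "p \<noteq> q" using pq pq'(2) by blast
  have "card c = 2" using c(1) D by (simp add: is_chord_diagram_def)
  then obtain s t where "c = {s, t}" unfolding card_2_iff by blast
  then have ceq: "c = {p, q}" using pq(1,2) ne by blast
  have m: "marker M' {p', q'} = marker M {p, q}" "sign D' {p', q'} = sign D {p, q}"
    using sg[OF c(1)] unfolding c(2) marker_def ceq by simp_all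
  have a: "arc_in D' p' = g (arc_in D p)" "arc_out D' p' = g (arc_out D p)" "arc_in D' q' = g (arc_in D q)" "arc_out D' q' = g (arc_out D q)"
    using arc[OF c(1) pq(1)] arc[OF c(1) pq(2)] pq(3,4) by simp_all
  have cpq: "{p, q} \<in> chords D - T" using c(1) ceq by simp
  have "\<exists>s t. x = g s \<and> y = g t \<and> (if marker M {p, q} = sign D {p, q} then s = arc_in D p \<and> t = arc_out D q
      else s = arc_in D p \<and> t = arc_in D q \<or> s = arc_out D p \<and> t = arc_out D q)"
    using glue unfolding m a by (cases "marker M {p, q} = sign D {p, q}") auto
  then obtain s t where st: "x = g s" "y = g t" and gl: "if marker M {p, q} = sign D {p, q} then s = arc_in D p \<and> t = arc_out D q
      else s = arc_in D p \<and> t = arc_in D q \<or> s = arc_out D p \<and> t = arc_out D q" by blast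
  have "(s, t) \<in> outer_glued D T M" unfolding outer_glued_def mem_Collect_eq prod.case
    by (intro exI[of _ p] exI[of _ q] conjI[OF cpq conjI[OF ne gl]])
  then show "(x, y) \<in> map_prod g g ` outer_glued D T M" unfolding st by (intro image_eqI[of _ _ "(s, t)"]) simp_all
next
  fix x y assume "(x, y) \<in> map_prod g g ` outer_glued D T M"
  then obtain s t where st: "(s, t) \<in> outer_glued D T M" "x = g s" "y = g t" by auto
  obtain p q where pq: "{p, q} \<in> chords D - T" "p \<noteq> q" and
    gl: "if marker M {p, q} = sign D {p, q} then s = arc_in D p \<and> t = arc_out D q
      else s = arc_in D p \<and> t = arc_in D q \<or> s = arc_out D p \<and> t = arc_out D q"
    using st(1) unfolding outer_glued_def by blast
  have P: "p \<in> points D" "q \<in> points D" using DiffD1[OF pq(1)] unfolding points_def by blast+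
  have "f p \<noteq> f q" using inj_on_eq_iff[OF inj P] pq(2) by simp
  moreover have im: "f ` {p, q} = {f p, f q}" by simp
  have "{f p, f q} \<in> chords D' - T'" unfolding ch using pq(1) im by blast
  moreover have "marker M' {f p, f q} = marker M {p, q}" "sign D' {f p, f q} = sign D {p, q}"
    using sg[OF pq(1)] unfolding im marker_def by simp_all
  moreover have "arc_in D' (f p) = g (arc_in D p)" "arc_out D' (f p) = g (arc_out D p)" "arc_in D' (f q) = g (arc_in D q)" "arc_out D' (f q) = g (arc_out D q)"
    using arc[OF pq(1), of p] arc[OF pq(1), of q] by simp_all
  ultimately show "(x, y) \<in> outer_glued D' T' M'" unfolding outer_glued_def mem_Collect_eq prod.case st(2,3)
    by (intro exI[of _ "f p"] exI[of _ "f q"]) (use gl in \<open>simp split: if_splits; blast\<close>)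
qed

text \<open>
  Only arcs in the image of \<open>g\<close> are joined by the second relation, so paths can be pulled back.
\<close>

lemma equiv_closure_transfer:
  assumes g: "inj_on g A" and uv: "u \<in> A" "v \<in> A"
    and fw: "\<And>x y. (x, y) \<in> R ==> (g x, g y) \<in> equiv_closure R'"
    and bw: "\<And>x y. (x, y) \<in> R' ==> \<exists>s t. s \<in> A \<and> t \<in> A \<and> x = g s \<and> y = g t \<and> (s, t) \<in> equiv_closure R"
  shows "(u, v) \<in> equiv_closure R \<longleftrightarrow> (g u, g v) \<in> equiv_closure R'"
proof
  show "(u, v) \<in> equiv_closure R ==> (g u, g v) \<in> equiv_closure R'" by (rule equiv_closure_map[OF _ fw])
  assume "(g u, g v) \<in> equiv_closure R'"
  then have "(inv_into A g (g u), inv_into A g (g v)) \<in> equiv_closure R"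
  proof (rule equiv_closure_map)
    fix x y assume "(x, y) \<in> R'"
    from bw[OF this] obtain s t where "s \<in> A" "t \<in> A" "x = g s" "y = g t" "(s, t) \<in> equiv_closure R" by blast
    then show "(inv_into A g x, inv_into A g y) \<in> equiv_closure R" using inv_into_f_f[OF g] by simp
  qed
  then show "(u, v) \<in> equiv_closure R" using inv_into_f_f[OF g] uv by simp
qed

text \<open>
  A third move reverses the cyclic direction of the triangle.  This exchanges the state in which no chord is
  smoothed along the direction with the one in which two chords are.
\<close>

definition flip_index :: "nat \<Rightarrow> nat" where
  "flip_index k = (if k = 2 then 3 else if k = 3 then 2 else k)"

lemma joined_ends_flip:
  assumes "k < 5"
  shows "joined_ends (g oz) (g iz) (g ou) (g iu) (g ov) (g iv) (flip_index k) = (\<lambda>(x, y). (g y, g x)) ` joined_ends iz oz iu ou iv ov k"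
  using assms by (cases rule: nat_less_5_cases) (simp_all add: joined_ends_def flip_index_def insert_commute)

lemma tri_tab_flip:
  assumes k: "k1 < 5" "k0 < 5" and t: "t = (\<lambda>k. if k = 4 \<or> b \<and> k = 0 then - 1 else 1 :: int)"
  shows "tri_tab b k1 k0 = t k1 * t k0 * tri_tab b (flip_index k1) (flip_index k0)"
proof -
  have all: "\<forall>k1\<in>{0, 1, 2, 3, 4}. \<forall>k0\<in>{0, 1, 2, 3, 4}. tri_tab b k1 k0 = t k1 * t k0 * tri_tab b (flip_index k1) (flip_index k0)"
    unfolding t by (cases b) (simp_all add: tri_tab_def flip_index_def)
  have k': "k1 \<in> {0, 1, 2, 3, 4}" "k0 \<in> {0, 1, 2, 3, 4}" using k by auto
  show ?thesis by (rule bspec[OF bspec[OF all k'(1)] k'(2)])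
qed

text \<open>
  Both complexes reduce to the same complex of five states of the triangle.  The arcs at an end point
  after the move are those at the other end point of the same strand before it, so that the direction
  of the triangle is reversed and the arcs \<open>i\<close> and \<open>o\<close> of each strand change their roles.
\<close>

theorem third_move_equivalence:
  fixes D' :: "('q, 'b, 'y) signed_chord_diagram_scheme" and D :: "('p, 'a, 'z) signed_chord_diagram_scheme"
  assumes S: "strands D az rz au ru av rv \<alpha>z \<alpha>u \<alpha>v"
    and D': "is_signed_chord_diagram D'" "orientable D'"
    and f: "bij_betw f (points D) (points D')" and g: "bij_betw g (arcs D) (arcs D')"
    and ch: "(\<lambda>c. f ` c) ` chords D = chords D'" and sg: "\<And>c. c \<in> chords D ==> sign D' (f ` c) = sign D c"
    and rest: "\<And>p. p \<in> points D - {az, rz, au, ru, av, rv} ==>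
      arc_in D' (f p) = g (arc_in D p) \<and> arc_out D' (f p) = g (arc_out D p)"
    and swap: "\<And>p q. (p, q) \<in> {(az, rz), (rz, az), (au, ru), (ru, au), (av, rv), (rv, av)} ==>
      arc_in D' (f p) = g (arc_in D q) \<and> arc_out D' (f p) = g (arc_out D q)"
    and num: "inj_on num (chords D)" "inj_on num' (chords D')"
  shows "homotopy_equivalent_complexes (khovanov_complex D num) (khovanov_complex D' num')"
proof -
  interpret S: strands D az rz au ru av rv \<alpha>z \<alpha>u \<alpha>v by (rule S)
  have near': "near D' \<beta> (f p) = g (near D \<beta> q)" if "(p, q) \<in> {(az, rz), (rz, az), (au, ru), (ru, au), (av, rv), (rv, av)}" for \<beta> p q
    using swap[OF that] by (simp add: near_def)
  have near1: "near D' \<beta> (f az) = g (near D \<beta> rz)" "near D' \<beta> (f rz) = g (near D \<beta> az)" "near D' \<beta> (f au) = g (near D \<beta> ru)"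
    "near D' \<beta> (f ru) = g (near D \<beta> au)" "near D' \<beta> (f av) = g (near D \<beta> rv)" "near D' \<beta> (f rv) = g (near D \<beta> av)" for \<beta>
    using near' by simp_all
  have finj: "inj_on f (points D)" by (rule bij_betw_imp_inj_on[OF f])
  have im: "f ` S.cs = {f az, f ru}" "f ` S.ct = {f au, f rv}" "f ` S.cw = {f av, f rz}" by simp_all
  have fch: "f ` c \<in> chords D'" if "c \<in> chords D" for c using that ch by blast
  interpret S': strands D' "f az" "f rz" "f au" "f ru" "f av" "f rv" "\<not> \<alpha>z" "\<not> \<alpha>u" "\<not> \<alpha>v"
  proof
    show "{f az, f ru} \<in> chords D'" "{f au, f rv} \<in> chords D'" "{f av, f rz} \<in> chords D'"
      using fch[OF S.ends(1)] fch[OF S.ends(2)] fch[OF S.ends(3)] by simp_all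
    have "f p = f q \<longleftrightarrow> p = q" if "p \<in> points D" "q \<in> points D" for p q by (rule inj_on_eq_iff[OF finj that])
    then show "distinct [f az, f rz, f au, f ru, f av, f rv]" using S.dist S.pts by simp
    show "near D' (\<not> \<not> \<alpha>z) (f az) = near D' (\<not> \<alpha>z) (f rz)" "near D' (\<not> \<not> \<alpha>u) (f au) = near D' (\<not> \<alpha>u) (f ru)"
      "near D' (\<not> \<not> \<alpha>v) (f av) = near D' (\<not> \<alpha>v) (f rv)"
      unfolding near1 using S.mid by simp_all
    show "sign D' {f az, f ru} = (if (\<not> \<alpha>z) = (\<not> \<alpha>u) then 1 else - 1)" "sign D' {f av, f rz} = (if (\<not> \<alpha>v) = (\<not> \<alpha>z) then - 1 else 1)"
      using sg[OF S.ends(1)] sg[OF S.ends(3)] S.signs by simp_all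
  qed (rule D')+
  let ?\<phi> = "\<lambda>c. f ` c" and ?V = "arcs D - S.Y" and ?C0 = "chords D - S.T"
  have b: "S'.b = S.b" using sg[OF S.ends(2)] by (simp add: S.b_def S'.b_def)
  have Y': "S'.Y = g ` S.Y" unfolding S'.Y_def S.Y_def near1 using S.mid by simp
  have ginj: "inj_on g (arcs D)" by (rule bij_betw_imp_inj_on[OF g])
  have gV: "g ` ?V = arcs D' - S'.Y"
    using inj_on_image_set_diff[OF ginj, of "arcs D" S.Y] S.Y_arcs bij_betw_imp_surj_on[OF g] unfolding Y' by simp
  have chP: "chords D \<subseteq> Pow (points D)" by (auto simp: points_def)
  have \<phi>inj: "inj_on ?\<phi> (chords D)" using inj_on_subset[OF inj_on_image_Pow[OF finj] chP] by simp
  have T': "S'.T = ?\<phi> ` S.T" by simp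
  have T: "S.T \<subseteq> chords D" using S.ends by simp
  have ch0: "chords D' - S'.T = ?\<phi> ` ?C0"
    unfolding T' ch[symmetric] by (rule inj_on_image_set_diff[OF \<phi>inj _ T, symmetric]) simp
  have \<phi>bij: "bij_betw ?\<phi> ?C0 (chords D' - S'.T)"
    unfolding bij_betw_def ch0 using inj_on_subset[OF \<phi>inj] by blast
  have fin: "finite (chords D)" using S.diagram by (simp add: is_chord_diagram_def)
  \<comment> \<open>Numbering the chords of the triangle last separates their signs from those of the other chords.\<close>
  define B where "B = Suc (\<Sum>c\<in>chords D. num c)"
  have numB: "num c < B" if "c \<in> chords D" for c
    using member_le_sum[OF that _ fin, of num] by (simp add: B_def)
  define n where "n c = (if c = S.ct then B else if c = S.cs then B + 1 else if c = S.cw then B + 2 else num c)" for c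
  have nv: "n S.ct = B" "n S.cs = B + 1" "n S.cw = B + 2" using S.ne3 by (simp_all add: n_def)
  have no: "n c = num c" "n c < B" if "c \<in> ?C0" for c using that numB by (simp_all add: n_def)
  have ninj: "inj_on n (chords D)"
  proof (rule inj_onI)
    fix c c' assume c: "c \<in> chords D" "c' \<in> chords D" "n c = n c'"
    show "c = c'"
    proof (cases "c \<in> S.T \<or> c' \<in> S.T")
      case False
      then show ?thesis using no(1)[of c] no(1)[of c'] c inj_onD[OF num(1)] by simp
    next
      case True
      have lt: "d \<in> chords D ==> d \<notin> S.T ==> n d < B" for d using no(2)[of d] by simp
      have ge: "d \<in> S.T ==> B \<le> n d" for d using nv by auto
      have inT: "c \<in> S.T" "c' \<in> S.T" using True lt[OF c(1)] lt[OF c(2)] ge[of c] ge[of c'] c(3) by linarith+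
      then show ?thesis using c(3) nv by auto
    qed
  qed
  define n' where "n' c = n (inv_into (chords D) ?\<phi> c)" for c
  have n'\<phi>: "n' (f ` c) = n c" if "c \<in> chords D" for c using inv_into_f_f[OF \<phi>inj that] by (simp add: n'_def)
  have n'inj: "inj_on n' (chords D')"
  proof (rule inj_onI)
    fix c c' assume c: "c \<in> chords D'" "c' \<in> chords D'" "n' c = n' c'"
    have im: "c \<in> ?\<phi> ` chords D" "c' \<in> ?\<phi> ` chords D" using c(1,2) unfolding ch .
    obtain d where d: "c = f ` d" "d \<in> chords D" using im(1) by (rule imageE)
    obtain d' where d': "c' = f ` d'" "d' \<in> chords D" using im(2) by (rule imageE)
    have "n d = n d'" using c(3) unfolding d(1) d'(1) n'\<phi>[OF d(2)] n'\<phi>[OF d'(2)] .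
    then have "d = d'" by (rule inj_onD[OF ninj _ d(2) d'(2)])
    then show "c = c'" using d(1) d'(1) by simp
  qed
  have n'v: "n' {f au, f rv} = B" "n' {f az, f ru} = B + 1" "n' {f av, f rz} = B + 2"
    using n'\<phi>[OF S.ends(2)] n'\<phi>[OF S.ends(1)] n'\<phi>[OF S.ends(3)] nv by simp_all
  interpret A: triangle D ?V "\<lambda>a. a" S.Y S.ct S.cs S.cw S.b ?C0 "\<lambda>c. c" n
    by (rule S.triangle_strands) (use ninj nv no in \<open>simp_all add: bij_betw_def\<close>)
  interpret A': triangle D' ?V g S'.Y S'.ct S'.cs S'.cw S.b ?C0 ?\<phi> n'
    by (rule S'.triangle_strands[unfolded b]) (use gV \<phi>bij n'inj n'v n'\<phi> no in simp_all)
  let ?F = "\<lambda>N k. A.E (A.st N k)" and ?dg = "\<lambda>(N, k). sdeg (A.sites (order_sign n)) (A.st N k, False)"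
    and ?os = "\<lambda>N x. order_sign n N x" and ?t = "\<lambda>k. if k = 4 \<or> S.b \<and> k = 0 then - 1 else 1 :: int"
  let ?Z = "tri_sites S.b ?C0 ?F ?dg ?os"
  have fl5: "flip_index k < 5" if "k < 5" for k using that by (simp add: flip_index_def)
  have rel: "?F N k = A'.E (A'.st N (flip_index k))" if N: "N \<subseteq> ?C0" and k: "k < 5" for N k
  proof -
    let ?M = "A.st N k" and ?M' = "A'.st N (flip_index k)"
    have o: "outer_glued D' S'.T ?M' = map_prod g g ` outer_glued D S.T ?M"
    proof (rule outer_glued_image[OF S.diagram finj ch0])
      show "sign D' (f ` c) = sign D c \<and> (f ` c \<in> ?M' \<longleftrightarrow> c \<in> ?M)" if "c \<in> ?C0" for c
        using sg[of c] that A.st_mem(4)[OF N that] A'.st_mem(4)[OF N that] by simp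
      show "arc_in D' (f p) = g (arc_in D p) \<and> arc_out D' (f p) = g (arc_out D p)" if c: "c \<in> ?C0" "p \<in> c" for c p
      proof (rule rest)
        have ne: "p \<notin> d" if d: "d \<in> S.T" for d
        proof
          assume "p \<in> d"
          then have "p \<in> c \<inter> d" using c(2) by simp
          moreover have "c \<inter> d = {}"
          proof (rule chords_disjoint[OF S.diagram DiffD1[OF c(1)] subsetD[OF T d]])
            show "c \<noteq> d"
            proof
              assume e: "c = d"
              show False by (rule DiffD2[OF c(1)]) (unfold e, rule d)
            qed
          qed
          ultimately show False by simp
        qed
        have "p \<notin> S.ct" "p \<notin> S.cs" "p \<notin> S.cw" by (rule ne, simp)+
        then have "p \<notin> {az, rz, au, ru, av, rv}" by simp
        moreover have "p \<in> points D" unfolding points_def by (rule UnionI[OF DiffD1[OF c(1)] c(2)])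
        ultimately show "p \<in> points D - {az, rz, au, ru, av, rv}" by blast
      qed
    qed
    let ?J = "joined_ends S.iz S.oz S.iu S.ou S.iv S.ov k" and ?J' = "joined_ends S'.iz S'.oz S'.iu S'.ou S'.iv S'.ov (flip_index k)"
    have J': "?J' = (\<lambda>(x, y). (g y, g x)) ` ?J"
      unfolding near1 not_not by (rule joined_ends_flip[OF k])
    have kk: "k \<notin> {0, 2, 4} \<longleftrightarrow> k \<in> {1, 3}" if "k < 5" for k :: nat
      using that by (cases rule: nat_less_5_cases) simp_all
    have i1: "(u, v) \<in> smoothing_rel D ?M \<longleftrightarrow> (u, v) \<in> equiv_closure (outer_glued D S.T ?M \<union> ?J)" if "u \<in> ?V" "v \<in> ?V" for u v
    proof (rule S.smoothing_rel_iff[OF k _ _ _ that])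
      show "(S.cs \<notin> ?M) = (k \<in> {1, 3})" unfolding A.st_mem(2)[OF N] by (rule kk[OF k])
      show "((S.ct \<in> ?M) = S.b) = (k = 0)" unfolding A.st_mem(1)[OF N] by argo
      show "(S.cw \<in> ?M) = (k \<in> {3, 4})" by (rule A.st_mem(3)[OF N])
    qed
    have gin: "g u \<in> arcs D' - S'.Y" if "u \<in> ?V" for u using imageI[OF that, of g] unfolding gV .
    have i2: "(g u, g v) \<in> smoothing_rel D' ?M' \<longleftrightarrow> (g u, g v) \<in> equiv_closure (outer_glued D' S'.T ?M' \<union> ?J')"
      if "u \<in> ?V" "v \<in> ?V" for u v
    proof (rule S'.smoothing_rel_iff[OF fl5[OF k] _ _ _ gin[OF that(1)] gin[OF that(2)]])
      show "(S'.cs \<notin> ?M') = (flip_index k \<in> {1, 3})" unfolding A'.st_mem(2)[OF N] by (rule kk[OF fl5[OF k]])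
      show "((S'.ct \<in> ?M') = S'.b) = (flip_index k = 0)" unfolding A'.st_mem(1)[OF N] b by argo
      show "(S'.cw \<in> ?M') = (flip_index k \<in> {3, 4})" by (rule A'.st_mem(3)[OF N])
    qed
    have oarcs: "s \<in> arcs D \<and> t \<in> arcs D" if "(s, t) \<in> outer_glued D S.T ?M" for s t
      using subsetD[OF glued_arcs[OF S.diagram] subsetD[OF S.outer_incl that]] by simp
    have Jarcs: "s \<in> arcs D \<and> t \<in> arcs D" if "(s, t) \<in> ?J" for s t
      using that S.all_arcs unfolding joined_ends_def by (auto split: if_splits)
    have eq: "(u, v) \<in> equiv_closure (outer_glued D S.T ?M \<union> ?J) \<longleftrightarrow> (g u, g v) \<in> equiv_closure (outer_glued D' S'.T ?M' \<union> ?J')"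
      if "u \<in> ?V" "v \<in> ?V" for u v
    proof (rule equiv_closure_transfer[OF ginj])
      show "u \<in> arcs D" "v \<in> arcs D" using that by simp_all
      fix x y assume "(x, y) \<in> outer_glued D S.T ?M \<union> ?J"
      then show "(g x, g y) \<in> equiv_closure (outer_glued D' S'.T ?M' \<union> ?J')"
      proof (rule UnE)
        assume "(x, y) \<in> outer_glued D S.T ?M"
        then have "(g x, g y) \<in> outer_glued D' S'.T ?M'" unfolding o by (intro image_eqI[of _ _ "(x, y)"]) simp_all
        then show ?thesis by (intro equiv_closure_incl UnI1)
      next
        assume "(x, y) \<in> ?J"
        then have "(g y, g x) \<in> ?J'" unfolding J' by (intro image_eqI[of _ _ "(x, y)"]) simp_all
        then show ?thesis by (intro equiv_closure_sym[OF equiv_closure_incl] UnI2)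
      qed
    next
      fix x y assume "(x, y) \<in> outer_glued D' S'.T ?M' \<union> ?J'"
      then show "\<exists>s t. s \<in> arcs D \<and> t \<in> arcs D \<and> x = g s \<and> y = g t \<and> (s, t) \<in> equiv_closure (outer_glued D S.T ?M \<union> ?J)"
      proof (rule UnE)
        assume "(x, y) \<in> outer_glued D' S'.T ?M'"
        then have "(x, y) \<in> map_prod g g ` outer_glued D S.T ?M" unfolding o .
        then obtain z where z: "(x, y) = map_prod g g z" "z \<in> outer_glued D S.T ?M" by (rule imageE)
        obtain s t where st: "z = (s, t)" by (cases z)
        have zin: "(s, t) \<in> outer_glued D S.T ?M" using z(2) st by simp
        show ?thesis using z(1) st oarcs[OF zin] equiv_closure_incl[OF UnI1[OF zin]] by (intro exI[of _ s] exI[of _ t]) simp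
      next
        assume "(x, y) \<in> ?J'"
        then have "(x, y) \<in> (\<lambda>(x, y). (g y, g x)) ` ?J" unfolding J' .
        then obtain z where z: "(x, y) = (case z of (x, y) \<Rightarrow> (g y, g x))" "z \<in> ?J" by (rule imageE)
        obtain s t where st: "z = (t, s)" by (cases z)
        have zin: "(t, s) \<in> ?J" using z(2) st by simp
        show ?thesis using z(1) st Jarcs[OF zin] equiv_closure_sym[OF equiv_closure_incl[OF UnI2[OF zin]]]
          by (intro exI[of _ s] exI[of _ t]) simp
      qed
    qed
    have "(u, v) \<in> ?F N k \<longleftrightarrow> (u, v) \<in> A'.E ?M'" for u v
    proof (cases "u \<in> ?V \<and> v \<in> ?V")
      case True
      then have V: "u \<in> ?V" "v \<in> ?V" by (rule conjunct1, rule conjunct2)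
      have "(u, v) \<in> smoothing_rel D ?M \<longleftrightarrow> (g u, g v) \<in> smoothing_rel D' ?M'"
        unfolding i1[OF V] i2[OF V] by (rule eq[OF V])
      then show ?thesis using True by (simp add: vrel_def)
    next
      case False
      then show ?thesis unfolding vrel_def mem_Collect_eq prod.case by argo
    qed
    then show ?thesis by (simp only: set_eq_iff split_paired_All) simp
  qed
  have wr: "writhe D' = writhe D"
    unfolding writhe_def ch[symmetric] sum.reindex[OF \<phi>inj] o_def by (rule sum.cong[OF refl]) (rule sg)
  have cc: "card (chords D') = card (chords D)" unfolding ch[symmetric] by (rule card_image[OF \<phi>inj])
  have deg: "?dg (N, k) = sdeg (A'.sites (order_sign n')) (A'.st N (flip_index k), False)" if N: "N \<subseteq> ?C0" and k: "k < 5" for N k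
  proof -
    have "card (A.st N k) = card (A'.st N (flip_index k))"
      unfolding A.card_st[OF N] A'.card_st[OF N] using k by (cases rule: nat_less_5_cases) (simp_all add: flip_index_def)
    moreover have "card (components D (A.st N k)) = card (components D' (A'.st N (flip_index k)))"
      using card_quotient_components[OF A.circle_model_axioms A.st_chords[OF N, of k]]
        card_quotient_components[OF A'.circle_model_axioms A'.st_chords[OF N, of "flip_index k"]]
        A.st_not_circle[OF N, of k] A'.st_not_circle[OF N, of "flip_index k"] rel[OF N k] by simp
    ultimately show ?thesis using A.num_neg_pos[OF A.st_chords[OF N, of k]] A'.num_neg_pos[OF A'.st_chords[OF N, of "flip_index k"]] wr cc
      by (simp add: model_sites_def)
  qed
  have valid: "valid_sites ?Z"
  proof (rule A.valid_tri_sites)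
    show "?os N x \<in> {1, - 1}" if "N \<subseteq> ?C0" "x \<in> ?C0 - N" for N x by (rule order_sign_cases)
  qed simp_all
  have e1: "pc_equiv (site_complex (A.sites (order_sign n))) (site_complex ?Z)"
    by (rule A.triangle_reduction[where \<sigma> = "\<lambda>k. k" and t = "\<lambda>_. 1"]) (use valid in \<open>simp_all add: bij_betw_def\<close>)
  have e2: "pc_equiv (site_complex (A'.sites (order_sign n'))) (site_complex ?Z)"
  proof (rule A'.triangle_reduction[where \<sigma> = flip_index and t = ?t])
    show "?F N k = A'.E (A'.st N (flip_index k))" if "N \<subseteq> ?C0" "k < 5" for N k by (rule rel[OF that])
    have ff: "flip_index (flip_index k) = k" for k by (simp add: flip_index_def)
    show "bij_betw flip_index {..<5} {..<5}"
      by (rule bij_betw_byWitness[of _ flip_index]) (use ff fl5 in auto)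
    show "tri_sign S.b (flip_index k) = tri_sign S.b k" for k by (simp add: tri_sign_def flip_index_def)
    show "?dg (N, k) = sdeg (A'.sites (order_sign n')) (A'.st N (flip_index k), False)" if "N \<subseteq> ?C0" "k < 5" for N k by (rule deg[OF that])
    show "?os N x = order_sign n' (?\<phi> ` N) (?\<phi> x)" if N: "N \<subseteq> ?C0" "x \<in> ?C0 - N" for N x
    proof -
      have NC: "c \<in> chords D" if "c \<in> N" for c by (rule DiffD1[OF subsetD[OF N(1) that]])
      have nx: "n' (?\<phi> x) = n x" by (rule n'\<phi>[OF DiffD1[OF DiffD1[OF N(2)]]])
      have "{c' \<in> ?\<phi> ` N. n' (?\<phi> x) < n' c'} = ?\<phi> ` {c' \<in> N. n x < n c'}"
      proof (intro equalityI subsetI)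
        fix c' assume "c' \<in> {c' \<in> ?\<phi> ` N. n' (?\<phi> x) < n' c'}"
        then have c': "c' \<in> ?\<phi> ` N" "n' (?\<phi> x) < n' c'" by (simp_all only: mem_Collect_eq)
        obtain c where c: "c' = ?\<phi> c" "c \<in> N" using c'(1) by (rule imageE)
        have "n x < n c" using c'(2) unfolding c(1) n'\<phi>[OF NC[OF c(2)]] nx .
        then show "c' \<in> ?\<phi> ` {c' \<in> N. n x < n c'}" unfolding c(1) by (intro imageI CollectI conjI c(2))
      next
        fix c' assume "c' \<in> ?\<phi> ` {c' \<in> N. n x < n c'}"
        then obtain c where c: "c' = ?\<phi> c" "c \<in> {c' \<in> N. n x < n c'}" by (rule imageE)
        have cN: "c \<in> N" "n x < n c" using c(2) by (simp_all only: mem_Collect_eq)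
        have "n' (?\<phi> x) < n' c'" unfolding c(1) n'\<phi>[OF NC[OF cN(1)]] nx by (rule cN(2))
        then show "c' \<in> {c' \<in> ?\<phi> ` N. n' (?\<phi> x) < n' c'}" unfolding c(1) by (intro CollectI conjI imageI cN(1))
      qed
      moreover have "inj_on ?\<phi> {c' \<in> N. n x < n c'}" by (rule inj_on_subset[OF \<phi>inj]) (use N in blast)
      ultimately show ?thesis by (simp add: order_sign_def card_image)
    qed
    show "?t k \<in> {1, - 1}" for k by simp
    show "tri_tab S.b k1 k0 = ?t k1 * ?t k0 * tri_tab S.b (flip_index k1) (flip_index k0)" if "k1 < 5" "k0 < 5" for k1 k0
      by (rule tri_tab_flip[OF that refl])
    show "valid_sites ?Z" by (rule valid)
  qed
  have c1: "pc_equiv (site_complex (A.sites (order_sign num))) (site_complex (A.sites (order_sign n)))"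
    by (rule A.change_signs[OF num(1) sign_assignment_order_sign[OF fin ninj]])
  have c2: "pc_equiv (site_complex (A'.sites (order_sign num'))) (site_complex (A'.sites (order_sign n')))"
    by (rule A'.change_signs[OF num(2) sign_assignment_order_sign[OF A'.finite_chords n'inj]])
  have "pc_equiv (site_complex (A.sites (order_sign num))) (site_complex (A'.sites (order_sign num')))"
    using pc_equiv_trans[OF pc_equiv_trans[OF c1 e1] pc_equiv_sym[OF pc_equiv_trans[OF c2 e2]]] .
  then show ?thesis by (rule presents_equiv[OF A.presents_model A'.presents_model])
qed

section \<open>The geometry of the third move\<close>

text \<open>The three sides of the triangle, run through cyclically, add up to zero.\<close>

lemma triangle_closing:
  fixes P Q R U V W :: complex and a a' b b' c c' :: real
  assumes "P + of_real a * U = Q + of_real a' * V" "P + of_real b * U = R + of_real b' * W"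
    "Q + of_real c * V = R + of_real c' * W"
  shows "(a' - c) * cross U V + (c' - b') * cross U W = 0"
proof -
  define w where "w = of_real (b - a) * U + of_real (a' - c) * V + of_real (c' - b') * W"
  have "w = (P + of_real b * U - (R + of_real b' * W)) - (P + of_real a * U - (Q + of_real a' * V)) - (Q + of_real c * V - (R + of_real c' * W))"
    by (simp add: w_def algebra_simps)
  then have "w = 0" unfolding assms by simp
  then have "cross U w = 0" by (simp add: cross_def)
  moreover have "cross U w = (a' - c) * cross U V + (c' - b') * cross U W"
    by (simp add: w_def cross_def algebra_simps)
  ultimately show ?thesis by simp
qed

section \<open>Invariance\<close>

lemma homotopy_equivalent_sym:
  "homotopy_equivalent_complexes K L ==> homotopy_equivalent_complexes L K"
  unfolding homotopy_equivalent_complexes_def by blast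

text \<open>
  Running through a triangle of lines cyclically, the directed sides \<open>d\<^sub>0\<close>, \<open>d\<^sub>u\<close>, \<open>d\<^sub>v\<close> add up to
  zero; taken with respect to these directions, the two crossings of a side therefore have opposite signs.
\<close>

lemma strands_of_fragment:
  fixes G :: "('p, 'a, 'z) signed_chord_diagram_scheme" and x :: "nat \<Rightarrow> nat \<Rightarrow> 'p"
    and P V :: "nat \<Rightarrow> complex" and t :: "nat \<Rightarrow> nat \<Rightarrow> real"
  assumes G: "is_signed_chord_diagram G" "orientable G"
    and x: "inj_on (\<lambda>(i, j). x i j) {(i, j). i < 3 \<and> j < 3 \<and> i \<noteq> j}"
    and ch: "\<And>i j. i < 3 ==> j < 3 ==> i \<noteq> j ==> {x i j, x j i} \<in> chords G"
    and cr: "\<And>i j. i < 3 ==> j < 3 ==> i \<noteq> j ==> cross (V i) (V j) \<noteq> 0"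
    and PV: "\<And>i j. i < 3 ==> j < 3 ==> i \<noteq> j ==> P i + of_real (t i j) * V i = P j + of_real (t j i) * V j"
    and sg: "\<And>i j. i < j ==> j < 3 ==> real_of_int (sign G {x i j, x j i}) = sgn (cross (V i) (V j))"
    and t: "\<And>i j k. i < 3 ==> j < 3 ==> k < 3 ==> distinct [i, j, k] ==> t i j \<noteq> t i k \<and> (t i j < t i k \<longrightarrow> arc_out G (x i j) = arc_in G (x i k))"
  obtains u v where "u < 3" "v < 3" "distinct [0, u, v]"
    "strands G (x 0 u) (x 0 v) (x u v) (x u 0) (x v 0) (x v u) (t 0 u < t 0 v) (t u v < t u 0) (t v 0 < t v u)"
proof -
  define es where "es u v \<longleftrightarrow> sign G {x 0 u, x u 0} = (if (t 0 u < t 0 v) = (t u v < t u 0) then 1 else - 1) \<and>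
    sign G {x v 0, x 0 v} = (if (t v 0 < t v u) = (t 0 u < t 0 v) then - 1 else 1)" for u v
  have "es 1 2 \<or> es 2 1"
  proof -
    have tr: "(t 1 0 - t 1 2) * cross (V 0) (V 1) + (t 2 1 - t 2 0) * cross (V 0) (V 2) = 0"
      by (rule triangle_closing[OF PV[of 0 1] PV[of 0 2] PV[of 1 2]]) simp_all
    have ne: "t 0 1 \<noteq> t 0 2" "t 1 0 \<noteq> t 1 2" "t 2 1 \<noteq> t 2 0" using t[of 0 1 2] t[of 1 0 2] t[of 2 1 0] by simp_all
    have s1: "real_of_int (sign G {x 0 1, x 1 0}) = sgn (cross (V 0) (V 1))" and s2: "real_of_int (sign G {x 0 2, x 2 0}) = sgn (cross (V 0) (V 2))"
      using sg[of 0 1] sg[of 0 2] by simp_all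
    have c: "cross (V 0) (V 1) \<noteq> 0" "cross (V 0) (V 2) \<noteq> 0" using cr[of 0 1] cr[of 0 2] by simp_all
    have S1: "sign G {x 0 1, x 1 0} = (if cross (V 0) (V 1) > 0 then 1 else - 1)"
      using s1 c(1) by (auto simp: sgn_if split: if_splits)
    have S2: "sign G {x 0 2, x 2 0} = (if cross (V 0) (V 2) > 0 then 1 else - 1)"
      using s2 c(2) by (auto simp: sgn_if split: if_splits)
    have opp: "((t 1 2 < t 1 0) = (0 < cross (V 0) (V 1))) \<noteq> ((t 2 0 < t 2 1) = (0 < cross (V 0) (V 2)))"
    proof -
      define d e p q where "d = t 1 0 - t 1 2" and "e = t 2 1 - t 2 0" and "p = cross (V 0) (V 1)" and "q = cross (V 0) (V 2)"
      have "d * p + e * q = 0" "d \<noteq> 0" "e \<noteq> 0" "p \<noteq> 0" "q \<noteq> 0" using tr ne c by (simp_all add: d_def e_def p_def q_def)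
      then have "0 < d * p \<longleftrightarrow> e * q < 0" "d * p \<noteq> 0" by auto
      then have "((0 < d) = (0 < p)) \<noteq> ((0 < e) = (0 < q))"
        using \<open>d \<noteq> 0\<close> \<open>e \<noteq> 0\<close> \<open>p \<noteq> 0\<close> \<open>q \<noteq> 0\<close> by (auto simp: zero_less_mult_iff mult_less_0_iff)
      then show ?thesis by (simp add: d_def e_def p_def q_def)
    qed
    have i: "{x 2 0, x 0 2} = {x 0 2, x 2 0}" "{x 1 0, x 0 1} = {x 0 1, x 1 0}" by auto
    have n: "t 0 2 < t 0 1 \<longleftrightarrow> \<not> t 0 1 < t 0 2" "t 1 0 < t 1 2 \<longleftrightarrow> \<not> t 1 2 < t 1 0" "t 2 1 < t 2 0 \<longleftrightarrow> \<not> t 2 0 < t 2 1"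
      using ne by auto
    show ?thesis unfolding es_def i n S1 S2 using opp by (simp split: if_splits; argo)
  qed
  then obtain u v where uv: "u < (3::nat)" "v < 3" "distinct [0, u, v]" "es u v"
  proof (rule disjE)
    assume "es 1 2" then show ?thesis by (intro that[of 1 2]) simp_all
  next
    assume "es 2 1" then show ?thesis by (intro that[of 2 1]) simp_all
  qed
  have "strands G (x 0 u) (x 0 v) (x u v) (x u 0) (x v 0) (x v u) (t 0 u < t 0 v) (t u v < t u 0) (t v 0 < t v u)"
  proof
    have lt: "u < 3" "v < 3" "(0::nat) < 3" and d: "u \<noteq> 0" "v \<noteq> 0" "u \<noteq> v" "v \<noteq> u" "0 \<noteq> u" "0 \<noteq> v" using uv by auto
    show "{x 0 u, x u 0} \<in> chords G" "{x u v, x v u} \<in> chords G" "{x v 0, x 0 v} \<in> chords G" using ch lt d by simp_all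
    have xe: "x i j = x i' j' \<longleftrightarrow> i = i' \<and> j = j'" if "i < 3" "j < 3" "i \<noteq> j" "i' < 3" "j' < 3" "i' \<noteq> j'" for i j i' j'
      using inj_on_eq_iff[OF x, of "(i, j)" "(i', j')"] that by simp
    show "distinct [x 0 u, x 0 v, x u v, x u 0, x v 0, x v u]" using lt d by (simp add: xe)
    have m: "near G (\<not> (t i j < t i k)) (x i j) = near G (t i j < t i k) (x i k)" if "i < 3" "j < 3" "k < 3" "distinct [i, j, k]" for i j k
      using t[OF that] t[of i k j] that by (auto simp: near_def)
    show "near G (\<not> (t 0 u < t 0 v)) (x 0 u) = near G (t 0 u < t 0 v) (x 0 v)"
      "near G (\<not> (t u v < t u 0)) (x u v) = near G (t u v < t u 0) (x u 0)"
      "near G (\<not> (t v 0 < t v u)) (x v 0) = near G (t v 0 < t v u) (x v u)" by (rule m; use lt d in simp)+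
    show "sign G {x 0 u, x u 0} = (if (t 0 u < t 0 v) = (t u v < t u 0) then 1 else - 1)"
      "sign G {x v 0, x 0 v} = (if (t v 0 < t v u) = (t 0 u < t 0 v) then - 1 else 1)" using uv(4) by (simp_all add: es_def)
  qed (rule G)+
  then show ?thesis using that uv by blast
qed

lemma truncate_fields [simp]:
  "arcs (signed_chord_diagram.truncate G) = arcs G" "chords (signed_chord_diagram.truncate G) = chords G"
  "arc_in (signed_chord_diagram.truncate G) = arc_in G" "arc_out (signed_chord_diagram.truncate G) = arc_out G"
  "sign (signed_chord_diagram.truncate G) = sign G"
  by (simp_all add: signed_chord_diagram.truncate_def)

lemma points_truncate [simp]: "points (signed_chord_diagram.truncate G) = points G"
  by (simp add: points_def)

lemma erased_truncate:
  "erases G' X f g G ==> erased (signed_chord_diagram.truncate G') X f g (signed_chord_diagram.truncate G)"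
  unfolding erases_def erased_def by simp

lemma first_move_homotopy_equivalent:
  assumes m: "first_move G G' R" and DD: "D = signed_chord_diagram.truncate G" "D' = signed_chord_diagram.truncate G'"
    and D: "is_signed_chord_diagram D" "orientable D" and D': "is_signed_chord_diagram D'" "orientable D'"
    and num: "inj_on num (chords D)" "inj_on num' (chords D')"
  shows "homotopy_equivalent_complexes (khovanov_complex D num) (khovanov_complex D' num')"
proof -
  obtain f g p q where h: "p \<noteq> q" "erases G' {{p, q}} f g G" "arc_out G' p = arc_in G' q"
    using m unfolding first_move_def by blast
  show ?thesis
    by (rule first_move_equivalence[OF D D' h(1) erased_truncate[OF h(2), folded DD] _ num]) (simp add: DD h(3))
qed

lemma second_move_homotopy_equivalent:
  assumes m: "second_move G G' R" and DD: "D = signed_chord_diagram.truncate G" "D' = signed_chord_diagram.truncate G'"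
    and D: "is_signed_chord_diagram D" "orientable D" and D': "is_signed_chord_diagram D'" "orientable D'"
    and num: "inj_on num (chords D)" "inj_on num' (chords D')"
  shows "homotopy_equivalent_complexes (khovanov_complex D num) (khovanov_complex D' num')"
proof -
  obtain f g p1 p2 q1 q2 c c' where h: "distinct [p1, p2, q1, q2]"
    "c = {p1, q1} \<and> c' = {p2, q2} \<or> c = {p1, q2} \<and> c' = {p2, q1}" "erases G' {c, c'} f g G"
    "sign G' c = - sign G' c'" "arc_out G' p1 = arc_in G' p2" "arc_out G' q1 = arc_in G' q2"
    using m unfolding second_move_def by (elim exE conjE) (rule that)
  show ?thesis
    by (rule second_move_equivalence[OF D D' h(1,2) erased_truncate[OF h(3), folded DD] _ _ _ num]) (simp_all add: DD h(4-6))
qed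

lemma third_move_homotopy_equivalent:
  assumes m: "third_move G G' R" and DD: "D = signed_chord_diagram.truncate G" "D' = signed_chord_diagram.truncate G'"
    and D: "is_signed_chord_diagram D" "orientable D" and D': "is_signed_chord_diagram D'" "orientable D'"
    and num: "inj_on num (chords D)" "inj_on num' (chords D')"
  shows "homotopy_equivalent_complexes (khovanov_complex D num) (khovanov_complex D' num')"
proof -
  obtain f g x t where fr: "third_move_fragment G x t" and f: "bij_betw f (points G) (points G')" and g: "bij_betw g (arcs G) (arcs G')"
    and ch: "(\<lambda>c. f ` c) ` chords G = chords G'" and sg: "\<forall>c\<in>chords G. sign G' (f ` c) = sign G c"
    and rest: "\<forall>p\<in>points G - {x i j | i j. i < 3 \<and> j < 3 \<and> i \<noteq> j}. arc_in G' (f p) = g (arc_in G p) \<and> arc_out G' (f p) = g (arc_out G p)"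
    and swap: "\<forall>i<3. \<forall>j<3. \<forall>k<3. distinct [i, j, k] \<longrightarrow> arc_in G' (f (x i j)) = g (arc_in G (x i k)) \<and> arc_out G' (f (x i j)) = g (arc_out G (x i k))"
    using m unfolding third_move_def by (elim exE conjE) (rule that)
  obtain P V where x: "inj_on (\<lambda>(i, j). x i j) {(i, j). i < 3 \<and> j < 3 \<and> i \<noteq> j}" and
    PV: "\<forall>i<3. \<forall>j<3. i \<noteq> j \<longrightarrow> {x i j, x j i} \<in> chords G \<and> (x i j \<in> overs G \<longleftrightarrow> i < j) \<and> cross (V i) (V j) \<noteq> 0 \<and>
      P i + of_real (t i j) * V i = P j + of_real (t j i) * V j \<and>
      (i < j \<longrightarrow> real_of_int (sign G {x i j, x j i}) = sgn (cross (V i) (V j)))" and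
    T: "\<forall>i<3. \<forall>j<3. \<forall>k<3. distinct [i, j, k] \<longrightarrow> t i j \<noteq> t i k \<and> (t i j < t i k \<longrightarrow> arc_out G (x i j) = arc_in G (x i k))"
    using fr unfolding third_move_fragment_def by (elim exE conjE) (rule that)
  obtain u v where uv: "u < 3" "v < 3" "distinct [0, u, v]" and
    S: "strands D (x 0 u) (x 0 v) (x u v) (x u 0) (x v 0) (x v u) (t 0 u < t 0 v) (t u v < t u 0) (t v 0 < t v u)"
  proof (rule strands_of_fragment[OF D x, of V P t])
    show "{x i j, x j i} \<in> chords D" "cross (V i) (V j) \<noteq> 0" "P i + of_real (t i j) * V i = P j + of_real (t j i) * V j"
      if "i < 3" "j < 3" "i \<noteq> j" for i j using PV that by (simp_all add: DD)
    show "real_of_int (sign D {x i j, x j i}) = sgn (cross (V i) (V j))" if "i < j" "j < 3" for i j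
      using PV[rule_format, of i j] that by (simp add: DD)
    show "t i j \<noteq> t i k \<and> (t i j < t i k \<longrightarrow> arc_out D (x i j) = arc_in D (x i k))" if "i < 3" "j < 3" "k < 3" "distinct [i, j, k]" for i j k
      using T[rule_format, OF that] by (simp add: DD)
  qed (rule that)
  have xs: "{x i j | i j. i < 3 \<and> j < 3 \<and> i \<noteq> j} \<subseteq> {x 0 u, x 0 v, x u v, x u 0, x v 0, x v u}"
  proof -
    have "i \<in> {0, u, v}" if "i < 3" for i using that uv by auto
    then show ?thesis by blast
  qed
  have d: "distinct [u, v, 0]" "distinct [u, 0, v]" "distinct [v, 0, u]" "distinct [v, u, 0]" "distinct [0, v, u]" using uv(3) by auto
  show ?thesis
  proof (rule third_move_equivalence[OF S D', where f = f and g = g])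
    show "bij_betw f (points D) (points D')" "bij_betw g (arcs D) (arcs D')" "(\<lambda>c. f ` c) ` chords D = chords D'"
      using f g ch by (simp_all add: DD)
    show "sign D' (f ` c) = sign D c" if "c \<in> chords D" for c using sg that by (simp add: DD)
    show "arc_in D' (f p) = g (arc_in D p) \<and> arc_out D' (f p) = g (arc_out D p)"
      if "p \<in> points D - {x 0 u, x 0 v, x u v, x u 0, x v 0, x v u}" for p
    proof -
      have "p \<in> points G - {x i j | i j. i < 3 \<and> j < 3 \<and> i \<noteq> j}" using that xs unfolding DD points_truncate by blast
      then show ?thesis using rest unfolding DD truncate_fields by blast
    qed
    have sw: "arc_in D' (f (x i j)) = g (arc_in D (x i k)) \<and> arc_out D' (f (x i j)) = g (arc_out D (x i k))"
      if "i < 3" "j < 3" "k < 3" "distinct [i, j, k]" for i j k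
      using swap[rule_format, OF that] by (simp add: DD)
    have z3: "(0::nat) < 3" by simp
    show "arc_in D' (f p) = g (arc_in D q) \<and> arc_out D' (f p) = g (arc_out D q)"
      if "(p, q) \<in> {(x 0 u, x 0 v), (x 0 v, x 0 u), (x u v, x u 0), (x u 0, x u v), (x v 0, x v u), (x v u, x v 0)}" for p q
      using that sw[OF z3 uv(1,2,3)] sw[OF z3 uv(2,1) d(5)] sw[OF uv(1,2) z3 d(1)] sw[OF uv(1) z3 uv(2) d(2)]
        sw[OF uv(2) z3 uv(1) d(3)] sw[OF uv(2,1) z3 d(4)] by (elim insertE emptyE) (simp_all only: prod.inject)
  qed (rule num)+
qed

lemma khovanov_is_complex:
  assumes "is_signed_chord_diagram D" "orientable D" "inj_on num (chords D)"
  shows "is_bigraded_complex (khovanov_complex D num)"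
proof -
  interpret circle_model D "arcs D" "\<lambda>a. a" "{}" by (rule empty_circle_model) (use assms in simp_all)
  show ?thesis by (rule presents_complex[OF presents_model]) (rule model_dif_dif[OF assms(3)])
qed

theorem mainTheorem1:
  fixes D :: "('p, 'a) signed_chord_diagram"
  assumes "is_signed_chord_diagram D" and "orientable D"
  shows "(\<forall>num. chord_ordering D num \<longrightarrow> is_bigraded_complex (khovanov_complex D num)) \<and>
    (\<forall>(D' :: ('q, 'b) signed_chord_diagram) R.
       is_signed_chord_diagram D' \<and> orientable D' \<and>
       reidemeister_move D D' R \<and> preserves_orientation D D' R \<longrightarrow>
       (\<forall>num num'. chord_ordering D num \<and> chord_ordering D' num' \<longrightarrow>
          homotopy_equivalent_complexes (khovanov_complex D num) (khovanov_complex D' num')))"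
proof (intro conjI allI impI; (elim conjE)?)
  show "is_bigraded_complex (khovanov_complex D num)" if "chord_ordering D num" for num
    using khovanov_is_complex[OF assms] that by (simp add: chord_ordering_def bij_betw_def)
next
  fix D' :: "('q, 'b) signed_chord_diagram" and R num num'
  assume D': "is_signed_chord_diagram D'" "orientable D'" and m: "reidemeister_move D D' R"
    and nn: "chord_ordering D num" "chord_ordering D' num'"
  have num: "inj_on num (chords D)" "inj_on num' (chords D')" using nn by (simp_all add: chord_ordering_def bij_betw_def)
  obtain G G' where DD: "signed_chord_diagram.truncate G = D" "signed_chord_diagram.truncate G' = D'" and "gauss_move G G' R"
    using m unfolding reidemeister_move_def by blast
  then consider "first_move G G' R" | "first_move G' G (converse R)" | "second_move G G' R" | "second_move G' G (converse R)"
    | "third_move G G' R" | "third_move G' G (converse R)" unfolding gauss_move_def by blast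
  then show "homotopy_equivalent_complexes (khovanov_complex D num) (khovanov_complex D' num')"
  proof cases
    case 1 show ?thesis by (rule first_move_homotopy_equivalent[OF 1 DD[symmetric] assms D' num])
  next
    case 2 show ?thesis
      by (rule homotopy_equivalent_sym, rule first_move_homotopy_equivalent[OF 2 DD(2,1)[symmetric] D' assms num(2,1)])
  next
    case 3 show ?thesis by (rule second_move_homotopy_equivalent[OF 3 DD[symmetric] assms D' num])
  next
    case 4 show ?thesis
      by (rule homotopy_equivalent_sym, rule second_move_homotopy_equivalent[OF 4 DD(2,1)[symmetric] D' assms num(2,1)])
  next
    case 5 show ?thesis by (rule third_move_homotopy_equivalent[OF 5 DD[symmetric] assms D' num])
  next
    case 6 show ?thesis
      by (rule homotopy_equivalent_sym, rule third_move_homotopy_equivalent[OF 6 DD(2,1)[symmetric] D' assms num(2,1)])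
  qed
qed

end
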